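(* Let $d\geq3$ be an integer. Then $$\Psi_d(R)=\frac{d}{2\zeta(d-1)}R^{-(d-1)}+O_d\bigl(R^{-d-\frac1{d-2}}\bigr)\qquad\text{as } R\to\infty.$$ Here the error term is sharp; in fact there exists a constant $c>0$ which depends only on $d$ such that for all sufficiently large $R$, $$\Psi_d(R)>\frac{d}{2\zeta(d-1)}R^{-(d-1)}+cR^{-d-\frac1{d-2}}.$$
   Context: $\zeta$ is the Riemann zeta function, and $O_d$ means that the implied constant depends only on $d$. The function $\Psi_d:\mathbb{R}_{\geq0}\to\mathbb{R}_{\geq0}$ is the tail function of the limit distribution of normalized Frobenius numbers. Let $\widehat{\mathbb{N}}^d$ be the set of vectors $\boldsymbol a=(a_1,\ldots,a_d)$ with positive integer coefficients whose greatest common divisor is $1$, let $g(\boldsymbol a)$ be the largest integer not representable as a non-negative integer linear combination of $a_1,\ldots,a_d$, and let $f(\boldsymbol a)=g(\boldsymbol a)+a_1+\cdots+a_d$. By a theorem of Marklof there is a unique continuous non-increasing function $\Psi_d$ with $\Psi_d(0)=1$ such that for every bounded set $\mathcal D\subset\mathbb{R}_{\geq0}^d$ with nonempty interior and boundary of Lebesgue measure zero and every $R\geq0$, $$\lim_{T\to\infty}\frac{\#\{\boldsymbol a\in\widehat{\mathbb{N}}^d\cap T\mathcal D : f(\boldsymbol a)/(a_1\cdots a_d)^{1/(d-1)}>R\}}{\#(\widehat{\mathbb{N}}^d\cap T\mathcal D)}=\Psi_d(R).$$ Equivalently (also by Marklof), $\Psi_d$ is given explicitly by $$\Psi_d(R)=\mu_{d-1}\bigl(\{L\in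 X_{d-1} : \rho(L)>R\}\bigr),$$ where $X_{n}$ is the set of all lattices $L\subset\mathbb{R}^{n}$ of covolume one, identified with $\mathrm{SL}(n,\mathbb{Z})\backslash\mathrm{SL}(n,\mathbb{R})$ via $M\mapsto\mathbb{Z}^nM$; $\mu_n$ is the $\mathrm{SL}(n,\mathbb{R})$-invariant probability measure on $X_n$; $\Delta=\{\boldsymbol x\in\mathbb{R}_{\geq0}^{d-1} : x_1+\cdots+x_{d-1}\leq1\}$; and $\rho(L)=\inf\{\rho>0 : L+\rho\Delta=\mathbb{R}^{d-1}\}$. *)

theory Defs
  imports "HOL-Analysis.Analysis" "HOL-Library.Landau_Symbols"
begin

text \<open>
  Vectors with \<open>d\<close> coordinates are indexed by a finite type \<open>'n\<close> with \<open>CARD('n) = d\<close>.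
\<close>

definition zeta :: "real \<Rightarrow> real" where
  "zeta s = (\<Sum>n. real (Suc n) powr (- s))"  \<comment> \<open>only meaningful for \<open>s > 1\<close>\<close>

definition primitive_vectors :: "(nat ^ 'n) set" where
  "primitive_vectors = {a. (\<forall>i. 0 < a $ i) \<and> Gcd (range (($) a)) = 1}"

definition representable :: "nat ^ 'n \<Rightarrow> int \<Rightarrow> bool" where
  "representable a k \<longleftrightarrow> (\<exists>x :: nat ^ 'n. k = int (\<Sum>i\<in>UNIV. x $ i * a $ i))"

text \<open>
  The maximum is over all integers: negative integers are never representable, so the
  Frobenius number is \<open>-1\<close> if some coordinate equals \<open>1\<close>.
\<close>

definition frobenius_number :: "nat ^ 'n \<Rightarrow> int" where
  "frobenius_number a = (GREATEST k. \<not> representable a k)"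

definition shifted_frobenius_number :: "nat ^ 'n \<Rightarrow> int" where
  "shifted_frobenius_number a = frobenius_number a + int (\<Sum>i\<in>UNIV. a $ i)"

definition normalized_frobenius_number :: "nat ^ 'n \<Rightarrow> real" where
  "normalized_frobenius_number a =
     real_of_int (shifted_frobenius_number a) /
       (\<Prod>i\<in>UNIV. real (a $ i)) powr (1 / (real CARD('n) - 1))"

definition primitive_vectors_in :: "(real ^ 'n) set \<Rightarrow> (nat ^ 'n) set" where
  "primitive_vectors_in S = {a \<in> primitive_vectors. (\<chi> i. real (a $ i)) \<in> S}"

definition admissible_domain :: "(real ^ 'n) set \<Rightarrow> bool" where
  "admissible_domain D \<longleftrightarrow>
     bounded D \<and> (\<forall>x\<in>D. \<forall>i. 0 \<le> x $ i) \<and> interior D \<noteq> {} \<and> negligible (frontier D)"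

definition is_frobenius_tail :: "'n::finite itself \<Rightarrow> (real \<Rightarrow> real) \<Rightarrow> bool" where
  "is_frobenius_tail _ \<Psi> \<longleftrightarrow>
     continuous_on {0..} \<Psi> \<and> antimono_on {0..} \<Psi> \<and> \<Psi> 0 = 1 \<and> (\<forall>R\<ge>0. 0 \<le> \<Psi> R) \<and>
     (\<forall>(D :: (real ^ 'n) set) R. admissible_domain D \<longrightarrow> 0 \<le> R \<longrightarrow>
        ((\<lambda>T :: real.
            real (card {a \<in> primitive_vectors_in ((*\<^sub>R) T ` D). normalized_frobenius_number a > R}) /
            real (card (primitive_vectors_in ((*\<^sub>R) T ` D))))
          \<longlongrightarrow> \<Psi> R) at_top)"

text \<open>
  The limit relation determines the function on the non-negative reals. Hence constants that
  are chosen after the function depend on the index type, that is on the dimension, only.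
\<close>

lemma is_frobenius_tail_unique:
  assumes "is_frobenius_tail TYPE('n::finite) \<Psi>" "is_frobenius_tail TYPE('n) \<Psi>'" "0 \<le> R"
  shows "\<Psi> R = \<Psi>' R"
proof -
  let ?D = "cbox 0 1 :: (real ^ 'n) set"
  have "box 0 1 \<noteq> ({} :: (real ^ 'n) set)"
    by (auto simp: interval_ne_empty_cart)
  then have "admissible_domain ?D"
    unfolding admissible_domain_def
    by (auto simp: interior_cbox mem_box_cart intro: negligible_convex_frontier)
  with assms show ?thesis
    unfolding is_frobenius_tail_def by (meson tendsto_unique trivial_limit_at_top_linorder)
qed

end

theory Submission
  imports Defs "HOL-Number_Theory.Number_Theory" "HOL-Computational_Algebra.Squarefree" "HOL-Real_Asymp.Real_Asymp"
begin

text \<open>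
  The proof works directly with the arithmetic definition of the tail function, for
  \<open>n = d - 1\<close>. Fix one coordinate \<open>q\<close> of \<open>a\<close> and reduce the others modulo \<open>q\<close>. Up to
  factors tending to \<open>1\<close>, the normalised Frobenius number exceeds \<open>R\<close> iff some residue
  modulo \<open>q\<close> is not a sum of at most \<open>R q\<^sup>1\<^sup>/\<^sup>n\<close> of the remaining coordinates. In terms of
  the lattice \<open>M\<close> of integer vectors congruent to a multiple of \<open>a\<close> modulo \<open>q\<close>, this covering
  property fails if \<open>M\<close> has a nonzero vector \<open>w\<close> of width less than about \<open>q / (R q\<^sup>1\<^sup>/\<^sup>n)\<close>, where
  width means the width of the standard simplex in the direction \<open>w\<close>. The first moment of the
  number of pairs \<open>\<plusminus>w\<close> of primitive vectors below this threshold is the main term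
  \<open>(n + 1) / (2 \<zeta>(n) R\<^sup>n)\<close>.

  For the upper bound, covering holds once \<open>q / |w| + C q / |u|\<close> is at most the threshold, where
  \<open>w\<close> is a shortest vector, \<open>|w|\<close> its width, and \<open>u\<close> a short vector independent of \<open>w\<close>. A failure that
  is not explained by the main term forces \<open>w\<close> into a shell of relative thickness
  \<open>q\<^sup>1\<^sup>-\<^sup>1\<^sup>/\<^sup>n / (R |u|)\<close>, and the sum over dyadic ranges of \<open>|u|\<close> of the number of such pairs
  produces the error term. For the lower bound, some vectors \<open>w\<close> whose width exceeds the threshold
  by a factor \<open>1 + \<kappa>\<close> with \<open>\<kappa> \<approx> R\<^sup>-\<^sup>n\<^sup>/\<^sup>(\<^sup>n\<^sup>-\<^sup>1\<^sup>)\<close> still obstruct covering: the residues in a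
  short window are reached only from two corners of the simplex, which contain too few points.
\<close>

section \<open>Residue vectors and their lattices\<close>

text \<open>The tail is given as a limit over integer vectors. All bounds are therefore proved for a
  fixed modulus q and uniform \<open>a\<close> in \<open>primitive_residues\<close>, and transferred
  through one special family of domains. Two mean values replace integration over the space of
  lattices: a first moment, by Moebius inversion, and a bound for the number of independent pairs of
  short vectors. The obstacle in the latter is that a pair of multipliers (l, l') may generate a
  very skew planar lattice, where thin boxes hold more points than their area predicts. Such
  multipliers are rare for n >= 3; for n = 2 the determinant excludes the pairs altogether. The
  exponent comes from (\<kappa> R)^n ~ \<kappa>, that is \<kappa> ~ R^(-n/(n-1)), and n + n/(n-1) =
  d + 1/(d-2) for n = d - 1. In the upper bound, widths within a relative margin \<theta> of the
  threshold all count as failures, at cost \<theta> R^(-n), while the remaining failures cost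
  R^(-2n) \<theta>^(-(n-2)); the two costs agree for \<theta> ~ R^(-n/(n-1)).\<close>

definition residue_vectors :: "'i set \<Rightarrow> nat \<Rightarrow> ('i \<Rightarrow> int) set" where
  "residue_vectors I q = I \<rightarrow>\<^sub>E {0..<int q}"

text \<open>The gcd is taken together with q: for q > 0 these are the \<open>a\<close> for which (q,
  a) is a primitive vector. Quantifying over common divisors is the form on which Moebius sums over
  the divisors of q act.\<close>

definition primitive_residues :: "'i set \<Rightarrow> nat \<Rightarrow> ('i \<Rightarrow> int) set" where
  "primitive_residues I q =
     {a \<in> residue_vectors I q. \<forall>e::nat. e dvd q \<longrightarrow> (\<forall>i\<in>I. int e dvd a i) \<longrightarrow> e = 1}"

text \<open>This is q times the dual of the lattice of all integer x with a . x = 0 (mod q). Its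
  short vectors are the directions in which that lattice lies on widely spaced hyperplanes, hence
  the obstructions to covering.\<close>

definition multiples_lattice :: "'i set \<Rightarrow> nat \<Rightarrow> ('i \<Rightarrow> int) \<Rightarrow> ('i \<Rightarrow> int) set" where
  "multiples_lattice I q a = {b \<in> extensional I. \<exists>k. \<forall>i\<in>I. [b i = k * a i] (mod int q)}"

text \<open>The inserted \<open>0\<close> is the value of \<open>b\<close> at the vertex \<open>0\<close> of the standard simplex.\<close>

definition width :: "'i set \<Rightarrow> ('i \<Rightarrow> int) \<Rightarrow> int" where
  "width I b = Max (insert 0 (b ` I)) - Min (insert 0 (b ` I))"

text \<open>
  The lattice points of the dilated simplex \<open>s \<Delta>\<close> represent all classes modulo the lattice
  \<open>{x. a \<bullet> x \<equiv> 0 (mod q)}\<close>.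
\<close>

definition covers :: "'i set \<Rightarrow> nat \<Rightarrow> ('i \<Rightarrow> int) \<Rightarrow> real \<Rightarrow> bool" where
  "covers I q a s \<longleftrightarrow>
     (\<forall>r::int. \<exists>x::'i \<Rightarrow> nat. [(\<Sum>i\<in>I. int (x i) * a i) = r] (mod int q) \<and> real (\<Sum>i\<in>I. x i) \<le> s)"

definition height :: "'i set \<Rightarrow> ('i \<Rightarrow> int) \<Rightarrow> int" where
  "height I b = Max ((\<lambda>i. \<bar>b i\<bar>) ` I)"

text \<open>Primitivity is relative to \<open>multiples_lattice\<close>: as an integer vector such a
  \<open>b\<close> may still have a common factor. Since m is natural, \<open>b\<close> and its
  negative are both allowed.\<close>

definition primitive_multiples :: "'i set \<Rightarrow> nat \<Rightarrow> ('i \<Rightarrow> int) \<Rightarrow> ('i \<Rightarrow> int) set" where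
  "primitive_multiples I q a =
     {b \<in> multiples_lattice I q a. (\<exists>i\<in>I. b i \<noteq> 0) \<and>
        (\<forall>m. \<forall>c\<in>multiples_lattice I q a. (\<forall>i\<in>I. b i = int m * c i) \<longrightarrow> m = 1)}"

lemma height_ge: "finite I \<Longrightarrow> i \<in> I \<Longrightarrow> \<bar>b i\<bar> \<le> height I b"
  unfolding height_def by auto

lemma height_attained:
  assumes "finite I" "I \<noteq> {}"
  obtains i where "i \<in> I" "height I b = \<bar>b i\<bar>"
  using Max_in[of "(\<lambda>i. \<bar>b i\<bar>) ` I"] assms unfolding height_def by (auto simp del: Max_in)

lemma height_le_iff:
  "finite I \<Longrightarrow> I \<noteq> {} \<Longrightarrow> height I b \<le> c \<longleftrightarrow> (\<forall>i\<in>I. \<bar>b i\<bar> \<le> c)"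
  unfolding height_def by auto

lemma height_pos_iff:
  "finite I \<Longrightarrow> I \<noteq> {} \<Longrightarrow> 0 < height I b \<longleftrightarrow> (\<exists>i\<in>I. b i \<noteq> 0)"
  using height_le_iff[of I b 0] by (auto simp: not_le[symmetric])

lemma width_restrict [simp]: "width I (restrict b I) = width I b"
  unfolding width_def by (metis (mono_tags, lifting) image_cong restrict_apply)

lemma Max_insert_0_attained:
  fixes b :: "'i \<Rightarrow> int" assumes "finite I"
  shows "Max (insert 0 (b ` I)) = 0 \<or> (\<exists>i\<in>I. Max (insert 0 (b ` I)) = b i)"
  using Max_in[of "insert 0 (b ` I)"] assms by (auto simp del: Max_in)

lemma Min_insert_0_attained:
  fixes b :: "'i \<Rightarrow> int" assumes "finite I"
  shows "Min (insert 0 (b ` I)) = 0 \<or> (\<exists>i\<in>I. Min (insert 0 (b ` I)) = b i)"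
  using Min_in[of "insert 0 (b ` I)"] assms by (auto simp del: Min_in)

lemma abs_le_width:
  assumes "finite I" "i \<in> I"
  shows "\<bar>b i\<bar> \<le> width I b"
proof -
  have "b i \<le> Max (insert 0 (b ` I))" "0 \<le> Max (insert 0 (b ` I))"
    "Min (insert 0 (b ` I)) \<le> b i" "Min (insert 0 (b ` I)) \<le> 0"
    using assms by auto
  then show ?thesis unfolding width_def by linarith
qed

lemma width_le_iff:
  assumes "finite I"
  shows "width I b \<le> c \<longleftrightarrow>
    0 \<le> c \<and> (\<forall>i\<in>I. \<bar>b i\<bar> \<le> c) \<and> (\<forall>i\<in>I. \<forall>j\<in>I. b i - b j \<le> c)" (is "_ \<longleftrightarrow> ?R")
proof
  assume w: "width I b \<le> c"
  have "b i - b j \<le> width I b" if "i \<in> I" "j \<in> I" for i j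
    unfolding width_def using assms that by (intro diff_mono) auto
  moreover have "0 \<le> width I b"
    unfolding width_def using assms by (simp add: order.trans[of _ 0])
  ultimately show ?R using w abs_le_width[OF assms, of _ b] by fastforce
next
  assume r: ?R
  show "width I b \<le> c"
    using Max_insert_0_attained[OF assms, of b] Min_insert_0_attained[OF assms, of b] r
    unfolding width_def by fastforce
qed

lemma height_le_width: "finite I \<Longrightarrow> I \<noteq> {} \<Longrightarrow> height I b \<le> width I b"
  by (simp add: height_le_iff abs_le_width)

lemma multiples_latticeI:
  "(\<And>i. i \<in> I \<Longrightarrow> [b i = k * a i] (mod int q)) \<Longrightarrow> restrict b I \<in> multiples_lattice I q a"
  unfolding multiples_lattice_def by auto

text \<open>If g = gcd c q and q = g e, then e divides every a i, so primitivity forces e = 1.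
  Consequently the multiplier that produces a lattice vector is determined modulo q.\<close>

lemma primitive_residues_cancel:
  assumes "a \<in> primitive_residues I q" "q > 0" "\<And>i. i \<in> I \<Longrightarrow> [c * a i = 0] (mod int q)"
  shows "int q dvd c"
proof -
  define g where "g = gcd c (int q)"
  have g: "g > 0" "g dvd int q" "g dvd c" using assms(2) unfolding g_def by auto
  obtain e where e: "int q = g * e" using g by auto
  then have "e > 0" using assms(2) g by (metis of_nat_0_less_iff zero_less_mult_pos)
  obtain c' where c': "c = g * c'" using g by auto
  have "coprime c' e"
  proof -
    have "gcd (g * c') (g * e) = g * gcd c' e" using g by (simp add: gcd_mult_distrib_int[symmetric])
    then have "gcd c' e = 1" using g c' e g_def by (metis mult_cancel_left1 order_less_irrefl)
    then show ?thesis by (simp add: coprime_iff_gcd_eq_1)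
  qed
  have "e dvd a i" if "i \<in> I" for i
  proof -
    have "g * e dvd g * (c' * a i)" using assms(3)[OF that] c' e by (simp add: cong_0_iff mult.assoc)
    then have "e dvd c' * a i" using g by simp
    then show ?thesis using \<open>coprime c' e\<close> by (metis coprime_commute coprime_dvd_mult_right_iff)
  qed
  moreover have "nat e dvd q" using e \<open>e > 0\<close> by (metis dvd_triv_right int_dvd_int_iff int_nat_eq less_imp_le)
  ultimately have "nat e = 1" using assms(1) \<open>e > 0\<close> unfolding primitive_residues_def by auto
  then have "e = 1" using \<open>e > 0\<close> by simp
  then show ?thesis using e g by simp
qed

section \<open>Covering by the dilated simplex\<close>

text \<open>The 6 reflects that the quotient by a short vector \<open>w\<close> has vectors of
  length at least |w| / 6 only; the eliminated coordinate collects a rounding error of at most 1 /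
  |w| and the errors of the m other coordinates.\<close>

fun covering_const :: "nat \<Rightarrow> real" where
  "covering_const 0 = 0"
| "covering_const (Suc m) = 1 + 6 * (real m + 1) * covering_const m"

lemma covering_const_nonneg: "0 \<le> covering_const m"
  by (induction m) auto

text \<open>
  The set \<open>G\<close> consists of linear conditions \<open>v \<bullet> x \<equiv> p\<close> modulo \<open>1\<close>. If all nonzero \<open>v\<close> are long then
  a solution exists near every point \<open>y\<close>; the induction eliminates a coordinate at which a nearly shortest
  \<open>v\<close> is largest.
\<close>

lemma covering_by_elimination:
  fixes G :: "(('i \<Rightarrow> real) \<times> real) set" and y :: "'i \<Rightarrow> real"
  assumes "finite I" and "\<beta> > 0"
    and "\<And>v p w r k. (v, p) \<in> G \<Longrightarrow> (w, r) \<in> G \<Longrightarrow>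
           ((\<lambda>i. v i - of_int k * w i), p - of_int k * r) \<in> G"
    and "\<And>v p. (v, p) \<in> G \<Longrightarrow> \<exists>i\<in>I. v i \<noteq> 0 \<Longrightarrow> \<exists>i\<in>I. \<bar>v i\<bar> \<ge> \<beta>"
    and "\<And>v p. (v, p) \<in> G \<Longrightarrow> \<forall>i\<in>I. v i = 0 \<Longrightarrow> p \<in> \<int>"
  shows "\<exists>x. (\<forall>(v, p)\<in>G. (\<Sum>i\<in>I. v i * x i) - p \<in> \<int>) \<and>
             (\<forall>i\<in>I. \<bar>x i - y i\<bar> \<le> covering_const (card I) / \<beta>)"
  using assms
proof (induction "card I" arbitrary: I G \<beta>)
  case 0
  then have "I = {}" by simp
  show ?case
    by (rule exI[of _ y]) (use 0 \<open>I = {}\<close> in fastforce)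
next
  case (Suc m)
  note sub = Suc.prems(3) and norm = Suc.prems(4) and null = Suc.prems(5)
  have fin: "finite I" and ne: "I \<noteq> {}" using Suc by auto
  define nrm where "nrm v = Max ((\<lambda>i. \<bar>v i\<bar>) ` I)" for v :: "'i \<Rightarrow> real"
  have nrm_ge: "\<bar>v i\<bar> \<le> nrm v" if "i \<in> I" for v i
    unfolding nrm_def using fin that by auto
  have nrm_at: "\<exists>i\<in>I. nrm v = \<bar>v i\<bar>" for v
    using Max_in[of "(\<lambda>i. \<bar>v i\<bar>) ` I"] fin ne unfolding nrm_def by (auto simp del: Max_in)
  define N where "N = {nrm v |v p. (v, p) \<in> G \<and> (\<exists>i\<in>I. v i \<noteq> 0)}"
  show ?case
  proof (cases "N = {}")
    case True
    then have "v i = 0" if "(v, p) \<in> G" "i \<in> I" for v p i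
      using that unfolding N_def by blast
    then have "\<forall>(v, p)\<in>G. (\<Sum>i\<in>I. v i * y i) - p \<in> \<int>"
      using null by (auto simp: sum.neutral)
    then show ?thesis
      using \<open>\<beta> > 0\<close> covering_const_nonneg[of "card I"] by (intro exI[of _ y]) auto
  next
    case False
    have N_ge: "\<beta> \<le> t" if t: "t \<in> N" for t
    proof -
      obtain v p i where "(v, p) \<in> G" "t = nrm v" "i \<in> I" "\<beta> \<le> \<bar>v i\<bar>"
        using t norm unfolding N_def by blast
      then show ?thesis using nrm_ge[of i v] by linarith
    qed
    have bdd: "bdd_below N" using N_ge by (meson bdd_belowI)
    \<comment> \<open>The vector \<open>w\<close> is chosen only within the factor 3/2 of the
      infimum; the constants 2/3 and 1/6 below come from this choice.\<close>
    define \<iota> where "\<iota> = Inf N"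
    have "\<iota> \<ge> \<beta>" unfolding \<iota>_def using False N_ge by (intro cInf_greatest) auto
    then have "\<iota> < 3/2 * \<iota>" using \<open>\<beta> > 0\<close> by simp
    then obtain t where "t \<in> N" "t < 3/2 * \<iota>"
      using cInf_lessD[OF False] unfolding \<iota>_def by blast
    then obtain w pw where w: "(w, pw) \<in> G" "nrm w < 3/2 * \<iota>" "\<exists>i\<in>I. w i \<noteq> 0" "nrm w \<in> N"
      unfolding N_def by blast
    have short: "2/3 * nrm w \<le> nrm v" if "(v, p) \<in> G" "\<exists>i\<in>I. v i \<noteq> 0" for v p
    proof -
      have "nrm v \<in> N" using that unfolding N_def by blast
      then have "\<iota> \<le> nrm v" unfolding \<iota>_def using bdd by (rule cInf_lower)
      then show ?thesis using w(2) by simp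
    qed
    have wpos: "nrm w \<ge> \<beta>" "nrm w > 0" using N_ge[OF w(4)] \<open>\<beta> > 0\<close> by auto
    obtain j where j: "j \<in> I" "nrm w = \<bar>w j\<bar>" using nrm_at by blast
    have wj: "w j \<noteq> 0" using j wpos by auto
    have ratio: "\<bar>w i / w j\<bar> \<le> 1" if "i \<in> I" for i
      using nrm_ge[OF that, of w] j wj by (simp add: field_simps)
    \<comment> \<open>The condition on \<open>w\<close> is met exactly by imposing w . x = h, where
      h is the representative of \<open>pw\<close> modulo 1 nearest to w . y.\<close>
    define h where "h = pw + of_int (round ((\<Sum>i\<in>I. w i * y i) - pw))"
    have h: "\<bar>h - (\<Sum>i\<in>I. w i * y i)\<bar> \<le> 1/2"
      using of_int_round_abs_le[of "(\<Sum>i\<in>I. w i * y i) - pw"] unfolding h_def by (simp add: abs_minus_commute algebra_simps)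
    \<comment> \<open>Substituting the value of coordinate j forced by w . x = h turns a condition
      on \<open>I\<close> into one on \<open>J\<close>; its vector is projected along
      \<open>w\<close>.\<close>
    define E where "E = (\<lambda>(v, p). ((\<lambda>i. v i - v j / w j * w i), p - v j / w j * h))"
    define J where "J = I - {j}"
    have J: "card J = m" "finite J" "I = insert j J" "j \<notin> J"
      using Suc.hyps(2) fin j unfolding J_def by auto
    have zero_j: "(fst (E z)) j = 0" for z
      unfolding E_def using wj by (auto split: prod.splits)
    have small: "\<forall>i\<in>I. v i = 0" if "(v, p) \<in> G" "\<And>i. i \<in> I \<Longrightarrow> \<bar>v i\<bar> \<le> nrm w / 2" for v p
    proof (rule ccontr)
      assume "\<not> ?thesis"
      then have "2/3 * nrm w \<le> nrm v" using short that(1) by blast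
      moreover obtain i where "i \<in> I" "nrm v = \<bar>v i\<bar>" using nrm_at by blast
      ultimately show False using that(2)[of i] wpos by auto
    qed
    have step: "\<exists>x. (\<forall>(v, p)\<in>E ` G. (\<Sum>i\<in>J. v i * x i) - p \<in> \<int>) \<and>
             (\<forall>i\<in>J. \<bar>x i - y i\<bar> \<le> covering_const (card J) / (nrm w / 6))"
    proof (rule Suc.hyps(1))
      show "m = card J" "finite J" "nrm w / 6 > 0" using J wpos by auto
    next
      fix v p v' r k assume "(v, p) \<in> E ` G" "(v', r) \<in> E ` G"
      then obtain u pu u' pu' where u: "(u, pu) \<in> G" "(u', pu') \<in> G" "(v, p) = E (u, pu)" "(v', r) = E (u', pu')"
        by auto
      have "((\<lambda>i. v i - of_int k * v' i), p - of_int k * r) =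
          E ((\<lambda>i. u i - of_int k * u' i), pu - of_int k * pu')"
      proof -
        have e: "v = (\<lambda>i. u i - u j / w j * w i)" "p = pu - u j / w j * h"
          "v' = (\<lambda>i. u' i - u' j / w j * w i)" "r = pu' - u' j / w j * h"
          using u(3,4) unfolding E_def by auto
        show ?thesis
          unfolding e E_def by (simp add: fun_eq_iff diff_divide_distrib algebra_simps)
      qed
      then show "((\<lambda>i. v i - of_int k * v' i), p - of_int k * r) \<in> E ` G"
        using sub[OF u(1,2)] by blast
    next
      fix v p assume v: "(v, p) \<in> E ` G" "\<exists>i\<in>J. v i \<noteq> 0"
      then obtain u pu where u: "(u, pu) \<in> G" "(v, p) = E (u, pu)" by auto
      define t where "t = u j / w j"
      define k where "k = round t"
      define z where "z = (\<lambda>i. u i - of_int k * w i)"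
      have z: "(z, pu - of_int k * pw) \<in> G" unfolding z_def by (rule sub[OF u(1) w(1)])
      have vz: "z i = v i + (t - of_int k) * w i" for i
        using u(2) unfolding z_def t_def E_def by (simp add: algebra_simps)
      have vj: "v j = 0" using zero_j[of "(u,pu)"] u(2) by (metis fst_conv)
      have tk: "\<bar>t - of_int k\<bar> \<le> 1/2" unfolding k_def
        using of_int_round_abs_le[of t] by (simp add: abs_minus_commute)
      have "\<exists>i\<in>I. z i \<noteq> 0"
      proof (rule ccontr)
        assume a: "\<not> ?thesis"
        then have "t - of_int k = 0" using vz[of j] vj j wj by auto
        then have "\<forall>i\<in>I. v i = 0" using a vz by auto
        then show False using v(2) J by auto
      qed
      then have "2/3 * nrm w \<le> nrm z" using short z by blast
      moreover obtain i where i: "i \<in> I" "nrm z = \<bar>z i\<bar>" using nrm_at by blast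
      moreover have "\<bar>z i\<bar> \<le> \<bar>v i\<bar> + 1/2 * nrm w"
      proof -
        have "\<bar>(t - of_int k) * w i\<bar> \<le> 1/2 * nrm w"
          unfolding abs_mult using tk nrm_ge[OF i(1), of w] by (intro mult_mono) auto
        then show ?thesis using vz[of i] by linarith
      qed
      \<comment> \<open>The lift z of v contains a multiple of \<open>w\<close> with coefficient at
        most 1/2, and |z| >= 2/3 |w|; what remains for v is 2/3 - 1/2 = 1/6.\<close>
      ultimately have ge: "nrm w / 6 \<le> \<bar>v i\<bar>" by linarith
      then have "i \<noteq> j" using vj wpos by auto
      then show "\<exists>i\<in>J. nrm w / 6 \<le> \<bar>v i\<bar>" using ge i J by auto
    next
      fix v p assume v: "(v, p) \<in> E ` G" "\<forall>i\<in>J. v i = 0"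
      then obtain u pu where u: "(u, pu) \<in> G" "(v, p) = E (u, pu)" by auto
      define t where "t = u j / w j"
      define k where "k = round t"
      define z where "z = (\<lambda>i. u i - of_int k * w i)"
      have z: "(z, pu - of_int k * pw) \<in> G" unfolding z_def by (rule sub[OF u(1) w(1)])
      have vz: "z i = v i + (t - of_int k) * w i" for i
        using u(2) unfolding z_def t_def E_def by (simp add: algebra_simps)
      have vj: "v j = 0" using zero_j[of "(u,pu)"] u(2) by (metis fst_conv)
      have v0: "v i = 0" if "i \<in> I" for i using v vj J that by auto
      have tk: "\<bar>t - of_int k\<bar> \<le> 1/2" unfolding k_def
        using of_int_round_abs_le[of t] by (simp add: abs_minus_commute)
      have z0: "\<forall>i\<in>I. z i = 0"
      proof (rule small[OF z])
        fix i assume i: "i \<in> I"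
        have "\<bar>(t - of_int k) * w i\<bar> \<le> 1/2 * nrm w"
          unfolding abs_mult using tk nrm_ge[OF i(1), of w] by (intro mult_mono) auto
        then show "\<bar>z i\<bar> \<le> nrm w / 2" using vz[of i] v0[OF i] by simp
      qed
      then have "t = of_int k" using vz[of j] vj j wj by auto
      moreover have "pu - of_int k * pw \<in> \<int>" using null[OF z] z0 by blast
      moreover have "p = pu - t * h" using u(2) unfolding E_def t_def by simp
      ultimately have "p = (pu - of_int k * pw) - of_int (k * round ((\<Sum>i\<in>I. w i * y i) - pw))"
        unfolding h_def by (simp add: algebra_simps)
      then show "p \<in> \<int>" using \<open>pu - of_int k * pw \<in> \<int>\<close> by (metis Ints_diff Ints_of_int)
    qed
    then obtain x where x: "\<forall>(v, p)\<in>E ` G. (\<Sum>i\<in>J. v i * x i) - p \<in> \<int>"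
      and xy: "\<And>i. i \<in> J \<Longrightarrow> \<bar>x i - y i\<bar> \<le> covering_const m / (nrm w / 6)" using J by auto
    define x' where "x' = x(j := (h - (\<Sum>i\<in>J. w i * x i)) / w j)"
    have x'J: "x' i = x i" if "i \<in> J" for i using that J unfolding x'_def by auto
    have sumJ: "(\<Sum>i\<in>J. f i * x' i) = (\<Sum>i\<in>J. f i * x i)" for f
      using x'J by (intro sum.cong) auto
    have xj: "w j * x' j = h - (\<Sum>i\<in>J. w i * x i)" unfolding x'_def using wj by simp
    have C: "covering_const m \<ge> 0" by (rule covering_const_nonneg)
    show ?thesis
    proof (intro exI[of _ x'] conjI ballI)
      fix z assume z: "z \<in> G"
      obtain v p where vp: "z = (v, p)" by (cases z)
      define t where "t = v j / w j"
      have "(\<Sum>i\<in>J. (v i - t * w i) * x i) - (p - t * h) \<in> \<int>"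
        using bspec[OF x imageI[OF z]] unfolding vp E_def t_def by simp
      moreover have "(\<Sum>i\<in>I. v i * x' i) - p = (\<Sum>i\<in>J. (v i - t * w i) * x i) - (p - t * h)"
      proof -
        have "v j = t * w j" unfolding t_def using wj by simp
        then have "v j * x' j = t * (h - (\<Sum>i\<in>J. w i * x i))" using xj by simp
        then show ?thesis using J sumJ[of v]
          by (simp add: algebra_simps sum_subtractf sum_distrib_left)
      qed
      ultimately show "case z of (v, p) \<Rightarrow> (\<Sum>i\<in>I. v i * x' i) - p \<in> \<int>"
        using vp by (simp only: split)
    next
      fix i assume i: "i \<in> I"
      define \<kappa> where "\<kappa> = 6 * covering_const m / nrm w"
      have \<kappa>: "\<kappa> \<ge> 0" unfolding \<kappa>_def using C wpos by simp
      have le: "1 / nrm w + (real m + 1) * \<kappa> \<le> covering_const (card I) / \<beta>"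
      proof -
        have "1 / nrm w + (real m + 1) * \<kappa> = covering_const (Suc m) / nrm w"
          unfolding \<kappa>_def using wpos by (simp add: field_simps)
        also have "\<dots> \<le> covering_const (Suc m) / \<beta>"
          using wpos \<open>\<beta> > 0\<close> covering_const_nonneg[of "Suc m"] by (intro divide_left_mono) auto
        finally show ?thesis using Suc.hyps(2) by simp
      qed
      have \<kappa>J: "\<bar>x i - y i\<bar> \<le> \<kappa>" if "i \<in> J" for i
        using xy[OF that] unfolding \<kappa>_def by (simp add: field_simps)
      show "\<bar>x' i - y i\<bar> \<le> covering_const (card I) / \<beta>"
      proof (cases "i = j")
        case False
        then have "i \<in> J" using i J by auto
        then have "\<bar>x' i - y i\<bar> \<le> \<kappa>" using \<kappa>J x'J by simp
        also have "\<dots> \<le> 1 / nrm w + (real m + 1) * \<kappa>"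
          using \<kappa> wpos by (simp add: algebra_simps)
        finally show ?thesis using le by simp
      next
        case True
        have "w j * (x' j - y j) = (h - (\<Sum>i\<in>I. w i * y i)) - (\<Sum>i\<in>J. w i * (x i - y i))"
          using J xj by (simp add: algebra_simps sum_subtractf)
        then have "x' j - y j = ((h - (\<Sum>i\<in>I. w i * y i)) - (\<Sum>i\<in>J. w i * (x i - y i))) / w j"
          using wj by (simp add: field_simps)
        also have "\<bar>\<dots>\<bar> \<le> (\<bar>h - (\<Sum>i\<in>I. w i * y i)\<bar> + \<bar>\<Sum>i\<in>J. w i * (x i - y i)\<bar>) / nrm w"
          unfolding abs_divide j(2) by (intro divide_right_mono) auto
        also have "\<dots> \<le> (1 + (\<Sum>i\<in>J. nrm w * \<kappa>)) / nrm w"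
        proof -
          have "\<bar>\<Sum>i\<in>J. w i * (x i - y i)\<bar> \<le> (\<Sum>i\<in>J. nrm w * \<kappa>)"
            unfolding abs_mult[symmetric] using nrm_ge[of _ w] \<kappa>J wpos J
            by (intro order.trans[OF sum_abs] sum_mono) (auto simp: abs_mult intro!: mult_mono)
          then show ?thesis using h wpos by (intro divide_right_mono) auto
        qed
        also have "\<dots> = 1 / nrm w + real m * \<kappa>" using wpos J by (simp add: field_simps)
        also have "\<dots> \<le> 1 / nrm w + (real m + 1) * \<kappa>" using \<kappa> by (simp add: algebra_simps)
        finally show ?thesis using le True by simp
      qed
    qed
  qed
qed

lemma nearest_multiple:
  fixes a b :: int assumes "b \<noteq> 0"
  obtains m where "2 * \<bar>a - m * b\<bar> \<le> \<bar>b\<bar>"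
proof
  define t where "t = real_of_int a / real_of_int b"
  have "\<bar>t - of_int (round t)\<bar> \<le> 1/2" using of_int_round_abs_le[of t] by (simp add: abs_minus_commute)
  then have "\<bar>t - of_int (round t)\<bar> * \<bar>real_of_int b\<bar> \<le> 1/2 * \<bar>real_of_int b\<bar>"
    by (intro mult_right_mono) auto
  moreover have "(t - of_int (round t)) * real_of_int b = real_of_int (a - round t * b)"
    using assms unfolding t_def by (simp add: field_simps)
  ultimately have "real_of_int (2 * \<bar>a - round t * b\<bar>) \<le> real_of_int \<bar>b\<bar>"
    by (simp add: abs_mult[symmetric])
  then show "2 * \<bar>a - round t * b\<bar> \<le> \<bar>b\<bar>" by linarith
qed

text \<open>Both extremes are attained at vertices of the dilated simplex, the vertex 0 accounting
  for the inserted 0; all values between them occur on the segment that joins these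
  vertices.\<close>

lemma sum_ray_attains:
  fixes w :: "'i \<Rightarrow> int" and s N :: real
  assumes "finite I" "s \<ge> 0"
    and "s * Min (insert 0 (w ` I)) \<le> N" "N \<le> s * Max (insert 0 (w ` I))"
  obtains z :: "'i \<Rightarrow> real" where "\<And>i. i \<in> I \<Longrightarrow> z i \<ge> 0" "(\<Sum>i\<in>I. z i) \<le> s" "(\<Sum>i\<in>I. w i * z i) = N"
proof -
  have vertex: "\<exists>z::'i \<Rightarrow> real. (\<forall>i\<in>I. z i \<ge> 0) \<and> (\<Sum>i\<in>I. z i) \<le> s \<and> (\<Sum>i\<in>I. w i * z i) = s * c"
    if "c = 0 \<or> (\<exists>i\<in>I. c = w i)" for c :: int
    using that
  proof
    assume "c = 0"
    then show ?thesis using assms by (intro exI[of _ "\<lambda>_. 0"]) auto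
  next
    assume "\<exists>i\<in>I. c = w i"
    then obtain i where "i \<in> I" "c = w i" by auto
    then show ?thesis using assms
      by (intro exI[of _ "\<lambda>j. if j = i then s else 0"]) (auto simp: if_distrib cong: if_cong)
  qed
  obtain z1 z2 :: "'i \<Rightarrow> real" where z: "\<forall>i\<in>I. z1 i \<ge> 0" "(\<Sum>i\<in>I. z1 i) \<le> s"
      "(\<Sum>i\<in>I. w i * z1 i) = s * Min (insert 0 (w ` I))"
      "\<forall>i\<in>I. z2 i \<ge> 0" "(\<Sum>i\<in>I. z2 i) \<le> s" "(\<Sum>i\<in>I. w i * z2 i) = s * Max (insert 0 (w ` I))"
    using vertex[OF Min_insert_0_attained[OF assms(1), of w]] vertex[OF Max_insert_0_attained[OF assms(1), of w]] by blast
  define A B where "A = s * Min (insert 0 (w ` I))" and "B = s * Max (insert 0 (w ` I))"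
  obtain t where l: "0 \<le> t" "t \<le> 1" "N = (1 - t) * A + t * B"
  proof (cases "A = B")
    case True
    then show ?thesis using that[of 0] assms unfolding A_def B_def by auto
  next
    case False
    then have AB: "A < B" "A \<le> N" "N \<le> B" using assms unfolding A_def B_def by linarith+
    define c where "c = (N - A) / (B - A)"
    have "c * (B - A) = N - A" unfolding c_def using AB by simp
    then have "N = (1 - c) * A + c * B" by (simp add: algebra_simps)
    moreover have "0 \<le> c" "c \<le> 1" unfolding c_def using AB by auto
    ultimately show ?thesis using that by blast
  qed
  show ?thesis
  proof (rule that[of "\<lambda>i. (1 - t) * z1 i + t * z2 i"])
    show "(1 - t) * z1 i + t * z2 i \<ge> 0" if "i \<in> I" for i using that z l by simp
    have "(\<Sum>i\<in>I. (1 - t) * z1 i + t * z2 i) = (1 - t) * (\<Sum>i\<in>I. z1 i) + t * (\<Sum>i\<in>I. z2 i)"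
      by (simp add: sum.distrib sum_distrib_left)
    also have "\<dots> \<le> (1 - t) * s + t * s" using z l by (intro add_mono mult_left_mono) auto
    finally show "(\<Sum>i\<in>I. (1 - t) * z1 i + t * z2 i) \<le> s" by (simp add: algebra_simps)
    have "(\<Sum>i\<in>I. w i * ((1 - t) * z1 i + t * z2 i)) = (1 - t) * (\<Sum>i\<in>I. w i * z1 i) + t * (\<Sum>i\<in>I. w i * z2 i)"
      unfolding sum_distrib_left sum.distrib[symmetric] by (intro sum.cong) (auto simp: algebra_simps)
    also have "\<dots> = N" using z l unfolding A_def B_def by simp
    finally show "(\<Sum>i\<in>I. w i * ((1 - t) * z1 i + t * z2 i)) = N" .
  qed
qed

text \<open>Each of the n coordinates is shifted by n \<kappa> and then displaced by at most n
  \<kappa>, where \<kappa> is the covering constant divided by \<beta> = |u| / (2 q). The total 2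
  n^2 \<kappa> is this constant times q / |u|.\<close>

definition flatness_const :: "nat \<Rightarrow> real" where
  "flatness_const n = 4 * (real n)\<^sup>2 * covering_const (n - 1)"

lemma cong_multiple_diff:
  fixes x y z :: int
  assumes "[x = k * z] (mod q)" "[y = l * z] (mod q)"
  shows "[x - m * y = (k - m * l) * z] (mod q)"
proof -
  have "[x - m * y = k * z - m * (l * z)] (mod q)"
    using assms by (intro cong_diff cong_scalar_left)
  then show ?thesis by (simp add: algebra_simps)
qed

text \<open>Take \<open>w\<close> of least height, and \<open>u\<close> of least height after
  projection along \<open>w\<close>. On a simplex of size q / width the pairing with
  \<open>w\<close> fills an interval of length exactly q, so some hyperplane with the required
  residue meets it. Within this hyperplane the remaining conditions have length bounded below in
  terms of \<open>u\<close>, and elimination finds a solution near a prescribed point. That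
  \<open>u\<close> is reduced against \<open>w\<close> is recorded for the later count of
  pairs.\<close>

lemma covers_of_short_pair:
  fixes a :: "'i \<Rightarrow> int"
  assumes fin: "finite I" and n: "card I \<ge> 2" and q: "q > 0" and a: "a \<in> primitive_residues I q"
  obtains w u i where "w \<in> primitive_multiples I q a" "u \<in> multiples_lattice I q a"
    "i \<in> I" "height I w = \<bar>w i\<bar>" "2 * \<bar>u i\<bar> \<le> \<bar>w i\<bar>" "\<exists>j\<in>I. w i * u j \<noteq> w j * u i"
    "height I w \<le> height I u"
    "covers I q a (real q / width I w + flatness_const (card I) * real q / height I u)"
proof -
  let ?M = "multiples_lattice I q a"
  have ne: "I \<noteq> {}" using n by auto
  define nz where "nz b \<longleftrightarrow> b \<in> ?M \<and> (\<exists>i\<in>I. b i \<noteq> 0)" for b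
  have unit: "restrict (\<lambda>i. if i = j then int q else 0) I \<in> ?M" for j
    by (rule multiples_latticeI[of _ _ 0]) (auto simp: cong_def)
  obtain i0 where "i0 \<in> I" using ne by auto
  then have "nz (restrict (\<lambda>i. if i = i0 then int q else 0) I)"
    unfolding nz_def using q unit by auto
  then obtain w where w: "nz w" and wmin: "\<And>b. nz b \<Longrightarrow> nat (height I w) \<le> nat (height I b)"
    using ex_has_least_nat[of nz _ "\<lambda>b. nat (height I b)"] by blast
  have hpos: "height I b > 0" if "nz b" for b
    using that height_pos_iff[OF fin ne] unfolding nz_def by auto
  have wmin: "height I w \<le> height I b" if "nz b" for b
    using wmin[OF that] hpos[OF that] by linarith
  obtain kw where kw: "\<And>i. i \<in> I \<Longrightarrow> [w i = kw * a i] (mod int q)"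
    using w unfolding nz_def multiples_lattice_def by auto
  obtain j where j: "j \<in> I" "height I w = \<bar>w j\<bar>" using height_attained[OF fin ne] .
  have wj: "w j \<noteq> 0" using hpos[OF w] j by auto
  have prim: "w \<in> primitive_multiples I q a"
    unfolding primitive_multiples_def
  proof (safe)
    show "w \<in> ?M" "\<exists>i\<in>I. w i \<noteq> 0" using w unfolding nz_def by auto
    fix m c assume c: "c \<in> ?M" "\<forall>i\<in>I. w i = int m * c i"
    then have "nz c" using w unfolding nz_def by auto
    then have "height I w \<le> height I c" by (rule wmin)
    moreover obtain i where i: "i \<in> I" "height I c = \<bar>c i\<bar>" using height_attained[OF fin ne] .
    moreover have "int m * \<bar>c i\<bar> \<le> height I w" using c(2) i(1) height_ge[OF fin i(1), of w] by (simp add: abs_mult)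
    ultimately have "int m * height I c \<le> 1 * height I c" by simp
    then have "int m \<le> 1" using hpos[OF \<open>nz c\<close>] by (simp only: mult_le_cancel_right)
    moreover have "m \<noteq> 0" using c(2) w unfolding nz_def by auto
    ultimately show "m = 1" by simp
  qed
  \<comment> \<open>The entries of w_j b - b_j w are w_j times those of the projection of
    \<open>b\<close> along \<open>w\<close> that kills coordinate j. They are kept integral so that
    a least value exists.\<close>
  define H where "H b = height I (\<lambda>i. w j * b i - b j * w i)" for b
  define ind where "ind b \<longleftrightarrow> b \<in> ?M \<and> (\<exists>i\<in>I. w j * b i - b j * w i \<noteq> 0)" for b
  have "\<exists>l\<in>I. l \<noteq> j"
  proof (rule ccontr)
    assume "\<not> ?thesis"
    then have "I \<subseteq> {j}" by auto
    then have "card I \<le> 1" using card_mono[of "{j}" I] by auto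
    then show False using n by simp
  qed
  then obtain l where l: "l \<in> I" "l \<noteq> j" by auto
  have "ind (restrict (\<lambda>i. if i = l then int q else 0) I)"
    unfolding ind_def using l q unit wj j by auto
  then obtain u0 where u0: "ind u0" and umin: "\<And>b. ind b \<Longrightarrow> nat (H u0) \<le> nat (H b)"
    using ex_has_least_nat[of ind _ "\<lambda>b. nat (H b)"] by blast
  have Hpos: "H b > 0" if "ind b" for b
    using that height_pos_iff[OF fin ne] unfolding ind_def H_def by auto
  obtain ku where ku: "\<And>i. i \<in> I \<Longrightarrow> [u0 i = ku * a i] (mod int q)"
    using u0 unfolding ind_def multiples_lattice_def by auto
  obtain m where m: "2 * \<bar>u0 j - m * w j\<bar> \<le> \<bar>w j\<bar>" using nearest_multiple[OF wj] .
  define u where "u = restrict (\<lambda>i. u0 i - m * w i) I"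
  have uM: "u \<in> ?M" unfolding u_def
    by (rule multiples_latticeI) (blast intro: cong_multiple_diff ku kw)
  have ue: "w j * u i - u j * w i = w j * u0 i - u0 j * w i" if "i \<in> I" for i
    using that j unfolding u_def by (simp add: algebra_simps)
  have Hu: "H u = H u0" unfolding H_def height_def using ue by (intro arg_cong[of _ _ Max] image_cong) auto
  have uind: "ind u" using u0 uM ue unfolding ind_def by auto
  have umin: "H u \<le> H b" if "ind b" for b
    using umin[OF that] Hpos[OF that] Hpos[OF u0] Hu by linarith
  have uj: "2 * \<bar>u j\<bar> \<le> \<bar>w j\<bar>" using m j unfolding u_def by simp
  have unz: "nz u" using uind j unfolding nz_def ind_def by (auto, metis mult_zero_left mult_zero_right)
  have wu: "height I w \<le> height I u" using unz by (rule wmin)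
  \<comment> \<open>As |u_j| <= |w_j| / 2 and |w_i| <= |w_j|, the projection changes a coordinate of
    \<open>u\<close> by at most half the height of \<open>w\<close>, hence by at most half the
    height of \<open>u\<close>.\<close>
  have H_ge: "height I w * height I u \<le> 2 * H u"
  proof -
    obtain i where i: "i \<in> I" "height I u = \<bar>u i\<bar>" using height_attained[OF fin ne] .
    have "\<bar>w j\<bar> * \<bar>u i\<bar> \<le> H u + \<bar>u j\<bar> * \<bar>w i\<bar>"
      using height_ge[OF fin i(1), of "\<lambda>i. w j * u i - u j * w i"] unfolding H_def
      by (simp add: abs_mult[symmetric])
    also have "2 * \<dots> \<le> 2 * H u + \<bar>w j\<bar> * height I w"
      using uj height_ge[OF fin i(1), of w] by (simp add: mult.assoc[symmetric] mult_mono)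
    finally have "2 * (height I w * height I u) \<le> 2 * H u + height I w * height I w"
      using i j by simp
    also have "height I w * height I w \<le> height I w * height I u"
      using wu hpos[OF w] by (intro mult_left_mono) auto
    finally show ?thesis by linarith
  qed
  define hu where "hu = real_of_int (height I u)"
  have hu: "hu > 0" using hpos[OF unz] unfolding hu_def by simp
  define \<beta> where "\<beta> = hu / (2 * real q)"
  have \<beta>: "\<beta> > 0" unfolding \<beta>_def using hu q by simp
  define n where "n = card I"
  define \<kappa> where "\<kappa> = covering_const (n - 1) / \<beta>"
  have \<kappa>: "\<kappa> \<ge> 0" unfolding \<kappa>_def using \<beta> covering_const_nonneg by simp
  define s where "s = real q / width I w + flatness_const n * real q / hu"
  define s' where "s' = real q / width I w"
  have s: "s = s' + 2 * (real n)\<^sup>2 * \<kappa>"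
    unfolding s_def s'_def flatness_const_def \<kappa>_def \<beta>_def using hu q by (simp add: field_simps)
  have wdpos: "width I w > 0" using height_le_width[OF fin ne, of w] hpos[OF w] by linarith
  have "covers I q a s" unfolding covers_def
  proof
    fix r :: int
    \<comment> \<open>Shifting every coordinate by n \<kappa> pays in advance for the displacement
      caused by the elimination, so that the solution stays nonnegative.\<close>
    define y0 where "y0 = real n * \<kappa>"
    define lo hi where "lo = s' * Min (insert 0 (w ` I))" and "hi = s' * Max (insert 0 (w ` I))"
    have hilo: "hi - lo = real q"
      unfolding hi_def lo_def s'_def width_def[of I w] right_diff_distrib[symmetric]
      using wdpos unfolding width_def by (simp add: field_simps flip: of_int_diff)
    \<comment> \<open>an admissible value of the pairing with \<open>w\<close> that the shrunken simplex takes\<close>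
    define base where "base = (\<Sum>i\<in>I. w i * y0) + lo"
    define N where "N = real_of_int (kw * r) + real q * of_int \<lceil>(base - real_of_int (kw * r)) / real q\<rceil>"
    have N: "base \<le> N" "N \<le> base + real q"
    proof -
      define c where "c = (base - real_of_int (kw * r)) / real q"
      have c: "base = real_of_int (kw * r) + real q * c" unfolding c_def using q by simp
      have "c \<le> of_int \<lceil>c\<rceil>" "of_int \<lceil>c\<rceil> \<le> c + 1" by linarith+
      then have "real q * c \<le> real q * of_int \<lceil>c\<rceil>" "real q * of_int \<lceil>c\<rceil> \<le> real q * (c + 1)"
        using q by (auto intro!: mult_left_mono)
      then show "base \<le> N" "N \<le> base + real q" unfolding N_def c_def[symmetric] using c by (auto simp: algebra_simps)
    qed
    have s'0: "s' \<ge> 0" unfolding s'_def using wdpos by simp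
    obtain z :: "'i \<Rightarrow> real" where z: "\<And>i. i \<in> I \<Longrightarrow> z i \<ge> 0" "(\<Sum>i\<in>I. z i) \<le> s'"
        "(\<Sum>i\<in>I. w i * z i) = N - (\<Sum>i\<in>I. w i * y0)"
      by (rule sum_ray_attains[OF fin s'0, of w "N - (\<Sum>i\<in>I. w i * y0)"])
        (use N hilo in \<open>auto simp: base_def lo_def hi_def\<close>)
    define y where "y i = z i + y0" for i
    have y: "(\<Sum>i\<in>I. w i * y i) = N"
      unfolding y_def using z(3) by (simp add: algebra_simps sum.distrib)
    define J where "J = I - {j}"
    have J: "finite J" "card J = n - 1" "I = insert j J" "j \<notin> J"
      using fin j unfolding J_def n_def by auto
    \<comment> \<open>These are the conditions b . x = k r (mod q) of all lattice vectors, divided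
      by q, after coordinate j has been eliminated through w . x = N.\<close>
    define G where "G = {((\<lambda>i. (b i - b j / w j * w i) / q), (k * r - b j / w j * N) / q) |b k. \<forall>i\<in>I. [b i = k * a i] (mod int q)}"
    have GI: "((\<lambda>i. (b i - b j / w j * w i) / q), (k * r - b j / w j * N) / q) \<in> G"
      if "\<And>i. i \<in> I \<Longrightarrow> [b i = k * a i] (mod int q)" for b :: "'i \<Rightarrow> int" and k
      using that unfolding G_def by blast
    have "\<exists>x. (\<forall>(v, p)\<in>G. (\<Sum>i\<in>J. v i * x i) - p \<in> \<int>) \<and>
             (\<forall>i\<in>J. \<bar>x i - y i\<bar> \<le> covering_const (card J) / \<beta>)"
    proof (rule covering_by_elimination[OF J(1) \<beta>])
      fix v p v' p' k assume "(v, p) \<in> G" "(v', p') \<in> G"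
      then obtain b l b' l' where b: "v = (\<lambda>i. (b i - b j / w j * w i) / q)" "p = (l * r - b j / w j * N) / q"
          "\<And>i. i \<in> I \<Longrightarrow> [b i = l * a i] (mod int q)"
          "v' = (\<lambda>i. (b' i - b' j / w j * w i) / q)" "p' = (l' * r - b' j / w j * N) / q"
          "\<And>i. i \<in> I \<Longrightarrow> [b' i = l' * a i] (mod int q)"
        unfolding G_def by blast
      have "((\<lambda>i. v i - of_int k * v' i), p - of_int k * p') =
        ((\<lambda>i. ((\<lambda>i. b i - k * b' i) i - (\<lambda>i. b i - k * b' i) j / w j * w i) / q), ((l - k * l') * r - (\<lambda>i. b i - k * b' i) j / w j * N) / q)"
      proof -
        have t: "real_of_int (b j - k * b' j) / w j = b j / w j - k * (b' j / w j)"
          by (simp add: diff_divide_distrib)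
        show ?thesis
          unfolding b(1,2,4,5) t
          by (simp add: fun_eq_iff diff_divide_distrib add_divide_distrib algebra_simps)
      qed
      also have "\<dots> \<in> G" by (rule GI) (blast intro: cong_multiple_diff b(3,6))
      finally show "((\<lambda>i. v i - of_int k * v' i), p - of_int k * p') \<in> G" .
    next
      fix v p assume v: "(v, p) \<in> G" "\<exists>i\<in>J. v i \<noteq> 0"
      then obtain b k where b: "v = (\<lambda>i. (b i - b j / w j * w i) / q)"
          "\<And>i. i \<in> I \<Longrightarrow> [b i = k * a i] (mod int q)"
        unfolding G_def by blast
      have vi: "v i = real_of_int (w j * b i - b j * w i) / (w j * q)" for i
        unfolding b(1) using wj q by (simp add: field_simps)
      have "ind (restrict b I)" unfolding ind_def
      proof
        show "restrict b I \<in> ?M" by (rule multiples_latticeI[OF b(2)])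
        show "\<exists>i\<in>I. w j * restrict b I i - restrict b I j * w i \<noteq> 0"
        proof -
          obtain i where i: "i \<in> J" "v i \<noteq> 0" using v(2) by auto
          then have "w j * b i - b j * w i \<noteq> 0" unfolding vi by (metis div_0 of_int_0)
          then show ?thesis using i J j by auto
        qed
      qed
      then have "H u \<le> H (restrict b I)" by (rule umin)
      also have "H (restrict b I) = H b" unfolding H_def height_def using j
        by (intro arg_cong[of _ _ Max] image_cong) auto
      finally have "H u \<le> H b" .
      then have "height I w * height I u \<le> 2 * H b" using H_ge by linarith
      moreover obtain i where i: "i \<in> I" "H b = \<bar>w j * b i - b j * w i\<bar>"
        using height_attained[OF fin ne] unfolding H_def by blast
      ultimately have "\<bar>w j\<bar> * height I u \<le> 2 * \<bar>w j * b i - b j * w i\<bar>" using j by simp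
      then have "real_of_int (\<bar>w j\<bar> * height I u) \<le> real_of_int (2 * \<bar>w j * b i - b j * w i\<bar>)"
        by (simp only: of_int_le_iff)
      then have "\<bar>real_of_int (w j)\<bar> * hu \<le> 2 * \<bar>real_of_int (w j * b i - b j * w i)\<bar>"
        unfolding hu_def by simp
      moreover have "\<bar>v i\<bar> = \<bar>real_of_int (w j * b i - b j * w i)\<bar> / (\<bar>real_of_int (w j)\<bar> * q)"
        unfolding vi by (simp add: abs_mult)
      ultimately have "\<beta> \<le> \<bar>v i\<bar>"
        unfolding \<beta>_def using wj q by (simp add: pos_le_divide_eq pos_divide_le_eq mult.commute)
      moreover have "v j = 0" unfolding vi by simp
      ultimately show "\<exists>i\<in>J. \<beta> \<le> \<bar>v i\<bar>" using i \<beta> J by (metis abs_zero insertE not_le)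
    next
      fix v p assume v: "(v, p) \<in> G" "\<forall>i\<in>J. v i = 0"
      then obtain b k where b: "v = (\<lambda>i. (b i - b j / w j * w i) / q)" "p = (k * r - b j / w j * N) / q"
          "\<And>i. i \<in> I \<Longrightarrow> [b i = k * a i] (mod int q)"
        unfolding G_def by blast
      have "v i = 0" if "i \<in> I" for i
        using v(2) J that unfolding b(1) using wj by auto
      then have e0: "real_of_int (w j * b i - b j * w i) = 0" if "i \<in> I" for i
        using that wj q unfolding b(1) by (simp add: field_simps)
      have e: "w j * b i = b j * w i" if "i \<in> I" for i
        using e0[OF that] by linarith
      obtain m where m: "2 * \<bar>b j - m * w j\<bar> \<le> \<bar>w j\<bar>" using nearest_multiple[OF wj] .
      define c where "c = restrict (\<lambda>i. b i - m * w i) I"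
      have cM: "c \<in> ?M" unfolding c_def
        by (rule multiples_latticeI) (blast intro: cong_multiple_diff b(3) kw)
      have "\<not> nz c"
      proof
        assume "nz c"
        then have "height I w \<le> height I c" by (rule wmin)
        moreover obtain i where i: "i \<in> I" "height I c = \<bar>c i\<bar>" using height_attained[OF fin ne] .
        moreover have "\<bar>w j\<bar> * (2 * \<bar>c i\<bar>) \<le> \<bar>w j\<bar> * \<bar>w j\<bar>"
        proof -
          have "w j * c i = (b j - m * w j) * w i" using e[OF i(1)] i(1) unfolding c_def by (simp add: algebra_simps)
          then have "\<bar>w j\<bar> * (2 * \<bar>c i\<bar>) = 2 * \<bar>b j - m * w j\<bar> * \<bar>w i\<bar>" by (simp add: abs_mult[symmetric])
          also have "\<dots> \<le> \<bar>w j\<bar> * \<bar>w j\<bar>" using m height_ge[OF fin i(1), of w] j by (intro mult_mono) auto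
          finally show ?thesis .
        qed
        then have "2 * \<bar>c i\<bar> \<le> \<bar>w j\<bar>" by (rule mult_left_le_imp_le) (use wj in simp)
        ultimately show False using j hpos[OF w] by simp
      qed
      then have c0: "b i = m * w i" if "i \<in> I" for i
        using cM that unfolding nz_def c_def by auto
      \<comment> \<open>Primitivity of \<open>a\<close> enters here: a condition whose vector is m
        \<open>w\<close> must have multiplier m \<open>kw\<close> modulo q, so w . x = N already
        implies it.\<close>
      have "[(k - m * kw) * a i = 0] (mod int q)" if "i \<in> I" for i
        using cong_multiple_diff[OF b(3)[OF that] kw[OF that], of m] c0[OF that] by (simp add: cong_sym_eq)
      then have "int q dvd k - m * kw" by (rule primitive_residues_cancel[OF a q])
      then obtain z where z: "k = m * kw + int q * z" by (metis add_diff_cancel_left' add_diff_eq dvd_def)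
      have "b j / w j = m" using c0[OF j(1)] wj by simp
      then have "p = (k * r - m * N) / q" unfolding b(2) by simp
      also have "\<dots> = of_int (z * r - m * \<lceil>(base - real_of_int (kw * r)) / real q\<rceil>)"
        unfolding N_def z using q by (simp add: field_simps)
      finally show "p \<in> \<int>" by simp
    qed
    then obtain x where x: "\<And>v p. (v, p) \<in> G \<Longrightarrow> (\<Sum>i\<in>J. v i * x i) - p \<in> \<int>"
      and xy: "\<And>i. i \<in> J \<Longrightarrow> \<bar>x i - y i\<bar> \<le> \<kappa>" unfolding \<kappa>_def using J(2) by fastforce
    define x' where "x' = x(j := (N - (\<Sum>i\<in>J. w i * x i)) / w j)"
    have x'J: "x' i = x i" if "i \<in> J" for i using that J unfolding x'_def by auto
    have sumJ: "(\<Sum>i\<in>J. f i * x' i) = (\<Sum>i\<in>J. f i * x i)" for f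
      using x'J by (intro sum.cong) auto
    have xj: "w j * x' j = N - (\<Sum>i\<in>J. w i * x i)" unfolding x'_def using wj by simp
    have int: "((\<Sum>i\<in>I. b i * x' i) - k * r) / q \<in> \<int>" if "\<And>i. i \<in> I \<Longrightarrow> [b i = k * a i] (mod int q)" for b :: "'i \<Rightarrow> int" and k
    proof -
      define t where "t = b j / w j"
      have "(\<Sum>i\<in>J. (b i - t * w i) / q * x i) - (k * r - t * N) / q \<in> \<int>"
        using x[OF GI[of b k, OF that]] unfolding t_def .
      moreover have "(\<Sum>i\<in>J. (b i - t * w i) / q * x i) = (\<Sum>i\<in>J. (b i - t * w i) * x i) / q"
        by (simp add: sum_divide_distrib)
      moreover have "(\<Sum>i\<in>I. b i * x' i) - k * r = (\<Sum>i\<in>J. (b i - t * w i) * x i) - (k * r - t * N)"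
      proof -
        have "b j = t * w j" unfolding t_def using wj by simp
        then have "b j * x' j = t * (N - (\<Sum>i\<in>J. w i * x i))" using xj by simp
        then show ?thesis using J sumJ[of b]
          by (simp add: algebra_simps sum_subtractf sum_distrib_left)
      qed
      ultimately show ?thesis by (simp only: diff_divide_distrib)
    qed
    have x'y: "\<bar>x' i - y i\<bar> \<le> real n * \<kappa>" if "i \<in> I" for i
    proof (cases "i = j")
      case False
      then have "\<bar>x' i - y i\<bar> \<le> \<kappa>" using xy x'J that J by auto
      also have "\<dots> \<le> real n * \<kappa>" using \<kappa> assms(2) n_def by (intro mult_le_cancel_right1[THEN iffD2]) auto
      finally show ?thesis .
    next
      case True
      have "w j * (x' j - y j) = - (\<Sum>i\<in>J. w i * (x i - y i))"
        using J xj y by (simp add: algebra_simps sum_subtractf)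
      then have "\<bar>real_of_int (w j)\<bar> * \<bar>x' j - y j\<bar> = \<bar>\<Sum>i\<in>J. w i * (x i - y i)\<bar>"
        by (simp add: abs_mult[symmetric])
      also have "\<dots> \<le> (\<Sum>i\<in>J. \<bar>real_of_int (w j)\<bar> * \<kappa>)"
      proof (intro order.trans[OF sum_abs] sum_mono)
        fix i assume i: "i \<in> J"
        have "\<bar>w i\<bar> \<le> \<bar>w j\<bar>" using height_ge[OF fin, of i w] i J j by auto
        then have "\<bar>real_of_int (w i)\<bar> \<le> \<bar>real_of_int (w j)\<bar>" by linarith
        then show "\<bar>w i * (x i - y i)\<bar> \<le> \<bar>real_of_int (w j)\<bar> * \<kappa>"
          unfolding abs_mult using xy[OF i] by (intro mult_mono) auto
      qed
      also have "\<dots> = \<bar>real_of_int (w j)\<bar> * (real (n - 1) * \<kappa>)" using J by simp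
      finally have "\<bar>x' j - y j\<bar> \<le> real (n - 1) * \<kappa>" using wj by simp
      also have "\<dots> \<le> real n * \<kappa>" using \<kappa> by (intro mult_right_mono) auto
      finally show ?thesis using True by simp
    qed
    \<comment> \<open>Each vector q e_l lies in the lattice with multiplier 0, and its condition
      says that x_l is an integer. Below, \<open>a\<close> itself with multiplier 1 gives a . x = r
      (mod q).\<close>
    have x'int: "x' l \<in> \<int>" if "l \<in> I" for l
    proof -
      have "((\<Sum>i\<in>I. (if i = l then int q else 0) * x' i) - (0::int) * r) / q \<in> \<int>"
        using int[of "\<lambda>i. if i = l then int q else 0" 0] by (auto simp: cong_def)
      also have "((\<Sum>i\<in>I. (if i = l then int q else 0) * x' i) - (0::int) * r) / q = x' l"
        using that fin q by (simp add: if_distrib if_distribR cong: if_cong)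
      finally show ?thesis .
    qed
    have x'pos: "x' i \<ge> 0" if "i \<in> I" for i
      using x'y[OF that] z(1)[OF that] unfolding y_def y0_def by linarith
    define X where "X i = nat \<lfloor>x' i\<rfloor>" for i
    have X: "real (X i) = x' i" if "i \<in> I" for i
      using x'int[OF that] x'pos[OF that] unfolding X_def by (auto elim!: Ints_cases)
    have "((\<Sum>i\<in>I. a i * x' i) - (1::int) * r) / q \<in> \<int>"
      using int[of a 1] by simp
    then obtain c where c: "((\<Sum>i\<in>I. a i * x' i) - r) / q = of_int c" by (auto elim!: Ints_cases)
    then have "(\<Sum>i\<in>I. a i * x' i) - r = of_int (int q * c)" using q by (simp add: field_simps)
    moreover have "(\<Sum>i\<in>I. a i * x' i) = real_of_int (\<Sum>i\<in>I. int (X i) * a i)"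
      using X by (simp add: mult.commute)
    ultimately have "real_of_int ((\<Sum>i\<in>I. int (X i) * a i) - r) = of_int (int q * c)" by simp
    then have "(\<Sum>i\<in>I. int (X i) * a i) - r = int q * c" by (simp only: of_int_eq_iff)
    then have "[(\<Sum>i\<in>I. int (X i) * a i) = r] (mod int q)" by (simp add: cong_iff_dvd_diff)
    moreover have "real (\<Sum>i\<in>I. X i) \<le> s"
    proof -
      have "real (\<Sum>i\<in>I. X i) = (\<Sum>i\<in>I. x' i)" using X by simp
      also have "\<dots> \<le> (\<Sum>i\<in>I. z i + (y0 + real n * \<kappa>))"
        using x'y unfolding y_def by (intro sum_mono) (smt (verit))
      also have "\<dots> = (\<Sum>i\<in>I. z i) + real n * (2 * real n * \<kappa>)"
        unfolding y0_def n_def by (simp add: sum.distrib algebra_simps)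
      also have "\<dots> \<le> s" using z(2) unfolding s by (simp add: power2_eq_square algebra_simps)
      finally show ?thesis .
    qed
    ultimately show "\<exists>x::'i \<Rightarrow> nat. [(\<Sum>i\<in>I. int (x i) * a i) = r] (mod int q) \<and> real (\<Sum>i\<in>I. x i) \<le> s"
      by blast
  qed
  then show ?thesis
    using that[OF prim uM j(1,2) uj _ wu] uind unfolding ind_def s_def n_def hu_def by fastforce
qed

section \<open>Obstructions to covering\<close>

lemma bezout_residue:
  fixes k g :: int assumes "g = gcd k (int q)"
  obtains u where "\<And>j. [k * (u * j) = g * j] (mod int q)"
proof -
  obtain u v where "u * k + v * int q = g" using bezout_int[of k "int q"] assms by auto
  then have e: "g * j = k * (u * j) + v * int q * j" for j by (simp add: algebra_simps flip: \<open>_ = g\<close>)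
  have "[k * (u * j) = g * j] (mod int q)" for j
    unfolding e[of j] by (simp add: cong_iff_dvd_diff)
  then show ?thesis using that by blast
qed

lemma pairing_cong:
  assumes "\<And>i. i \<in> I \<Longrightarrow> [b i = k * a i] (mod int q)" "[(\<Sum>i\<in>I. int (x i) * a i) = r] (mod int q)"
  shows "[(\<Sum>i\<in>I. int (x i) * b i) = k * r] (mod int q)"
proof -
  have "[(\<Sum>i\<in>I. int (x i) * b i) = (\<Sum>i\<in>I. int (x i) * (k * a i))] (mod int q)"
    by (intro cong_sum cong_scalar_left assms(1))
  also have "(\<Sum>i\<in>I. int (x i) * (k * a i)) = k * (\<Sum>i\<in>I. int (x i) * a i)"
    by (simp add: sum_distrib_left algebra_simps)
  also have "[\<dots> = k * r] (mod int q)" by (intro cong_scalar_left assms(2))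
  finally show ?thesis .
qed

lemma gcd_dvd_multiple:
  assumes "[x = k * y] (mod int q)" shows "gcd k (int q) dvd x"
proof -
  have "gcd k (int q) dvd x - k * y"
    using assms by (meson cong_iff_dvd_diff dvd_trans gcd_dvd2)
  then have "gcd k (int q) dvd (x - k * y) + k * y" by (intro dvd_add) auto
  then show ?thesis by simp
qed

text \<open>Pairing with \<open>b\<close> sends the simplex of size s into an interval of length s
  times the width, but covering requires every multiple of g = gcd k q to occur modulo q. Values of
  the interval congruent to the first multiple of g beyond its upper end lie at least q below that
  multiple. Rounding to a multiple of g costs at most g <= width, hence s + 1.\<close>

lemma not_covers_of_small_width:
  assumes fin: "finite I" and q: "q > 0" and b: "b \<in> multiples_lattice I q a" "\<exists>i\<in>I. b i \<noteq> 0"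
    and s: "real_of_int (width I b) * (s + 1) < real q"
  shows "\<not> covers I q a s"
proof
  assume c: "covers I q a s"
  obtain k where k: "\<And>i. i \<in> I \<Longrightarrow> [b i = k * a i] (mod int q)"
    using b unfolding multiples_lattice_def by auto
  define g where "g = gcd k (int q)"
  have g: "g > 0" using q unfolding g_def by auto
  obtain i where i: "i \<in> I" "b i \<noteq> 0" using b by auto
  have "g dvd b i" unfolding g_def by (rule gcd_dvd_multiple[OF k[OF i(1)]])
  then have "g \<le> \<bar>b i\<bar>" using dvd_imp_le_int[OF i(2)] g by fastforce
  then have gw: "g \<le> width I b" using abs_le_width[OF fin i(1), of b] by linarith
  define hi lo where "hi = Max (insert 0 (b ` I))" and "lo = Min (insert 0 (b ` I))"
  define j where "j = \<lfloor>s * hi / g\<rfloor> + 1"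
  have j: "s * hi < g * j" "g * j \<le> s * hi + g"
  proof -
    define c where "c = s * hi / g"
    have c: "s * hi = g * c" using g unfolding c_def by simp
    have "c < of_int \<lfloor>c\<rfloor> + 1" "of_int \<lfloor>c\<rfloor> \<le> c" by linarith+
    then have "g * c < g * (of_int \<lfloor>c\<rfloor> + 1)" "g * of_int \<lfloor>c\<rfloor> \<le> g * c" using g by auto
    then show "s * hi < g * j" "g * j \<le> s * hi + g" unfolding c j_def c_def[symmetric] by (auto simp: algebra_simps)
  qed
  obtain u where u: "[k * (u * j) = g * j] (mod int q)" using bezout_residue g_def by metis
  obtain x :: "'a \<Rightarrow> nat" where x: "[(\<Sum>i\<in>I. int (x i) * a i) = u * j] (mod int q)" "real (\<Sum>i\<in>I. x i) \<le> s"
    using c unfolding covers_def by blast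
  define S where "S = (\<Sum>i\<in>I. int (x i) * b i)"
  have S: "[S = g * j] (mod int q)" unfolding S_def using pairing_cong[OF k x(1)] u by (rule cong_trans)
  have b_le: "lo \<le> b i" "b i \<le> hi" if "i \<in> I" for i using fin that unfolding lo_def hi_def by auto
  have lh: "lo \<le> 0" "0 \<le> hi" using fin unfolding lo_def hi_def by auto
  have "S \<le> (\<Sum>i\<in>I. int (x i) * hi)" "(\<Sum>i\<in>I. int (x i) * lo) \<le> S"
    unfolding S_def using b_le by (auto intro!: sum_mono mult_left_mono)
  then have S2: "S \<le> int (\<Sum>i\<in>I. x i) * hi" "int (\<Sum>i\<in>I. x i) * lo \<le> S"
    by (simp_all add: sum_distrib_right)
  have "real_of_int S \<le> real (\<Sum>i\<in>I. x i) * hi" "real (\<Sum>i\<in>I. x i) * lo \<le> real_of_int S"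
    using S2[folded of_int_le_iff[where 'a=real]] by auto
  moreover have "real (\<Sum>i\<in>I. x i) * hi \<le> s * hi" using x(2) lh by (intro mult_right_mono) auto
  moreover have "s * lo \<le> real (\<Sum>i\<in>I. x i) * lo" using x(2) lh by (intro mult_right_mono_neg) auto
  ultimately have S3: "S \<le> s * hi" "s * lo \<le> S" by auto
  obtain m where m: "g * j - S = int q * m" using S by (metis cong_iff_dvd_diff cong_sym dvd_def)
  have "real_of_int S < real_of_int (g * j)" using S3 j by simp
  then have "g * j - S > 0" by linarith
  then have "m > 0" using m q by (metis of_nat_0_less_iff zero_less_mult_pos)
  then have "int q \<le> g * j - S" using m by (metis int_one_le_iff_zero_less mult.right_neutral mult_left_mono of_nat_0_le_iff)
  then have "real q \<le> real_of_int (g * j) - S" by linarith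
  also have "\<dots> \<le> s * (hi - lo) + g" using S3 j by (simp add: algebra_simps)
  also have "\<dots> \<le> s * width I b + width I b" using gw unfolding width_def hi_def lo_def by simp
  finally show False using s by (simp add: algebra_simps)
qed

lemma card_box_le:
  fixes c :: real assumes "finite I" "c \<ge> 0"
  shows "finite {x::'i \<Rightarrow> nat. x \<in> extensional I \<and> (\<forall>i\<in>I. real (x i) \<le> c)}"
    and "real (card {x::'i \<Rightarrow> nat. x \<in> extensional I \<and> (\<forall>i\<in>I. real (x i) \<le> c)}) \<le> (c + 1) ^ card I"
proof -
  have e: "{x::'i \<Rightarrow> nat. x \<in> extensional I \<and> (\<forall>i\<in>I. real (x i) \<le> c)} = I \<rightarrow>\<^sub>E {..nat \<lfloor>c\<rfloor>}"
    using assms(2) by (auto simp: PiE_def Pi_def le_nat_floor le_floor_iff nat_le_iff le_nat_iff)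
  show "finite {x::'i \<Rightarrow> nat. x \<in> extensional I \<and> (\<forall>i\<in>I. real (x i) \<le> c)}"
    unfolding e using assms by (intro finite_PiE) auto
  have "real (nat \<lfloor>c\<rfloor> + 1) ^ card I \<le> (c + 1) ^ card I"
    using assms(2) by (intro power_mono) auto
  then show "real (card {x::'i \<Rightarrow> nat. x \<in> extensional I \<and> (\<forall>i\<in>I. real (x i) \<le> c)}) \<le> (c + 1) ^ card I"
    unfolding e using assms by (simp add: card_funcsetE)
qed

text \<open>
  A vector of width slightly above the threshold still obstructs covering: the residues \<open>r\<close> for which
  \<open>k r\<close> lies in a window of length \<open>\<tau>\<close> can only be reached from two corners of the simplex,
  and these corners contain fewer than \<open>\<tau>\<close> lattice points.
\<close>

lemma not_covers_near_threshold:
  fixes a b :: "'i \<Rightarrow> int" and s Y \<tau> :: real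
  assumes fin: "finite I" and q: "q > 0" and b: "b \<in> multiples_lattice I q a"
    and h: "h \<in> I" and Y: "Y > 0" "Y \<le> b h"
    and bj: "\<And>j. j \<in> I \<Longrightarrow> j \<noteq> h \<Longrightarrow> Y / 3 \<le> b j \<and> b j \<le> 2 * Y / 3"
    and \<tau>: "s * b h \<le> q + \<tau>" "0 \<le> \<tau>" "\<tau> < q" "2 * (3 * \<tau> / Y + 1) ^ card I < \<tau>"
  shows "\<not> covers I q a s"
proof
  assume "covers I q a s"
  then obtain X :: "int \<Rightarrow> 'i \<Rightarrow> nat" where X: "\<And>r. [(\<Sum>i\<in>I. int (X r i) * a i) = r] (mod int q)"
    "\<And>r. real (\<Sum>i\<in>I. X r i) \<le> s"
    unfolding covers_def by metis
  obtain k where k: "\<And>i. i \<in> I \<Longrightarrow> [b i = k * a i] (mod int q)"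
    using b unfolding multiples_lattice_def by auto
  define g where "g = gcd k (int q)"
  have g: "g > 0" "g dvd int q" "g dvd k" using q unfolding g_def by auto
  obtain u where u: "\<And>j. [k * (u * j) = g * j] (mod int q)" using bezout_residue g_def by metis
  obtain e where e: "int q = g * e" using g by auto
  obtain k' where k': "k = g * k'" using g by auto
  have epos: "e > 0" using e q g by (metis of_nat_0_less_iff zero_less_mult_pos)
  \<comment> \<open>For each j, adding multiples of e = q / g to u j gives g classes r modulo q with
    k r = g j. So the window holds at least \<tau> classes even though it meets only about \<tau> /
    g multiples of g.\<close>
  define r where "r = (\<lambda>(j, i). u * j + e * i)"
  have kr: "[k * r (j, i) = g * j] (mod int q)" for j i
  proof -
    have "k * r (j, i) = k * (u * j) + int q * (k' * i)" unfolding r_def e k' by (simp add: algebra_simps)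
    then show ?thesis using cong_add[OF u[of j] cong_mult_self_left[of "int q" "k' * i"]] by simp
  qed
  define T where "T = {0..\<lfloor>\<tau> / g\<rfloor>} \<times> {0..<g}"
  have finT: "finite T" unfolding T_def by simp
  have gj: "0 \<le> g * j" "g * j \<le> \<tau>" "g * j < int q" if "(j, i) \<in> T" for j i
  proof -
    have "j \<ge> 0" "j \<le> \<tau> / g" using that unfolding T_def by (auto simp: le_floor_iff)
    then show a: "0 \<le> g * j" "g * j \<le> \<tau>" using g by (auto simp: field_simps)
    show "g * j < int q" using a(2) \<tau>(3) by linarith
  qed
  have cardT: "\<tau> \<le> card T"
  proof -
    have "\<tau> / g \<le> \<lfloor>\<tau> / g\<rfloor> + 1" by linarith
    then have "\<tau> \<le> (\<lfloor>\<tau> / g\<rfloor> + 1) * g" using g by (simp add: field_simps)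
    moreover have "\<lfloor>\<tau> / g\<rfloor> \<ge> 0" using g \<tau> by simp
    ultimately show ?thesis unfolding T_def using g by (simp add: card_cartesian_product)
  qed
  define f where "f t = restrict (X (r t)) I" for t
  have inj: "inj_on f T"
  proof (rule inj_onI)
    fix t t' assume t: "t \<in> T" "t' \<in> T" "f t = f t'"
    obtain j i where ji: "t = (j, i)" by (cases t)
    obtain j' i' where ji': "t' = (j', i')" by (cases t')
    have "X (r t) l = X (r t') l" if "l \<in> I" for l
      using t(3) that unfolding f_def by (metis restrict_apply')
    then have "(\<Sum>l\<in>I. int (X (r t) l) * a l) = (\<Sum>l\<in>I. int (X (r t') l) * a l)"
      by (intro sum.cong) auto
    then have rr: "[r t = r t'] (mod int q)" using X(1)[of "r t"] X(1)[of "r t'"]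
      by (metis cong_sym cong_trans)
    then have "[g * j = g * j'] (mod int q)"
      using kr[of j i] kr[of j' i'] cong_scalar_left[OF rr, of k] unfolding ji ji'
      by (metis cong_sym cong_trans)
    then have "g * j = g * j'" using gj[of j i] gj[of j' i'] t(1,2) unfolding ji ji'
      by (simp add: cong_def)
    then have jj: "j = j'" using g by simp
    then have "[e * i = e * i'] (mod int q)" using rr unfolding ji ji' r_def by (simp add: cong_add_lcancel)
    then have "e * g dvd e * (i - i')" using e by (simp add: cong_iff_dvd_diff algebra_simps)
    then have "g dvd i - i'" using epos by simp
    moreover have "\<bar>i - i'\<bar> < g" using t(1,2) unfolding ji ji' T_def by auto
    ultimately have "i = i'" using dvd_imp_le_int[of "i - i'" g] by fastforce
    then show "t = t'" using jj ji ji' by simp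
  qed
  define c where "c = 3 * \<tau> / Y"
  have c0: "c \<ge> 0" unfolding c_def using \<tau> Y by simp
  define Bot where "Bot = {x::'i \<Rightarrow> nat. x \<in> extensional I \<and> (\<forall>i\<in>I. real (x i) \<le> c)}"
  have Bot: "finite Bot" "real (card Bot) \<le> (c + 1) ^ card I"
    unfolding Bot_def using card_box_le[OF fin c0] by auto
  define \<sigma> where "\<sigma> = nat \<lfloor>s\<rfloor>"
  \<comment> \<open>Replacing coordinate h by the slack of the coordinate sum carries the corner of
    the simplex at \<sigma> e_h into the corner at 0, so one box count serves both corners.\<close>
  define \<phi> where "\<phi> = (\<lambda>x::'i \<Rightarrow> nat. x(h := \<sigma> - (\<Sum>i\<in>I. x i)))"
  define Top where "Top = {x. x \<in> extensional I \<and> (\<Sum>i\<in>I. x i) \<le> \<sigma> \<and> \<phi> x \<in> Bot}"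
  have split: "(\<Sum>i\<in>I. x i) = x h + (\<Sum>i\<in>I - {h}. x i)" for x :: "'i \<Rightarrow> nat"
    using fin h by (simp add: sum.remove)
  have "inj_on \<phi> Top"
  proof (rule inj_onI)
    fix x y assume xy: "x \<in> Top" "y \<in> Top" "\<phi> x = \<phi> y"
    have off: "x i = y i" if "i \<noteq> h" for i using fun_cong[OF xy(3), of i] that unfolding \<phi>_def by simp
    then have "(\<Sum>i\<in>I - {h}. x i) = (\<Sum>i\<in>I - {h}. y i)" by (intro sum.cong) auto
    moreover have "\<sigma> - (\<Sum>i\<in>I. x i) = \<sigma> - (\<Sum>i\<in>I. y i)"
      using fun_cong[OF xy(3), of h] unfolding \<phi>_def by simp
    moreover have "(\<Sum>i\<in>I. x i) \<le> \<sigma>" "(\<Sum>i\<in>I. y i) \<le> \<sigma>" using xy(1,2) unfolding Top_def by auto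
    ultimately have "x h = y h" using split[of x] split[of y] by linarith
    then show "x = y" using off by (intro ext) metis
  qed
  moreover have "\<phi> ` Top \<subseteq> Bot" unfolding Top_def by auto
  ultimately have Top: "finite Top" "card Top \<le> card Bot"
    using Bot(1) by (auto intro: inj_on_finite card_inj_on_le)
  have "f ` T \<subseteq> Bot \<union> Top"
  proof
    fix y assume "y \<in> f ` T"
    then obtain j i where ji: "(j, i) \<in> T" "y = f (j, i)" by auto
    define x where "x = X (r (j, i))"
    have y: "y = restrict x I" using ji unfolding f_def x_def by simp
    define S where "S = (\<Sum>i\<in>I. int (x i) * b i)"
    have "[S = k * r (j, i)] (mod int q)" unfolding S_def by (rule pairing_cong[OF k]) (simp_all add: x_def X)
    then have S: "[S = g * j] (mod int q)" using kr by (rule cong_trans)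
    define len where "len = (\<Sum>i\<in>I. x i)"
    have l: "real len \<le> s" using X(2) unfolding len_def x_def by simp
    then have "s \<ge> 0" by linarith
    then have \<sigma>: "len \<le> \<sigma>" "real \<sigma> \<le> s" using l unfolding \<sigma>_def by (auto simp: le_nat_floor)
    have bpos: "Y / 3 \<le> b i" if "i \<in> I" for i using bj[OF that] Y by (cases "i = h") auto
    have term_nonneg: "0 \<le> real (x i) * b i" if "i \<in> I" for i using bpos[OF that] Y by simp
    have realS: "real_of_int S = (\<Sum>i\<in>I. real (x i) * b i)" unfolding S_def by simp
    then have "real_of_int S \<ge> 0" using term_nonneg by (simp add: sum_nonneg)
    then have S0: "S \<ge> 0" by simp
    obtain m where m: "S - g * j = int q * m" using S by (metis cong_iff_dvd_diff dvd_def)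
    \<comment> \<open>All b_i, and b_h - b_i for i \<noteq> h, are at least Y / 3. A unit step away
      from either vertex therefore changes the pairing by at least Y / 3, and with \<tau> at
      disposal every coordinate is at most 3 \<tau> / Y.\<close>
    have small: "real n \<le> c" if "real n * z \<le> \<tau>" "Y / 3 \<le> z" for n z
    proof -
      have "real n * (Y / 3) \<le> real n * z" using that by (intro mult_left_mono) auto
      then show ?thesis using that Y unfolding c_def by (simp add: field_simps)
    qed
    \<comment> \<open>If m <= 0 the pairing is at most \<tau> and the point lies near the vertex 0.
      Otherwise the pairing is at least q, within \<tau> of its maximum s b_h, and the point lies
      near the vertex of h.\<close>
    show "y \<in> Bot \<union> Top"
    proof (cases "m \<le> 0")
      case True
      then have "int q * m \<le> 0" by (simp add: mult_nonneg_nonpos)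
      then have "S \<le> g * j" using m by simp
      then have "real_of_int S \<le> \<tau>" using gj[OF ji(1)] by linarith
      then have "real (x i) * b i \<le> \<tau>" if "i \<in> I" for i
        using member_le_sum[OF that, of "\<lambda>i. real (x i) * b i"] term_nonneg fin that
        unfolding realS by auto
      then have "real (x i) \<le> c" if "i \<in> I" for i using small bpos that by blast
      then show ?thesis unfolding y Bot_def by auto
    next
      case False
      then have "int q * 1 \<le> int q * m" by (intro mult_left_mono) auto
      then have "int q \<le> S" using m gj[OF ji(1)] by linarith
      then have "real q \<le> real_of_int S" by linarith
      define B where "B = real_of_int (b h)"
      have Bb: "Y / 3 \<le> B - b i" if "i \<in> I" "i \<noteq> h" for i using bj[OF that] Y unfolding B_def by auto
      have BY: "Y / 3 \<le> B" using Y unfolding B_def by auto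
      have "B * \<sigma> \<le> B * s" using \<sigma> Y unfolding B_def by (intro mult_left_mono) auto
      then have "B * \<sigma> - S \<le> \<tau>" using \<tau>(1) \<open>real q \<le> S\<close> unfolding B_def by (simp add: mult.commute)
      moreover have "B * \<sigma> - S = real (\<sigma> - len) * B + (\<Sum>i\<in>I. real (x i) * (B - b i))"
        using \<sigma> unfolding realS len_def
        by (simp add: algebra_simps of_nat_diff sum_subtractf sum_distrib_left)
      moreover have "(\<Sum>i\<in>I. real (x i) * (B - b i)) = (\<Sum>i\<in>I - {h}. real (x i) * (B - b i))"
        using fin h unfolding B_def by (simp add: sum.remove)
      ultimately have le: "real (\<sigma> - len) * B + (\<Sum>i\<in>I - {h}. real (x i) * (B - b i)) \<le> \<tau>" by simp
      have nn: "0 \<le> real (x i) * (B - b i)" if "i \<in> I - {h}" for i using Bb that Y by fastforce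
      have p1: "real (\<sigma> - len) \<le> c"
      proof (rule small[OF _ BY])
        have "0 \<le> (\<Sum>i\<in>I - {h}. real (x i) * (B - b i))" using nn by (rule sum_nonneg)
        then show "real (\<sigma> - len) * B \<le> \<tau>" using le by linarith
      qed
      have p2: "real (x i) \<le> c" if "i \<in> I" "i \<noteq> h" for i
      proof (rule small[OF _ Bb[OF that]])
        have "real (x i) * (B - b i) \<le> (\<Sum>i\<in>I - {h}. real (x i) * (B - b i))"
          using that fin nn by (intro member_le_sum) auto
        moreover have "0 \<le> real (\<sigma> - len) * B" using BY Y by simp
        ultimately show "real (x i) * (B - b i) \<le> \<tau>" using le by linarith
      qed
      have "(\<Sum>i\<in>I. y i) = len" unfolding y len_def by simp
      then have "y \<in> Top" using p1 p2 \<sigma> h unfolding Top_def Bot_def \<phi>_def y by (auto simp: extensional_def)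
      then show ?thesis by simp
    qed
  qed
  then have "card (f ` T) \<le> card (Bot \<union> Top)" using Bot Top by (intro card_mono) auto
  also have "\<dots> \<le> card Bot + card Top" by (rule card_Un_le)
  finally have "card T \<le> 2 * card Bot" using Top inj by (simp add: card_image)
  then have "real (card T) \<le> 2 * real (card Bot)" by linarith
  then have "\<tau> \<le> 2 * (c + 1) ^ card I" using Bot(2) cardT by linarith
  then show False using \<tau>(4) unfolding c_def by simp
qed

section \<open>Moebius inversion and divisors\<close>

definition moebius_mu :: "nat \<Rightarrow> real" where
  "moebius_mu m = (if squarefree m then (- 1) ^ card (prime_factors m) else 0)"

lemma moebius_mu_0 [simp]: "moebius_mu 0 = 0"
  by (simp add: moebius_mu_def)

lemma abs_moebius_mu_le: "\<bar>moebius_mu m\<bar> \<le> 1"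
  by (simp add: moebius_mu_def)

lemma moebius_mu_prime_mult:
  assumes "prime p" "\<not> p dvd e" "e > 0"
  shows "moebius_mu (p * e) = - moebius_mu e"
proof -
  have cop: "coprime p e" using assms by (simp add: prime_imp_coprime)
  have "squarefree (p * e) \<longleftrightarrow> squarefree e"
    using squarefree_mult_coprime[OF cop squarefree_prime[OF assms(1)]] squarefree_mono[of e "p * e"] by auto
  moreover have "prime_factors (p * e) = insert p (prime_factors e)"
    using assms by (subst prime_factors_product) (auto simp: prime_prime_factors)
  moreover have "p \<notin> prime_factors e" using assms by (auto simp: prime_factors_dvd)
  ultimately show ?thesis unfolding moebius_mu_def by simp
qed

text \<open>For a prime p dividing m, divisors e prime to p cancel against p e; the other divisors
  are multiples of p^2, where the function vanishes.\<close>

lemma sum_moebius_mu_divisors: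
  fixes m :: nat assumes "m > 0"
  shows "(\<Sum>e | e dvd m. moebius_mu e) = (if m = 1 then 1 else 0)"
proof (cases "m = 1")
  case True then show ?thesis by (simp add: moebius_mu_def)
next
  case False
  then obtain p where p: "prime p" "p dvd m" by (metis prime_factor_nat)
  define A where "A = {e. e dvd m \<and> \<not> p dvd e}"
  have fin: "finite {e. e dvd m}" using assms by simp
  have p0: "p > 0" using p prime_gt_0_nat by blast
  have epos: "e > 0" if "e dvd m" for e using that assms by (auto intro: Nat.gr0I)
  have finA: "finite A" unfolding A_def using assms by simp
  have inj: "inj_on ((*) p) A" using p0 by (auto simp: inj_on_def)
  have sub: "A \<union> (*) p ` A \<subseteq> {e. e dvd m}"
  proof -
    have "p * e dvd m" if "e dvd m" "\<not> p dvd e" for e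
      using p that by (intro divides_mult) (auto simp: prime_imp_coprime)
    then show ?thesis unfolding A_def by auto
  qed
  have "(\<Sum>e | e dvd m. moebius_mu e) = (\<Sum>e\<in>A \<union> (*) p ` A. moebius_mu e)"
  proof (rule sum.mono_neutral_right[OF fin sub], rule ballI)
    fix e assume "e \<in> {e. e dvd m} - (A \<union> (*) p ` A)"
    then have e: "e dvd m" "e \<notin> A" "e \<notin> (*) p ` A" by auto
    then have "p dvd e" unfolding A_def by auto
    then obtain f where f: "e = p * f" by auto
    have "f dvd m" using e(1) f by (metis dvd_mult_right)
    then have "p dvd f" using e(3) f unfolding A_def by auto
    then have "p\<^sup>2 dvd e" using f by (simp add: power2_eq_square)
    then have "\<not> squarefree e" using p(1) by (intro not_squarefreeI[of p]) auto
    then show "moebius_mu e = 0" by (simp add: moebius_mu_def)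
  qed
  also have "\<dots> = (\<Sum>e\<in>A. moebius_mu e) + (\<Sum>e\<in>(*) p ` A. moebius_mu e)"
    using finA by (intro sum.union_disjoint) (auto simp: A_def)
  also have "(\<Sum>e\<in>(*) p ` A. moebius_mu e) = (\<Sum>e\<in>A. moebius_mu (p * e))"
    using inj by (simp add: sum.reindex)
  also have "\<dots> = (\<Sum>e\<in>A. - moebius_mu e)"
    by (intro sum.cong moebius_mu_prime_mult) (auto simp: A_def p(1) intro: epos)
  finally show ?thesis using False by (simp add: sum_negf)
qed

lemma summable_inverse_power: "n \<ge> 2 \<Longrightarrow> summable (\<lambda>k. 1 / real k ^ n)"
  using inverse_power_summable[of n] by (simp add: field_simps)

lemma summable_moebius_mu_power:
  assumes "n \<ge> 2" shows "summable (\<lambda>k. norm (moebius_mu k / real k ^ n))"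
proof (rule summable_comparison_test'[OF summable_inverse_power[OF assms]])
  fix k show "norm (norm (moebius_mu k / real k ^ n)) \<le> 1 / real k ^ n"
    using abs_moebius_mu_le[of k] by (simp add: divide_right_mono)
qed

text \<open>The series may start at k = 0 because that term is 1 / 0 = 0.\<close>

lemma zeta_eq_suminf:
  assumes "n \<ge> 2" shows "zeta (real n) = (\<Sum>k. 1 / real k ^ n)"
proof -
  have "(\<Sum>k. 1 / real (Suc k) ^ n) = (\<Sum>k. 1 / real k ^ n)"
    using suminf_split_initial_segment[OF summable_inverse_power[OF assms], of 1] assms by simp
  moreover have "real (Suc k) powr (- real n) = 1 / real (Suc k) ^ n" for k
    by (simp add: powr_minus powr_realpow field_simps)
  ultimately show ?thesis unfolding zeta_def by simp
qed

text \<open>The product of the two absolutely convergent series is rearranged by N = m k; the inner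
  sum over the divisors of N vanishes unless N = 1.\<close>

lemma suminf_moebius_mu:
  assumes n: "n \<ge> 2" shows "(\<Sum>k. moebius_mu k / real k ^ n) * zeta (real n) = 1"
proof -
  define g where "g k = moebius_mu k / real k ^ n" for k
  define h where "h k = 1 / real k ^ n" for k
  have hsum: "(h has_sum suminf h) UNIV"
    by (rule norm_summable_imp_has_sum) (use summable_inverse_power[OF n] in \<open>auto simp: h_def[abs_def] summable_sums\<close>)
  have gsum: "(g has_sum suminf g) UNIV"
    by (rule norm_summable_imp_has_sum)
      (use summable_moebius_mu_power[OF n] summable_norm_cancel[OF summable_moebius_mu_power[OF n]] in \<open>auto simp: g_def[abs_def] summable_sums\<close>)
  have gabs: "(\<lambda>k. \<bar>g k\<bar>) summable_on UNIV"
    by (rule norm_summable_imp_summable_on) (use summable_moebius_mu_power[OF n] in \<open>simp add: g_def\<close>)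
  define F where "F = (\<lambda>(m, k). g m * h k)"
  have "(\<lambda>z. norm (F z)) summable_on Sigma UNIV (\<lambda>_. UNIV)"
  proof (rule summable_on_SigmaI)
    show "((\<lambda>k. norm (F (m, k))) has_sum \<bar>g m\<bar> * suminf h) UNIV" for m
      using has_sum_cmult_right[OF hsum, of "\<bar>g m\<bar>"] unfolding F_def by (simp add: abs_mult h_def)
    show "(\<lambda>m. \<bar>g m\<bar> * suminf h) summable_on UNIV" using gabs by (rule summable_on_cmult_left)
  qed auto
  then have Fsum: "F summable_on UNIV \<times> UNIV" by (rule abs_summable_summable)
  have "infsum F (UNIV \<times> UNIV) = (\<Sum>\<^sub>\<infinity>m. \<Sum>\<^sub>\<infinity>k. g m * h k)"
    using infsum_Sigma_banach[OF Fsum] unfolding F_def by simp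
  also have "\<dots> = suminf g * suminf h"
    using infsumI[OF hsum] infsumI[OF gsum] by (simp add: infsum_cmult_right' infsum_cmult_left')
  finally have prod: "infsum F (UNIV \<times> UNIV) = suminf g * suminf h" .
  have "infsum F (UNIV \<times> UNIV) = infsum F ({0<..} \<times> {0<..})"
    by (rule infsum_cong_neutral) (use n in \<open>auto simp: F_def g_def h_def\<close>)
  also have "\<dots> = infsum (\<lambda>(N, m). moebius_mu m / real N ^ n) (Sigma {0<..} (\<lambda>N. {m. m dvd N}))"
    by (rule infsum_reindex_bij_witness[of _ "\<lambda>(N, m). (m, N div m)" "\<lambda>(m, k). (m * k, m)"])
      (auto simp: F_def g_def h_def power_mult_distrib elim!: dvdE)
  also have "\<dots> = (\<Sum>\<^sub>\<infinity>N\<in>{0<..}. \<Sum>\<^sub>\<infinity>m\<in>{m. m dvd N}. moebius_mu m / real N ^ n)"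
  proof (rule infsum_Sigma'_banach[symmetric])
    have "F summable_on {0<..} \<times> {0<..}" using Fsum by (rule summable_on_subset_banach) auto
    also have "?this \<longleftrightarrow> (\<lambda>(N, m). moebius_mu m / real N ^ n) summable_on (Sigma {0<..} (\<lambda>N. {m. m dvd N}))"
      by (rule summable_on_reindex_bij_witness[of _ "\<lambda>(N, m). (m, N div m)" "\<lambda>(m, k). (m * k, m)"])
        (auto simp: F_def g_def h_def power_mult_distrib elim!: dvdE)
    finally show "(\<lambda>(N, m). moebius_mu m / real N ^ n) summable_on (Sigma {0<..} (\<lambda>N. {m. m dvd N}))" .
  qed
  also have "\<dots> = (\<Sum>\<^sub>\<infinity>N\<in>{0::nat<..}. if N = 1 then 1 else 0)"
  proof (rule infsum_cong)
    fix N :: nat assume "N \<in> {0<..}"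
    then have N: "N > 0" by simp
    then have "(\<Sum>\<^sub>\<infinity>m\<in>{m. m dvd N}. moebius_mu m / real N ^ n) = (\<Sum>m | m dvd N. moebius_mu m) / real N ^ n"
      by (simp add: sum_divide_distrib)
    then show "(\<Sum>\<^sub>\<infinity>m\<in>{m. m dvd N}. moebius_mu m / real N ^ n) = (if N = 1 then 1 else 0)"
      using sum_moebius_mu_divisors[OF N] by simp
  qed
  also have "\<dots> = (\<Sum>\<^sub>\<infinity>N\<in>{1::nat}. 1)" by (rule infsum_cong_neutral) auto
  also have "\<dots> = (1::real)" by simp
  finally show ?thesis using prod zeta_eq_suminf[OF n] unfolding g_def h_def by simp
qed

section \<open>Bounds for the number of divisors\<close>

definition divisor_count :: "nat \<Rightarrow> nat" where
  "divisor_count m = card {f. f dvd m}"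

lemma divisor_count_mult_le:
  assumes "x > 0" "y > 0" shows "divisor_count (x * y) \<le> divisor_count x * divisor_count y"
proof -
  have "{f. f dvd x * y} \<subseteq> (\<lambda>(f, g). f * g) ` ({f. f dvd x} \<times> {g. g dvd y})"
    by (auto elim!: dvd_productE simp: image_def)
  then have "card {f. f dvd x * y} \<le> card ({f. f dvd x} \<times> {g. g dvd y})"
    using assms by (intro surj_card_le) auto
  then show ?thesis unfolding divisor_count_def by (simp add: card_cartesian_product)
qed

lemma divisor_count_prime_power:
  assumes "prime p" shows "divisor_count (p ^ a) \<le> a + 1"
proof -
  have "{f. f dvd p ^ a} \<subseteq> (\<lambda>i. p ^ i) ` {..a}" using divides_primepow_nat[OF assms] by auto
  then have "card {f. f dvd p ^ a} \<le> card {..a}" by (intro surj_card_le) auto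
  then show ?thesis unfolding divisor_count_def by simp
qed

text \<open>
  A prime \<open>p \<ge> 5\<close> at most doubles the number of divisors and \<open>2 ^ 16 \<le> 5 ^ 7\<close>; the primes \<open>2\<close> and \<open>3\<close> contribute
  powers of \<open>log q\<close> only. The exponent \<open>7 / 16 < 1 / 2\<close> is what the planar case \<open>n = 2\<close> needs.
\<close>

lemma divisor_count_coprime_6:
  "m > 0 \<Longrightarrow> \<not> 2 dvd m \<Longrightarrow> \<not> 3 dvd m \<Longrightarrow> divisor_count m ^ 16 \<le> m ^ 7"
proof (induction m rule: less_induct)
  case (less m)
  show ?case
  proof (cases "m = 1")
    case True then show ?thesis by (simp add: divisor_count_def)
  next
    case False
    then obtain p where p: "prime p" "p dvd m" by (metis prime_factor_nat)
    obtain m' where m': "m = p * m'" using p by auto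
    have "p \<noteq> 2" "p \<noteq> 3" "p \<noteq> 4" using less.prems p by auto
    moreover have "p \<ge> 2" using p prime_ge_2_nat by blast
    ultimately have p5: "p \<ge> 5" by linarith
    have "m' > 0" using less.prems m' by (auto intro: Nat.gr0I)
    then have "m' < m" using m' p5 by simp
    moreover have "\<not> 2 dvd m'" "\<not> 3 dvd m'" using less.prems m' by auto
    ultimately have IH: "divisor_count m' ^ 16 \<le> m' ^ 7" using less.IH \<open>m' > 0\<close> by blast
    have "divisor_count p \<le> 2" using divisor_count_prime_power[OF p(1), of 1] by simp
    then have "divisor_count m \<le> 2 * divisor_count m'"
      using order.trans[OF divisor_count_mult_le[of p m'] mult_le_mono1] p5 \<open>m' > 0\<close> unfolding m' by simp
    then have "divisor_count m ^ 16 \<le> (2 * divisor_count m') ^ 16" by (intro power_mono) auto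
    also have "\<dots> = 2 ^ 16 * divisor_count m' ^ 16" by (simp only: power_mult_distrib)
    also have "\<dots> \<le> 5 ^ 7 * m' ^ 7" by (intro mult_mono IH) auto
    also have "\<dots> \<le> p ^ 7 * m' ^ 7" using p5 by (intro mult_mono power_mono) auto
    also have "\<dots> = m ^ 7" unfolding m' by (simp add: power_mult_distrib)
    finally show ?thesis .
  qed
qed

lemma divisor_count_le:
  assumes "q > 0"
  shows "real (divisor_count q) \<le> (1 + log 2 q)\<^sup>2 * q powr (7/16)"
proof -
  have log2: "real c \<le> log 2 q" if "2 ^ c \<le> q" for c
  proof -
    have "real (2 ^ c) \<le> real q" using that by (simp only: of_nat_le_iff)
    then have "log 2 (2 ^ c) \<le> log 2 q" by (intro log_mono) auto
    then show ?thesis by simp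
  qed
  define a where "a = multiplicity 2 q"
  obtain y where y: "q = 2 ^ a * y" "\<not> 2 dvd y" unfolding a_def using multiplicity_decompose'[of q 2] assms by auto
  have ypos: "y > 0" using assms y by (auto intro: Nat.gr0I)
  define b where "b = multiplicity 3 y"
  obtain m where m: "y = 3 ^ b * m" "\<not> 3 dvd m" unfolding b_def using multiplicity_decompose'[of y 3] ypos by auto
  have pos: "y > 0" "m > 0" using assms y m by (auto intro: Nat.gr0I)
  have "2 ^ a * 1 \<le> q" unfolding y(1) using pos by (intro mult_le_mono) auto
  then have a: "real a \<le> log 2 q" using log2 by simp
  have "2 ^ b \<le> (3::nat) ^ b" by (intro power_mono) auto
  moreover have "1 * (3 ^ b * 1) \<le> q" unfolding y(1) m(1) using pos by (intro mult_le_mono) auto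
  ultimately have "2 ^ b \<le> q" by simp
  then have b: "real b \<le> log 2 q" using log2 by simp
  have m6: "\<not> 2 dvd m" "\<not> 3 dvd m" using m y by auto
  have "real (divisor_count m) ^ 16 \<le> real m ^ 7"
    using divisor_count_coprime_6[OF pos(2) m6] by (metis of_nat_le_iff of_nat_power)
  also have "\<dots> = (real m powr (7/16)) ^ 16" using pos by (simp add: powr_power)
  finally have "real (divisor_count m) \<le> real m powr (7/16)"
    by (rule power_le_imp_le_base[of _ 15, simplified]) auto
  also have "\<dots> \<le> real q powr (7/16)"
  proof (rule powr_mono2)
    have "1 * (1 * m) \<le> q" unfolding y(1) m(1) by (intro mult_le_mono) auto
    then show "real m \<le> real q" by simp
  qed auto
  finally have cm: "real (divisor_count m) \<le> real q powr (7/16)" .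
  have "divisor_count q \<le> divisor_count (2 ^ a) * divisor_count y"
    unfolding y(1) using pos by (intro divisor_count_mult_le) auto
  also have "\<dots> \<le> (a + 1) * (divisor_count (3 ^ b) * divisor_count m)"
    unfolding m(1) using pos by (intro mult_le_mono divisor_count_mult_le divisor_count_prime_power) auto
  also have "\<dots> \<le> (a + 1) * ((b + 1) * divisor_count m)"
    by (intro mult_le_mono divisor_count_prime_power) auto
  finally have "real (divisor_count q) \<le> real ((a + 1) * ((b + 1) * divisor_count m))"
    by (simp only: of_nat_le_iff)
  also have "\<dots> = (real a + 1) * ((real b + 1) * real (divisor_count m))" by (simp add: algebra_simps)
  also have "\<dots> \<le> (1 + log 2 q) * ((1 + log 2 q) * q powr (7/16))"
    using a b cm by (intro mult_mono) auto
  finally show ?thesis by (simp add: power2_eq_square mult.assoc)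
qed

lemma divisor_count_small:
  assumes "\<epsilon> > 0"
  shows "\<forall>\<^sub>F q in sequentially. real (divisor_count q) \<le> \<epsilon> * sqrt q"
proof -
  have "(\<lambda>q::nat. (1 + log 2 (real q))\<^sup>2 * real q powr (7/16) / sqrt (real q)) \<longlonglongrightarrow> 0"
    by real_asymp
  then have "\<forall>\<^sub>F q::nat in sequentially. (1 + log 2 (real q))\<^sup>2 * real q powr (7/16) / sqrt (real q) < \<epsilon>"
    using assms by (rule order_tendstoD)
  then show ?thesis using eventually_gt_at_top[of 0]
  proof eventually_elim
    case (elim q)
    then have "(1 + log 2 (real q))\<^sup>2 * real q powr (7/16) < \<epsilon> * sqrt (real q)" by (simp add: field_simps)
    then show ?case using divisor_count_le[of q] elim by linarith
  qed
qed

lemma card_multiples_below: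
  assumes "g > 0" "g dvd q" shows "card {k. k < q \<and> g dvd k} = q div g"
proof -
  have "{k. k < q \<and> g dvd k} = (\<lambda>j. g * j) ` {..<q div g}"
    using assms by (auto simp: image_def elim!: dvdE)
  moreover have "inj_on (\<lambda>j. g * j) {..<q div g}" using assms by (auto simp: inj_on_def)
  ultimately show ?thesis by (simp add: card_image)
qed

text \<open>Such a k is a multiple of some divisor g > G of q, and g has fewer than q / G multiples
  below q. For G of order at least sqrt q the divisor bound makes these k a vanishing
  proportion.\<close>

lemma card_large_gcd:
  fixes G :: real
  assumes "q > 0" "G > 0"
  shows "real (card {k. k < q \<and> real (gcd k q) > G}) \<le> divisor_count q * q / G"
proof -
  define D where "D = {g. g dvd q \<and> real g > G}"
  have fin: "finite D" unfolding D_def using assms by simp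
  have "{k. k < q \<and> real (gcd k q) > G} \<subseteq> (\<Union>g\<in>D. {k. k < q \<and> g dvd k})"
    unfolding D_def by auto
  then have "card {k. k < q \<and> real (gcd k q) > G} \<le> card (\<Union>g\<in>D. {k. k < q \<and> g dvd k})"
    using fin by (intro card_mono) auto
  also have "\<dots> \<le> (\<Sum>g\<in>D. card {k. k < q \<and> g dvd k})" by (rule card_UN_le[OF fin])
  finally have "real (card {k. k < q \<and> real (gcd k q) > G}) \<le> (\<Sum>g\<in>D. real (card {k. k < q \<and> g dvd k}))"
    by (simp flip: of_nat_sum)
  also have "\<dots> \<le> (\<Sum>g\<in>D. q / G)"
  proof (rule sum_mono)
    fix g assume "g \<in> D"
    then have g: "g dvd q" "real g > G" "g > 0" using assms unfolding D_def by (auto intro: Nat.gr0I)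
    have "real (card {k. k < q \<and> g dvd k}) = real q / real g"
      using g by (simp add: card_multiples_below real_of_nat_div)
    also have "\<dots> \<le> q / G" using g assms by (intro divide_left_mono) auto
    finally show "real (card {k. k < q \<and> g dvd k}) \<le> q / G" .
  qed
  also have "\<dots> \<le> divisor_count q * (q / G)"
  proof -
    have "card D \<le> divisor_count q" unfolding D_def divisor_count_def using assms by (intro card_mono) auto
    then show ?thesis using assms by (simp add: mult_right_mono divide_right_mono)
  qed
  finally show ?thesis by simp
qed

section \<open>Counting pairs of lattice vectors\<close>

text \<open>This describes one coordinate (a_i, b_i, c_i) of a triple of vectors with fixed
  multipliers l and l'. The residue t is kept because several t may give the same point (u,
  v).\<close>

definition incidences :: "nat \<Rightarrow> int \<Rightarrow> int \<Rightarrow> (int \<times> int) set \<Rightarrow> (int \<times> int \<times> int) set" where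
  "incidences q l l' Q =
     {(t, u, v). t \<in> {0..<int q} \<and> (u, v) \<in> Q \<and> [u = l * t] (mod int q) \<and> [v = l' * t] (mod int q)}"

definition planar_box :: "real \<Rightarrow> real \<Rightarrow> (int \<times> int) set" where
  "planar_box A B = {(u, v). \<bar>real_of_int u\<bar> \<le> A \<and> \<bar>real_of_int v\<bar> \<le> B}"

definition spans_plane :: "(int \<times> int \<times> int) set \<Rightarrow> bool" where
  "spans_plane P \<longleftrightarrow> (\<exists>(t, u, v)\<in>P. \<exists>(t', u', v')\<in>P. u * v' \<noteq> u' * v)"

lemma planar_box_eq: "planar_box A B = {-\<lfloor>A\<rfloor>..\<lfloor>A\<rfloor>} \<times> {-\<lfloor>B\<rfloor>..\<lfloor>B\<rfloor>}"
proof -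
  have "\<bar>real_of_int u\<bar> \<le> C \<longleftrightarrow> -\<lfloor>C\<rfloor> \<le> u \<and> u \<le> \<lfloor>C\<rfloor>" for u C by linarith
  then show ?thesis unfolding planar_box_def by auto
qed

lemma finite_planar_box [simp]: "finite (planar_box A B)"
  unfolding planar_box_eq by simp

lemma card_planar_box:
  assumes "A \<ge> 0" "B \<ge> 0" shows "real (card (planar_box A B)) \<le> (2 * A + 1) * (2 * B + 1)"
proof -
  have c: "real (card {-\<lfloor>C\<rfloor>..\<lfloor>C\<rfloor>}) \<le> 2 * C + 1" if "C \<ge> 0" for C :: real
  proof -
    have "\<lfloor>C\<rfloor> \<ge> 0" using that by simp
    then have "real (card {-\<lfloor>C\<rfloor>..\<lfloor>C\<rfloor>}) = 2 * of_int \<lfloor>C\<rfloor> + 1" by simp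
    then show ?thesis by linarith
  qed
  show ?thesis unfolding planar_box_eq card_cartesian_product of_nat_mult
    using assms by (intro mult_mono c) auto
qed

lemma incidences_subset: "incidences q l l' Q \<subseteq> {0..<int q} \<times> Q"
  unfolding incidences_def by auto

lemma finite_incidences: "finite Q \<Longrightarrow> finite (incidences q l l' Q)"
  by (rule finite_subset[OF incidences_subset]) auto

lemma spans_plane_mono: "P \<subseteq> P' \<Longrightarrow> spans_plane P \<Longrightarrow> spans_plane P'"
  unfolding spans_plane_def by blast

text \<open>
  Two independent vectors of the box reduce every integer vector into the box modulo the lattice;
  hence every residue class contains as many points of the doubled box as the lattice has points in the box.
\<close>

lemma card_incidences_box:
  assumes q: "q > 0" and sp: "spans_plane (incidences q l l' (planar_box A B))"
  shows "real (card (incidences q l l' (planar_box A B))) * real q \<le> 25 * A * B"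
proof -
  let ?P = "incidences q l l' (planar_box A B)"
  obtain t1 u1 v1 t2 u2 v2 where p: "(t1, u1, v1) \<in> ?P" "(t2, u2, v2) \<in> ?P" "u1 * v2 \<noteq> u2 * v1"
    using sp unfolding spans_plane_def by blast
  have b: "\<bar>real_of_int u1\<bar> \<le> A" "\<bar>real_of_int v1\<bar> \<le> B" "\<bar>real_of_int u2\<bar> \<le> A" "\<bar>real_of_int v2\<bar> \<le> B"
    using p unfolding incidences_def planar_box_def by auto
  have c: "[u1 = l * t1] (mod int q)" "[v1 = l' * t1] (mod int q)" "[u2 = l * t2] (mod int q)" "[v2 = l' * t2] (mod int q)"
    using p unfolding incidences_def by auto
  have "u1 \<noteq> 0 \<or> u2 \<noteq> 0" "v1 \<noteq> 0 \<or> v2 \<noteq> 0" using p(3) by auto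
  then have AB: "A \<ge> 1" "B \<ge> 1" using b by linarith+
  define \<Delta> where "\<Delta> = real_of_int (u1 * v2 - u2 * v1)"
  have \<Delta>: "\<Delta> \<noteq> 0" using p(3) unfolding \<Delta>_def by (metis of_int_eq_0_iff right_minus_eq)
  \<comment> \<open>The coordinates of (x, y) in the basis of the two vectors are rounded. The
    remainder \<open>Y\<close> is a combination with coefficients of modulus at most 1/2 and stays
    in the box.\<close>
  define \<alpha> where "\<alpha> = (\<lambda>(x, y). round ((x * v2 - y * u2) / \<Delta>))"
  define \<beta> where "\<beta> = (\<lambda>(x, y). round ((y * u1 - x * v1) / \<Delta>))"
  define Y where "Y = (\<lambda>(x, y). (x - \<alpha> (x, y) * u1 - \<beta> (x, y) * u2, y - \<alpha> (x, y) * v1 - \<beta> (x, y) * v2))"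
  define \<tau> where "\<tau> z = \<alpha> z * t1 + \<beta> z * t2" for z
  have Yc: "[x = fst (Y (x, y)) + l * \<tau> (x, y)] (mod int q)" "[y = snd (Y (x, y)) + l' * \<tau> (x, y)] (mod int q)" for x y
  proof -
    define s r where "s = \<alpha> (x, y)" and "r = \<beta> (x, y)"
    have "[x - s * u1 - r * u2 + (s * u1 + r * u2) = x - s * u1 - r * u2 + (s * (l * t1) + r * (l * t2))] (mod int q)"
      by (intro cong_add cong_scalar_left c) auto
    then show "[x = fst (Y (x, y)) + l * \<tau> (x, y)] (mod int q)"
      unfolding Y_def \<tau>_def s_def[symmetric] r_def[symmetric] by (simp add: s_def[symmetric] r_def[symmetric] algebra_simps)
    have "[y - s * v1 - r * v2 + (s * v1 + r * v2) = y - s * v1 - r * v2 + (s * (l' * t1) + r * (l' * t2))] (mod int q)"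
      by (intro cong_add cong_scalar_left c) auto
    then show "[y = snd (Y (x, y)) + l' * \<tau> (x, y)] (mod int q)"
      unfolding Y_def \<tau>_def s_def[symmetric] r_def[symmetric] by (simp add: s_def[symmetric] r_def[symmetric] algebra_simps)
  qed
  have Yb: "\<bar>real_of_int (fst (Y (x, y)))\<bar> \<le> A" "\<bar>real_of_int (snd (Y (x, y)))\<bar> \<le> B" for x y
  proof -
    define s r where "s = (x * v2 - y * u2) / \<Delta>" and "r = (y * u1 - x * v1) / \<Delta>"
    have D: "s * \<Delta> = x * v2 - y * u2" "r * \<Delta> = y * u1 - x * v1" unfolding s_def r_def using \<Delta> by auto
    have "x * \<Delta> = (s * \<Delta>) * u1 + (r * \<Delta>) * u2" "y * \<Delta> = (s * \<Delta>) * v1 + (r * \<Delta>) * v2"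
      unfolding D unfolding \<Delta>_def by (simp_all add: algebra_simps)
    then have "x * \<Delta> = (s * u1 + r * u2) * \<Delta>" "y * \<Delta> = (s * v1 + r * v2) * \<Delta>" by (simp_all add: algebra_simps)
    then have xy: "x = s * u1 + r * u2" "y = s * v1 + r * v2" using \<Delta> by auto
    have rd: "\<bar>s - round s\<bar> \<le> 1/2" "\<bar>r - round r\<bar> \<le> 1/2"
      using of_int_round_abs_le[of s] of_int_round_abs_le[of r] by (simp_all add: abs_minus_commute)
    have half: "\<bar>(s - round s) * z1 + (r - round r) * z2\<bar> \<le> C" if "\<bar>z1\<bar> \<le> C" "\<bar>z2\<bar> \<le> C" for z1 z2 C :: real
    proof -
      have "\<bar>(s - round s) * z1\<bar> \<le> 1/2 * C" "\<bar>(r - round r) * z2\<bar> \<le> 1/2 * C"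
        unfolding abs_mult by (rule mult_mono; use rd that in auto)+
      then show ?thesis by linarith
    qed
    have ab: "\<alpha> (x, y) = round s" "\<beta> (x, y) = round r"
      unfolding \<alpha>_def \<beta>_def s_def r_def by simp_all
    have "real_of_int (fst (Y (x, y))) = (s - round s) * u1 + (r - round r) * u2"
      using xy(1) unfolding Y_def by (simp add: ab algebra_simps)
    then show "\<bar>real_of_int (fst (Y (x, y)))\<bar> \<le> A" using half[OF b(1,3)] by simp
    have "real_of_int (snd (Y (x, y))) = (s - round s) * v1 + (r - round r) * v2"
      using xy(2) unfolding Y_def by (simp add: ab algebra_simps)
    then show "\<bar>real_of_int (snd (Y (x, y)))\<bar> \<le> B" using half[OF b(2,4)] by simp
  qed
  define R where "R = {0..<int q}"
  \<comment> \<open>The q^2 classes times the incidences inject into the doubled box times q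
    residues. Since A, B >= 1, the doubled box has at most (4 A + 1) (4 B + 1) <= 25 A B
    points.\<close>
  define \<Phi> where "\<Phi> = (\<lambda>((x, y), (t, u, v)). ((fst (Y (x, y)) + u, snd (Y (x, y)) + v), (t - \<tau> (x, y)) mod int q))"
  have "inj_on \<Phi> ((R \<times> R) \<times> ?P)"
  proof (rule inj_onI)
    fix z z' assume z: "z \<in> (R \<times> R) \<times> ?P" "z' \<in> (R \<times> R) \<times> ?P" "\<Phi> z = \<Phi> z'"
    obtain x y t u v where zz: "z = ((x, y), (t, u, v))" by (metis surj_pair)
    obtain x' y' t' u' v' where zz': "z' = ((x', y'), (t', u', v'))" by (metis surj_pair)
    define w where "w = fst (Y (x, y)) + u"
    define w' where "w' = snd (Y (x, y)) + v"
    have w: "w = fst (Y (x', y')) + u'" "w' = snd (Y (x', y')) + v'"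
      and \<sigma>: "[t - \<tau> (x, y) = t' - \<tau> (x', y')] (mod int q)"
      using z(3) unfolding zz zz' \<Phi>_def w_def w'_def cong_def by auto
    have uv: "[u = l * t] (mod int q)" "[v = l' * t] (mod int q)" "[u' = l * t'] (mod int q)" "[v' = l' * t'] (mod int q)"
      using z(1,2) unfolding zz zz' incidences_def by auto
    have red: "[X = W - m * (T - S)] (mod int q)"
      if "[X = F + m * S] (mod int q)" "[U = m * T] (mod int q)" "W = F + U" for X W F U m T S :: int
    proof -
      have "[F + m * S + (U - U) = F + m * S + (U - m * T)] (mod int q)"
        by (intro cong_add cong_diff that(2)) auto
      then have "[F + m * S = W - m * (T - S)] (mod int q)" unfolding that(3) by (simp add: algebra_simps)
      with that(1) show ?thesis by (rule cong_trans)
    qed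
    have "[x = w - l * (t - \<tau> (x, y))] (mod int q)" "[x' = w - l * (t' - \<tau> (x', y'))] (mod int q)"
      "[y = w' - l' * (t - \<tau> (x, y))] (mod int q)" "[y' = w' - l' * (t' - \<tau> (x', y'))] (mod int q)"
      using red[OF Yc(1) uv(1) w_def] red[OF Yc(1) uv(3) w(1)] red[OF Yc(2) uv(2) w'_def] red[OF Yc(2) uv(4) w(2)]
      by auto
    moreover have "[w - l * (t - \<tau> (x, y)) = w - l * (t' - \<tau> (x', y'))] (mod int q)"
      "[w' - l' * (t - \<tau> (x, y)) = w' - l' * (t' - \<tau> (x', y'))] (mod int q)"
      using \<sigma> by (auto intro!: cong_diff cong_scalar_left)
    ultimately have "[x = x'] (mod int q)" "[y = y'] (mod int q)"
      by (meson cong_sym cong_trans)+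
    then have xx: "x = x'" "y = y'" using z(1,2) unfolding zz zz' R_def by (auto simp: cong_def)
    then have "u = u'" "v = v'" using w unfolding w_def w'_def by auto
    moreover have "[t - \<tau> (x, y) + \<tau> (x, y) = t' - \<tau> (x', y') + \<tau> (x, y)] (mod int q)"
      by (intro cong_add \<sigma>) auto
    then have "[t = t'] (mod int q)" using xx by simp
    then have "t = t'" using z(1,2) unfolding zz zz' incidences_def by (auto simp: cong_def)
    ultimately show "z = z'" using xx unfolding zz zz' by simp
  qed
  moreover have "\<Phi> ` ((R \<times> R) \<times> ?P) \<subseteq> planar_box (2 * A) (2 * B) \<times> R"
  proof
    fix z assume "z \<in> \<Phi> ` ((R \<times> R) \<times> ?P)"
    then obtain x y t u v where z: "(t, u, v) \<in> ?P" "z = \<Phi> ((x, y), (t, u, v))" by (auto simp del: split_paired_Ex)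
    have "\<bar>real_of_int u\<bar> \<le> A" "\<bar>real_of_int v\<bar> \<le> B" using z(1) unfolding incidences_def planar_box_def by auto
    then show "z \<in> planar_box (2 * A) (2 * B) \<times> R" using Yb[of x y] q
      unfolding z(2) \<Phi>_def planar_box_def R_def by auto
  qed
  ultimately have "card ((R \<times> R) \<times> ?P) \<le> card (planar_box (2 * A) (2 * B) \<times> R)"
    by (intro card_inj_on_le[of \<Phi>]) (auto simp: R_def)
  then have "q * (q * card ?P) \<le> q * card (planar_box (2 * A) (2 * B))"
    unfolding R_def by (simp add: card_cartesian_product algebra_simps)
  then have "q * card ?P \<le> card (planar_box (2 * A) (2 * B))" using q by simp
  then have "real q * real (card ?P) \<le> real (card (planar_box (2 * A) (2 * B)))" by (metis of_nat_le_iff of_nat_mult)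
  also have "\<dots> \<le> (2 * (2 * A) + 1) * (2 * (2 * B) + 1)" using AB by (intro card_planar_box) auto
  also have "\<dots> \<le> (5 * A) * (5 * B)" using AB by (intro mult_mono) auto
  finally show ?thesis by (simp add: algebra_simps)
qed

text \<open>Subtracting one fixed incidence moves all others into the box of differences, so a box
  far from the origin is controlled by a centred one.\<close>

lemma card_incidences_translate:
  assumes q: "q > 0" and diam: "\<And>u v u' v'. (u, v) \<in> Q \<Longrightarrow> (u', v') \<in> Q \<Longrightarrow> (u - u', v - v') \<in> planar_box A B"
  shows "card (incidences q l l' Q) \<le> card (incidences q l l' (planar_box A B))"
proof (cases "incidences q l l' Q = {}")
  case False
  then obtain t0 u0 v0 where p0: "(t0, u0, v0) \<in> incidences q l l' Q" by auto
  define f where "f = (\<lambda>(t, u, v). ((t - t0) mod int q, u - u0, v - v0))"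
  show ?thesis
  proof (rule card_inj_on_le[of f])
    show "inj_on f (incidences q l l' Q)"
    proof (rule inj_onI)
      fix z z' assume z: "z \<in> incidences q l l' Q" "z' \<in> incidences q l l' Q" "f z = f z'"
      obtain t u v where zz: "z = (t, u, v)" by (metis surj_pair)
      obtain t' u' v' where zz': "z' = (t', u', v')" by (metis surj_pair)
      have "[t - t0 = t' - t0] (mod int q)" using z(3) unfolding zz zz' f_def cong_def by auto
      then have "[t = t'] (mod int q)" using cong_add[of "t - t0" "t' - t0" "int q" t0 t0] by simp
      then have "t = t'" using z(1,2) unfolding zz zz' incidences_def by (auto simp: cong_def)
      then show "z = z'" using z(3) unfolding zz zz' f_def by auto
    qed
    show "f ` incidences q l l' Q \<subseteq> incidences q l l' (planar_box A B)"
    proof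
      fix z assume "z \<in> f ` incidences q l l' Q"
      then obtain t u v where z: "(t, u, v) \<in> incidences q l l' Q" "z = f (t, u, v)" by auto
      have m: "[U - U0 = m * ((t - t0) mod int q)] (mod int q)"
        if "[U = m * t] (mod int q)" "[U0 = m * t0] (mod int q)" for U U0 m
      proof -
        have "[U - U0 = m * t - m * t0] (mod int q)" using that by (rule cong_diff)
        also have "m * t - m * t0 = m * (t - t0)" by (simp add: algebra_simps)
        also have "[\<dots> = m * ((t - t0) mod int q)] (mod int q)" by (intro cong_scalar_left) (simp add: cong_def)
        finally show ?thesis .
      qed
      show "z \<in> incidences q l l' (planar_box A B)"
        using z(1) p0 diam[of u v u0 v0] m q unfolding z(2) f_def incidences_def by auto
    qed
  qed (simp add: finite_incidences)
qed simp

text \<open>The range of the distinguished coordinate h may depend on the other coordinates. The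
  condition on the width has this form: it confines one coordinate to an interval placed relative to
  another one.\<close>

lemma card_dependent_product_le:
  fixes T :: "'i \<Rightarrow> 'b set" and K :: real
  assumes fin: "finite I" "h \<in> I" "\<And>i. i \<in> I - {h} \<Longrightarrow> finite (T i)" "\<And>g. finite (Z g)"
    and K: "\<And>g. real (card (Z g)) \<le> K"
    and S: "\<And>f. f \<in> S \<Longrightarrow> f \<in> extensional I \<and> (\<forall>i\<in>I - {h}. f i \<in> T i) \<and> f h \<in> Z (restrict f (I - {h}))"
  shows "finite S" "real (card S) \<le> K * (\<Prod>i\<in>I - {h}. real (card (T i)))"
proof -
  define G where "G = Pi\<^sub>E (I - {h}) T"
  have finG: "finite G" unfolding G_def using fin by (intro finite_PiE) auto
  define U where "U = (\<Union>g\<in>G. (\<lambda>y. g(h := y)) ` Z g)"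
  have finU: "finite U" unfolding U_def using finG fin by auto
  have "S \<subseteq> U"
  proof
    fix f assume "f \<in> S"
    then have f: "f \<in> extensional I" "\<And>i. i \<in> I - {h} \<Longrightarrow> f i \<in> T i" "f h \<in> Z (restrict f (I - {h}))"
      using S by auto
    have "restrict f (I - {h}) \<in> G" unfolding G_def using f by auto
    moreover have "f = (restrict f (I - {h}))(h := f h)"
      using f(1) fin(2) by (auto simp: fun_eq_iff extensional_def)
    ultimately show "f \<in> U" unfolding U_def using f(3) by blast
  qed
  then show "finite S" using finU finite_subset by blast
  have "card S \<le> card U" using \<open>S \<subseteq> U\<close> finU by (rule card_mono[rotated])
  also have "\<dots> \<le> (\<Sum>g\<in>G. card ((\<lambda>y. g(h := y)) ` Z g))" unfolding U_def by (rule card_UN_le[OF finG])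
  also have "\<dots> \<le> (\<Sum>g\<in>G. card (Z g))" using fin by (intro sum_mono card_image_le) auto
  finally have "real (card S) \<le> (\<Sum>g\<in>G. real (card (Z g)))" by (simp flip: of_nat_sum)
  also have "\<dots> \<le> (\<Sum>g\<in>G. K)" by (intro sum_mono K)
  also have "\<dots> = K * (\<Prod>i\<in>I - {h}. real (card (T i)))"
    unfolding G_def using fin by (simp add: card_PiE)
  finally show "real (card S) \<le> K * (\<Prod>i\<in>I - {h}. real (card (T i)))" .
qed

definition independent_pair :: "'i set \<Rightarrow> ('i \<Rightarrow> int) \<Rightarrow> ('i \<Rightarrow> int) \<Rightarrow> bool" where
  "independent_pair I b c \<longleftrightarrow> (\<exists>i\<in>I. \<exists>j\<in>I. b i * c j \<noteq> b j * c i)"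

text \<open>Once both multipliers are fixed the coordinates decouple, and counts of triples become
  products of planar counts.\<close>

definition proportional_triples ::
  "'i set \<Rightarrow> nat \<Rightarrow> int \<Rightarrow> int \<Rightarrow> (('i \<Rightarrow> int) \<times> ('i \<Rightarrow> int) \<times> ('i \<Rightarrow> int)) set" where
  "proportional_triples I q l l' = {(a, b, c). a \<in> residue_vectors I q \<and> b \<in> extensional I \<and> c \<in> extensional I \<and>
     (\<forall>i\<in>I. [b i = l * a i] (mod int q) \<and> [c i = l' * a i] (mod int q))}"

lemma card_proportional_triples_le:
  fixes K :: real
  assumes fin: "finite I" "h \<in> I" "\<And>i. i \<in> I - {h} \<Longrightarrow> finite (Q i)" "\<And>g. finite (Z g)"
    and K: "\<And>g. real (card (incidences q l l' (Z g))) \<le> K"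
    and S: "S \<subseteq> proportional_triples I q l l'"
      "\<And>a b c. (a, b, c) \<in> S \<Longrightarrow> (\<forall>i\<in>I - {h}. (b i, c i) \<in> Q i) \<and> (b h, c h) \<in> Z (restrict b (I - {h}))"
  shows "finite S" "real (card S) \<le> K * (\<Prod>i\<in>I - {h}. real (card (incidences q l l' (Q i))))"
proof -
  define F where "F = (\<lambda>(a::'a \<Rightarrow> int, b::'a \<Rightarrow> int, c::'a \<Rightarrow> int). \<lambda>i\<in>I. (a i, b i, c i))"
  have inj: "inj_on F S"
  proof (rule inj_onI)
    fix z z' assume z: "z \<in> S" "z' \<in> S" "F z = F z'"
    obtain a b c where zz: "z = (a, b, c)" by (metis surj_pair)
    obtain a' b' c' where zz': "z' = (a', b', c')" by (metis surj_pair)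
    have ext: "a \<in> extensional I" "b \<in> extensional I" "c \<in> extensional I"
       "a' \<in> extensional I" "b' \<in> extensional I" "c' \<in> extensional I"
      using S(1) z(1,2) unfolding zz zz' proportional_triples_def residue_vectors_def by (auto simp: PiE_def)
    have eq: "a i = a' i \<and> b i = b' i \<and> c i = c' i" if "i \<in> I" for i
      using fun_cong[OF z(3), of i] that unfolding zz zz' F_def by simp
    have "a = a'" "b = b'" "c = c'" using eq ext by (auto intro!: extensionalityI)
    then show "z = z'" unfolding zz zz' by simp
  qed
  have props: "finite (F ` S)" "real (card (F ` S)) \<le> K * (\<Prod>i\<in>I - {h}. real (card (incidences q l l' (Q i))))"
  proof -
    let ?Z = "\<lambda>g. incidences q l l' (Z (restrict (\<lambda>i. fst (snd (g i))) (I - {h})))"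
    have *: "f \<in> extensional I \<and> (\<forall>i\<in>I - {h}. f i \<in> incidences q l l' (Q i)) \<and> f h \<in> ?Z (restrict f (I - {h}))"
      if f: "f \<in> F ` S" for f
    proof -
      obtain z where "z \<in> S" "f = F z" using f by auto
      then obtain a b c where abc: "(a, b, c) \<in> S" "f = F (a, b, c)" by (metis surj_pair)
      have a: "a \<in> residue_vectors I q" "\<And>i. i \<in> I \<Longrightarrow> [b i = l * a i] (mod int q) \<and> [c i = l' * a i] (mod int q)"
        using S(1) abc(1) unfolding proportional_triples_def by auto
      have "restrict (\<lambda>i. fst (snd (restrict f (I - {h}) i))) (I - {h}) = restrict b (I - {h})"
        unfolding abc(2) F_def by auto
      then show ?thesis using S(2)[OF abc(1)] a fin(2) unfolding abc(2) F_def incidences_def residue_vectors_def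
        by (auto simp: PiE_def Pi_def)
    qed
    show "finite (F ` S)" "real (card (F ` S)) \<le> K * (\<Prod>i\<in>I - {h}. real (card (incidences q l l' (Q i))))"
      by (rule card_dependent_product_le[where Z = ?Z and T = "\<lambda>i. incidences q l l' (Q i)", OF fin(1,2) _ _ K *]; simp add: finite_incidences fin)+
  qed
  then show "finite S" "real (card S) \<le> K * (\<Prod>i\<in>I - {h}. real (card (incidences q l l' (Q i))))"
    using inj by (auto simp: card_image finite_image_iff)
qed

lemma spans_plane_of_independent_pair:
  assumes "(a, b, c) \<in> proportional_triples I q l l'" "independent_pair I b c"
    and "\<And>i. i \<in> I \<Longrightarrow> (b i, c i) \<in> Q"
  shows "spans_plane (incidences q l l' Q)"
proof -
  obtain i j where ij: "i \<in> I" "j \<in> I" "b i * c j \<noteq> b j * c i" using assms(2) unfolding independent_pair_def by blast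
  have "(a i, b i, c i) \<in> incidences q l l' Q" if "i \<in> I" for i
    using assms(1,3) that unfolding incidences_def proportional_triples_def residue_vectors_def by (auto simp: PiE_def Pi_def)
  then show ?thesis using ij unfolding spans_plane_def by blast
qed

text \<open>The area bound needs two independent incidences in the box. A single independent pair of
  vectors supplies them, and the bound then applies at every coordinate; without such a pair the set
  is empty.\<close>

lemma card_independent_triples_le:
  fixes A B :: real
  assumes fin: "finite I" "I \<noteq> {}" and q: "q > 0" and AB: "A \<ge> 0" "B \<ge> 0"
    and S: "S \<subseteq> {(a, b, c) \<in> proportional_triples I q l l'. independent_pair I b c \<and>
          (\<forall>i\<in>I. \<bar>real_of_int (b i)\<bar> \<le> A \<and> \<bar>real_of_int (c i)\<bar> \<le> B)}"
  shows "finite S" "real (card S) \<le> (25 * A * B / q) ^ card I"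
proof -
  have "finite S \<and> real (card S) \<le> (25 * A * B / q) ^ card I"
  proof (cases "S = {}")
    case False
    obtain h where h: "h \<in> I" using fin by auto
    obtain a b c where "(a, b, c) \<in> S" using False by auto
    then have "(a, b, c) \<in> proportional_triples I q l l'" "independent_pair I b c"
        "\<And>i. i \<in> I \<Longrightarrow> (b i, c i) \<in> planar_box A B"
      using S by (auto simp: planar_box_def)
    then have sp: "spans_plane (incidences q l l' (planar_box A B))" by (rule spans_plane_of_independent_pair)
    define K where "K = 25 * A * B / q"
    have K: "real (card (incidences q l l' (planar_box A B))) \<le> K" unfolding K_def
      using card_incidences_box[OF q sp] q by (simp add: field_simps)
    have *: "finite S" "real (card S) \<le> K * (\<Prod>i\<in>I - {h}. real (card (incidences q l l' (planar_box A B))))"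
    proof -
      have sub: "S \<subseteq> proportional_triples I q l l'" using S by auto
      have "(\<forall>i\<in>I - {h}. (b i, c i) \<in> planar_box A B) \<and> (b h, c h) \<in> planar_box A B" if "(a, b, c) \<in> S" for a b c
        using S h that by (auto simp: planar_box_def)
      then show "finite S" "real (card S) \<le> K * (\<Prod>i\<in>I - {h}. real (card (incidences q l l' (planar_box A B))))"
        using card_proportional_triples_le[where Z = "\<lambda>_. planar_box A B" and Q = "\<lambda>_. planar_box A B" and S = S, OF fin(1) h _ _ K] sub
        by auto
    qed
    have "K * (\<Prod>i\<in>I - {h}. real (card (incidences q l l' (planar_box A B)))) \<le> K * (\<Prod>i\<in>I - {h}. K)"
      using K AB unfolding K_def by (intro mult_left_mono prod_mono) auto
    also have "\<dots> = K ^ card I" using fin h by (simp add: card_Diff_singleton card_gt_0_iff power_Suc[symmetric] del: power_Suc)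
    finally show ?thesis using * unfolding K_def by simp
  qed (use AB in simp)
  then show "finite S" "real (card S) \<le> (25 * A * B / q) ^ card I" by auto
qed

lemma card_linear_congruence:
  fixes k b :: int
  assumes "q > 0"
  shows "card {l \<in> {0..<int q}. [k * l = b] (mod int q)} =
     (if gcd k (int q) dvd b then nat (gcd k (int q)) else 0)"
proof -
  define g where "g = gcd k (int q)"
  have g: "g > 0" "g dvd k" "g dvd int q" using assms unfolding g_def by auto
  obtain e where e: "int q = g * e" using g by auto
  have epos: "e > 0" using e assms g by (metis of_nat_0_less_iff zero_less_mult_pos)
  obtain k' where k': "k = g * k'" using g by auto
  have cop: "coprime k' e"
  proof -
    have "g * gcd k' e = g * 1" unfolding gcd_mult_distrib_int[symmetric]
      using g e k' g_def by (metis abs_of_pos gcd_mult_distrib_int mult.right_neutral)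
    then show ?thesis using g by (simp add: coprime_iff_gcd_eq_1)
  qed
  show ?thesis
  proof (cases "g dvd b")
    case True
    then obtain b' where b': "b = g * b'" by auto
    obtain u where u: "[k' * u = 1] (mod e)" using cong_solve_coprime_int[OF cop] by auto
    define l0 where "l0 = (u * b') mod e"
    have l0: "0 \<le> l0" "l0 < e" using epos unfolding l0_def by auto
    have l0c: "[k' * l0 = b'] (mod e)"
    proof -
      have "[k' * l0 = k' * (u * b')] (mod e)" unfolding l0_def by (intro cong_scalar_left) (simp add: cong_def)
      also have "k' * (u * b') = (k' * u) * b'" by simp
      also have "[\<dots> = 1 * b'] (mod e)" by (intro cong_scalar_right u)
      finally show ?thesis by simp
    qed
    have iff: "[k * l = b] (mod int q) \<longleftrightarrow> [l = l0] (mod e)" for l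
    proof -
      have "[k * l = b] (mod int q) \<longleftrightarrow> [k' * l = b'] (mod e)"
        unfolding k' b' e using g by (simp add: cong_iff_dvd_diff mult.assoc flip: right_diff_distrib)
      also have "\<dots> \<longleftrightarrow> [k' * l = k' * l0] (mod e)" using l0c by (meson cong_sym cong_trans)
      also have "\<dots> \<longleftrightarrow> [l = l0] (mod e)" using cop by (simp add: cong_mult_lcancel coprime_commute)
      finally show ?thesis .
    qed
    have "bij_betw (\<lambda>j. l0 + e * j) {0..<g} {l \<in> {0..<int q}. [k * l = b] (mod int q)}"
    proof (rule bij_betwI[where g = "\<lambda>l. l div e"])
      show "(\<lambda>j. l0 + e * j) \<in> {0..<g} \<rightarrow> {l \<in> {0..<int q}. [k * l = b] (mod int q)}"
      proof
        fix j assume j: "j \<in> {0..<g}"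
        have "e * j \<le> e * (g - 1)" using j epos by (intro mult_left_mono) auto
        then have "l0 + e * j < int q" using l0 unfolding e by (simp add: algebra_simps)
        moreover have "[l0 + e * j = l0] (mod e)" by (simp add: cong_def)
        ultimately show "l0 + e * j \<in> {l \<in> {0..<int q}. [k * l = b] (mod int q)}"
          using j l0 epos iff by auto
      qed
      show "(\<lambda>l. l div e) \<in> {l \<in> {0..<int q}. [k * l = b] (mod int q)} \<rightarrow> {0..<g}"
      proof
        fix l assume l: "l \<in> {l \<in> {0..<int q}. [k * l = b] (mod int q)}"
        have "\<not> g \<le> l div e"
        proof
          assume "g \<le> l div e"
          then have "e * g \<le> e * (l div e)" using epos by (intro mult_left_mono) auto
          also have "\<dots> \<le> l" using mult_div_mod_eq[of e l] pos_mod_sign[OF epos, of l] by linarith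
          finally show False using l e by (simp add: mult.commute)
        qed
        then show "l div e \<in> {0..<g}" using l epos by (auto simp: pos_imp_zdiv_nonneg_iff)
      qed
      show "(l0 + e * j) div e = j" for j using l0 epos by simp
      show "l0 + e * (l div e) = l" if "l \<in> {l \<in> {0..<int q}. [k * l = b] (mod int q)}" for l
      proof -
        have "l mod e = l0" using that iff l0 unfolding cong_def by simp
        then show ?thesis using mod_mult_div_eq[of l e] by simp
      qed
    qed
    then show ?thesis using True g unfolding g_def[symmetric] by (auto dest: bij_betw_same_card)
  next
    case False
    have "\<not> [k * l = b] (mod int q)" for l
      using False g by (metis cong_dvd_iff cong_dvd_modulus dvd_mult2)
    then show ?thesis using False unfolding g_def[symmetric] by simp
  qed
qed

section \<open>Pairs of multipliers with a skew planar lattice\<close>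

lemma card_le_card_mult_fiber:
  assumes "finite S" "finite C" "S \<noteq> {}" "f ` S \<subseteq> C"
  shows "\<exists>c. card S \<le> card C * card {s \<in> S. f s = c} \<and> {s \<in> S. f s = c} \<noteq> {}"
proof -
  define m where "m c = card {s \<in> S. f s = c}" for c
  have C: "C \<noteq> {}" using assms by auto
  have "Max (m ` C) \<in> m ` C" using assms C by (intro Max_in) auto
  then obtain c where c: "c \<in> C" "m c = Max (m ` C)" by auto
  then have max: "m c' \<le> m c" if "c' \<in> C" for c' using assms(2) that by auto
  have "card S = (\<Sum>c'\<in>C. m c')"
    using sum.group[OF assms(1,2,4), of "\<lambda>_. 1::nat"] unfolding m_def by simp
  also have "\<dots> \<le> card C * m c" using max sum_bounded_above[of C m "m c"] by simp
  finally have *: "card S \<le> card C * m c" .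
  moreover have "card S > 0" using assms by (simp add: card_gt_0_iff)
  ultimately have "m c > 0" by (auto intro: Nat.gr0I)
  then show ?thesis using * unfolding m_def by (intro exI[of _ c]) (auto simp: card_gt_0_iff)
qed

definition short_residues :: "nat \<Rightarrow> int \<Rightarrow> int \<Rightarrow> real \<Rightarrow> int set" where
  "short_residues q l l' Y = {t. \<exists>u v. (t, u, v) \<in> incidences q l l' (planar_box Y Y)}"

text \<open>Two applications of the pigeonhole principle. Among the q points (l t, l' t) reduced
  modulo q, at least Z^2 / (4 q) share a square cell of side Z; their differences lie in the box of
  size Z, so degeneracy makes them collinear. Cutting the line into pieces of length Y leaves at
  least Z Y / (16 q) of them with differences short in both coordinates.\<close>

lemma card_short_residues_ge:
  assumes q: "q > 0" and Z: "1 \<le> Z" "Z \<le> q" and Y: "0 < Y" "Y \<le> Z"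
    and deg: "\<not> spans_plane (incidences q l l' (planar_box Z Z))"
  shows "Z * Y \<le> 16 * real q * real (card (short_residues q l l' Y))"
proof -
  define p where "p m t = (m * t) mod int q" for m t
  have p: "0 \<le> p m t" "p m t < int q" "[p m t = m * t] (mod int q)" for m t
    using q unfolding p_def by (auto simp: cong_def)
  define f where "f t = (\<lfloor>p l t / Z\<rfloor>, \<lfloor>p l' t / Z\<rfloor>)" for t
  define N where "N = \<lfloor>real q / Z\<rfloor>"
  have N: "real_of_int (N + 1) \<le> 2 * q / Z" "N \<ge> 0"
  proof -
    have "1 \<le> real q / Z" using Z by simp
    then show "real_of_int (N + 1) \<le> 2 * q / Z" "N \<ge> 0" unfolding N_def by linarith+
  qed
  have cell: "\<lfloor>p m t / Z\<rfloor> \<in> {0..N}" for m t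
  proof -
    have "real_of_int (p m t) / Z \<le> real q / Z" using p(2)[of m t] Z by (intro divide_right_mono) auto
    moreover have "0 \<le> real_of_int (p m t) / Z" using p(1) Z by simp
    ultimately show ?thesis unfolding N_def by (auto intro: floor_mono)
  qed
  have fC: "f ` {0..<int q} \<subseteq> {0..N} \<times> {0..N}" unfolding f_def using cell by auto
  have "{0..<int q} \<noteq> {}" using q by simp
  from card_le_card_mult_fiber[OF _ _ this fC] obtain c0 where c0: "card {0..<int q} \<le> card ({0..N} \<times> {0..N}) * card {t \<in> {0..<int q}. f t = c0}"
      "{t \<in> {0..<int q}. f t = c0} \<noteq> {}"
    by blast
  define S where "S = {t \<in> {0..<int q}. f t = c0}"
  have finS: "finite S" unfolding S_def by (rule finite_subset[of _ "{0..<int q}"]) auto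
  have neS: "S \<noteq> {}" using c0 unfolding S_def by blast
  have "real q \<le> real (card ({0..N} \<times> {0..N})) * real (card S)"
    using c0(1) unfolding S_def[symmetric] by (simp flip: of_nat_mult)
  also have "real (card ({0..N} \<times> {0..N})) = real_of_int (N + 1) * real_of_int (N + 1)"
    using N by (simp add: card_cartesian_product)
  also have "\<dots> \<le> (2 * q / Z) * (2 * q / Z)" using N by (intro mult_mono) auto
  finally have "real q \<le> (2 * q / Z) * (2 * q / Z) * real (card S)" by (simp add: mult_right_mono)
  then have cS: "Z * Z \<le> 4 * q * real (card S)" using Z q by (simp add: field_simps)
  obtain t0 where t0: "t0 \<in> S" using neS by auto
  define U where "U m t = p m t - p m t0" for m t
  have U: "(\<bar>real_of_int (U l t)\<bar> < Z) \<and> \<bar>real_of_int (U l' t)\<bar> < Z" if "t \<in> S" for t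
  proof -
    have same: "\<bar>a - b\<bar> < Z" if "\<lfloor>a / Z\<rfloor> = \<lfloor>b / Z\<rfloor>" for a b :: real
    proof -
      have "\<bar>a / Z - b / Z\<bar> < 1" using that by linarith
      then show ?thesis using Z by (simp add: diff_divide_distrib[symmetric] field_simps)
    qed
    have "f t = f t0" using that t0 unfolding S_def by auto
    then show ?thesis unfolding f_def U_def using same by auto
  qed
  have Uc: "[U m t - U m t' = m * (t - t')] (mod int q)" for m t t'
    unfolding U_def using cong_diff[OF p(3)[of m t] p(3)[of m t']] by (simp add: algebra_simps)
  have U0: "U m t0 = 0" for m unfolding U_def by simp
  have inc: "((t - t') mod int q, U l t - U l t', U l' t - U l' t') \<in> incidences q l l' (planar_box W W)"
    if "\<bar>real_of_int (U l t - U l t')\<bar> \<le> W" "\<bar>real_of_int (U l' t - U l' t')\<bar> \<le> W" for t t' W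
  proof -
    have "[m * (t - t') = m * ((t - t') mod int q)] (mod int q)" for m
      by (intro cong_scalar_left) (simp add: cong_def)
    then have "[U m t - U m t' = m * ((t - t') mod int q)] (mod int q)" for m
      using Uc cong_trans by blast
    then show ?thesis using that q unfolding incidences_def planar_box_def by auto
  qed
  have col: "U l t * U l' t' = U l t' * U l' t" if "t \<in> S" "t' \<in> S" for t t'
  proof -
    have "((t - t0) mod int q, U l t, U l' t) \<in> incidences q l l' (planar_box Z Z)" if "t \<in> S" for t
      using inc[of t t0 Z] U[OF that] U0 by auto
    then show ?thesis using deg that unfolding spans_plane_def by fastforce
  qed
  \<comment> \<open>The points lie on a line through 0, so the coordinate in which its direction is
    larger bounds the differences in both.\<close>
  have "\<exists>m. (m = l \<or> m = l') \<and> (\<forall>t\<in>S. \<forall>t'\<in>S. \<bar>U l t - U l t'\<bar> \<le> \<bar>U m t - U m t'\<bar> \<and> \<bar>U l' t - U l' t'\<bar> \<le> \<bar>U m t - U m t'\<bar>)"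
  proof (cases "\<forall>t\<in>S. U l t = 0 \<and> U l' t = 0")
    case True then show ?thesis by (intro exI[of _ l]) auto
  next
    case False
    then obtain s where s: "s \<in> S" "U l s \<noteq> 0 \<or> U l' s \<noteq> 0" by auto
    have diff: "(U l t - U l t') * U l' s = (U l' t - U l' t') * U l s" if "t \<in> S" "t' \<in> S" for t t'
      using col[OF that(1) s(1)] col[OF that(2) s(1)] by (simp add: algebra_simps)
    show ?thesis
    proof (cases "\<bar>U l' s\<bar> \<le> \<bar>U l s\<bar>")
      case True
      have "\<bar>U l' t - U l' t'\<bar> \<le> \<bar>U l t - U l t'\<bar>" if "t \<in> S" "t' \<in> S" for t t'
      proof -
        have "\<bar>U l' t - U l' t'\<bar> * \<bar>U l s\<bar> = \<bar>U l t - U l t'\<bar> * \<bar>U l' s\<bar>"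
          using diff[OF that] by (simp add: abs_mult[symmetric])
        also have "\<dots> \<le> \<bar>U l t - U l t'\<bar> * \<bar>U l s\<bar>" using True by (intro mult_left_mono) auto
        finally show ?thesis using True s(2) by (auto simp: mult_le_cancel_right)
      qed
      then show ?thesis by (intro exI[of _ l]) auto
    next
      case False
      have "\<bar>U l t - U l t'\<bar> \<le> \<bar>U l' t - U l' t'\<bar>" if "t \<in> S" "t' \<in> S" for t t'
      proof -
        have "\<bar>U l t - U l t'\<bar> * \<bar>U l' s\<bar> = \<bar>U l' t - U l' t'\<bar> * \<bar>U l s\<bar>"
          using diff[OF that] by (simp add: abs_mult[symmetric])
        also have "\<dots> \<le> \<bar>U l' t - U l' t'\<bar> * \<bar>U l' s\<bar>" using False by (intro mult_left_mono) auto
        finally show ?thesis using False by (auto simp: mult_le_cancel_right)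
      qed
      then show ?thesis by (intro exI[of _ l']) auto
    qed
  qed
  then obtain m where m: "m = l \<or> m = l'"
    "\<And>t t'. t \<in> S \<Longrightarrow> t' \<in> S \<Longrightarrow> \<bar>U l t - U l t'\<bar> \<le> \<bar>U m t - U m t'\<bar> \<and> \<bar>U l' t - U l' t'\<bar> \<le> \<bar>U m t - U m t'\<bar>"
    by blast
  define h where "h t = \<lfloor>U m t / Y\<rfloor>" for t
  define M where "M = \<lceil>Z / Y\<rceil>"
  have hC: "h ` S \<subseteq> {-M..<M}"
  proof
    fix c assume "c \<in> h ` S"
    then obtain t where t: "t \<in> S" "c = h t" by auto
    have "\<bar>real_of_int (U m t)\<bar> < Z" using U[OF t(1)] m(1) by auto
    then have "\<bar>U m t / Y\<bar> < Z / Y" using Y by (simp add: divide_strict_right_mono)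
    then show "c \<in> {-M..<M}" unfolding t h_def M_def by (auto; linarith)
  qed
  from card_le_card_mult_fiber[OF finS _ neS hC] obtain c1 where c1: "card S \<le> card {-M..<M} * card {t \<in> S. h t = c1}" "{t \<in> S. h t = c1} \<noteq> {}"
    by blast
  define T where "T = {t \<in> S. h t = c1}"
  obtain t1 where t1: "t1 \<in> T" using c1 unfolding T_def by blast
  have "real (card S) \<le> real (card {-M..<M}) * real (card T)"
    using c1(1) unfolding T_def[symmetric] by (simp only: of_nat_le_iff of_nat_mult[symmetric])
  also have "real (card {-M..<M}) \<le> 4 * Z / Y"
  proof -
    have "1 \<le> Z / Y" using Y by simp
    then have "real_of_int M \<le> 2 * (Z / Y)" "M \<ge> 0" unfolding M_def by linarith+
    then show ?thesis by simp
  qed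
  finally have cT: "real (card S) \<le> 4 * Z / Y * real (card T)" by (simp add: mult_right_mono)
  define \<tau> where "\<tau> t = (t - t1) mod int q" for t
  have "inj_on \<tau> T"
  proof (rule inj_onI)
    fix t t' assume t: "t \<in> T" "t' \<in> T" "\<tau> t = \<tau> t'"
    then have "[t - t1 + t1 = t' - t1 + t1] (mod int q)" unfolding \<tau>_def by (intro cong_add) (auto simp: cong_def)
    then show "t = t'" using t(1,2) unfolding T_def S_def by (simp add: cong_def)
  qed
  moreover have "\<tau> ` T \<subseteq> short_residues q l l' Y"
  proof
    fix z assume "z \<in> \<tau> ` T"
    then obtain t where t: "t \<in> T" "z = \<tau> t" by auto
    have "\<bar>U m t / Y - U m t1 / Y\<bar> < 1" using t(1) t1 unfolding T_def h_def by (auto; linarith)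
    then have "\<bar>real_of_int (U m t) - U m t1\<bar> < Y" using Y by (simp add: diff_divide_distrib[symmetric] field_simps)
    moreover have "\<bar>U l t - U l t1\<bar> \<le> \<bar>U m t - U m t1\<bar>" "\<bar>U l' t - U l' t1\<bar> \<le> \<bar>U m t - U m t1\<bar>"
      using m(2)[of t t1] t(1) t1 unfolding T_def by auto
    ultimately have "\<bar>real_of_int (U l t - U l t1)\<bar> \<le> Y" "\<bar>real_of_int (U l' t - U l' t1)\<bar> \<le> Y" by linarith+
    from inc[OF this] show "z \<in> short_residues q l l' Y" unfolding t(2) \<tau>_def short_residues_def by blast
  qed
  moreover have "finite (short_residues q l l' Y)"
    by (rule finite_subset[of _ "{0..<int q}"]) (auto simp: short_residues_def incidences_def)
  ultimately have "card T \<le> card (short_residues q l l' Y)" by (rule card_inj_on_le)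
  then have "real (card T) \<le> real (card (short_residues q l l' Y))" by simp
  then have "real (card S) \<le> 4 * Z / Y * real (card (short_residues q l l' Y))"
    using cT Y Z by (meson divide_nonneg_pos mult_left_mono mult_nonneg_nonneg order_trans zero_le_numeral zero_le_one)
  then have "4 * q * real (card S) \<le> 4 * q * (4 * Z / Y * real (card (short_residues q l l' Y)))"
    by (intro mult_left_mono) auto
  with cS have "Z * Z \<le> 4 * q * (4 * Z / Y * real (card (short_residues q l l' Y)))" by linarith
  then have "Z * (Z * Y) \<le> Z * (16 * q * real (card (short_residues q l l' Y)))"
    using Y by (simp add: field_simps)
  then show ?thesis using Z by (simp only: mult_le_cancel_left_pos)
qed

text \<open>The products l t run through the multiples of g = gcd t q modulo q, each attained for g
  values of l, and at most 2 Y / g + 1 multiples of g have modulus at most Y.\<close>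

lemma card_multipliers_le:
  fixes Y :: real assumes q: "q > 0" and Y: "Y \<ge> 0"
  shows "real (card {l \<in> {0..<int q}. \<exists>u. \<bar>real_of_int u\<bar> \<le> Y \<and> [u = l * t] (mod int q)}) \<le> 2 * Y + gcd t (int q)"
proof -
  define g where "g = gcd t (int q)"
  have g: "g > 0" using q unfolding g_def by auto
  define K where "K = \<lfloor>Y / g\<rfloor>"
  have K: "K \<ge> 0" "real_of_int K \<le> Y / g" using Y g unfolding K_def by auto
  have "{l \<in> {0..<int q}. \<exists>u. \<bar>real_of_int u\<bar> \<le> Y \<and> [u = l * t] (mod int q)} \<subseteq>
      (\<Union>j\<in>{-K..K}. {l \<in> {0..<int q}. [t * l = g * j] (mod int q)})"
  proof
    fix l assume "l \<in> {l \<in> {0..<int q}. \<exists>u. \<bar>real_of_int u\<bar> \<le> Y \<and> [u = l * t] (mod int q)}"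
    then obtain u where u: "l \<in> {0..<int q}" "\<bar>real_of_int u\<bar> \<le> Y" "[u = t * l] (mod int q)"
      by (auto simp: mult.commute)
    have "g dvd int q" "g dvd t * l" unfolding g_def by auto
    then have "g dvd u" using u(3) by (meson cong_dvd_iff cong_dvd_modulus)
    then obtain j where j: "u = g * j" by auto
    have "\<bar>real_of_int j\<bar> * g \<le> Y" using u(2) g unfolding j by (simp add: abs_mult mult.commute)
    then have "\<bar>real_of_int j\<bar> \<le> Y / g" using g by (simp add: field_simps)
    then have "j \<in> {-K..K}" unfolding K_def by (auto; linarith)
    then show "l \<in> (\<Union>j\<in>{-K..K}. {l \<in> {0..<int q}. [t * l = g * j] (mod int q)})"
      using u cong_sym unfolding j by blast
  qed
  then have "card {l \<in> {0..<int q}. \<exists>u. \<bar>real_of_int u\<bar> \<le> Y \<and> [u = l * t] (mod int q)} \<le>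
      card (\<Union>j\<in>{-K..K}. {l \<in> {0..<int q}. [t * l = g * j] (mod int q)})"
    by (intro card_mono finite_UN_I) (auto intro: finite_subset[of _ "{0..<int q}"])
  also have "\<dots> \<le> (\<Sum>j\<in>{-K..K}. card {l \<in> {0..<int q}. [t * l = g * j] (mod int q)})"
    by (rule card_UN_le) auto
  also have "\<dots> = (\<Sum>j\<in>{-K..K}. nat g)"
    using card_linear_congruence[OF q, of t] unfolding g_def by (intro sum.cong) auto
  also have "\<dots> = nat (2 * K + 1) * nat g" by simp
  finally have "real (card {l \<in> {0..<int q}. \<exists>u. \<bar>real_of_int u\<bar> \<le> Y \<and> [u = l * t] (mod int q)}) \<le> real (nat (2 * K + 1) * nat g)"
    by (simp only: of_nat_le_iff)
  also have "\<dots> = (2 * real_of_int K + 1) * g" using K g by simp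
  also have "\<dots> \<le> (2 * (Y / g) + 1) * g" using K g by (intro mult_right_mono) auto
  also have "\<dots> = 2 * Y + g" using g by (simp add: field_simps)
  finally show ?thesis unfolding g_def .
qed

text \<open>At most q / g residues have gcd g, and they contribute at most q g. With f = q / g the
  sum over divisors becomes q^2 times a sum of reciprocals 1 / f.\<close>

lemma sum_gcd_square_le:
  assumes "q > 0"
  shows "(\<Sum>t\<in>{0..<int q}. (real_of_int (gcd t (int q)))\<^sup>2) \<le> (real q)\<^sup>2 * (1 + ln q)"
proof -
  have harm_le: "harm m \<le> 1 + ln (real m)" if "m > 0" for m
    using that
  proof (induction m rule: nat_induct_non_zero)
    case (Suc m)
    have "ln (real m / real (Suc m)) \<le> real m / real (Suc m) - 1" using Suc by (intro ln_le_minus_one) auto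
    also have "\<dots> = - (1 / real (Suc m))" by (simp add: field_simps)
    finally have "ln (real m) - ln (real (Suc m)) \<le> - (1 / real (Suc m))" using Suc by (simp add: ln_div)
    then show ?case using Suc by (simp add: harm_Suc inverse_eq_divide)
  qed (simp add: harm_expand)
  define D where "D = {g. g dvd q}"
  have fin: "finite D" unfolding D_def using assms by simp
  have "(\<Sum>t\<in>{0..<int q}. (real_of_int (gcd t (int q)))\<^sup>2) = (\<Sum>k<q. (real (gcd k q))\<^sup>2)"
  proof -
    have "{0..<int q} = int ` {..<q}" using image_int_atLeastLessThan[of 0 q] by (simp add: lessThan_atLeast0)
    then show ?thesis by (simp add: sum.reindex)
  qed
  also have "\<dots> = (\<Sum>g\<in>D. \<Sum>k\<in>{k \<in> {..<q}. gcd k q = g}. (real (gcd k q))\<^sup>2)"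
    by (rule sum.group[symmetric, OF _ fin]) (auto simp: D_def)
  also have "\<dots> \<le> (\<Sum>g\<in>D. real q * real g)"
  proof (rule sum_mono)
    fix g assume "g \<in> D"
    then have g: "g dvd q" "g > 0" using assms unfolding D_def by (auto intro: Nat.gr0I)
    have "(\<Sum>k\<in>{k \<in> {..<q}. gcd k q = g}. (real (gcd k q))\<^sup>2) = real (card {k \<in> {..<q}. gcd k q = g}) * (real g)\<^sup>2"
      by simp
    also have "\<dots> \<le> real (card ((\<lambda>j. g * j) ` {..<q div g})) * (real g)\<^sup>2"
    proof -
      have "{k \<in> {..<q}. gcd k q = g} \<subseteq> (\<lambda>j. g * j) ` {..<q div g}"
      proof
        fix k assume k: "k \<in> {k \<in> {..<q}. gcd k q = g}"
        then have "g dvd k" by auto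
        then obtain j where "k = g * j" by auto
        then show "k \<in> (\<lambda>j. g * j) ` {..<q div g}" using k g by (auto elim!: dvdE)
      qed
      then have "card {k \<in> {..<q}. gcd k q = g} \<le> card ((\<lambda>j. g * j) ` {..<q div g})" by (intro card_mono) auto
      then show ?thesis by (intro mult_right_mono) auto
    qed
    also have "\<dots> \<le> real (q div g) * (real g)\<^sup>2"
      using card_image_le[of "{..<q div g}" "\<lambda>j. g * j"] by (intro mult_right_mono) auto
    also have "\<dots> = real q * real g" using g by (simp add: real_of_nat_div power2_eq_square)
    finally show "(\<Sum>k\<in>{k \<in> {..<q}. gcd k q = g}. (real (gcd k q))\<^sup>2) \<le> real q * real g" .
  qed
  also have "\<dots> = (\<Sum>f\<in>D. real q * (real q / real f))"
    by (rule sum.reindex_bij_witness[of _ "\<lambda>f. q div f" "\<lambda>f. q div f"])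
      (use assms in \<open>auto simp: D_def real_of_nat_div elim!: dvdE\<close>)
  also have "\<dots> \<le> (\<Sum>f\<in>{1..q}. real q * (real q / real f))"
    using assms by (intro sum_mono2) (auto simp: D_def dvd_imp_le intro: Nat.gr0I)
  also have "\<dots> = (real q)\<^sup>2 * harm q"
    unfolding harm_def by (simp add: sum_distrib_left power2_eq_square field_simps)
  also have "\<dots> \<le> (real q)\<^sup>2 * (1 + ln q)" using harm_le[OF assms] by (intro mult_left_mono) auto
  finally show ?thesis .
qed

definition degenerate_pairs :: "nat \<Rightarrow> real \<Rightarrow> (int \<times> int) set" where
  "degenerate_pairs q Z = {(l, l') \<in> {0..<int q} \<times> {0..<int q}. \<not> spans_plane (incidences q l l' (planar_box Z Z))}"

text \<open>Triples (l, l', t) with t short for (l, l') are counted twice: from below by the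
  pigeonhole bound for each degenerate pair, from above for each t by the square of the number of
  admissible multipliers, as l and l' are subject to the same condition.\<close>

lemma card_degenerate_pairs_le:
  fixes Y Z :: real
  assumes q: "q > 0" and Z: "1 \<le> Z" "Z \<le> q" and Y: "0 < Y" "Y \<le> Z"
  shows "real (card (degenerate_pairs q Z)) * (Z * Y) \<le> 16 * real q * (8 * Y\<^sup>2 * q + 2 * (real q)\<^sup>2 * (1 + ln q))"
proof -
  define R where "R = {0..<int q}"
  have finR: "finite R" unfolding R_def by simp
  have sub: "degenerate_pairs q Z \<subseteq> R \<times> R" unfolding degenerate_pairs_def R_def by auto
  define W where "W t = {l \<in> R. \<exists>u. \<bar>real_of_int u\<bar> \<le> Y \<and> [u = l * t] (mod int q)}" for t
  have finW: "finite (W t)" for t unfolding W_def using finR by simp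
  have fin: "finite (short_residues q l l' Y)" for l l'
    by (rule finite_subset[of _ "{0..<int q}"]) (auto simp: short_residues_def incidences_def)
  have "real (card (degenerate_pairs q Z)) * (Z * Y) = (\<Sum>(l, l')\<in>degenerate_pairs q Z. Z * Y)" by simp
  also have "\<dots> \<le> (\<Sum>(l, l')\<in>degenerate_pairs q Z. 16 * real q * real (card (short_residues q l l' Y)))"
    using card_short_residues_ge[OF q Z Y] by (intro sum_mono) (auto simp: degenerate_pairs_def)
  also have "\<dots> \<le> (\<Sum>(l, l')\<in>R \<times> R. 16 * real q * real (card (short_residues q l l' Y)))"
    using sub finR by (intro sum_mono2) auto
  also have "\<dots> = 16 * real q * real (\<Sum>(l, l')\<in>R \<times> R. card (short_residues q l l' Y))"
    by (simp add: sum_distrib_left case_prod_unfold)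
  also have "(\<Sum>(l, l')\<in>R \<times> R. card (short_residues q l l' Y)) = card (Sigma (R \<times> R) (\<lambda>(l, l'). short_residues q l l' Y))"
    using finR fin by (subst card_SigmaI) (auto simp: case_prod_unfold)
  also have "card (Sigma (R \<times> R) (\<lambda>(l, l'). short_residues q l l' Y)) \<le> card (Sigma R (\<lambda>t. W t \<times> W t))"
  proof (rule card_inj_on_le[of "\<lambda>((l, l'), t). (t, (l, l'))"])
    show "(\<lambda>((l, l'), t). (t, (l, l'))) ` (Sigma (R \<times> R) (\<lambda>(l, l'). short_residues q l l' Y)) \<subseteq> Sigma R (\<lambda>t. W t \<times> W t)"
      unfolding short_residues_def incidences_def planar_box_def W_def R_def by auto
  qed (use finR finW in \<open>auto simp: inj_on_def\<close>)
  also have "card (Sigma R (\<lambda>t. W t \<times> W t)) = (\<Sum>t\<in>R. card (W t) ^ 2)"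
    using finR finW by (subst card_SigmaI) (auto simp: card_cartesian_product power2_eq_square)
  also have "real \<dots> = (\<Sum>t\<in>R. (real (card (W t)))\<^sup>2)" by simp
  also have "\<dots> \<le> (\<Sum>t\<in>R. 8 * Y\<^sup>2 + 2 * (real_of_int (gcd t (int q)))\<^sup>2)"
  proof (rule sum_mono)
    fix t
    define g where "g = real_of_int (gcd t (int q))"
    have "(real (card (W t)))\<^sup>2 \<le> (2 * Y + g)\<^sup>2"
      unfolding g_def W_def R_def using card_multipliers_le[OF q, of Y t] Y by (intro power_mono) auto
    also have "\<dots> \<le> 8 * Y\<^sup>2 + 2 * g\<^sup>2"
      using zero_le_power2[of "2 * Y - g"] by (simp add: power2_eq_square algebra_simps)
    finally show "(real (card (W t)))\<^sup>2 \<le> 8 * Y\<^sup>2 + 2 * (real_of_int (gcd t (int q)))\<^sup>2" unfolding g_def .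
  qed
  also have "\<dots> = 8 * Y\<^sup>2 * q + 2 * (\<Sum>t\<in>R. (real_of_int (gcd t (int q)))\<^sup>2)"
    unfolding R_def by (simp add: sum.distrib sum_distrib_left)
  also have "\<dots> \<le> 8 * Y\<^sup>2 * q + 2 * (real q)\<^sup>2 * (1 + ln q)"
    using sum_gcd_square_le[OF q] unfolding R_def by simp
  finally show ?thesis by (simp add: mult_left_mono)
qed

text \<open>With Y = \<delta> Z the first term is a small multiple of q^2, and the second is q^2
  times a quantity of order q ln q / Z^2. For n >= 3 the exponent 2 - 2/n of Z^2 is at least 4/3, so
  this tends to 0; in the plane Z^2 would only be of order q.\<close>

lemma few_degenerate_pairs:
  fixes \<eta> \<epsilon> :: real
  assumes n: "n \<ge> 3" and \<eta>: "\<eta> > 0" and \<epsilon>: "\<epsilon> > 0"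
  shows "\<forall>\<^sub>F q in sequentially.
     real (card (degenerate_pairs q (\<eta> * real q powr (1 - 1 / real n)))) \<le> \<epsilon> * (real q)\<^sup>2"
proof -
  define \<delta> where "\<delta> = min 1 (\<epsilon> / 256)"
  have \<delta>: "0 < \<delta>" "\<delta> \<le> 1" "128 * \<delta> \<le> \<epsilon> / 2" using \<epsilon> unfolding \<delta>_def by auto
  define C where "C = \<epsilon> * \<delta> * \<eta>\<^sup>2 / 64"
  have C: "C > 0" unfolding C_def using \<epsilon> \<delta> \<eta> by simp
  have "(\<lambda>q::nat. (1 + ln (real q)) * real q powr (-1/3)) \<longlonglongrightarrow> 0" by real_asymp
  then have e1: "\<forall>\<^sub>F q::nat in sequentially. (1 + ln (real q)) * real q powr (-1/3) < C"
    using C by (rule order_tendstoD)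
  have "(\<lambda>q::nat. real q powr (-1 / real n)) \<longlonglongrightarrow> 0" using n by real_asymp
  then have e2: "\<forall>\<^sub>F q::nat in sequentially. real q powr (-1 / real n) < 1 / \<eta>"
    using \<eta> by (intro order_tendstoD) auto
  have "filterlim (\<lambda>q::nat. real q powr (2/3)) at_top sequentially" by real_asymp
  then have e3: "\<forall>\<^sub>F q::nat in sequentially. real q powr (2/3) \<ge> 1 / \<eta>" by (simp add: filterlim_at_top)
  show ?thesis using e1 e2 e3 eventually_ge_at_top[of 1]
  proof eventually_elim
    case (elim q)
    have q: "real q \<ge> 1" "q > 0" using elim by auto
    define Z where "Z = \<eta> * real q powr (1 - 1 / real n)"
    have n3: "1 / real n \<le> 1/3" using n by simp
    have Z1: "1 \<le> Z"
    proof -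
      have "1 \<le> \<eta> * real q powr (2/3)" using elim \<eta> by (simp add: field_simps)
      also have "\<dots> \<le> Z" unfolding Z_def using \<eta> q n3 by (intro mult_left_mono powr_mono) auto
      finally show ?thesis .
    qed
    have Zq: "Z \<le> q"
    proof -
      have "Z = real q * (\<eta> * real q powr (-1 / real n))" unfolding Z_def using q by (simp add: powr_diff powr_minus field_simps)
      also have "\<dots> \<le> real q * (\<eta> * (1 / \<eta>))" using elim \<eta> by (intro mult_left_mono) auto
      finally show ?thesis using \<eta> by simp
    qed
    define Y where "Y = \<delta> * Z"
    have Y: "0 < Y" "Y \<le> Z" unfolding Y_def using \<delta> Z1 by (auto simp: mult_le_cancel_right1)
    have "real (card (degenerate_pairs q Z)) * (Z * Y) \<le> 16 * real q * (8 * Y\<^sup>2 * q + 2 * (real q)\<^sup>2 * (1 + ln q))"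
      by (rule card_degenerate_pairs_le[OF q(2) Z1 Zq Y])
    also have "\<dots> \<le> \<epsilon> * (real q)\<^sup>2 * (Z * Y)"
    proof -
      have "16 * real q * (8 * Y\<^sup>2 * q) = (128 * \<delta>) * (real q)\<^sup>2 * (Z * Y)"
        unfolding Y_def by (simp add: power2_eq_square)
      also have "\<dots> \<le> (\<epsilon> / 2) * (real q)\<^sup>2 * (Z * Y)" using \<delta> Y Z1 by (intro mult_right_mono) auto
      finally have a: "16 * real q * (8 * Y\<^sup>2 * q) \<le> (\<epsilon> / 2) * (real q)\<^sup>2 * (Z * Y)" .
      have "32 * real q * (1 + ln q) \<le> (\<epsilon> / 2) * (Z * Y)"
      proof -
        have "(1 + ln q) * real q = ((1 + ln q) * real q powr (-1/3)) * real q powr (4/3)"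
        proof -
          have "real q powr (-1/3) * real q powr (4/3) = real q" using q by (simp flip: powr_add)
          then show ?thesis by (simp add: mult.assoc)
        qed
        also have "\<dots> \<le> C * real q powr (4/3)" using elim by (intro mult_right_mono) auto
        also have "\<dots> = C * (real q powr (2/3) * real q powr (2/3))" by (simp add: powr_add[symmetric])
        also have "\<dots> \<le> C * (real q powr (1 - 1 / real n) * real q powr (1 - 1 / real n))"
          using C q n3 by (intro mult_left_mono mult_mono powr_mono) auto
        also have "32 * \<dots> = (\<epsilon> / 2) * (Z * Y)" unfolding C_def Y_def Z_def by (simp add: power2_eq_square)
        finally show ?thesis by (simp add: algebra_simps)
      qed
      then have "(real q)\<^sup>2 * (32 * real q * (1 + ln q)) \<le> (real q)\<^sup>2 * ((\<epsilon> / 2) * (Z * Y))" by (intro mult_left_mono) auto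
      then show ?thesis using a by (simp add: algebra_simps power2_eq_square)
    qed
    finally have "real (card (degenerate_pairs q Z)) \<le> \<epsilon> * (real q)\<^sup>2"
      using Y Z1 by (simp add: mult_le_cancel_right_pos)
    then show ?case unfolding Z_def .
  qed
qed

section \<open>The first moment\<close>

definition scaled_points :: "'i set \<Rightarrow> ('i \<Rightarrow> real) set \<Rightarrow> real \<Rightarrow> ('i \<Rightarrow> int) set" where
  "scaled_points I S y = {b \<in> extensional I. (\<exists>i\<in>I. b i \<noteq> 0) \<and> (\<lambda>i\<in>I. real_of_int (b i) / y) \<in> S}"

definition multiple_triples ::
  "'i set \<Rightarrow> ('i \<Rightarrow> real) set \<Rightarrow> nat \<Rightarrow> nat \<Rightarrow> real \<Rightarrow> (('i \<Rightarrow> int) \<times> int \<times> ('i \<Rightarrow> int)) set" where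
  "multiple_triples I S q e y = {(a, k, b). a \<in> residue_vectors I q \<and> (\<forall>i\<in>I. int e dvd a i) \<and>
     k \<in> {0..<int q} \<and> b \<in> scaled_points I S y \<and> (\<forall>i\<in>I. [b i = k * a i] (mod int q))}"

lemma finite_residue_vectors: "finite I \<Longrightarrow> finite (residue_vectors I q)"
  unfolding residue_vectors_def by (intro finite_PiE) auto

lemma card_scaled_points_multiples:
  assumes "d > 0" "y > 0"
  shows "card {b \<in> scaled_points I S y. \<forall>i\<in>I. int d dvd b i} = card (scaled_points I S (y / real d))"
proof -
  have "bij_betw (\<lambda>b. \<lambda>i\<in>I. int d * b i) (scaled_points I S (y / real d)) {b \<in> scaled_points I S y. \<forall>i\<in>I. int d dvd b i}"
  proof (rule bij_betwI[where g = "\<lambda>b. \<lambda>i\<in>I. b i div int d"])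
    show "(\<lambda>b. \<lambda>i\<in>I. int d * b i) \<in> scaled_points I S (y / real d) \<rightarrow> {b \<in> scaled_points I S y. \<forall>i\<in>I. int d dvd b i}"
    proof
      fix b assume b: "b \<in> scaled_points I S (y / real d)"
      have "(\<lambda>i\<in>I. real_of_int ((\<lambda>i\<in>I. int d * b i) i) / y) = (\<lambda>i\<in>I. real_of_int (b i) / (y / real d))"
        using assms by (auto simp: fun_eq_iff)
      then show "(\<lambda>i\<in>I. int d * b i) \<in> {b \<in> scaled_points I S y. \<forall>i\<in>I. int d dvd b i}"
        using b assms unfolding scaled_points_def by auto
    qed
    show "(\<lambda>b. \<lambda>i\<in>I. b i div int d) \<in> {b \<in> scaled_points I S y. \<forall>i\<in>I. int d dvd b i} \<rightarrow> scaled_points I S (y / real d)"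
    proof
      fix b assume b: "b \<in> {b \<in> scaled_points I S y. \<forall>i\<in>I. int d dvd b i}"
      have eq: "real_of_int (b i div int d) = real_of_int (b i) / real d" if "i \<in> I" for i
        using b that by (simp add: real_of_int_div)
      have "(\<lambda>i\<in>I. real_of_int ((\<lambda>i\<in>I. b i div int d) i) / (y / real d)) = (\<lambda>i\<in>I. real_of_int (b i) / y)"
        using assms eq by (auto simp: fun_eq_iff)
      moreover have "\<exists>i\<in>I. b i div int d \<noteq> 0"
      proof -
        obtain i where "i \<in> I" "b i \<noteq> 0" "int d dvd b i" using b unfolding scaled_points_def by auto
        then show ?thesis by (intro bexI[of _ i]) (auto simp: dvd_div_eq_0_iff)
      qed
      ultimately show "(\<lambda>i\<in>I. b i div int d) \<in> scaled_points I S (y / real d)"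
        using b unfolding scaled_points_def by auto
    qed
  qed (use assms in \<open>auto simp: scaled_points_def fun_eq_iff extensional_def\<close>)
  then show ?thesis by (auto dest: bij_betw_same_card)
qed

lemma card_congruence_multiples:
  assumes q: "q > 0" and e: "e dvd q"
  shows "card {t \<in> {0..<int q}. int e dvd t \<and> [b = k * t] (mod int q)} =
    (if int e * gcd k (int (q div e)) dvd b then nat (gcd k (int (q div e))) else 0)"
proof -
  define f where "f = q div e"
  have qf: "q = e * f" using e unfolding f_def by simp
  have pos: "e > 0" "f > 0" using q qf by auto
  show ?thesis
  proof (cases "int e dvd b")
    case True
    then obtain b' where b': "b = int e * b'" by auto
    have "bij_betw (\<lambda>t. int e * t) {t \<in> {0..<int f}. [k * t = b'] (mod int f)}
       {t \<in> {0..<int q}. int e dvd t \<and> [b = k * t] (mod int q)}"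
    proof (rule bij_betwI[where g = "\<lambda>t. t div int e"])
      have iff: "[b = k * (int e * t)] (mod int q) \<longleftrightarrow> [k * t = b'] (mod int f)" for t
      proof -
        have "b - k * (int e * t) = int e * (b' - k * t)" unfolding b' by (simp add: algebra_simps)
        then have "[b = k * (int e * t)] (mod int q) \<longleftrightarrow> [b' = k * t] (mod int f)"
          using pos unfolding qf by (simp add: cong_iff_dvd_diff)
        then show ?thesis by (simp add: cong_sym_eq)
      qed
      show "(\<lambda>t. int e * t) \<in> {t \<in> {0..<int f}. [k * t = b'] (mod int f)} \<rightarrow>
         {t \<in> {0..<int q}. int e dvd t \<and> [b = k * t] (mod int q)}"
        using iff pos unfolding qf by auto
      show "(\<lambda>t. t div int e) \<in> {t \<in> {0..<int q}. int e dvd t \<and> [b = k * t] (mod int q)} \<rightarrow>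
        {t \<in> {0..<int f}. [k * t = b'] (mod int f)}"
      proof
        fix t assume t: "t \<in> {t \<in> {0..<int q}. int e dvd t \<and> [b = k * t] (mod int q)}"
        then obtain t' where "t = int e * t'" by auto
        then show "t div int e \<in> {t \<in> {0..<int f}. [k * t = b'] (mod int f)}"
          using t iff pos unfolding qf by (auto simp: zero_le_mult_iff)
      qed
    qed (use pos in auto)
    then have "card {t \<in> {0..<int q}. int e dvd t \<and> [b = k * t] (mod int q)} =
        card {t \<in> {0..<int f}. [k * t = b'] (mod int f)}" by (simp add: bij_betw_same_card)
    also have "\<dots> = (if gcd k (int f) dvd b' then nat (gcd k (int f)) else 0)"
      by (rule card_linear_congruence[OF pos(2)])
    finally show ?thesis unfolding f_def[symmetric] b' using pos by simp
  next
    case False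
    have "\<not> (int e dvd t \<and> [b = k * t] (mod int q))" for t
    proof
      assume a: "int e dvd t \<and> [b = k * t] (mod int q)"
      then have "[b = k * t] (mod int e)" unfolding qf by (auto intro: cong_dvd_modulus)
      then show False using a False by (metis cong_dvd_iff dvd_mult)
    qed
    then have empty: "{t \<in> {0..<int q}. int e dvd t \<and> [b = k * t] (mod int q)} = {}" by blast
    have "\<not> int e * gcd k (int (q div e)) dvd b" using False dvd_mult_left by blast
    then show ?thesis unfolding empty by simp
  qed
qed

text \<open>Fix k and let h = gcd k (q / e). In one coordinate the congruence has h solutions
  divisible by e if e h divides b_i, and none otherwise. So \<open>b\<close> is e h times a point at
  the smaller scale y / (e h), and it occurs for h^n vectors \<open>a\<close>.\<close>

lemma card_multiple_triples:
  assumes fin: "finite I" "I \<noteq> {}" and q: "q > 0" and e: "e dvd q" and y: "y > 0"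
    and S: "finite (scaled_points I S y)"
  shows "finite (multiple_triples I S q e y)"
    and "card (multiple_triples I S q e y) =
      (\<Sum>k<q. gcd k (q div e) ^ card I * card (scaled_points I S (y / real (e * gcd k (q div e)))))"
proof -
  have epos: "e > 0" using e q by (auto intro: Nat.gr0I)
  have qe: "q div e > 0" using e q by (auto elim!: dvdE)
  define A where "A k b = (\<Pi>\<^sub>E i\<in>I. {t \<in> {0..<int q}. int e dvd t \<and> [b i = k * t] (mod int q)})" for k :: int and b :: "'a \<Rightarrow> int"
  have finA: "finite (A k b)" for k b unfolding A_def using fin
    by (intro finite_PiE) (auto intro: finite_subset[of _ "{0..<int q}"])
  define B where "B = Sigma ({0..<int q} \<times> scaled_points I S y) (\<lambda>(k, b). A k b)"
  have bij: "bij_betw (\<lambda>((k, b), a). (a, k, b)) B (multiple_triples I S q e y)"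
    by (rule bij_betwI[where g = "\<lambda>(a, k, b). ((k, b), a)"])
      (auto simp: B_def A_def multiple_triples_def residue_vectors_def PiE_def Pi_def)
  have finB: "finite B" unfolding B_def using S finA by auto
  then show "finite (multiple_triples I S q e y)" using bij bij_betw_finite by blast
  have "card (multiple_triples I S q e y) = card B" using bij by (simp add: bij_betw_same_card)
  also have "\<dots> = (\<Sum>(k, b)\<in>{0..<int q} \<times> scaled_points I S y. card (A k b))"
    unfolding B_def using S finA by (subst card_SigmaI) (auto simp: case_prod_unfold)
  also have "\<dots> = (\<Sum>k\<in>{0..<int q}. \<Sum>b\<in>scaled_points I S y. card (A k b))"
    by (simp add: sum.cartesian_product)
  also have "\<dots> = (\<Sum>k<q. \<Sum>b\<in>scaled_points I S y. card (A (int k) b))"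
  proof -
    have "{0..<int q} = int ` {..<q}" using image_int_atLeastLessThan[of 0 q] by (simp add: lessThan_atLeast0)
    then show ?thesis by (simp add: sum.reindex)
  qed
  also have "\<dots> = (\<Sum>k<q. gcd k (q div e) ^ card I * card (scaled_points I S (y / real (e * gcd k (q div e)))))"
  proof (intro sum.cong refl)
    fix k
    define h where "h = gcd k (q div e)"
    have h: "h > 0" using qe unfolding h_def by (metis gcd_pos_nat less_numeral_extra(3))
    have cA: "card (A (int k) b) = (if \<forall>i\<in>I. int (e * h) dvd b i then h ^ card I else 0)" for b
    proof -
      have "card (A (int k) b) = (\<Prod>i\<in>I. card {t \<in> {0..<int q}. int e dvd t \<and> [b i = int k * t] (mod int q)})"
        unfolding A_def by (rule card_PiE[OF fin(1)])
      also have "\<dots> = (\<Prod>i\<in>I. if int (e * h) dvd b i then h else 0)"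
      proof (intro prod.cong refl)
        fix i
        have "int e * gcd (int k) (int (q div e)) = int (e * h)" "nat (gcd (int k) (int (q div e))) = h"
          unfolding h_def by (simp_all only: gcd_int_int_eq of_nat_mult nat_int)
        then show "card {t \<in> {0..<int q}. int e dvd t \<and> [b i = int k * t] (mod int q)} =
            (if int (e * h) dvd b i then h else 0)"
          by (simp only: card_congruence_multiples[OF q e])
      qed
      also have "\<dots> = (if \<forall>i\<in>I. int (e * h) dvd b i then h ^ card I else 0)"
      proof (cases "\<forall>i\<in>I. int (e * h) dvd b i")
        case False
        then show ?thesis using fin(1) by (auto intro!: prod_zero)
      qed simp
      finally show ?thesis .
    qed
    have "(\<Sum>b\<in>scaled_points I S y. card (A (int k) b)) =
        (\<Sum>b\<in>{b \<in> scaled_points I S y. \<forall>i\<in>I. int (e * h) dvd b i}. h ^ card I)"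
      unfolding cA by (simp only: sum.inter_filter[OF S])
    also have "\<dots> = h ^ card I * card (scaled_points I S (y / real (e * h)))"
      using card_scaled_points_multiples[of "e * h" y I S] epos h y by simp
    finally show "(\<Sum>b\<in>scaled_points I S y. card (A (int k) b)) =
        gcd k (q div e) ^ card I * card (scaled_points I S (y / real (e * gcd k (q div e))))"
      unfolding h_def .
  qed
  finally show "card (multiple_triples I S q e y) =
      (\<Sum>k<q. gcd k (q div e) ^ card I * card (scaled_points I S (y / real (e * gcd k (q div e)))))" .
qed

lemma sum_moebius_common_divisors:
  assumes "q > 0" "a \<in> residue_vectors I q"
  shows "(\<Sum>e | e dvd q \<and> (\<forall>i\<in>I. int e dvd a i). moebius_mu e) = (if a \<in> primitive_residues I q then 1 else 0)"
proof -
  define D where "D = nat (gcd (int q) (Gcd (a ` I)))"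
  have D: "int D = gcd (int q) (Gcd (a ` I))" unfolding D_def by simp
  have "gcd (int q) (Gcd (a ` I)) > 0" unfolding gcd_pos_int using assms(1) by simp
  then have Dpos: "D > 0" unfolding D_def by simp
  have dvd: "e dvd D \<longleftrightarrow> e dvd q \<and> (\<forall>i\<in>I. int e dvd a i)" for e
  proof -
    have "e dvd D \<longleftrightarrow> int e dvd int D" by simp
    also have "\<dots> \<longleftrightarrow> int e dvd int q \<and> int e dvd Gcd (a ` I)" unfolding D by simp
    also have "int e dvd Gcd (a ` I) \<longleftrightarrow> (\<forall>i\<in>I. int e dvd a i)" by (auto simp: dvd_Gcd_iff)
    finally show ?thesis by simp
  qed
  have "a \<in> primitive_residues I q \<longleftrightarrow> (\<forall>e. e dvd D \<longrightarrow> e = 1)"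
    using assms(2) unfolding primitive_residues_def dvd by blast
  also have "\<dots> \<longleftrightarrow> D = 1" by (metis dvd_refl nat_dvd_1_iff_1)
  finally have "a \<in> primitive_residues I q \<longleftrightarrow> D = 1" .
  then show ?thesis using sum_moebius_mu_divisors[OF Dpos] dvd by simp
qed

lemma sum_moebius_weighted_count:
  fixes q :: nat
  assumes "q > 0" "finite N" "\<And>z. z \<in> N \<Longrightarrow> f z \<in> residue_vectors I q"
  shows "(\<Sum>e | e dvd q. moebius_mu e * real (card {z \<in> N. \<forall>i\<in>I. int e dvd f z i})) =
    real (card {z \<in> N. f z \<in> primitive_residues I q})"
proof -
  have fin: "finite {e. e dvd q}" using assms by simp
  have "(\<Sum>e | e dvd q. moebius_mu e * real (card {z \<in> N. \<forall>i\<in>I. int e dvd f z i})) =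
      (\<Sum>e | e dvd q. \<Sum>z\<in>N. if \<forall>i\<in>I. int e dvd f z i then moebius_mu e else 0)"
    using assms(2) by (intro sum.cong) (auto simp: sum.If_cases Int_def)
  also have "\<dots> = (\<Sum>z\<in>N. \<Sum>e | e dvd q. if \<forall>i\<in>I. int e dvd f z i then moebius_mu e else 0)"
    by (rule sum.swap)
  also have "\<dots> = (\<Sum>z\<in>N. \<Sum>e | e dvd q \<and> (\<forall>i\<in>I. int e dvd f z i). moebius_mu e)"
  proof (rule sum.cong[OF refl])
    fix z assume "z \<in> N"
    have "{e. e dvd q \<and> (\<forall>i\<in>I. int e dvd f z i)} = {e \<in> {e. e dvd q}. \<forall>i\<in>I. int e dvd f z i}" by auto
    then show "(\<Sum>e | e dvd q. if \<forall>i\<in>I. int e dvd f z i then moebius_mu e else 0) =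
      (\<Sum>e | e dvd q \<and> (\<forall>i\<in>I. int e dvd f z i). moebius_mu e)"
      by (simp only: sum.inter_filter[OF fin])
  qed
  also have "\<dots> = (\<Sum>z\<in>N. if f z \<in> primitive_residues I q then 1 else 0)"
    using assms by (intro sum.cong refl sum_moebius_common_divisors) auto
  also have "\<dots> = real (card {z \<in> N. f z \<in> primitive_residues I q})"
    using assms(2) by (simp add: sum.If_cases Int_def)
  finally show ?thesis .
qed

lemma primitive_residues_subset: "primitive_residues I q \<subseteq> residue_vectors I q"
  unfolding primitive_residues_def by auto

lemma finite_primitive_residues: "finite I \<Longrightarrow> finite (primitive_residues I q)"
  by (rule finite_subset[OF primitive_residues_subset finite_residue_vectors])

text \<open>The right-hand side is Jordan's totient of q.\<close>

lemma card_primitive_residues: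
  assumes fin: "finite I" and q: "q > 0"
  shows "real (card (primitive_residues I q)) = real q ^ card I * (\<Sum>e | e dvd q. moebius_mu e / real e ^ card I)"
proof -
  have "card {a \<in> residue_vectors I q. \<forall>i\<in>I. int e dvd a i} = (q div e) ^ card I" if e: "e dvd q" for e
  proof -
    have "{a \<in> residue_vectors I q. \<forall>i\<in>I. int e dvd a i} = (\<Pi>\<^sub>E i\<in>I. {t \<in> {0..<int q}. int e dvd t \<and> [0 = 0 * t] (mod int q)})"
      unfolding residue_vectors_def by (auto simp: PiE_def Pi_def)
    moreover have "card {t \<in> {0..<int q}. int e dvd t \<and> [0 = 0 * t] (mod int q)} = q div e"
      using card_congruence_multiples[OF q e, of 0 0] by simp
    ultimately show ?thesis using fin by (simp add: card_PiE)
  qed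
  moreover have "real ((q div e) ^ card I) = real q ^ card I / real e ^ card I" if "e dvd q" for e
    using that by (simp add: real_of_nat_div power_divide)
  moreover have "{a \<in> residue_vectors I q. a \<in> primitive_residues I q} = primitive_residues I q"
    using primitive_residues_subset by auto
  ultimately show ?thesis
    using sum_moebius_weighted_count[OF q finite_residue_vectors[OF fin], of q "\<lambda>a. a" I]
    by (simp add: sum_distrib_left mult.commute)
qed

text \<open>For primitive \<open>a\<close> the multiplier of a lattice vector is unique modulo q, so
  pairs (a, b) correspond to triples (a, k, b); the Moebius sum over common divisors of
  \<open>a\<close> and q selects the primitive \<open>a\<close>.\<close>

lemma card_multiples_lattice_points:
  assumes fin: "finite I" "I \<noteq> {}" and q: "q > 0" and y: "y > 0" and S: "finite (scaled_points I S y)"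
  shows "(\<Sum>a\<in>primitive_residues I q. real (card (multiples_lattice I q a \<inter> scaled_points I S y))) =
     (\<Sum>e | e dvd q. moebius_mu e * real (card (multiple_triples I S q e y)))"
proof -
  define N where "N = multiple_triples I S q 1 y"
  have finN: "finite N" unfolding N_def using card_multiple_triples(1)[OF fin q _ y S, of 1] by simp
  have "(\<Sum>e | e dvd q. moebius_mu e * real (card {z \<in> N. \<forall>i\<in>I. int e dvd fst z i})) =
      real (card {z \<in> N. fst z \<in> primitive_residues I q})"
    by (rule sum_moebius_weighted_count[OF q finN]) (auto simp: N_def multiple_triples_def)
  moreover have "{z \<in> N. \<forall>i\<in>I. int e dvd fst z i} = multiple_triples I S q e y" for e
    unfolding N_def multiple_triples_def by auto
  moreover have "card {z \<in> N. fst z \<in> primitive_residues I q} =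
      (\<Sum>a\<in>primitive_residues I q. card (multiples_lattice I q a \<inter> scaled_points I S y))"
  proof -
    have "bij_betw (\<lambda>(a, k, b). (a, b)) {z \<in> N. fst z \<in> primitive_residues I q}
       (Sigma (primitive_residues I q) (\<lambda>a. multiples_lattice I q a \<inter> scaled_points I S y))"
      unfolding bij_betw_def
    proof
      show "inj_on (\<lambda>(a, k, b). (a, b)) {z \<in> N. fst z \<in> primitive_residues I q}"
      proof (rule inj_onI)
        fix z z' assume z: "z \<in> {z \<in> N. fst z \<in> primitive_residues I q}" "z' \<in> {z \<in> N. fst z \<in> primitive_residues I q}"
          "(\<lambda>(a, k, b). (a, b)) z = (\<lambda>(a, k, b). (a, b)) z'"
        obtain a k b where zz: "z = (a, k, b)" by (metis surj_pair)
        obtain k' where zz': "z' = (a, k', b)" using z(3) unfolding zz by (cases z') auto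
        have "[(k - k') * a i = 0] (mod int q)" if "i \<in> I" for i
        proof -
          have "[k * a i = k' * a i] (mod int q)"
            using z(1,2) that unfolding zz zz' N_def multiple_triples_def by (auto dest!: bspec intro: cong_trans cong_sym)
          then show ?thesis by (simp add: cong_iff_dvd_diff left_diff_distrib)
        qed
        then have "int q dvd k - k'" using z(1) q unfolding zz by (intro primitive_residues_cancel[of a I q]) auto
        then have "[k = k'] (mod int q)" by (simp add: cong_iff_dvd_diff)
        then have "k = k'" using z(1,2) unfolding zz zz' N_def multiple_triples_def by (auto simp: cong_def)
        then show "z = z'" unfolding zz zz' by simp
      qed
      show "(\<lambda>(a, k, b). (a, b)) ` {z \<in> N. fst z \<in> primitive_residues I q} =
         Sigma (primitive_residues I q) (\<lambda>a. multiples_lattice I q a \<inter> scaled_points I S y)"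
      proof (intro equalityI subsetI)
        fix x assume "x \<in> (\<lambda>(a, k, b). (a, b)) ` {z \<in> N. fst z \<in> primitive_residues I q}"
        then show "x \<in> Sigma (primitive_residues I q) (\<lambda>a. multiples_lattice I q a \<inter> scaled_points I S y)"
          unfolding N_def multiple_triples_def multiples_lattice_def by (auto simp: scaled_points_def)
      next
        fix x assume "x \<in> Sigma (primitive_residues I q) (\<lambda>a. multiples_lattice I q a \<inter> scaled_points I S y)"
        then obtain a b k where x: "x = (a, b)" "a \<in> primitive_residues I q" "b \<in> scaled_points I S y"
          "\<forall>i\<in>I. [b i = k * a i] (mod int q)" unfolding multiples_lattice_def by auto
        have "[b i = (k mod int q) * a i] (mod int q)" if "i \<in> I" for i
        proof -
          have "[k * a i = (k mod int q) * a i] (mod int q)" by (intro cong_scalar_right) (simp add: cong_def)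
          then show ?thesis using x(4) that by (meson cong_trans)
        qed
        then have "(a, k mod int q, b) \<in> {z \<in> N. fst z \<in> primitive_residues I q}"
          using x q subsetD[OF primitive_residues_subset x(2)] unfolding N_def multiple_triples_def by auto
        then show "x \<in> (\<lambda>(a, k, b). (a, b)) ` {z \<in> N. fst z \<in> primitive_residues I q}"
          unfolding x(1) by (force simp: image_iff)
      qed
    qed
    then have "card {z \<in> N. fst z \<in> primitive_residues I q} =
      card (Sigma (primitive_residues I q) (\<lambda>a. multiples_lattice I q a \<inter> scaled_points I S y))"
      by (rule bij_betw_same_card)
    also have "\<dots> = (\<Sum>a\<in>primitive_residues I q. card (multiples_lattice I q a \<inter> scaled_points I S y))"
      using S finite_primitive_residues[OF fin(1)] by (intro card_SigmaI) auto
    finally show ?thesis .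
  qed
  ultimately show ?thesis by simp
qed

text \<open>The m for which b / m still lies in the lattice are closed under lcm and under taking
  divisors, so they are the divisors of the largest of them; the Moebius sum over them detects
  primitivity.\<close>

lemma sum_primitive_multiples:
  assumes fin: "finite I" "I \<noteq> {}" and q: "q > 0" and y: "y > 0" and S: "\<And>z. z > 0 \<Longrightarrow> finite (scaled_points I S z)"
    and M: "\<And>m. m > M \<Longrightarrow> scaled_points I S (y / real m) = {}"
  shows "real (card (primitive_multiples I q a \<inter> scaled_points I S y)) =
    (\<Sum>m\<in>{1..M}. moebius_mu m * real (card (multiples_lattice I q a \<inter> scaled_points I S (y / real m))))"
proof -
  let ?L = "multiples_lattice I q a"
  define D where "D b = {m. m > 0 \<and> (\<exists>c\<in>?L. \<forall>i\<in>I. b i = int m * c i)}" for b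
  define B where "B = ?L \<inter> scaled_points I S y"
  have finB: "finite B" unfolding B_def using S[OF y] by simp
  have DM: "D b \<subseteq> {1..M}" if "b \<in> B" for b
  proof
    fix m assume "m \<in> D b"
    then obtain c where c: "m > 0" "c \<in> ?L" "\<forall>i\<in>I. b i = int m * c i" unfolding D_def by auto
    have "(\<lambda>i\<in>I. real_of_int (c i) / (y / real m)) = (\<lambda>i\<in>I. real_of_int (b i) / y)"
      using c by (auto simp: fun_eq_iff)
    moreover have "\<exists>i\<in>I. c i \<noteq> 0" using \<open>b \<in> B\<close> c(3) unfolding B_def scaled_points_def by auto
    ultimately have "c \<in> scaled_points I S (y / real m)"
      using \<open>b \<in> B\<close> c(2) unfolding B_def scaled_points_def multiples_lattice_def by auto
    then have "\<not> m > M" using M by blast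
    then show "m \<in> {1..M}" using c(1) by simp
  qed
  have Ddvd: "\<exists>d>0. D b = {m. m dvd d} \<and> (d = 1 \<longleftrightarrow> b \<in> primitive_multiples I q a)" if b: "b \<in> B" for b
  proof -
    have finD: "finite (D b)" using DM[OF b] finite_subset by blast
    have one: "1 \<in> D b" using b unfolding D_def B_def by auto
    define d where "d = Max (D b)"
    have d: "d \<in> D b" unfolding d_def using finD one by (intro Max_in) auto
    have max: "m \<le> d" if "m \<in> D b" for m unfolding d_def using finD that by simp
    have dpos: "d > 0" using d unfolding D_def by simp
    \<comment> \<open>If x m + z m' = gcd m m', then b / lcm m m' equals x (b / m') + z (b / m) and
      is a lattice vector again.\<close>
    have lcmD: "lcm m m' \<in> D b" if m: "m \<in> D b" "m' \<in> D b" for m m'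
    proof -
      obtain c where c: "m > 0" "c \<in> ?L" "\<forall>i\<in>I. b i = int m * c i" using m(1) unfolding D_def by auto
      obtain c' where c': "m' > 0" "c' \<in> ?L" "\<forall>i\<in>I. b i = int m' * c' i" using m(2) unfolding D_def by auto
      obtain k where k: "\<forall>i\<in>I. [c i = k * a i] (mod int q)" using c(2) unfolding multiples_lattice_def by auto
      obtain k' where k': "\<forall>i\<in>I. [c' i = k' * a i] (mod int q)" using c'(2) unfolding multiples_lattice_def by auto
      define g where "g = int (gcd m m')"
      obtain x z where xz: "x * int m + z * int m' = g" using bezout_int[of "int m" "int m'"] unfolding g_def by auto
      define e where "e = restrict (\<lambda>i. x * c' i + z * c i) I"
      have "e \<in> ?L" unfolding e_def
      proof (rule multiples_latticeI[where k = "x * k' + z * k"])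
        fix i assume "i \<in> I"
        then have "[x * c' i + z * c i = x * (k' * a i) + z * (k * a i)] (mod int q)"
          using k k' by (intro cong_add cong_scalar_left) auto
        then show "[x * c' i + z * c i = (x * k' + z * k) * a i] (mod int q)" by (simp add: algebra_simps)
      qed
      moreover have "b i = int (lcm m m') * e i" if "i \<in> I" for i
      proof -
        have "g * b i = int m * int m' * e i"
          using that c(3) c'(3) xz[symmetric] unfolding e_def by (simp add: algebra_simps)
        also have "int m * int m' = g * int (lcm m m')" unfolding g_def
          by (metis of_nat_mult prod_gcd_lcm_nat)
        finally show ?thesis using c(1) unfolding g_def by simp
      qed
      ultimately show ?thesis unfolding D_def using c(1) c'(1) by (auto simp: lcm_pos_nat)
    qed
    have "D b = {m. m dvd d}"
    proof (intro equalityI subsetI)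
      fix m assume "m \<in> D b"
      then have "lcm m d \<le> d" using lcmD d max by blast
      moreover have "d dvd lcm m d" "lcm m d > 0" using dpos \<open>m \<in> D b\<close> unfolding D_def by (auto simp: lcm_pos_nat)
      ultimately have "lcm m d = d" by (meson dvd_imp_le le_antisym)
      then show "m \<in> {m. m dvd d}" by (metis dvd_lcm1 mem_Collect_eq)
    next
      fix m assume "m \<in> {m. m dvd d}"
      then obtain m' where m': "d = m * m'" by auto
      obtain c where c: "c \<in> ?L" "\<forall>i\<in>I. b i = int d * c i" using d unfolding D_def by auto
      obtain k where k: "\<forall>i\<in>I. [c i = k * a i] (mod int q)" using c(1) unfolding multiples_lattice_def by auto
      have "restrict (\<lambda>i. int m' * c i) I \<in> ?L"
      proof (rule multiples_latticeI[where k = "int m' * k"])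
        fix i assume "i \<in> I"
        then show "[int m' * c i = int m' * k * a i] (mod int q)"
          using k by (simp add: mult.assoc cong_scalar_left)
      qed
      moreover have "\<forall>i\<in>I. b i = int m * restrict (\<lambda>i. int m' * c i) I i" using c(2) m' by simp
      moreover have "m > 0" using dpos m' by simp
      ultimately show "m \<in> D b" unfolding D_def by blast
    qed
    moreover have "d = 1 \<longleftrightarrow> b \<in> primitive_multiples I q a"
    proof -
      have nz: "\<exists>i\<in>I. b i \<noteq> 0" "b \<in> ?L" using b unfolding B_def scaled_points_def by auto
      then have "m > 0" if "\<forall>i\<in>I. b i = int m * c i" for m and c :: "'a \<Rightarrow> int" using that by (auto intro: Nat.gr0I)
      then have "b \<in> primitive_multiples I q a \<longleftrightarrow> (\<forall>m\<in>D b. m = 1)"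
        using nz unfolding primitive_multiples_def D_def by blast
      also have "\<dots> \<longleftrightarrow> d = 1"
      proof
        assume "d = 1"
        then have "m \<le> 1" "m > 0" if "m \<in> D b" for m using max[OF that] that unfolding D_def by auto
        then show "\<forall>m\<in>D b. m = 1" by (simp add: le_antisym Suc_leI)
      qed (use d in blast)
      finally show ?thesis by simp
    qed
    ultimately show ?thesis using dpos by blast
  qed
  have "(\<Sum>m\<in>{1..M}. moebius_mu m * real (card (?L \<inter> scaled_points I S (y / real m)))) =
      (\<Sum>m\<in>{1..M}. \<Sum>b\<in>B. if m \<in> D b then moebius_mu m else 0)"
  proof (rule sum.cong[OF refl])
    fix m assume "m \<in> {1..M}"
    then have m: "m > 0" by simp
    have "bij_betw (\<lambda>c. restrict (\<lambda>i. int m * c i) I) (?L \<inter> scaled_points I S (y / real m)) {b \<in> B. m \<in> D b}"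
      unfolding bij_betw_def
    proof
      show "inj_on (\<lambda>c. restrict (\<lambda>i. int m * c i) I) (?L \<inter> scaled_points I S (y / real m))"
      proof (rule inj_onI)
        fix c c' assume c: "c \<in> ?L \<inter> scaled_points I S (y / real m)" "c' \<in> ?L \<inter> scaled_points I S (y / real m)"
          "restrict (\<lambda>i. int m * c i) I = restrict (\<lambda>i. int m * c' i) I"
        have "c i = c' i" if "i \<in> I" for i using fun_cong[OF c(3), of i] that m by simp
        then show "c = c'" using c(1,2) unfolding scaled_points_def by (auto intro!: extensionalityI)
      qed
      have eq: "(\<lambda>i\<in>I. real_of_int (restrict (\<lambda>i. int m * c i) I i) / y) = (\<lambda>i\<in>I. real_of_int (c i) / (y / real m))" for c
        using m by (auto simp: fun_eq_iff)
      show "(\<lambda>c. restrict (\<lambda>i. int m * c i) I) ` (?L \<inter> scaled_points I S (y / real m)) = {b \<in> B. m \<in> D b}"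
      proof (intro equalityI subsetI)
        fix b assume "b \<in> (\<lambda>c. restrict (\<lambda>i. int m * c i) I) ` (?L \<inter> scaled_points I S (y / real m))"
        then obtain c where c: "b = restrict (\<lambda>i. int m * c i) I" "c \<in> ?L" "c \<in> scaled_points I S (y / real m)" by auto
        obtain k where k: "\<forall>i\<in>I. [c i = k * a i] (mod int q)" using c(2) unfolding multiples_lattice_def by auto
        have "b \<in> ?L" unfolding c(1)
        proof (rule multiples_latticeI[where k = "int m * k"])
          fix i assume "i \<in> I"
          then show "[int m * c i = int m * k * a i] (mod int q)"
            using k by (simp add: mult.assoc cong_scalar_left)
        qed
        moreover have "b \<in> scaled_points I S y" using c(3) m eq[of c] unfolding c(1) scaled_points_def by auto
        moreover have "m \<in> D b" unfolding D_def c(1) using c(2) m by auto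
        ultimately show "b \<in> {b \<in> B. m \<in> D b}" unfolding B_def by auto
      next
        fix b assume b: "b \<in> {b \<in> B. m \<in> D b}"
        then obtain c where c: "c \<in> ?L" "\<forall>i\<in>I. b i = int m * c i" unfolding D_def by auto
        have bc: "b = restrict (\<lambda>i. int m * c i) I"
          using b c(2) unfolding B_def scaled_points_def by (auto intro!: extensionalityI)
        have "c \<in> scaled_points I S (y / real m)"
          using b c eq[of c] unfolding B_def scaled_points_def bc multiples_lattice_def by auto
        then show "b \<in> (\<lambda>c. restrict (\<lambda>i. int m * c i) I) ` (?L \<inter> scaled_points I S (y / real m))"
          using bc c(1) by blast
      qed
    qed
    then have "card (?L \<inter> scaled_points I S (y / real m)) = card {b \<in> B. m \<in> D b}" by (rule bij_betw_same_card)
    then show "moebius_mu m * real (card (?L \<inter> scaled_points I S (y / real m))) = (\<Sum>b\<in>B. if m \<in> D b then moebius_mu m else 0)"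
      using sum.inter_filter[OF finB, of "\<lambda>_. moebius_mu m" "\<lambda>b. m \<in> D b"] by (simp add: mult.commute)
  qed
  also have "\<dots> = (\<Sum>b\<in>B. \<Sum>m\<in>{1..M}. if m \<in> D b then moebius_mu m else 0)" by (rule sum.swap)
  also have "\<dots> = (\<Sum>b\<in>B. if b \<in> primitive_multiples I q a then 1 else 0)"
  proof (rule sum.cong[OF refl])
    fix b assume b: "b \<in> B"
    obtain d where d: "d > 0" "D b = {m. m dvd d}" "d = 1 \<longleftrightarrow> b \<in> primitive_multiples I q a" using Ddvd[OF b] by metis
    have "{m \<in> {1..M}. m \<in> D b} = D b" using DM[OF b] by auto
    then have "(\<Sum>m\<in>{1..M}. if m \<in> D b then moebius_mu m else 0) = (\<Sum>m\<in>D b. moebius_mu m)"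
      by (simp only: sum.inter_filter[OF finite_atLeastAtMost, symmetric])
    also have "\<dots> = (if b \<in> primitive_multiples I q a then 1 else 0)"
      unfolding d(2) sum_moebius_mu_divisors[OF d(1)] using d(3) by simp
    finally show "(\<Sum>m\<in>{1..M}. if m \<in> D b then moebius_mu m else 0) = (if b \<in> primitive_multiples I q a then 1 else 0)" .
  qed
  also have "\<dots> = real (card {b \<in> B. b \<in> primitive_multiples I q a})"
    using sum.inter_filter[OF finB, of "\<lambda>_. 1::real" "\<lambda>b. b \<in> primitive_multiples I q a"] by simp
  also have "{b \<in> B. b \<in> primitive_multiples I q a} = primitive_multiples I q a \<inter> scaled_points I S y"
    unfolding B_def primitive_multiples_def by auto
  finally show ?thesis by simp
qed

text \<open>For primitive \<open>a\<close> the lattice \<open>multiples_lattice I q a\<close> has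
  covolume q^(n-1); this is the side of a cube of that volume.\<close>

definition lattice_scale :: "nat \<Rightarrow> nat \<Rightarrow> real" where
  "lattice_scale n q = real q powr (1 - 1 / real n)"

lemma lattice_scale_pos: "q > 0 \<Longrightarrow> lattice_scale n q > 0"
  unfolding lattice_scale_def by simp

lemma lattice_scale_power:
  assumes "n > 0" "q > 0" shows "real q * lattice_scale n q ^ n = real q ^ n"
proof -
  have "lattice_scale n q ^ n = real q powr (real n - 1)"
    unfolding lattice_scale_def using assms by (simp add: powr_power algebra_simps)
  then have "real q * lattice_scale n q ^ n = real q powr 1 * real q powr (real n - 1)" using assms by simp
  also have "\<dots> = real q powr (real n)" by (simp only: powr_add[symmetric]) simp
  finally show ?thesis using assms by (simp add: powr_realpow)
qed

lemma sqrt_le_lattice_scale: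
  assumes "n \<ge> 2" "q > 0" shows "sqrt q \<le> lattice_scale n q"
proof -
  have "1 / real n \<le> 1/2" using assms by simp
  then have "real q powr (1/2) \<le> real q powr (1 - 1 / real n)" using assms by (intro powr_mono) auto
  then show ?thesis unfolding lattice_scale_def by (simp add: powr_half_sqrt)
qed

context
  fixes I :: "'i set" and S :: "('i \<Rightarrow> real) set" and K V :: real and n :: nat
  assumes fin: "finite I" and n: "card I = n" "n \<ge> 2" and K: "K \<ge> 0"
    and S: "\<And>z. z > 0 \<Longrightarrow> finite (scaled_points I S z)"
    and bound: "\<And>z. z > 0 \<Longrightarrow> real (card (scaled_points I S z)) \<le> K * z ^ n"
    and lim: "((\<lambda>z. real (card (scaled_points I S z)) / z ^ n) \<longlongrightarrow> V) at_top"
begin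

lemma nonempty_index: "I \<noteq> {}"
  using n by auto

text \<open>The powers of h = gcd k (q / e) cancel: h^n vectors \<open>a\<close> belong to each
  point, but the scale is smaller by h. The bound is uniform in q and summable over m and e, as
  limits under these sums require.\<close>

lemma triples_density_le:
  assumes "q > 0" "m > 0" "e dvd q"
  shows "real (card (multiple_triples I S q e (lattice_scale n q / real m))) \<le> K * real q ^ n / (real m ^ n * real e ^ n)"
proof -
  define y where "y = lattice_scale n q / real m"
  have y: "y > 0" unfolding y_def using assms lattice_scale_pos by simp
  have e: "e > 0" using assms by (auto intro: Nat.gr0I)
  have h: "gcd k (q div e) > 0" for k using assms e by (auto elim!: dvdE simp: gcd_pos_nat)
  have "real (card (multiple_triples I S q e y)) =
      (\<Sum>k<q. real (gcd k (q div e)) ^ n * real (card (scaled_points I S (y / real (e * gcd k (q div e))))))"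
    using card_multiple_triples(2)[OF fin nonempty_index assms(1,3) y S[OF y]] n by simp
  also have "\<dots> \<le> (\<Sum>k<q. real (gcd k (q div e)) ^ n * (K * (y / real (e * gcd k (q div e))) ^ n))"
    using y e h by (intro sum_mono mult_left_mono bound) auto
  also have "\<dots> = (\<Sum>k<q. K * (y / e) ^ n)"
  proof (rule sum.cong[OF refl])
    fix k
    define g where "g = real (gcd k (q div e))"
    have "g > 0" unfolding g_def using h by simp
    then have "g ^ n * (K * (y / (e * g)) ^ n) = K * (y / e) ^ n" by (simp add: power_divide power_mult_distrib)
    then show "real (gcd k (q div e)) ^ n * (K * (y / real (e * gcd k (q div e))) ^ n) = K * (y / e) ^ n"
      unfolding g_def by simp
  qed
  also have "\<dots> = K * real q ^ n / (real m ^ n * real e ^ n)"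
    using lattice_scale_power[of n q] n assms unfolding y_def
    by (simp add: power_divide power_mult_distrib mult.left_commute[of "real q" K])
  finally show ?thesis unfolding y_def .
qed

text \<open>For most k the scale y / (e h) is large and the asymptotics V z^n apply. The other k
  have gcd k q of order at least sqrt q; they are few by the divisor bound, and K z^n limits what
  they contribute. The value 0 for e not dividing q yields one sequence in q for each fixed m and
  e.\<close>

lemma triples_density_tendsto:
  assumes m: "m > 0" and e: "e > 0"
  shows "(\<lambda>q. if e dvd q \<and> q > 0 then
      real (card (multiple_triples I S q e (lattice_scale n q / real m))) / real q ^ n - V / (real m ^ n * real e ^ n)
    else 0) \<longlonglongrightarrow> 0" (is "?f \<longlonglongrightarrow> 0")
proof (rule LIMSEQ_I)
  fix \<epsilon> :: real assume eps: "\<epsilon> > 0"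
  define c where "c z = real (card (scaled_points I S z))" for z
  have "\<forall>\<^sub>F z in at_top. dist (c z / z ^ n) V < \<epsilon> / 4"
    unfolding c_def using lim eps by (intro tendstoD) auto
  then obtain Y0 where Y0: "\<And>z. z \<ge> Y0 \<Longrightarrow> \<bar>c z / z ^ n - V\<bar> < \<epsilon> / 4"
    unfolding eventually_at_top_linorder dist_real_def by blast
  define Y where "Y = max Y0 1"
  define C where "C = K + \<bar>V\<bar> + 1"
  have C: "C > 0" unfolding C_def using K by linarith
  have near: "\<bar>c z - V * z ^ n\<bar> \<le> \<epsilon> / 4 * z ^ n" if "z \<ge> Y" for z
  proof -
    have z: "z > 0" "z \<ge> Y0" using that unfolding Y_def by auto
    have "c z - V * z ^ n = (c z / z ^ n - V) * z ^ n" using z by (simp add: field_simps)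
    then show ?thesis using Y0[OF z(2)] z by (simp add: abs_mult)
  qed
  have far: "\<bar>c z - V * z ^ n\<bar> \<le> C * z ^ n" if "z > 0" for z
  proof -
    have "0 \<le> c z" "c z \<le> K * z ^ n" "\<bar>V * z ^ n\<bar> = \<bar>V\<bar> * z ^ n" "0 \<le> z ^ n"
      using bound[OF that] that unfolding c_def by (auto simp: abs_mult)
    then show ?thesis unfolding C_def by (simp add: algebra_simps)
  qed
  define \<delta> where "\<delta> = \<epsilon> / (4 * C * (real m * real e * Y))"
  have \<delta>: "\<delta> > 0" unfolding \<delta>_def using eps C m e by (simp add: Y_def)
  have "\<forall>\<^sub>F q in sequentially. norm (?f q) < \<epsilon>"
    using divisor_count_small[OF \<delta>] eventually_gt_at_top[of 0]
  proof eventually_elim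
    case (elim q)
    show ?case
    proof (cases "e dvd q")
      case False then show ?thesis using eps by simp
    next
      case True
      have q: "q > 0" using elim by simp
      define X where "X = lattice_scale n q"
      have X: "X > 0" "sqrt q \<le> X" unfolding X_def using lattice_scale_pos[OF q] sqrt_le_lattice_scale[OF n(2) q] by auto
      define y where "y = X / real m"
      have y: "y > 0" unfolding y_def using X m by simp
      define h where "h k = gcd k (q div e)" for k
      have h: "h k > 0" for k using True q unfolding h_def by (auto elim!: dvdE simp: gcd_pos_nat)
      define z where "z k = y / real (e * h k)" for k
      have z: "z k > 0" for k unfolding z_def using y e h by simp
      have hz: "real (h k) ^ n * z k ^ n = (y / e) ^ n" for k
        unfolding z_def using h[of k] by (simp add: power_divide power_mult_distrib)
      have scale: "real q * (y / e) ^ n = real q ^ n / (real m ^ n * real e ^ n)"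
        using lattice_scale_power[of n q] n q unfolding y_def X_def by (simp add: power_divide power_mult_distrib)
      have ye: "(y / e) ^ n \<ge> 0" using y by simp
      have "real (card (multiple_triples I S q e y)) = (\<Sum>k<q. real (h k) ^ n * c (z k))"
        using card_multiple_triples(2)[OF fin nonempty_index q True y S[OF y]] n unfolding h_def z_def c_def by simp
      then have "real (card (multiple_triples I S q e y)) - V * (real q * (y / e) ^ n) =
         (\<Sum>k<q. real (h k) ^ n * c (z k) - V * (y / e) ^ n)"
        by (simp add: sum_subtractf)
      also have "\<dots> = (\<Sum>k<q. real (h k) ^ n * (c (z k) - V * z k ^ n))"
        using hz by (intro sum.cong refl) (simp add: right_diff_distrib mult.left_commute)
      also have "\<bar>\<dots>\<bar> \<le> (\<Sum>k<q. (\<epsilon> / 4 + (if z k < Y then C else 0)) * (y / e) ^ n)"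
      proof (intro order.trans[OF sum_abs] sum_mono)
        fix k
        have "\<bar>c (z k) - V * z k ^ n\<bar> \<le> (\<epsilon> / 4 + (if z k < Y then C else 0)) * z k ^ n"
          using near[of "z k"] far[OF z, of k] eps z[of k] by (auto simp: algebra_simps intro: order.trans)
        then have "real (h k) ^ n * \<bar>c (z k) - V * z k ^ n\<bar> \<le> real (h k) ^ n * ((\<epsilon> / 4 + (if z k < Y then C else 0)) * z k ^ n)"
          by (intro mult_left_mono) auto
        also have "\<dots> = (\<epsilon> / 4 + (if z k < Y then C else 0)) * (y / e) ^ n" using hz[of k] by (simp add: mult.left_commute)
        finally show "\<bar>real (h k) ^ n * (c (z k) - V * z k ^ n)\<bar> \<le> (\<epsilon> / 4 + (if z k < Y then C else 0)) * (y / e) ^ n"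
          by (simp add: abs_mult)
      qed
      also have "\<dots> = (real q * (\<epsilon> / 4) + C * real (card {k \<in> {..<q}. z k < Y})) * (y / e) ^ n"
      proof -
        have "(\<Sum>k<q. if z k < Y then C else 0) = C * real (card {k \<in> {..<q}. z k < Y})"
          unfolding sum.inter_filter[OF finite_lessThan, symmetric] by (simp add: mult.commute)
        then show ?thesis unfolding sum_distrib_right[symmetric] sum.distrib by (simp only: sum_constant card_lessThan)
      qed
      also have "\<dots> \<le> (real q * (\<epsilon> / 4) + real q * (\<epsilon> / 4)) * (y / e) ^ n"
      proof (intro mult_right_mono add_left_mono ye)
        define G where "G = y / (e * Y)"
        have G: "G > 0" unfolding G_def using y e by (simp add: Y_def)
        have "{k \<in> {..<q}. z k < Y} \<subseteq> {k. k < q \<and> real (gcd k q) > G}"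
        proof
          fix k assume k: "k \<in> {k \<in> {..<q}. z k < Y}"
          then have "y < Y * (e * real (h k))" unfolding z_def using e h[of k] by (simp add: field_simps)
          then have "G < real (h k)" unfolding G_def using e by (simp add: Y_def field_simps)
          also have "h k \<le> gcd k q"
          proof -
            have "h k dvd gcd k q"
            proof -
              have "q div e dvd q" using True by (metis dvd_mult_div_cancel dvd_triv_right)
              then show ?thesis unfolding h_def by (meson dvd_trans gcd_dvd1 gcd_dvd2 gcd_greatest)
            qed
            then show ?thesis using q by (intro dvd_imp_le) auto
          qed
          finally show "k \<in> {k. k < q \<and> real (gcd k q) > G}" using k by simp
        qed
        then have "card {k \<in> {..<q}. z k < Y} \<le> card {k. k < q \<and> real (gcd k q) > G}" by (intro card_mono) auto
        then have "real (card {k \<in> {..<q}. z k < Y}) \<le> divisor_count q * q / G" using card_large_gcd[OF q G] by linarith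
        also have "\<dots> \<le> (\<delta> * X) * q / G"
        proof -
          have "real (divisor_count q) \<le> \<delta> * X" using elim(1) mult_left_mono[OF X(2), of \<delta>] \<delta> by linarith
          then show ?thesis using G unfolding of_nat_mult by (intro divide_right_mono mult_right_mono) auto
        qed
        also have "\<dots> = \<delta> * (real m * real e * Y) * q" unfolding G_def y_def using X by (simp add: field_simps)
        also have "\<dots> = \<epsilon> / (4 * C) * q" unfolding \<delta>_def using m e by (simp add: Y_def)
        finally have "C * real (card {k \<in> {..<q}. z k < Y}) \<le> C * (\<epsilon> / (4 * C) * q)" using C by (intro mult_left_mono) auto
        then show "C * real (card {k \<in> {..<q}. z k < Y}) \<le> real q * (\<epsilon> / 4)" using C by (simp add: mult.commute)
      qed
      also have "\<dots> = \<epsilon> / 2 * (real q * (y / e) ^ n)" by (simp add: algebra_simps)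
      finally have main: "\<bar>real (card (multiple_triples I S q e y)) - V * (real q * (y / e) ^ n)\<bar> \<le> \<epsilon> / 2 * (real q * (y / e) ^ n)" .
      have qn: "real q ^ n > 0" using q by simp
      have "?f q = (real (card (multiple_triples I S q e y)) - V * (real q * (y / e) ^ n)) / real q ^ n"
        using True q qn scale unfolding y_def X_def by (simp add: diff_divide_distrib)
      then have "\<bar>?f q\<bar> \<le> \<epsilon> / 2 * (real q * (y / e) ^ n) / real q ^ n"
        using divide_right_mono[OF main, of "real q ^ n"] qn by (simp only: abs_divide abs_of_pos less_imp_le)
      also have "\<dots> = \<epsilon> / 2 / (real m ^ n * real e ^ n)" unfolding scale using qn by simp
      also have "\<dots> \<le> \<epsilon> / 2 / 1"
      proof (rule divide_left_mono)
        have "1 \<le> real m ^ n" "1 \<le> real e ^ n" using m e by (auto intro: one_le_power)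
        then have "1 * 1 \<le> real m ^ n * real e ^ n" by (intro mult_mono) auto
        then show "1 \<le> real m ^ n * real e ^ n" by simp
      qed (use eps m e in auto)
      finally show ?thesis using eps by simp
    qed
  qed
  then show "\<exists>N. \<forall>q\<ge>N. norm (?f q - 0) < \<epsilon>" unfolding eventually_sequentially by simp
qed

text \<open>Two Moebius sums, over m for primitive \<open>b\<close> and over e for primitive
  \<open>a\<close>, are interchanged with the limit by Tannery's theorem. The sum over m produces 1
  / \<zeta>(n). The sum over e is kept intact and recombines to the number of primitive
  \<open>a\<close>, whose quotient by q^n has no limit.\<close>

lemma first_moment:
  "(\<lambda>q. ((\<Sum>a\<in>primitive_residues I q. real (card (primitive_multiples I q a \<inter> scaled_points I S (lattice_scale n q))))
       - V / zeta (real n) * real (card (primitive_residues I q))) / real q ^ n) \<longlonglongrightarrow> 0"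
proof -
  define T where "T q m e = real (card (multiple_triples I S q e (lattice_scale n q / real m)))" for q m e
  define f where "f q m e = (if e dvd q \<and> q > 0 then T q m e / real q ^ n - V / (real m ^ n * real e ^ n) else 0)" for q m e
  define E where "E q m e = moebius_mu m * moebius_mu e * f q m e" for q m e
  define C where "C = K + \<bar>V\<bar>"
  have C0: "C \<ge> 0" unfolding C_def using K by simp
  have f_le: "\<bar>f q m e\<bar> \<le> C / (real m ^ n * real e ^ n)" if "m > 0" "e > 0" for q m e
  proof (cases "e dvd q \<and> q > 0")
    case True
    then have "T q m e / real q ^ n \<le> K / (real m ^ n * real e ^ n)"
      unfolding T_def using triples_density_le[of q m e] that True by (simp add: field_simps)
    moreover have "T q m e / real q ^ n \<ge> 0" unfolding T_def by simp
    moreover have "\<bar>V / (real m ^ n * real e ^ n)\<bar> = \<bar>V\<bar> / (real m ^ n * real e ^ n)" by (simp add: abs_mult)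
    moreover have "f q m e = T q m e / real q ^ n - V / (real m ^ n * real e ^ n)" using True unfolding f_def by simp
    ultimately show ?thesis unfolding C_def add_divide_distrib by linarith
  next
    case False
    then have "f q m e = 0" unfolding f_def by auto
    then show ?thesis using C0 by simp
  qed
  have E_le: "\<bar>E q m e\<bar> \<le> C / real m ^ n * (1 / real e ^ n)" for q m e
  proof (cases "m > 0 \<and> e > 0")
    case True
    have "\<bar>E q m e\<bar> \<le> 1 * 1 * \<bar>f q m e\<bar>"
      unfolding E_def abs_mult using abs_moebius_mu_le by (intro mult_mono) auto
    then show ?thesis using f_le[of m e q] True by simp
  next
    case False
    then have "E q m e = 0" unfolding E_def by auto
    then show ?thesis using C0 by simp
  qed
  have sumE: "summable (\<lambda>e. C / real m ^ n * (1 / real e ^ n))" for m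
    using summable_inverse_power[OF n(2)] by (rule summable_mult)
  have f_lim: "(\<lambda>q. f q m e) \<longlonglongrightarrow> 0" if "m > 0" "e > 0" for m e
    unfolding f_def T_def by (rule triples_density_tendsto[OF that])
  have E_lim: "(\<lambda>q. E q m e) \<longlonglongrightarrow> 0" for m e
  proof (cases "m > 0 \<and> e > 0")
    case True
    then show ?thesis unfolding E_def using f_lim by (intro tendsto_mult_right_zero) auto
  next
    case False
    then have "E q m e = 0" for q unfolding E_def by auto
    then show ?thesis by simp
  qed
  have inner: "(\<lambda>q. \<Sum>e. E q m e) \<longlonglongrightarrow> 0" for m
  proof -
    have "(\<lambda>q. \<Sum>e. E q m e) \<longlonglongrightarrow> (\<Sum>e::nat. 0)"
      using tannerys_theorem[where a = "\<lambda>e q. E q m e" and b = "\<lambda>_. 0" and F = sequentially, OF E_lim _ sumE[of m]] E_le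
      by (auto intro: always_eventually)
    then show ?thesis by simp
  qed
  define Z where "Z = (\<Sum>e. 1 / real e ^ n)"
  have inner_le: "\<bar>\<Sum>e. E q m e\<bar> \<le> C * Z * (1 / real m ^ n)" for q m
  proof -
    have s: "summable (\<lambda>e. \<bar>E q m e\<bar>)"
      by (rule summable_comparison_test'[OF sumE[of m]]) (use E_le in auto)
    have "\<bar>\<Sum>e. E q m e\<bar> \<le> (\<Sum>e. \<bar>E q m e\<bar>)" by (rule summable_rabs[OF s])
    also have "\<dots> \<le> (\<Sum>e. C / real m ^ n * (1 / real e ^ n))" by (rule suminf_le[OF E_le s sumE])
    also have "\<dots> = C * Z * (1 / real m ^ n)"
      unfolding Z_def using suminf_mult[OF summable_inverse_power[OF n(2)], of "C / real m ^ n"] by simp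
    finally show ?thesis .
  qed
  have "(\<lambda>q. \<Sum>m. \<Sum>e. E q m e) \<longlonglongrightarrow> (\<Sum>m::nat. 0)"
    using tannerys_theorem[where a = "\<lambda>m q. \<Sum>e. E q m e" and b = "\<lambda>_. 0" and F = sequentially, OF inner _ summable_mult[OF summable_inverse_power[OF n(2)], of "C * Z"]] inner_le
    by (auto intro: always_eventually)
  then have outer: "(\<lambda>q. \<Sum>m. \<Sum>e. E q m e) \<longlonglongrightarrow> 0" by simp
  have "(\<Sum>m. \<Sum>e. E q m e) =
     ((\<Sum>a\<in>primitive_residues I q. real (card (primitive_multiples I q a \<inter> scaled_points I S (lattice_scale n q))))
       - V / zeta (real n) * real (card (primitive_residues I q))) / real q ^ n" if q: "q > 0" for q
  proof -
    define X where "X = lattice_scale n q"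
    have X: "X > 0" unfolding X_def using q by (rule lattice_scale_pos)
    have Xm: "X / real m > 0" if "m > 0" for m using X that by simp
    \<comment> \<open>Beyond M the bound K (X / m)^n drops below 1, so the finite set is empty and
      only finitely many m contribute.\<close>
    define M where "M = nat \<lceil>K * X ^ n\<rceil> + 1"
    have empty: "scaled_points I S (X / real m) = {}" if "m > M" for m
    proof -
      have m: "m > 0" "K * X ^ n < real m" using that unfolding M_def by linarith+
      have "real m \<le> real m ^ n" using m n by (intro self_le_power) auto
      then have "K * X ^ n < real m ^ n" using m by linarith
      then have "K * (X / real m) ^ n < 1" using m by (simp add: power_divide)
      then have "real (card (scaled_points I S (X / real m))) < 1" using bound[OF Xm[OF m(1)]] by linarith
      then show ?thesis using S[OF Xm[OF m(1)]] by simp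
    qed
    have finD: "finite {e. e dvd q}" using q by simp
    define A where "A m = (\<Sum>e | e dvd q. moebius_mu m * moebius_mu e * (T q m e / real q ^ n))" for m
    define D where "D = (\<Sum>e | e dvd q. moebius_mu e / real e ^ n)"
    have inner_eq: "(\<Sum>e. E q m e) = A m - V * D * (moebius_mu m / real m ^ n)" for m
    proof -
      have "(\<Sum>e. E q m e) = (\<Sum>e | e dvd q. E q m e)"
        by (rule suminf_finite[OF finD]) (auto simp: E_def f_def)
      also have "\<dots> = (\<Sum>e | e dvd q. moebius_mu m * moebius_mu e * (T q m e / real q ^ n) - V * (moebius_mu e / real e ^ n) * (moebius_mu m / real m ^ n))"
        by (rule sum.cong[OF refl]) (use q in \<open>auto simp: E_def f_def right_diff_distrib mult_ac\<close>)
      also have "\<dots> = A m - (\<Sum>e | e dvd q. V * (moebius_mu e / real e ^ n) * (moebius_mu m / real m ^ n))"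
        unfolding A_def sum_subtractf ..
      also have "(\<Sum>e | e dvd q. V * (moebius_mu e / real e ^ n) * (moebius_mu m / real m ^ n)) = V * D * (moebius_mu m / real m ^ n)"
        unfolding D_def by (simp only: sum_distrib_left sum_distrib_right)
      finally show ?thesis .
    qed
    have A0: "A m = 0" if "m \<notin> {1..M}" for m
    proof -
      have "m = 0 \<or> m > M" using that by auto
      then show ?thesis
      proof
        assume "m > M"
        then have "multiple_triples I S q e (X / real m) = {}" for e
          unfolding multiple_triples_def using empty by auto
        then show ?thesis unfolding A_def T_def X_def[symmetric] by simp
      qed (simp add: A_def)
    qed
    have mu: "summable (\<lambda>m. moebius_mu m / real m ^ n)"
      using summable_norm_cancel[OF summable_moebius_mu_power[OF n(2)]] .
    have zeta: "(\<Sum>m. moebius_mu m / real m ^ n) = 1 / zeta (real n)"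
      using suminf_moebius_mu[OF n(2)] by (metis eq_divide_eq mult_zero_right zero_neq_one)
    have "(\<Sum>m. \<Sum>e. E q m e) = (\<Sum>m. A m - V * D * (moebius_mu m / real m ^ n))" using inner_eq by simp
    also have "\<dots> = (\<Sum>m. A m) - (\<Sum>m. V * D * (moebius_mu m / real m ^ n))"
      using summable_finite[of "{1..M}" A] A0 summable_mult[OF mu, of "V * D"] by (intro suminf_diff[symmetric]) auto
    also have "(\<Sum>m. A m) = (\<Sum>m\<in>{1..M}. A m)" using A0 by (intro suminf_finite) auto
    also have "(\<Sum>m. V * D * (moebius_mu m / real m ^ n)) = V * D / zeta (real n)"
      using suminf_mult[OF mu, of "V * D"] zeta by simp
    also have "V * D / zeta (real n) = V / zeta (real n) * real (card (primitive_residues I q)) / real q ^ n"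
      unfolding D_def using card_primitive_residues[OF fin q] n q by simp
    also have "(\<Sum>m\<in>{1..M}. A m) = (\<Sum>a\<in>primitive_residues I q. real (card (primitive_multiples I q a \<inter> scaled_points I S X))) / real q ^ n"
    proof -
      have "(\<Sum>a\<in>primitive_residues I q. real (card (primitive_multiples I q a \<inter> scaled_points I S X))) =
          (\<Sum>a\<in>primitive_residues I q. \<Sum>m\<in>{1..M}. moebius_mu m * real (card (multiples_lattice I q a \<inter> scaled_points I S (X / real m))))"
        by (intro sum.cong refl sum_primitive_multiples fin nonempty_index q X S empty)
      also have "\<dots> = (\<Sum>m\<in>{1..M}. moebius_mu m * (\<Sum>a\<in>primitive_residues I q. real (card (multiples_lattice I q a \<inter> scaled_points I S (X / real m)))))"
        by (subst sum.swap) (simp add: sum_distrib_left)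
      also have "\<dots> = (\<Sum>m\<in>{1..M}. moebius_mu m * (\<Sum>e | e dvd q. moebius_mu e * T q m e))"
        unfolding T_def X_def[symmetric]
        by (intro sum.cong refl arg_cong2[where f = "(*)"] card_multiples_lattice_points fin nonempty_index q S Xm) auto
      also have "\<dots> = (\<Sum>m\<in>{1..M}. A m) * real q ^ n"
        unfolding A_def sum_distrib_right sum_distrib_left using q by (intro sum.cong refl) simp
      finally show ?thesis using q by simp
    qed
    finally show ?thesis unfolding X_def by (simp add: diff_divide_distrib)
  qed
  note exact = this
  have ev: "\<forall>\<^sub>F q in sequentially. (\<Sum>m. \<Sum>e. E q m e) =
     ((\<Sum>a\<in>primitive_residues I q. real (card (primitive_multiples I q a \<inter> scaled_points I S (lattice_scale n q))))
       - V / zeta (real n) * real (card (primitive_residues I q))) / real q ^ n"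
    by (rule eventually_mono[OF eventually_gt_at_top[of "0::nat"] exact])
  show ?thesis by (rule Lim_transform_eventually[OF outer ev])
qed

end

section \<open>Reduction to residue vectors\<close>

definition uncovered :: "'i set \<Rightarrow> nat \<Rightarrow> real \<Rightarrow> ('i \<Rightarrow> int) set" where
  "uncovered I q R = {a \<in> primitive_residues I q. \<not> covers I q a (R * real q powr (1 / real (card I)))}"

lemma Greatest_int:
  fixes P :: "int \<Rightarrow> bool"
  assumes "P k0" "\<And>k. P k \<Longrightarrow> k \<le> B"
  shows "P (Greatest P)" "P k \<Longrightarrow> k \<le> Greatest P"
proof -
  define A where "A = {k. P k \<and> k0 \<le> k}"
  have "A \<subseteq> {k0..B}" unfolding A_def using assms(2) by auto
  then have fin: "finite A" using finite_subset by blast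
  have k0: "k0 \<in> A" unfolding A_def using assms(1) by simp
  have M: "Max A \<in> A" using fin k0 by (intro Max_in) auto
  have le: "k \<le> Max A" if "P k" for k
  proof (cases "k0 \<le> k")
    case True
    then show ?thesis using that fin unfolding A_def by simp
  next
    case False
    moreover have "k0 \<le> Max A" using fin k0 by simp
    ultimately show ?thesis by linarith
  qed
  have "Greatest P = Max A" using M le unfolding A_def by (intro Greatest_equality) auto
  then show "P (Greatest P)" "P k \<Longrightarrow> k \<le> Greatest P" using M le unfolding A_def by auto
qed

text \<open>On the cone a coordinate in \<open>I\<close> lies in [N q, (N + 1) q) with q the
  coordinate at \<open>i0\<close>, so this difference is its residue modulo q.\<close>

definition residue_part :: "'n::finite \<Rightarrow> 'n set \<Rightarrow> nat \<Rightarrow> nat ^ 'n \<Rightarrow> 'n \<Rightarrow> int" where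
  "residue_part i0 I N a = (\<lambda>i\<in>I. int (a $ i) - int N * int (a $ i0))"

definition cone_vector :: "'n::finite \<Rightarrow> 'n set \<Rightarrow> nat \<Rightarrow> nat ^ 'n \<Rightarrow> bool" where
  "cone_vector i0 I N a \<longleftrightarrow> a $ i0 > 0 \<and> (\<forall>i\<in>I. N * a $ i0 \<le> a $ i \<and> a $ i < (N + 1) * a $ i0)"

text \<open>
  Over \<open>cone_domain\<close> each residue vector occurs exactly once for each \<open>q\<close>, and for large \<open>N\<close> the normalising
  product is close to \<open>N ^ n * q ^ (n + 1)\<close>.
\<close>

definition cone_domain :: "'n::finite \<Rightarrow> 'n set \<Rightarrow> nat \<Rightarrow> (real ^ 'n) set" where
  "cone_domain i0 I N = {x. x $ i0 \<in> {1<..2} \<and>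
     (\<forall>i\<in>I. x $ i - real N * x $ i0 \<in> {0..} \<and> x $ i - real (N + 1) * x $ i0 \<in> {..<0})}"

definition modulus_range :: "real \<Rightarrow> nat set" where
  "modulus_range T = {q. T < real q \<and> real q \<le> 2 * T}"

context
  fixes i0 :: "'n::finite" and I :: "'n set" and n N :: nat
  assumes I: "I = UNIV - {i0}" and n: "n = CARD('n) - 1" "n \<ge> 2" and N: "N \<ge> 1"
begin

lemma card_index: "card I = n" "finite I" "i0 \<notin> I" "UNIV = insert i0 I"
  unfolding I n(1) by auto

lemma mem_index: "i \<in> I \<longleftrightarrow> i \<noteq> i0"
  unfolding I by simp

lemma sum_coordinates: "(\<Sum>i\<in>UNIV. f i) = f i0 + (\<Sum>i\<in>I. f i)"
  unfolding card_index(4) using card_index(2,3) by simp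

lemma sum_residue_part_cong:
  "[(\<Sum>i\<in>I. int (x i) * residue_part i0 I N a i) = (\<Sum>i\<in>I. int (x i) * int (a $ i))] (mod int (a $ i0))"
proof (intro cong_sum cong_scalar_left)
  fix i assume "i \<in> I"
  then show "[residue_part i0 I N a i = int (a $ i)] (mod int (a $ i0))"
    unfolding residue_part_def by (simp add: cong_iff_dvd_diff)
qed

lemma representable_iff:
  "representable a k \<longleftrightarrow> (\<exists>x y. k = int y * int (a $ i0) + (\<Sum>i\<in>I. int (x i) * int (a $ i)))"
proof
  assume "representable a k"
  then obtain x :: "nat ^ 'n" where "k = int (\<Sum>i\<in>UNIV. x $ i * a $ i)" unfolding representable_def by auto
  then have "k = int (x $ i0) * int (a $ i0) + (\<Sum>i\<in>I. int (x $ i) * int (a $ i))"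
    by (simp add: sum_coordinates)
  then show "\<exists>x y. k = int y * int (a $ i0) + (\<Sum>i\<in>I. int (x i) * int (a $ i))"
    by (intro exI[of _ "\<lambda>i. x $ i"] exI[of _ "x $ i0"])
next
  assume "\<exists>x y. k = int y * int (a $ i0) + (\<Sum>i\<in>I. int (x i) * int (a $ i))"
  then obtain x y where k: "k = int y * int (a $ i0) + (\<Sum>i\<in>I. int (x i) * int (a $ i))" by auto
  define z :: "nat ^ 'n" where "z = (\<chi> i. if i = i0 then y else x i)"
  have "(\<Sum>i\<in>I. int (z $ i) * int (a $ i)) = (\<Sum>i\<in>I. int (x i) * int (a $ i))"
    using card_index(3) by (intro sum.cong) (auto simp: z_def)
  then have "k = int (\<Sum>i\<in>UNIV. z $ i * a $ i)"
    unfolding k by (simp add: sum_coordinates z_def)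
  then show "representable a k" unfolding representable_def by blast
qed

text \<open>The class of k is reached by at most s generators, each below (N + 1) q. What is missing
  to k is a nonnegative multiple of q, supplied by the coordinate \<open>i0\<close>.\<close>

lemma representable_of_covers:
  assumes a: "cone_vector i0 I N a" and c: "covers I (a $ i0) (residue_part i0 I N a) s"
    and k: "real ((N + 1) * a $ i0) * s \<le> real_of_int k"
  shows "representable a k"
proof -
  define q where "q = a $ i0"
  have q: "q > 0" using a unfolding cone_vector_def q_def by simp
  obtain x where x: "[(\<Sum>i\<in>I. int (x i) * residue_part i0 I N a i) = k] (mod int q)" "real (\<Sum>i\<in>I. x i) \<le> s"
    using c unfolding covers_def q_def by blast
  define S where "S = (\<Sum>i\<in>I. int (x i) * int (a $ i))"
  have "[S = k] (mod int q)" unfolding S_def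
    using sum_residue_part_cong[of x a] x(1) unfolding q_def by (meson cong_sym cong_trans)
  then obtain m where m: "k - S = int q * m" by (metis cong_iff_dvd_diff cong_sym dvd_def)
  have "S \<le> (\<Sum>i\<in>I. int (x i) * int ((N + 1) * q))"
    unfolding S_def q_def using a unfolding cone_vector_def
    by (intro sum_mono mult_left_mono) (auto simp: le_less simp del: of_nat_mult of_nat_add)
  also have "\<dots> = int ((N + 1) * q) * int (\<Sum>i\<in>I. x i)" by (simp add: sum_distrib_left sum_distrib_right mult.commute)
  finally have "real_of_int S \<le> real ((N + 1) * q) * real (\<Sum>i\<in>I. x i)"
    by (metis (no_types, lifting) of_int_le_iff of_int_mult of_int_of_nat_eq)
  also have "\<dots> \<le> real ((N + 1) * q) * s" using x(2) by (intro mult_left_mono) auto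
  also have "\<dots> \<le> real_of_int k" using k unfolding q_def .
  finally have "0 \<le> int q * m" using m by linarith
  then have "m \<ge> 0" using q by (simp add: zero_le_mult_iff)
  then have "k = int (nat m) * int q + S" using m by (simp add: algebra_simps)
  then show ?thesis unfolding representable_iff S_def q_def by blast
qed

lemma not_representable_minus_1: "\<not> representable a (-1)"
  unfolding representable_def by (metis of_nat_0_le_iff neg_0_le_iff_le not_one_le_zero)

lemma shifted_frobenius_le:
  assumes a: "cone_vector i0 I N a" and c: "covers I (a $ i0) (residue_part i0 I N a) s"
  shows "real_of_int (shifted_frobenius_number a) \<le> real ((N + 1) * a $ i0) * (s + real n + 1)"
proof -
  define q where "q = a $ i0"
  define B where "B = real ((N + 1) * q) * s"
  have nonrep: "k \<le> \<lfloor>B\<rfloor>" if "\<not> representable a k" for k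
  proof (rule ccontr)
    assume "\<not> k \<le> \<lfloor>B\<rfloor>"
    then have "B \<le> real_of_int k" by linarith
    then show False using representable_of_covers[OF a c, of k] that unfolding B_def q_def by simp
  qed
  have "frobenius_number a \<le> \<lfloor>B\<rfloor>" unfolding frobenius_number_def
    using nonrep Greatest_int(1)[of "\<lambda>k. \<not> representable a k", OF not_representable_minus_1 nonrep] by blast
  then have "real_of_int (frobenius_number a) \<le> B" by linarith
  moreover have "real (\<Sum>i\<in>UNIV. a $ i) \<le> real ((N + 1) * q) * (real n + 1)"
  proof -
    have "(\<Sum>i\<in>I. a $ i) \<le> (\<Sum>i\<in>I. (N + 1) * q)"
      using a unfolding cone_vector_def q_def by (intro sum_mono) (auto simp: le_less)
    then have "(\<Sum>i\<in>UNIV. a $ i) \<le> (N + 1) * q + n * ((N + 1) * q)"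
      unfolding sum_coordinates using card_index by (simp add: q_def)
    then have "real (\<Sum>i\<in>UNIV. a $ i) \<le> real ((N + 1) * q + n * ((N + 1) * q))" by (simp only: of_nat_le_iff)
    then show ?thesis by (simp add: algebra_simps)
  qed
  ultimately show ?thesis unfolding shifted_frobenius_number_def B_def q_def by (simp add: algebra_simps)
qed

text \<open>Let k be the largest number up to N q s in an uncovered class. A representation of k
  would use more than s generators, each at least N q, and so exceed k. Passing from N q s to k
  loses less than q, which the coordinate \<open>i0\<close> restores in the shifted number.\<close>

lemma shifted_frobenius_ge:
  assumes a: "cone_vector i0 I N a" and prim: "residue_part i0 I N a \<in> primitive_residues I (a $ i0)"
    and c: "\<not> covers I (a $ i0) (residue_part i0 I N a) s"
  shows "real (N * a $ i0) * s \<le> real_of_int (shifted_frobenius_number a)"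
proof -
  define q where "q = a $ i0"
  have q: "q > 0" using a unfolding cone_vector_def q_def by simp
  \<comment> \<open>Some radius always covers. This bounds the non-representable integers, so that
    the Frobenius number is an actual maximum.\<close>
  obtain s' where s': "covers I q (residue_part i0 I N a) s'"
    using covers_of_short_pair[OF card_index(2) _ q, of "residue_part i0 I N a"] prim card_index(1) n(2) unfolding q_def by metis
  define B where "B = real ((N + 1) * q) * s'"
  have nonrep: "k \<le> \<lfloor>B\<rfloor>" if "\<not> representable a k" for k
  proof (rule ccontr)
    assume "\<not> k \<le> \<lfloor>B\<rfloor>"
    then have "B \<le> real_of_int k" by linarith
    then show False using representable_of_covers[OF a s'[unfolded q_def], of k] that unfolding B_def q_def by simp
  qed
  obtain r where r: "\<And>x. [(\<Sum>i\<in>I. int (x i) * residue_part i0 I N a i) = r] (mod int q) \<Longrightarrow> s < real (\<Sum>i\<in>I. x i)"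
    using c unfolding covers_def q_def by (meson not_le)
  define E where "E = real (N * q) * s"
  define k where "k = r + int q * \<lfloor>(E - r) / q\<rfloor>"
  have k: "real_of_int k \<le> E" "E - q < real_of_int k"
  proof -
    define t where "t = (E - r) / q"
    have E: "E = r + q * t" unfolding t_def using q by simp
    have "of_int \<lfloor>t\<rfloor> \<le> t" "t - 1 < of_int \<lfloor>t\<rfloor>" by linarith+
    then have "q * of_int \<lfloor>t\<rfloor> \<le> q * t" "q * (t - 1) < q * of_int \<lfloor>t\<rfloor>" using q by auto
    then show "real_of_int k \<le> E" "E - q < real_of_int k" unfolding k_def t_def[symmetric] E by (auto simp: algebra_simps)
  qed
  have "\<not> representable a k"
  proof
    assume "representable a k"
    then obtain x y where xy: "k = int y * int q + (\<Sum>i\<in>I. int (x i) * int (a $ i))"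
      unfolding representable_iff q_def by auto
    define S where "S = (\<Sum>i\<in>I. int (x i) * int (a $ i))"
    have "S - r = int q * (\<lfloor>(E - r) / q\<rfloor> - int y)" using xy unfolding S_def k_def by (simp add: algebra_simps)
    then have "[S = r] (mod int q)" by (simp add: cong_iff_dvd_diff)
    then have "s < real (\<Sum>i\<in>I. x i)" using sum_residue_part_cong[of x a] unfolding S_def q_def
      by (intro r[unfolded q_def]) (rule cong_trans)
    then have "E < real (N * q) * real (\<Sum>i\<in>I. x i)" unfolding E_def using q N by (intro mult_strict_left_mono) auto
    also have "\<dots> = real_of_int (\<Sum>i\<in>I. int (x i) * int (N * q))" by (simp add: sum_distrib_left sum_distrib_right mult.commute)
    also have "\<dots> \<le> real_of_int S"
      unfolding of_int_le_iff S_def q_def using a unfolding cone_vector_def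
      by (intro sum_mono mult_left_mono) (auto simp del: of_nat_mult)
    also have "\<dots> \<le> real_of_int k" unfolding of_int_le_iff using xy unfolding S_def by simp
    finally show False using k(1) by simp
  qed
  then have "k \<le> frobenius_number a" unfolding frobenius_number_def
    by (intro Greatest_int(2)[of "\<lambda>k. \<not> representable a k", OF not_representable_minus_1 nonrep])
  then have "E - q < real_of_int (frobenius_number a)" using k(2) by linarith
  moreover have "real q \<le> real (\<Sum>i\<in>UNIV. a $ i)" unfolding sum_coordinates q_def by (simp add: sum_nonneg)
  ultimately show ?thesis unfolding shifted_frobenius_number_def E_def q_def by simp
qed

lemma norm_factor_bounds:
  assumes a: "cone_vector i0 I N a"
  defines "P \<equiv> (\<Prod>i\<in>UNIV. real (a $ i)) powr (1 / (real CARD('n) - 1))"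
  defines "q \<equiv> a $ i0"
  shows "real (N * q) * real q powr (1 / n) \<le> P" "P \<le> real ((N + 1) * q) * real q powr (1 / n)" "P > 0"
proof -
  have q: "q > 0" using a unfolding cone_vector_def q_def by simp
  have d: "real CARD('n) - 1 = real n" unfolding n(1) by (simp add: of_nat_diff Suc_leI)
  have prod: "(\<Prod>i\<in>UNIV. real (a $ i)) = real q * (\<Prod>i\<in>I. real (a $ i))"
    unfolding card_index(4) q_def using card_index(2,3) by simp
  have n0: "n > 0" using n by simp
  have root: "(real q * C ^ n) powr (1 / n) = C * real q powr (1 / n)" if "C > 0" for C :: real
    using that q n0 by (simp add: powr_mult powr_realpow[symmetric] powr_powr)
  have ai: "real (N * q) \<le> real (a $ i)" "real (a $ i) \<le> real ((N + 1) * q)" if "i \<in> I" for i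
    using a that unfolding cone_vector_def q_def of_nat_le_iff by (auto simp: le_less)
  have NC: "real (N * q) > 0" "real ((N + 1) * q) > 0" using q N by (auto simp: add_pos_nonneg)
  have "real (N * q) ^ n \<le> (\<Prod>i\<in>I. real (a $ i))"
    using prod_mono[of I "\<lambda>_. real (N * q)" "\<lambda>i. real (a $ i)"] ai NC card_index by auto
  then have "(real q * real (N * q) ^ n) powr (1 / n) \<le> P"
    unfolding P_def d prod using q NC by (intro powr_mono2 mult_left_mono) auto
  then show 1: "real (N * q) * real q powr (1 / n) \<le> P" using root[OF NC(1)] by simp
  have "(\<Prod>i\<in>I. real (a $ i)) \<le> real ((N + 1) * q) ^ n"
    using prod_mono[of I "\<lambda>i. real (a $ i)" "\<lambda>_. real ((N + 1) * q)"] ai card_index by auto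
  then have "P \<le> (real q * real ((N + 1) * q) ^ n) powr (1 / n)"
    unfolding P_def d prod using q by (intro powr_mono2 mult_left_mono mult_nonneg_nonneg prod_nonneg) auto
  then show "P \<le> real ((N + 1) * q) * real q powr (1 / n)" using root[OF NC(2)] by simp
  have "0 < real (N * q) * real q powr (1 / n)" using NC q by simp
  with 1 show "P > 0" by linarith
qed

text \<open>The term (n + 1) q^(-1/n) bounds the sum of the coordinates after normalisation; (N + 1)
  / N compares the largest generator allowed by the cone with the smallest, which enters the
  normalising product.\<close>

lemma normalized_gt_imp_not_covers:
  assumes a: "cone_vector i0 I N a" and R: "R \<ge> 0" "normalized_frobenius_number a > R"
    and R': "(N + 1) / N * (R' + (real n + 1) * real (a $ i0) powr (- 1 / n)) \<le> R"
  shows "\<not> covers I (a $ i0) (residue_part i0 I N a) (R' * real (a $ i0) powr (1 / n))"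
proof
  define q where "q = a $ i0"
  define P where "P = (\<Prod>i\<in>UNIV. real (a $ i)) powr (1 / (real CARD('n) - 1))"
  define Q where "Q = real q powr (1 / n)"
  have q: "q > 0" using a unfolding cone_vector_def q_def by simp
  have Q: "Q > 0" "real q powr (- 1 / n) = 1 / Q" unfolding Q_def using q by (auto simp: powr_minus field_simps)
  assume "covers I (a $ i0) (residue_part i0 I N a) (R' * real (a $ i0) powr (1 / n))"
  from shifted_frobenius_le[OF a this] have "real_of_int (shifted_frobenius_number a) \<le> real ((N + 1) * q) * (R' * Q + real n + 1)"
    unfolding q_def Q_def .
  also have "\<dots> = ((N + 1) / N * (R' + (real n + 1) * (1 / Q))) * (real (N * q) * Q)"
    using N Q by (simp add: field_simps)
  also have "\<dots> \<le> R * (real (N * q) * Q)"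
    using R' unfolding q_def[symmetric] Q(2) using Q by (intro mult_right_mono) auto
  also have "\<dots> \<le> R * P" unfolding P_def Q_def q_def using norm_factor_bounds[OF a] R by (intro mult_left_mono) auto
  also have "R * P < real_of_int (shifted_frobenius_number a)"
    using R norm_factor_bounds(3)[OF a] unfolding normalized_frobenius_number_def P_def[symmetric] by (simp add: field_simps)
  finally show False by simp
qed

lemma not_covers_imp_normalized_gt:
  assumes a: "cone_vector i0 I N a" and prim: "residue_part i0 I N a \<in> primitive_residues I (a $ i0)"
    and R: "R \<ge> 0" "(N + 1) / N * R < R'"
    and c: "\<not> covers I (a $ i0) (residue_part i0 I N a) (R' * real (a $ i0) powr (1 / n))"
  shows "normalized_frobenius_number a > R"
proof -
  define q where "q = a $ i0"
  define P where "P = (\<Prod>i\<in>UNIV. real (a $ i)) powr (1 / (real CARD('n) - 1))"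
  define Q where "Q = real q powr (1 / n)"
  have q: "q > 0" using a unfolding cone_vector_def q_def by simp
  have Q: "Q > 0" unfolding Q_def using q by auto
  have "R * P \<le> R * (real ((N + 1) * q) * Q)"
    unfolding P_def Q_def q_def using norm_factor_bounds[OF a] R by (intro mult_left_mono) auto
  also have "\<dots> = ((N + 1) / N * R) * (real (N * q) * Q)" using N by (simp add: field_simps)
  also have "\<dots> < R' * (real (N * q) * Q)" using R Q q N by (intro mult_strict_right_mono) auto
  also have "\<dots> = real (N * q) * (R' * Q)" by simp
  also have "\<dots> \<le> real_of_int (shifted_frobenius_number a)"
    using shifted_frobenius_ge[OF a prim c] unfolding q_def Q_def .
  finally show ?thesis
    using norm_factor_bounds(3)[OF a] unfolding normalized_frobenius_number_def P_def[symmetric] by (simp add: field_simps)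
qed

text \<open>The domain is cut out by linear inequalities and hence convex, so its frontier is
  negligible.\<close>

lemma admissible_cone_domain: "admissible_domain (cone_domain i0 I N)"
  unfolding admissible_domain_def
proof (intro conjI ballI allI)
  have coord: "0 \<le> x $ i \<and> x $ i \<le> real (2 * (N + 1))" if x: "x \<in> (cone_domain i0 I N)" for x i
  proof (cases "i = i0")
    case True
    then show ?thesis using x unfolding cone_domain_def by auto
  next
    case False
    then have "i \<in> I" using mem_index by simp
    then have b: "real N * x $ i0 \<le> x $ i" "x $ i < real (N + 1) * x $ i0" "1 < x $ i0" "x $ i0 \<le> 2"
      using x unfolding cone_domain_def by auto
    have "0 \<le> real N * x $ i0" using b by simp
    then have "0 \<le> x $ i" using b(1) by (rule order.trans)
    moreover have "real (N + 1) * x $ i0 \<le> real (N + 1) * 2" using b by (intro mult_left_mono) auto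
    then have "x $ i \<le> real (N + 1) * 2" using b(2) by linarith
    ultimately show ?thesis by simp
  qed
  then show "0 \<le> x $ i" if "x \<in> (cone_domain i0 I N)" for x i using that by blast
  have "(cone_domain i0 I N) \<subseteq> cbox 0 (\<chi> i. real (2 * (N + 1)))" using coord by (auto simp: mem_box_cart)
  then show "bounded (cone_domain i0 I N)" by (rule bounded_subset[OF bounded_cbox])
  have lin: "linear (\<lambda>x::real ^ 'n. x $ i - c * x $ j)" for i j c
    by (auto simp: linear_iff algebra_simps)
  have lin0: "linear (\<lambda>x::real ^ 'n. x $ i)" for i by (auto simp: linear_iff)
  have eq: "(cone_domain i0 I N) = (\<lambda>x. x $ i0) -` {1<..2} \<inter> (\<Inter>i\<in>I. (\<lambda>x. x $ i - real N * x $ i0) -` {0..} \<inter> (\<lambda>x. x $ i - real (N + 1) * x $ i0) -` {..<0})"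
    unfolding cone_domain_def by auto
  have "convex (cone_domain i0 I N)" unfolding eq
    by (intro convex_Int convex_INT convex_linear_vimage lin lin0) auto
  then show "negligible (frontier (cone_domain i0 I N))" by (rule negligible_convex_frontier)
  define U :: "(real ^ 'n) set" where "U = {x. 1 < x $ i0 \<and> x $ i0 < 2} \<inter> (\<Inter>i\<in>I. {x. real N * x $ i0 < x $ i} \<inter> {x. x $ i < real (N + 1) * x $ i0})"
  have "open U" unfolding U_def
    by (intro open_Int open_INT ballI open_Collect_conj open_Collect_less continuous_intros) auto
  moreover have "U \<subseteq> (cone_domain i0 I N)" unfolding U_def cone_domain_def by (auto intro: less_imp_le)
  moreover have "(\<chi> i. if i = i0 then 3/2 else (real N + 1/2) * (3/2)) \<in> U"
    using card_index(3) unfolding U_def by (auto simp: field_simps)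
  ultimately show "interior (cone_domain i0 I N) \<noteq> {}" by (metis empty_iff interior_maximal subsetD)
qed

lemma mem_scaled_cone_domain:
  assumes "T > 0"
  shows "(\<chi> i. real (a $ i)) \<in> (*\<^sub>R) T ` (cone_domain i0 I N) \<longleftrightarrow> T < real (a $ i0) \<and> real (a $ i0) \<le> 2 * T \<and> cone_vector i0 I N a"
proof -
  have "(\<chi> i. real (a $ i)) \<in> (*\<^sub>R) T ` (cone_domain i0 I N) \<longleftrightarrow> (1 / T) *\<^sub>R (\<chi> i. real (a $ i)) \<in> (cone_domain i0 I N)"
  proof
    assume "(\<chi> i. real (a $ i)) \<in> (*\<^sub>R) T ` (cone_domain i0 I N)"
    then show "(1 / T) *\<^sub>R (\<chi> i. real (a $ i)) \<in> (cone_domain i0 I N)" using assms by auto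
  next
    assume "(1 / T) *\<^sub>R (\<chi> i. real (a $ i)) \<in> (cone_domain i0 I N)"
    moreover have "(\<chi> i. real (a $ i)) = T *\<^sub>R ((1 / T) *\<^sub>R (\<chi> i. real (a $ i)))" using assms by simp
    ultimately show "(\<chi> i. real (a $ i)) \<in> (*\<^sub>R) T ` (cone_domain i0 I N)" by (metis imageI)
  qed
  also have "\<dots> \<longleftrightarrow> (T < real (a $ i0) \<and> real (a $ i0) \<le> 2 * T) \<and>
      (\<forall>i\<in>I. real (N * a $ i0) \<le> real (a $ i) \<and> real (a $ i) < real ((N + 1) * a $ i0))"
    unfolding cone_domain_def using assms by (auto simp: field_simps)
  also have "\<dots> \<longleftrightarrow> T < real (a $ i0) \<and> real (a $ i0) \<le> 2 * T \<and> cone_vector i0 I N a"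
    unfolding cone_vector_def of_nat_le_iff of_nat_less_iff using assms by (auto intro: Nat.gr0I)
  finally show ?thesis .
qed

lemma finite_modulus_range: "finite (modulus_range T)"
proof (rule finite_subset)
  show "modulus_range T \<subseteq> {..nat \<lfloor>2 * T\<rfloor>}"
    unfolding modulus_range_def by (auto simp: le_nat_floor)
qed simp

lemma primitive_iff_residue_part:
  assumes "cone_vector i0 I N a"
  shows "a \<in> primitive_vectors \<longleftrightarrow> residue_part i0 I N a \<in> primitive_residues I (a $ i0)"
proof -
  have pos: "a $ i > 0" for i
  proof (cases "i = i0")
    case False
    then have "N * a $ i0 \<le> a $ i" "0 < a $ i0" using assms mem_index unfolding cone_vector_def by auto
    then show ?thesis using N by (metis less_le_trans mult_pos_pos less_eq_Suc_le One_nat_def)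
  qed (use assms in \<open>auto simp: cone_vector_def\<close>)
  have rv: "residue_part i0 I N a \<in> residue_vectors I (a $ i0)"
    using assms unfolding residue_part_def residue_vectors_def cone_vector_def
    by (auto simp: algebra_simps simp flip: of_nat_mult of_nat_add)
  have "a \<in> primitive_vectors \<longleftrightarrow> Gcd (range (($) a)) = 1" unfolding primitive_vectors_def using pos by auto
  also have "\<dots> \<longleftrightarrow> (\<forall>e. (\<forall>i. e dvd a $ i) \<longrightarrow> e = 1)"
  proof
    assume "Gcd (range (($) a)) = 1"
    then show "\<forall>e. (\<forall>i. e dvd a $ i) \<longrightarrow> e = 1" by (metis Gcd_greatest nat_dvd_1_iff_1 rangeE)
  next
    assume "\<forall>e. (\<forall>i. e dvd a $ i) \<longrightarrow> e = 1"
    then show "Gcd (range (($) a)) = 1" by (metis Gcd_dvd rangeI)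
  qed
  finally have prim: "a \<in> primitive_vectors \<longleftrightarrow> (\<forall>e. (\<forall>i. e dvd a $ i) \<longrightarrow> e = 1)" .
  have "(\<forall>i. e dvd a $ i) \<longleftrightarrow> e dvd a $ i0 \<and> (\<forall>i\<in>I. int e dvd residue_part i0 I N a i)" for e
  proof -
    have "int e dvd residue_part i0 I N a i \<longleftrightarrow> e dvd a $ i" if "e dvd a $ i0" "i \<in> I" for i
    proof -
      have "int e dvd int N * int (a $ i0)" using that by simp
      then have "int e dvd int (a $ i) - int N * int (a $ i0) \<longleftrightarrow> int e dvd int (a $ i)"
        by (metis diff_add_cancel dvd_add dvd_diff)
      then show ?thesis using that unfolding residue_part_def by simp
    qed
    then show ?thesis by (metis mem_index)
  qed
  then show ?thesis unfolding prim primitive_residues_def using rv by auto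
qed

lemma bij_betw_residue_part:
  assumes "T > 0"
  shows "bij_betw (\<lambda>a. (a $ i0, residue_part i0 I N a)) (primitive_vectors_in ((*\<^sub>R) T ` (cone_domain i0 I N)))
     (Sigma (modulus_range T) (primitive_residues I))"
proof (rule bij_betw_byWitness[where f' = "\<lambda>(q, r). \<chi> i. if i = i0 then q else nat (int N * int q + r i)"])
  have mem: "a \<in> primitive_vectors_in ((*\<^sub>R) T ` (cone_domain i0 I N)) \<longleftrightarrow>
      a $ i0 \<in> modulus_range T \<and> cone_vector i0 I N a \<and> residue_part i0 I N a \<in> primitive_residues I (a $ i0)" for a
    unfolding primitive_vectors_in_def using mem_scaled_cone_domain[OF assms, of a] primitive_iff_residue_part
    by (auto simp: modulus_range_def)
  show "\<forall>a\<in>primitive_vectors_in ((*\<^sub>R) T ` (cone_domain i0 I N)).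
       (\<lambda>(q, r). \<chi> i. if i = i0 then q else nat (int N * int q + r i)) (a $ i0, residue_part i0 I N a) = a"
    by (auto simp: vec_eq_iff residue_part_def mem_index)
  have inv: "cone_vector i0 I N b" "b $ i0 = q" "residue_part i0 I N b = r"
    if "q > 0" "r \<in> residue_vectors I q" "b = (\<chi> i. if i = i0 then q else nat (int N * int q + r i))" for q r b
  proof -
    have r: "0 \<le> r i" "r i < int q" if "i \<in> I" for i using that \<open>r \<in> _\<close> unfolding residue_vectors_def by auto
    have bi: "int (b $ i) = int N * int q + r i" if "i \<in> I" for i
      using that r card_index(3) unfolding \<open>b = _\<close> by auto
    show b0: "b $ i0 = q" unfolding \<open>b = _\<close> by simp
    have "N * q \<le> b $ i \<and> b $ i < (N + 1) * q" if "i \<in> I" for i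
      using bi[OF that] r[OF that] by (simp add: algebra_simps flip: of_nat_less_iff[where 'a=int] of_nat_le_iff[where 'a=int])
    then show "cone_vector i0 I N b" unfolding cone_vector_def b0 using \<open>q > 0\<close> by blast
    show "residue_part i0 I N b = r"
    proof (rule extensionalityI[of _ I])
      show "residue_part i0 I N b \<in> extensional I" unfolding residue_part_def by simp
      show "r \<in> extensional I" using \<open>r \<in> _\<close> unfolding residue_vectors_def by (auto simp: PiE_def)
      show "residue_part i0 I N b i = r i" if "i \<in> I" for i using bi[OF that] that b0 unfolding residue_part_def by simp
    qed
  qed
  have pos: "q > 0" if "q \<in> modulus_range T" for q using that assms unfolding modulus_range_def by (auto intro: Nat.gr0I)
  show "\<forall>z\<in>Sigma (modulus_range T) (primitive_residues I).
      (\<lambda>a. (a $ i0, residue_part i0 I N a)) ((\<lambda>(q, r). \<chi> i. if i = i0 then q else nat (int N * int q + r i)) z) = z"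
  proof
    fix z assume "z \<in> Sigma (modulus_range T) (primitive_residues I)"
    then obtain q r where z: "z = (q, r)" "q \<in> modulus_range T" "r \<in> primitive_residues I q" by auto
    have "r \<in> residue_vectors I q" using z(3) primitive_residues_subset by blast
    from inv(2,3)[OF pos[OF z(2)] this refl]
    show "(\<lambda>a. (a $ i0, residue_part i0 I N a)) ((\<lambda>(q, r). \<chi> i. if i = i0 then q else nat (int N * int q + r i)) z) = z"
      unfolding z(1) by (simp only: split)
  qed
  show "(\<lambda>a. (a $ i0, residue_part i0 I N a)) ` primitive_vectors_in ((*\<^sub>R) T ` (cone_domain i0 I N)) \<subseteq> Sigma (modulus_range T) (primitive_residues I)"
    using mem by auto
  show "(\<lambda>(q, r). \<chi> i. if i = i0 then q else nat (int N * int q + r i)) ` Sigma (modulus_range T) (primitive_residues I) \<subseteq>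
      primitive_vectors_in ((*\<^sub>R) T ` (cone_domain i0 I N))"
  proof
    fix b :: "nat ^ 'n" assume "b \<in> (\<lambda>(q, r). \<chi> i. if i = i0 then q else nat (int N * int q + r i)) ` Sigma (modulus_range T) (primitive_residues I)"
    then obtain q r where qr: "q \<in> modulus_range T" "r \<in> primitive_residues I q" "b = (\<chi> i. if i = i0 then q else nat (int N * int q + r i))" by auto
    have rv: "r \<in> residue_vectors I q" using qr(2) primitive_residues_subset by blast
    show "b \<in> primitive_vectors_in ((*\<^sub>R) T ` (cone_domain i0 I N))"
      unfolding mem using inv[OF pos[OF qr(1)] rv qr(3)] qr(1,2) by simp
  qed
qed

lemma card_primitive_vectors_in_cone:
  assumes "T > 0"
  shows "finite (primitive_vectors_in ((*\<^sub>R) T ` (cone_domain i0 I N)))"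
    and "card (primitive_vectors_in ((*\<^sub>R) T ` (cone_domain i0 I N))) = (\<Sum>q\<in>modulus_range T. card (primitive_residues I q))"
proof -
  note fin = finite_modulus_range[of T] finite_primitive_residues[OF card_index(2)]
  then have "finite (Sigma (modulus_range T) (primitive_residues I))" by auto
  then show "finite (primitive_vectors_in ((*\<^sub>R) T ` (cone_domain i0 I N)))"
    using bij_betw_finite[OF bij_betw_residue_part[OF assms]] by blast
  show "card (primitive_vectors_in ((*\<^sub>R) T ` (cone_domain i0 I N))) = (\<Sum>q\<in>modulus_range T. card (primitive_residues I q))"
    using bij_betw_same_card[OF bij_betw_residue_part[OF assms]] fin by (simp add: card_SigmaI)
qed

lemma card_event_bounds:
  assumes T: "T > 0" and fin: "\<And>q. finite (W q)" and W: "\<And>q. W q \<subseteq> primitive_residues I q"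
  defines "A \<equiv> primitive_vectors_in ((*\<^sub>R) T ` (cone_domain i0 I N))"
  shows "(\<And>a. a \<in> A \<Longrightarrow> cone_vector i0 I N a \<Longrightarrow> a $ i0 \<in> modulus_range T \<Longrightarrow> residue_part i0 I N a \<in> primitive_residues I (a $ i0) \<Longrightarrow>
        Q a \<Longrightarrow> residue_part i0 I N a \<in> W (a $ i0)) \<Longrightarrow> card {a \<in> A. Q a} \<le> (\<Sum>q\<in>modulus_range T. card (W q))"
    and "(\<And>a. a \<in> A \<Longrightarrow> cone_vector i0 I N a \<Longrightarrow> a $ i0 \<in> modulus_range T \<Longrightarrow> residue_part i0 I N a \<in> primitive_residues I (a $ i0) \<Longrightarrow>
        residue_part i0 I N a \<in> W (a $ i0) \<Longrightarrow> Q a) \<Longrightarrow> (\<Sum>q\<in>modulus_range T. card (W q)) \<le> card {a \<in> A. Q a}"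
proof -
  let ?f = "\<lambda>a. (a $ i0, residue_part i0 I N a)"
  have bij: "bij_betw ?f A (Sigma (modulus_range T) (primitive_residues I))"
    unfolding A_def by (rule bij_betw_residue_part[OF T])
  have finA: "finite A" unfolding A_def using card_primitive_vectors_in_cone[OF T] by simp
  have memA: "cone_vector i0 I N a" "a $ i0 \<in> modulus_range T" "residue_part i0 I N a \<in> primitive_residues I (a $ i0)" if "a \<in> A" for a
    using that bij_betwE[OF bij] mem_scaled_cone_domain[OF T, of a] unfolding A_def primitive_vectors_in_def by auto
  have finS: "finite (Sigma (modulus_range T) W)" using finite_modulus_range fin by auto
  have cS: "card (Sigma (modulus_range T) W) = (\<Sum>q\<in>modulus_range T. card (W q))"
    using finite_modulus_range fin by (simp add: card_SigmaI)
  { assume "\<And>a. a \<in> A \<Longrightarrow> cone_vector i0 I N a \<Longrightarrow> a $ i0 \<in> modulus_range T \<Longrightarrow> residue_part i0 I N a \<in> primitive_residues I (a $ i0) \<Longrightarrow>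
        Q a \<Longrightarrow> residue_part i0 I N a \<in> W (a $ i0)"
    then have "?f ` {a \<in> A. Q a} \<subseteq> Sigma (modulus_range T) W" using memA by auto
    then show "card {a \<in> A. Q a} \<le> (\<Sum>q\<in>modulus_range T. card (W q))"
      unfolding cS[symmetric] using bij finS by (intro card_inj_on_le[of ?f]) (auto simp: bij_betw_def inj_on_def) }
  { assume *: "\<And>a. a \<in> A \<Longrightarrow> cone_vector i0 I N a \<Longrightarrow> a $ i0 \<in> modulus_range T \<Longrightarrow> residue_part i0 I N a \<in> primitive_residues I (a $ i0) \<Longrightarrow>
        residue_part i0 I N a \<in> W (a $ i0) \<Longrightarrow> Q a"
    have "Sigma (modulus_range T) W \<subseteq> ?f ` {a \<in> A. Q a}"
    proof
      fix z assume z: "z \<in> Sigma (modulus_range T) W"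
      then have "z \<in> ?f ` A" using W bij unfolding bij_betw_def by auto
      then obtain a where a: "a \<in> A" "z = ?f a" by auto
      then have "Q a" using z by (intro *[OF a(1) memA[OF a(1)]]) auto
      then show "z \<in> ?f ` {a \<in> A. Q a}" using a by auto
    qed
    then show "(\<Sum>q\<in>modulus_range T. card (W q)) \<le> card {a \<in> A. Q a}"
      unfolding cS[symmetric] using finA by (intro surj_card_le) auto }
qed

lemma primitive_vectors_in_cone_nonempty:
  assumes "T \<ge> 1" shows "0 < (\<Sum>q\<in>modulus_range T. card (primitive_residues I q))"
proof -
  define q where "q = nat \<lfloor>2 * T\<rfloor>"
  have q: "real q \<le> 2 * T" "2 * T < real q + 1" "q \<ge> 2"
    using assms unfolding q_def by (auto simp: le_nat_floor le_floor_iff)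
  then have "q \<in> modulus_range T" unfolding modulus_range_def using assms by auto
  moreover have "restrict (\<lambda>_. 1) I \<in> primitive_residues I q"
    unfolding primitive_residues_def residue_vectors_def using q card_index n by (auto simp: card_gt_0_iff[symmetric])
  then have "card (primitive_residues I q) > 0"
    using finite_primitive_residues[OF card_index(2)] by (auto simp: card_gt_0_iff)
  ultimately show ?thesis using finite_modulus_range by (intro sum_pos2[of _ q]) auto
qed

end

text \<open>On the cone domain the quotient dominates a weighted average, over q in (T, 2 T], of the
  proportions of uncovered residue vectors; N is taken so large that (N + 1) / N fits into the gap
  between R and R'.\<close>

lemma frobenius_tail_ge:
  fixes i0 :: "'n::finite" and \<kappa> :: real
  assumes tail: "is_frobenius_tail TYPE('n) \<Psi>" and d: "CARD('n) \<ge> 3"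
    and R: "0 < R" "R < R'"
    and ev: "\<forall>\<^sub>F q in sequentially. \<kappa> * real (card (primitive_residues (UNIV - {i0}) q)) \<le> real (card (uncovered (UNIV - {i0}) q R'))"
  shows "\<kappa> \<le> \<Psi> R"
proof -
  define I n where "I = UNIV - {i0}" and "n = CARD('n) - 1"
  have n2: "n \<ge> 2" using d unfolding n_def by simp
  have cI: "card I = n" unfolding I_def n_def by simp
  define N where "N = nat \<lceil>R / (R' - R)\<rceil> + 1"
  have N: "N \<ge> 1" "(real N + 1) / N * R < R'"
  proof -
    show "N \<ge> 1" unfolding N_def by simp
    have "R / (R' - R) < real N" unfolding N_def by linarith
    then have "R < real N * (R' - R)" using R by (simp add: field_simps)
    then show "(real N + 1) / N * R < R'" using \<open>N \<ge> 1\<close> by (simp add: field_simps)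
  qed
  note ctx = I_def n_def n2 N(1)
  define D where "D = cone_domain i0 I N"
  define F where "F = (\<lambda>T :: real.
            real (card {a \<in> primitive_vectors_in ((*\<^sub>R) T ` D). normalized_frobenius_number a > R}) /
            real (card (primitive_vectors_in ((*\<^sub>R) T ` D))))"
  have "admissible_domain D" unfolding D_def by (rule admissible_cone_domain[OF ctx])
  then have lim: "(F \<longlongrightarrow> \<Psi> R) at_top" unfolding F_def using tail R unfolding is_frobenius_tail_def by auto
  obtain q0 where q0: "\<And>q. q \<ge> q0 \<Longrightarrow> \<kappa> * real (card (primitive_residues I q)) \<le> real (card (uncovered I q R'))"
    using ev unfolding eventually_sequentially I_def by blast
  have "\<forall>\<^sub>F T in at_top. \<kappa> \<le> F T"
    using eventually_ge_at_top[of "max 1 (real q0)"]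
  proof eventually_elim
    case (elim T)
    then have T: "T > 0" "T \<ge> 1" "T \<ge> real q0" by auto
    define A where "A = primitive_vectors_in ((*\<^sub>R) T ` D)"
    have cA: "card A = (\<Sum>q\<in>modulus_range T. card (primitive_residues I q))"
      unfolding A_def D_def by (rule card_primitive_vectors_in_cone(2)[OF ctx T(1)])
    have "card A > 0" unfolding cA using primitive_vectors_in_cone_nonempty[OF ctx T(2)] by simp
    then have "real (card A) > 0" by simp
    have "(\<Sum>q\<in>modulus_range T. card (uncovered I q R')) \<le> card {a \<in> A. normalized_frobenius_number a > R}"
      unfolding A_def D_def
    proof (rule card_event_bounds(2)[OF ctx T(1), where W = "\<lambda>q. uncovered I q R'"])
      show "finite (uncovered I q R')" "uncovered I q R' \<subseteq> primitive_residues I q" for q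
        using finite_primitive_residues[of I q] unfolding uncovered_def I_def by auto
      fix a assume a: "cone_vector i0 I N a" "residue_part i0 I N a \<in> primitive_residues I (a $ i0)"
        "residue_part i0 I N a \<in> uncovered I (a $ i0) R'"
      then show "R < normalized_frobenius_number a"
        using not_covers_imp_normalized_gt[OF ctx a(1,2), of R R'] R N(2) cI
        unfolding uncovered_def by (auto simp: add.commute)
    qed
    moreover have "\<kappa> * real (card A) \<le> real (\<Sum>q\<in>modulus_range T. card (uncovered I q R'))"
      unfolding cA of_nat_sum sum_distrib_left
    proof (intro sum_mono q0)
      fix q assume "q \<in> modulus_range T"
      then show "q0 \<le> q" using T unfolding modulus_range_def by auto
    qed
    ultimately have "\<kappa> * real (card A) \<le> real (card {a \<in> A. normalized_frobenius_number a > R})" by linarith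
    then show ?case unfolding F_def A_def[symmetric] using \<open>real (card A) > 0\<close> by (simp add: field_simps)
  qed
  then show ?thesis by (intro tendsto_lowerbound[OF lim]) auto
qed

text \<open>Besides the factor (N + 1) / N, the normalised sum of the coordinates must fit into the
  gap between R' and R. It has order q^(-1/n), so this holds for large q.\<close>

lemma frobenius_tail_le:
  fixes i0 :: "'n::finite" and \<kappa> :: real
  assumes tail: "is_frobenius_tail TYPE('n) \<Psi>" and d: "CARD('n) \<ge> 3"
    and R: "0 < R'" "R' < R"
    and ev: "\<forall>\<^sub>F q in sequentially. real (card (uncovered (UNIV - {i0}) q R')) \<le> \<kappa> * real (card (primitive_residues (UNIV - {i0}) q))"
  shows "\<Psi> R \<le> \<kappa>"
proof -
  define I n where "I = UNIV - {i0}" and "n = CARD('n) - 1"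
  have n2: "n \<ge> 2" using d unfolding n_def by simp
  have cI: "card I = n" unfolding I_def n_def by simp
  define N where "N = nat \<lceil>R' / (R - R')\<rceil> + 1"
  have N: "N \<ge> 1" "(real N + 1) / N * R' < R"
  proof -
    show "N \<ge> 1" unfolding N_def by simp
    have "R' / (R - R') < real N" unfolding N_def by linarith
    then have "R' < real N * (R - R')" using R by (simp add: field_simps)
    then show "(real N + 1) / N * R' < R" using \<open>N \<ge> 1\<close> by (simp add: field_simps)
  qed
  note ctx = I_def n_def n2 N(1)
  define D where "D = cone_domain i0 I N"
  define F where "F = (\<lambda>T :: real.
            real (card {a \<in> primitive_vectors_in ((*\<^sub>R) T ` D). normalized_frobenius_number a > R}) /
            real (card (primitive_vectors_in ((*\<^sub>R) T ` D))))"
  have "admissible_domain D" unfolding D_def by (rule admissible_cone_domain[OF ctx])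
  then have lim: "(F \<longlongrightarrow> \<Psi> R) at_top" unfolding F_def using tail R unfolding is_frobenius_tail_def by auto
  have "(\<lambda>q::nat. (real N + 1) / N * (R' + (real n + 1) * real q powr (- 1 / n))) \<longlonglongrightarrow> (real N + 1) / N * (R' + (real n + 1) * 0)"
  proof -
    have "(\<lambda>q::nat. real q powr (- 1 / real n)) \<longlonglongrightarrow> 0" using n2 by real_asymp
    then show ?thesis by (intro tendsto_intros)
  qed
  then have "\<forall>\<^sub>F q::nat in sequentially. (real N + 1) / N * (R' + (real n + 1) * real q powr (- 1 / n)) < R"
    using N(2) by (intro order_tendstoD(2)) auto
  then obtain q1 where q1: "\<And>q. q \<ge> q1 \<Longrightarrow> (real N + 1) / N * (R' + (real n + 1) * real q powr (- 1 / n)) < R"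
    unfolding eventually_sequentially by blast
  obtain q0 where q0: "\<And>q. q \<ge> q0 \<Longrightarrow> real (card (uncovered I q R')) \<le> \<kappa> * real (card (primitive_residues I q))"
    using ev unfolding eventually_sequentially I_def by blast
  have "\<forall>\<^sub>F T in at_top. F T \<le> \<kappa>"
    using eventually_ge_at_top[of "max 1 (max (real q0) (real q1))"]
  proof eventually_elim
    case (elim T)
    then have T: "T > 0" "T \<ge> 1" "T \<ge> real q0" "T \<ge> real q1" by auto
    define A where "A = primitive_vectors_in ((*\<^sub>R) T ` D)"
    have cA: "card A = (\<Sum>q\<in>modulus_range T. card (primitive_residues I q))"
      unfolding A_def D_def by (rule card_primitive_vectors_in_cone(2)[OF ctx T(1)])
    have "card A > 0" unfolding cA using primitive_vectors_in_cone_nonempty[OF ctx T(2)] by simp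
    then have "real (card A) > 0" by simp
    have "card {a \<in> A. normalized_frobenius_number a > R} \<le> (\<Sum>q\<in>modulus_range T. card (uncovered I q R'))"
      unfolding A_def D_def
    proof (rule card_event_bounds(1)[OF ctx T(1), where W = "\<lambda>q. uncovered I q R'"])
      show "finite (uncovered I q R')" "uncovered I q R' \<subseteq> primitive_residues I q" for q
        using finite_primitive_residues[of I q] unfolding uncovered_def I_def by auto
      fix a assume a: "cone_vector i0 I N a" "residue_part i0 I N a \<in> primitive_residues I (a $ i0)"
        "a $ i0 \<in> modulus_range T" "R < normalized_frobenius_number a"
      have "q1 \<le> a $ i0" using a(3) T unfolding modulus_range_def by auto
      then show "residue_part i0 I N a \<in> uncovered I (a $ i0) R'"
        using normalized_gt_imp_not_covers[OF ctx a(1) _ a(4), of R'] R q1[of "a $ i0"] cI a(2) unfolding uncovered_def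
        by (auto simp: add.commute)
    qed
    moreover have "real (\<Sum>q\<in>modulus_range T. card (uncovered I q R')) \<le> \<kappa> * real (card A)"
      unfolding cA of_nat_sum sum_distrib_left
    proof (intro sum_mono q0)
      fix q assume "q \<in> modulus_range T"
      then show "q0 \<le> q" using T unfolding modulus_range_def by auto
    qed
    ultimately have "real (card {a \<in> A. normalized_frobenius_number a > R}) \<le> \<kappa> * real (card A)" by linarith
    then show ?case unfolding F_def A_def[symmetric] using \<open>real (card A) > 0\<close> by (simp add: field_simps)
  qed
  then show ?thesis by (intro tendsto_upperbound[OF lim]) auto
qed

section \<open>Bounds at a fixed radius\<close>

text \<open>The sum over divisors is at least 1 minus the sum of 1 / e^2 over e >= 2, and
  telescoping bounds the latter by 3/4. This turns errors relative to q^n into errors relative to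
  the number of primitive residues.\<close>

lemma card_primitive_residues_ge:
  assumes fin: "finite I" and n: "card I \<ge> 2" and q: "q > 0"
  shows "real q ^ card I / 4 \<le> real (card (primitive_residues I q))"
proof -
  have tail: "(\<Sum>e\<in>{2..m}. 1 / (real e)\<^sup>2) \<le> 3/4 - 1 / real m" if "m \<ge> 2" for m
    using that
  proof (induction m rule: nat_induct_at_least)
    case base show ?case by (simp add: power2_eq_square)
  next
    case (Suc m)
    have "1 / (real (Suc m))\<^sup>2 \<le> 1 / real m - 1 / real (Suc m)"
    proof -
      have "1 / (real (Suc m))\<^sup>2 \<le> 1 / (real m * real (Suc m))"
        unfolding power2_eq_square using Suc.hyps by (intro divide_left_mono mult_right_mono) auto
      also have "\<dots> = 1 / real m - 1 / real (Suc m)" using Suc.hyps by (simp add: field_simps)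
      finally show ?thesis .
    qed
    then show ?case using Suc by simp
  qed
  have term_le: "\<bar>moebius_mu e / real e ^ card I\<bar> \<le> 1 / (real e)\<^sup>2" if "e \<ge> 2" for e
  proof -
    have "\<bar>moebius_mu e / real e ^ card I\<bar> \<le> 1 / real e ^ card I"
      unfolding abs_divide using abs_moebius_mu_le[of e] by (simp add: divide_right_mono)
    also have "\<dots> \<le> 1 / (real e)\<^sup>2" using that n by (intro divide_left_mono power_increasing) auto
    finally show ?thesis .
  qed
  have finD: "finite {e. e dvd q}" using q by simp
  have one: "moebius_mu 1 = 1" by (simp add: moebius_mu_def)
  have "(\<Sum>e | e dvd q. moebius_mu e / real e ^ card I) = 1 + (\<Sum>e\<in>{e. e dvd q} - {1}. moebius_mu e / real e ^ card I)"
    using finD one by (subst sum.remove[of _ 1]) auto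
  moreover have "\<bar>\<Sum>e\<in>{e. e dvd q} - {1}. moebius_mu e / real e ^ card I\<bar> \<le> 3/4"
  proof -
    have sub: "{e. e dvd q} - {1} \<subseteq> {2..q}"
    proof
      fix e assume e: "e \<in> {e. e dvd q} - {1}"
      then have "e \<noteq> 0" "e \<le> q" using q by (auto simp: dvd_imp_le)
      then show "e \<in> {2..q}" using e by auto
    qed
    have "\<bar>\<Sum>e\<in>{e. e dvd q} - {1}. moebius_mu e / real e ^ card I\<bar> \<le> (\<Sum>e\<in>{e. e dvd q} - {1}. 1 / (real e)\<^sup>2)"
      using sub by (intro order.trans[OF sum_abs] sum_mono term_le) auto
    also have "\<dots> \<le> (\<Sum>e\<in>{2..q}. 1 / (real e)\<^sup>2)" using sub by (intro sum_mono2) auto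
    also have "\<dots> \<le> 3/4"
    proof (cases "q \<ge> 2")
      case True then show ?thesis using tail[OF True] by (smt (verit) divide_nonneg_nonneg of_nat_0_le_iff)
    qed simp
    finally show ?thesis .
  qed
  ultimately have "1/4 \<le> (\<Sum>e | e dvd q. moebius_mu e / real e ^ card I)" by linarith
  then have "real q ^ card I * (1/4) \<le> real q ^ card I * (\<Sum>e | e dvd q. moebius_mu e / real e ^ card I)"
    by (intro mult_left_mono) auto
  then show ?thesis unfolding card_primitive_residues[OF fin q] by simp
qed

text \<open>The power bound holds at every scale because the vector 0 is excluded: for \<rho> y < 1
  the set is empty, and otherwise 2 k + 1 <= 3 k for k the floor of \<rho> y.\<close>

lemma scaled_points_bounded:
  fixes \<rho> y :: real
  assumes fin: "finite I" and \<rho>: "\<rho> > 0" and y: "y > 0"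
    and S: "\<And>w i. w \<in> S \<Longrightarrow> i \<in> I \<Longrightarrow> \<bar>w i\<bar> \<le> \<rho>"
  shows "finite (scaled_points I S y)" "real (card (scaled_points I S y)) \<le> (3 * \<rho>) ^ card I * y ^ card I"
    and "b \<in> scaled_points I S y \<Longrightarrow> i \<in> I \<Longrightarrow> \<bar>real_of_int (b i)\<bar> \<le> \<rho> * y"
proof -
  show le: "\<bar>real_of_int (b i)\<bar> \<le> \<rho> * y" if "b \<in> scaled_points I S y" "i \<in> I" for b i
  proof -
    have "\<bar>(\<lambda>i\<in>I. real_of_int (b i) / y) i\<bar> \<le> \<rho>" using that S unfolding scaled_points_def by blast
    then show ?thesis using that y by (simp add: field_simps)
  qed
  define k where "k = \<lfloor>\<rho> * y\<rfloor>"
  have k: "k \<ge> 0" "real_of_int k \<le> \<rho> * y" unfolding k_def using \<rho> y by auto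
  have sub: "scaled_points I S y \<subseteq> I \<rightarrow>\<^sub>E {-k..k}"
  proof
    fix b assume b: "b \<in> scaled_points I S y"
    have "-k \<le> b i \<and> b i \<le> k" if "i \<in> I" for i using le[OF b that] unfolding k_def by linarith
    then show "b \<in> I \<rightarrow>\<^sub>E {-k..k}" using b unfolding scaled_points_def by (auto simp: PiE_def)
  qed
  have finP: "finite (I \<rightarrow>\<^sub>E {-k..k})" using fin by (intro finite_PiE) auto
  then show "finite (scaled_points I S y)" using sub finite_subset by blast
  show "real (card (scaled_points I S y)) \<le> (3 * \<rho>) ^ card I * y ^ card I"
  proof (cases "k = 0")
    case True
    have "scaled_points I S y = {}"
      using sub True unfolding scaled_points_def by (fastforce simp: PiE_def Pi_def)
    then show ?thesis using \<rho> y by simp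
  next
    case False
    then have k1: "k \<ge> 1" using k by simp
    have "card (scaled_points I S y) \<le> card (I \<rightarrow>\<^sub>E {-k..k})" using sub finP by (rule card_mono[rotated])
    also have "\<dots> = nat (2 * k + 1) ^ card I" using fin by (simp add: card_funcsetE)
    finally have "real (card (scaled_points I S y)) \<le> real (nat (2 * k + 1) ^ card I)" by (simp only: of_nat_le_iff)
    also have "\<dots> = (2 * real_of_int k + 1) ^ card I" using k by simp
    also have "\<dots> \<le> (3 * \<rho> * y) ^ card I" using k k1 by (intro power_mono) auto
    finally show ?thesis by (simp add: power_mult_distrib)
  qed
qed

lemma first_moment_bounded:
  fixes \<rho> V \<epsilon> :: real
  assumes fin: "finite I" and n: "card I = n" "n \<ge> 2" and \<rho>: "\<rho> > 0"
    and S: "\<And>w i. w \<in> S \<Longrightarrow> i \<in> I \<Longrightarrow> \<bar>w i\<bar> \<le> \<rho>"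
    and lim: "((\<lambda>y. real (card (scaled_points I S y)) / y ^ n) \<longlongrightarrow> V) at_top" and \<epsilon>: "\<epsilon> > 0"
  shows "\<forall>\<^sub>F q in sequentially.
    \<bar>(\<Sum>a\<in>primitive_residues I q. real (card (primitive_multiples I q a \<inter> scaled_points I S (lattice_scale n q))))
       - V / zeta (real n) * real (card (primitive_residues I q))\<bar> \<le> \<epsilon> * real (card (primitive_residues I q))"
proof -
  have bd: "finite (scaled_points I S y)" "real (card (scaled_points I S y)) \<le> (3 * \<rho>) ^ card I * y ^ card I"
    if "y > 0" for y
    using scaled_points_bounded(1,2)[OF fin \<rho> that, of S] S by blast+
  have "(\<lambda>q. ((\<Sum>a\<in>primitive_residues I q. real (card (primitive_multiples I q a \<inter> scaled_points I S (lattice_scale n q))))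
       - V / zeta (real n) * real (card (primitive_residues I q))) / real q ^ n) \<longlonglongrightarrow> 0"
    by (rule first_moment[OF fin n, of "(3 * \<rho>) ^ n"]) (use bd(1,2) lim \<rho> n(1) in auto)
  then have "\<forall>\<^sub>F q in sequentially. dist (((\<Sum>a\<in>primitive_residues I q. real (card (primitive_multiples I q a \<inter> scaled_points I S (lattice_scale n q))))
       - V / zeta (real n) * real (card (primitive_residues I q))) / real q ^ n) 0 < \<epsilon> / 4"
    using \<epsilon> by (intro tendstoD) auto
  then show ?thesis using eventually_gt_at_top[of 0]
  proof eventually_elim
    case (elim q)
    define D where "D = (\<Sum>a\<in>primitive_residues I q. real (card (primitive_multiples I q a \<inter> scaled_points I S (lattice_scale n q))))
       - V / zeta (real n) * real (card (primitive_residues I q))"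
    have "\<bar>D\<bar> / real q ^ n < \<epsilon> / 4" using elim unfolding D_def by (simp add: dist_real_def abs_divide)
    then have "\<bar>D\<bar> < \<epsilon> * (real q ^ n / 4)" using elim by (simp add: field_simps)
    also have "\<dots> \<le> \<epsilon> * real (card (primitive_residues I q))"
      using card_primitive_residues_ge[OF fin, of q] n elim \<epsilon> by (intro mult_left_mono) auto
    finally show ?case unfolding D_def by simp
  qed
qed

section \<open>Pairs of independent short vectors\<close>

definition short_independent_pairs ::
  "'i set \<Rightarrow> nat \<Rightarrow> ('i \<Rightarrow> int) \<Rightarrow> real \<Rightarrow> real \<Rightarrow> (('i \<Rightarrow> int) \<times> ('i \<Rightarrow> int)) set" where
  "short_independent_pairs I q a A B = {(b, c). b \<in> multiples_lattice I q a \<and> c \<in> multiples_lattice I q a \<and>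
     independent_pair I b c \<and> (\<forall>i\<in>I. \<bar>real_of_int (b i)\<bar> \<le> A \<and> \<bar>real_of_int (c i)\<bar> \<le> B)}"

lemma multiples_lattice_reduced:
  assumes "b \<in> multiples_lattice I q a" "q > 0"
  obtains l where "l \<in> {0..<int q}" "\<And>i. i \<in> I \<Longrightarrow> [b i = l * a i] (mod int q)"
proof -
  obtain k where k: "\<forall>i\<in>I. [b i = k * a i] (mod int q)" using assms(1) unfolding multiples_lattice_def by auto
  have "[b i = (k mod int q) * a i] (mod int q)" if "i \<in> I" for i
  proof -
    have "[k * a i = (k mod int q) * a i] (mod int q)" by (intro cong_scalar_right) (simp add: cong_def)
    then show ?thesis using k that by (meson cong_trans)
  qed
  then show ?thesis using that[of "k mod int q"] assms(2) by auto
qed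

text \<open>Every pair of vectors of the lattice of \<open>a\<close> arises from a pair of multipliers.\<close>

lemma sum_card_pairs_le:
  assumes fin: "finite I" and q: "q > 0"
    and P: "\<And>a. a \<in> residue_vectors I q \<Longrightarrow> P a \<subseteq> multiples_lattice I q a \<times> multiples_lattice I q a"
    and finT: "\<And>l l'. finite {(a, b, c) \<in> proportional_triples I q l l'. (b, c) \<in> P a}"
  shows "(\<Sum>a\<in>residue_vectors I q. card (P a)) \<le>
    (\<Sum>(l, l')\<in>{0..<int q} \<times> {0..<int q}. card {(a, b, c) \<in> proportional_triples I q l l'. (b, c) \<in> P a})"
proof -
  define T where "T l l' = {(a, b, c) \<in> proportional_triples I q l l'. (b, c) \<in> P a}" for l l'
  define R where "R = {0..<int q}"
  have sub: "Sigma (residue_vectors I q) P \<subseteq> (\<Union>(l, l')\<in>R \<times> R. T l l')"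
  proof
    fix z assume "z \<in> Sigma (residue_vectors I q) P"
    then obtain a b c where z: "z = (a, b, c)" "a \<in> residue_vectors I q" "(b, c) \<in> P a" by auto
    have M: "b \<in> multiples_lattice I q a" "c \<in> multiples_lattice I q a" using P[OF z(2)] z(3) by auto
    obtain l where l: "l \<in> R" "\<And>i. i \<in> I \<Longrightarrow> [b i = l * a i] (mod int q)"
      unfolding R_def using multiples_lattice_reduced[OF M(1) q] by metis
    obtain l' where l': "l' \<in> R" "\<And>i. i \<in> I \<Longrightarrow> [c i = l' * a i] (mod int q)"
      unfolding R_def using multiples_lattice_reduced[OF M(2) q] by metis
    have "z \<in> T l l'" unfolding T_def proportional_triples_def z(1)
      using z l l' M unfolding multiples_lattice_def by auto
    then show "z \<in> (\<Union>(l, l')\<in>R \<times> R. T l l')" using l(1) l'(1) by auto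
  qed
  have finU: "finite (\<Union>(l, l')\<in>R \<times> R. T l l')" unfolding R_def T_def using finT by auto
  have finP: "finite (P a)" if "a \<in> residue_vectors I q" for a
  proof (rule finite_subset)
    show "P a \<subseteq> snd ` (Sigma (residue_vectors I q) P)" using that by force
    show "finite (snd ` (Sigma (residue_vectors I q) P))" using finite_subset[OF sub finU] by simp
  qed
  have "(\<Sum>a\<in>residue_vectors I q. card (P a)) = card (Sigma (residue_vectors I q) P)"
    using finP finite_residue_vectors[OF fin] by (simp add: card_SigmaI)
  also have "\<dots> \<le> card (\<Union>(l, l')\<in>R \<times> R. T l l')" using sub finU by (rule card_mono[rotated])
  also have "\<dots> \<le> (\<Sum>(l, l')\<in>R \<times> R. card (T l l'))"
    using card_UN_le[of "R \<times> R" "\<lambda>(l, l'). T l l'"] unfolding R_def by (simp add: case_prod_unfold)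
  finally show ?thesis unfolding T_def R_def .
qed

lemma sum_short_independent_pairs_le:
  assumes fin: "finite I" "I \<noteq> {}" and q: "q > 0" and AB: "A \<ge> 0" "B \<ge> 0"
  shows "(\<Sum>a\<in>residue_vectors I q. real (card (short_independent_pairs I q a A B))) \<le> (real q)\<^sup>2 * (25 * A * B / q) ^ card I"
proof -
  define T where "T l l' = {(a, b, c) \<in> proportional_triples I q l l'. (b, c) \<in> short_independent_pairs I q a A B}" for l l'
  have sub: "T l l' \<subseteq> {(a, b, c) \<in> proportional_triples I q l l'. independent_pair I b c \<and>
          (\<forall>i\<in>I. \<bar>real_of_int (b i)\<bar> \<le> A \<and> \<bar>real_of_int (c i)\<bar> \<le> B)}" for l l'
    unfolding T_def short_independent_pairs_def by auto
  note T = card_independent_triples_le[OF fin q AB sub]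
  have "(\<Sum>a\<in>residue_vectors I q. card (short_independent_pairs I q a A B)) \<le>
    (\<Sum>(l, l')\<in>{0..<int q} \<times> {0..<int q}. card (T l l'))"
    unfolding T_def by (rule sum_card_pairs_le[OF fin(1) q]) (use T(1) in \<open>auto simp: short_independent_pairs_def T_def\<close>)
  then have "(\<Sum>a\<in>residue_vectors I q. real (card (short_independent_pairs I q a A B))) \<le>
     (\<Sum>(l, l')\<in>{0..<int q} \<times> {0..<int q}. real (card (T l l')))"
    by (simp add: case_prod_unfold flip: of_nat_sum)
  also have "\<dots> \<le> (\<Sum>(l, l')\<in>{0..<int q} \<times> {0..<int q}. (25 * A * B / q) ^ card I)"
    using T(2) by (intro sum_mono) (auto simp: case_prod_unfold)
  also have "\<dots> = (real q)\<^sup>2 * (25 * A * B / q) ^ card I" by (simp add: power2_eq_square)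
  finally show ?thesis .
qed

lemma finite_short_independent_pairs:
  assumes "finite I" shows "finite (short_independent_pairs I q a A B)"
proof -
  have f: "finite {b \<in> extensional I. \<forall>i\<in>I. \<bar>real_of_int (b i)\<bar> \<le> C}" for C
  proof (rule finite_subset)
    show "{b \<in> extensional I. \<forall>i\<in>I. \<bar>real_of_int (b i)\<bar> \<le> C} \<subseteq> I \<rightarrow>\<^sub>E {-\<lfloor>C\<rfloor>..\<lfloor>C\<rfloor>}"
    proof
      fix b :: "'a \<Rightarrow> int" assume b: "b \<in> {b \<in> extensional I. \<forall>i\<in>I. \<bar>real_of_int (b i)\<bar> \<le> C}"
      have "-\<lfloor>C\<rfloor> \<le> b i \<and> b i \<le> \<lfloor>C\<rfloor>" if "i \<in> I" for i
      proof -
        have "\<bar>real_of_int (b i)\<bar> \<le> C" using b that by auto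
        then show ?thesis by linarith
      qed
      then show "b \<in> I \<rightarrow>\<^sub>E {-\<lfloor>C\<rfloor>..\<lfloor>C\<rfloor>}" using b by (auto simp: PiE_def)
    qed
  qed (use assms in \<open>auto intro: finite_PiE\<close>)
  show ?thesis
    by (rule finite_subset[OF _ finite_cartesian_product[OF f f]])
      (auto simp: short_independent_pairs_def multiples_lattice_def)
qed

lemma lattice_scale_power2:
  assumes "n > 0" "q > 0"
  shows "(real q)\<^sup>2 * (C * lattice_scale n q * lattice_scale n q / q) ^ n = C ^ n * real q ^ n"
proof -
  define L where "L = lattice_scale n q ^ n"
  have L: "real q * L = real q ^ n" unfolding L_def by (rule lattice_scale_power[OF assms])
  have "(real q)\<^sup>2 * (C * lattice_scale n q * lattice_scale n q / q) ^ n = C ^ n * ((real q * L) * (real q * L)) / real q ^ n"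
    unfolding L_def by (simp add: power_divide power_mult_distrib power2_eq_square)
  also have "\<dots> = C ^ n * real q ^ n" unfolding L using assms by simp
  finally show ?thesis .
qed

lemma lattice_scale_square_2: "q > 0 \<Longrightarrow> lattice_scale 2 q * lattice_scale 2 q = real q"
  using lattice_scale_power[of 2 q] by (simp add: power2_eq_square)

text \<open>In the plane the determinant of two independent vectors is a nonzero multiple of \<open>q\<close>.\<close>

lemma planar_determinant_bound:
  assumes I: "finite I" "card I = 2" and M: "b \<in> multiples_lattice I q a" "c \<in> multiples_lattice I q a"
    and ind: "independent_pair I b c" and bd: "\<And>i. i \<in> I \<Longrightarrow> \<bar>real_of_int (b i)\<bar> \<le> A" "\<And>i. i \<in> I \<Longrightarrow> \<bar>real_of_int (c i)\<bar> \<le> B"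
  shows "real q \<le> 2 * A * B"
proof -
  obtain i j where ij: "i \<in> I" "j \<in> I" "b i * c j \<noteq> b j * c i" using ind unfolding independent_pair_def by blast
  obtain k where k: "\<forall>i\<in>I. [b i = k * a i] (mod int q)" using M(1) unfolding multiples_lattice_def by auto
  obtain l where l: "\<forall>i\<in>I. [c i = l * a i] (mod int q)" using M(2) unfolding multiples_lattice_def by auto
  have "[b i * c j - b j * c i = (k * a i) * (l * a j) - (k * a j) * (l * a i)] (mod int q)"
    using k l ij by (intro cong_diff cong_mult) auto
  then have "int q dvd b i * c j - b j * c i" by (simp add: cong_0_iff algebra_simps)
  then have "int q \<le> \<bar>b i * c j - b j * c i\<bar>" using ij(3) by (metis dvd_abs_iff zdvd_imp_le zero_less_abs_iff right_minus_eq)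
  then have "real q \<le> \<bar>real_of_int (b i) * c j - real_of_int (b j) * c i\<bar>"
    by (metis of_int_abs of_int_diff of_int_le_iff of_int_mult of_int_of_nat_eq)
  also have "\<dots> \<le> \<bar>real_of_int (b i)\<bar> * \<bar>real_of_int (c j)\<bar> + \<bar>real_of_int (b j)\<bar> * \<bar>real_of_int (c i)\<bar>"
    unfolding abs_mult[symmetric] by linarith
  also have "\<dots> \<le> A * B + A * B"
    using bd[OF ij(1)] bd[OF ij(2)] by (intro add_mono mult_mono) auto
  finally show ?thesis by simp
qed

text \<open>For n >= 3 this is a second moment estimate, with 4 from the lower bound for the number
  of primitive residues. In the plane, lengths of order 1 / R would give R^(-4), the very order of
  the second term, and spoil the lower bound; there the determinant rules out all such
  pairs.\<close>

lemma sum_short_pairs_le_primitive: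
  fixes \<alpha> \<beta> :: real
  assumes I: "finite I" "card I = n" "n \<ge> 2" and q: "q > 0" and ab: "\<alpha> \<ge> 0" "\<beta> \<ge> 0" and small: "n = 2 \<Longrightarrow> 2 * \<alpha> * \<beta> < 1"
  shows "(\<Sum>a\<in>primitive_residues I q. real (card (short_independent_pairs I q a (\<alpha> * lattice_scale n q) (\<beta> * lattice_scale n q))))
    \<le> (if n = 2 then 0 else 4 * (25 * \<alpha> * \<beta>) ^ n) * real (card (primitive_residues I q))"
proof (cases "n = 2")
  case True
  have "short_independent_pairs I q a (\<alpha> * lattice_scale n q) (\<beta> * lattice_scale n q) = {}" for a
  proof (rule ccontr)
    assume "short_independent_pairs I q a (\<alpha> * lattice_scale n q) (\<beta> * lattice_scale n q) \<noteq> {}"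
    then obtain b c where "b \<in> multiples_lattice I q a" "c \<in> multiples_lattice I q a" "independent_pair I b c"
      "\<And>i. i \<in> I \<Longrightarrow> \<bar>real_of_int (b i)\<bar> \<le> \<alpha> * lattice_scale n q" "\<And>i. i \<in> I \<Longrightarrow> \<bar>real_of_int (c i)\<bar> \<le> \<beta> * lattice_scale n q"
      unfolding short_independent_pairs_def by auto
    from planar_determinant_bound[OF I(1) _ this] have "real q \<le> 2 * \<alpha> * \<beta> * (lattice_scale 2 q * lattice_scale 2 q)"
      using I True by (simp add: algebra_simps)
    then have "real q \<le> 2 * \<alpha> * \<beta> * real q" unfolding lattice_scale_square_2[OF q] .
    then show False using small True q by simp
  qed
  then show ?thesis using True by simp
next
  case False
  have ne: "I \<noteq> {}" using I by auto
  have X: "lattice_scale n q > 0" by (rule lattice_scale_pos[OF q])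
  have "(\<Sum>a\<in>primitive_residues I q. real (card (short_independent_pairs I q a (\<alpha> * lattice_scale n q) (\<beta> * lattice_scale n q))))
     \<le> (\<Sum>a\<in>residue_vectors I q. real (card (short_independent_pairs I q a (\<alpha> * lattice_scale n q) (\<beta> * lattice_scale n q))))"
    using primitive_residues_subset finite_residue_vectors[OF I(1)] by (intro sum_mono2) auto
  also have "\<dots> \<le> (real q)\<^sup>2 * (25 * (\<alpha> * lattice_scale n q) * (\<beta> * lattice_scale n q) / q) ^ card I"
    using ab X by (intro sum_short_independent_pairs_le[OF I(1) ne q]) auto
  also have "\<dots> = (25 * \<alpha> * \<beta>) ^ n * real q ^ n"
    using lattice_scale_power2[of n q "25 * \<alpha> * \<beta>"] I q by (simp add: mult_ac)
  also have "\<dots> \<le> (25 * \<alpha> * \<beta>) ^ n * (4 * real (card (primitive_residues I q)))"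
    using card_primitive_residues_ge[OF I(1), of q] I q ab by (intro mult_left_mono) auto
  finally show ?thesis using False by simp
qed

lemma multiples_lattice_combination:
  assumes "b \<in> multiples_lattice I q a" "c \<in> multiples_lattice I q a"
  shows "restrict (\<lambda>i. x * b i + y * c i) I \<in> multiples_lattice I q a"
proof -
  obtain k where k: "\<forall>i\<in>I. [b i = k * a i] (mod int q)" using assms(1) unfolding multiples_lattice_def by auto
  obtain l where l: "\<forall>i\<in>I. [c i = l * a i] (mod int q)" using assms(2) unfolding multiples_lattice_def by auto
  show ?thesis
  proof (rule multiples_latticeI[where k = "x * k + y * l"])
    fix i assume "i \<in> I"
    then have "[x * b i + y * c i = x * (k * a i) + y * (l * a i)] (mod int q)"
      using k l by (intro cong_add cong_scalar_left) auto
    then show "[x * b i + y * c i = (x * k + y * l) * a i] (mod int q)" by (simp add: algebra_simps)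
  qed
qed

lemma primitive_multiples_factor:
  assumes b: "b \<in> primitive_multiples I q a" and c: "c \<in> multiples_lattice I q a"
    and eq: "\<And>i. i \<in> I \<Longrightarrow> b i = z * c i"
  shows "\<bar>z\<bar> = 1"
proof -
  define c' where "c' = restrict (\<lambda>i. sgn z * c i + 0 * c i) I"
  have "c' \<in> multiples_lattice I q a" unfolding c'_def by (rule multiples_lattice_combination[OF c c])
  moreover have "\<forall>i\<in>I. b i = int (nat \<bar>z\<bar>) * c' i"
    using eq unfolding c'_def by (auto simp: abs_mult_sgn mult.assoc[symmetric])
  ultimately have "nat \<bar>z\<bar> = 1" using b unfolding primitive_multiples_def by blast
  then show ?thesis by simp
qed

text \<open>A Bezout combination of \<open>b\<close> and \<open>c\<close> is a lattice vector of
  which both are integer multiples; primitivity makes both factors 1 or -1.\<close>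

lemma primitive_multiples_parallel:
  assumes b: "b \<in> primitive_multiples I q a" "c \<in> primitive_multiples I q a" and dep: "\<not> independent_pair I b c"
  shows "c = b \<or> c = (\<lambda>i\<in>I. - b i)"
proof -
  have bM: "b \<in> multiples_lattice I q a" "c \<in> multiples_lattice I q a" using b unfolding primitive_multiples_def by auto
  obtain i where i: "i \<in> I" "b i \<noteq> 0" using b unfolding primitive_multiples_def by auto
  have dep: "b i * c j = b j * c i" if "j \<in> I" for j using dep i that unfolding independent_pair_def by blast
  define g where "g = gcd (b i) (c i)"
  have g: "g > 0" using i unfolding g_def by simp
  obtain p where p: "b i = g * p" unfolding g_def by (metis dvdE gcd_dvd1)
  obtain r where r: "c i = g * r" unfolding g_def by (metis dvdE gcd_dvd2)
  obtain x y where "x * b i + y * c i = g" using bezout_int[of "b i" "c i"] unfolding g_def by auto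
  then have "g * (x * p + y * r) = g * 1" unfolding p r by (simp add: algebra_simps)
  then have xy: "x * p + y * r = 1" using g by simp
  have pr: "p * c j = r * b j" if "j \<in> I" for j
  proof -
    have "g * (p * c j) = g * (r * b j)" using dep[OF that] unfolding p r by (simp add: algebra_simps)
    then show ?thesis using g by simp
  qed
  define e where "e = restrict (\<lambda>j. x * b j + y * c j) I"
  have eM: "e \<in> multiples_lattice I q a" unfolding e_def by (rule multiples_lattice_combination[OF bM])
  have be: "b j = p * e j" and ce: "c j = r * e j" if "j \<in> I" for j
  proof -
    have "p * e j = x * p * b j + y * (p * c j)" using that unfolding e_def by (simp add: algebra_simps)
    also have "\<dots> = (x * p + y * r) * b j" unfolding pr[OF that] by (simp add: algebra_simps)
    finally show "b j = p * e j" using xy by simp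
    have "r * e j = x * (r * b j) + y * r * c j" using that unfolding e_def by (simp add: algebra_simps)
    also have "\<dots> = (x * p + y * r) * c j" unfolding pr[OF that, symmetric] by (simp add: algebra_simps)
    finally show "c j = r * e j" using xy by simp
  qed
  have "\<bar>p\<bar> = 1" "\<bar>r\<bar> = 1"
    using primitive_multiples_factor[OF b(1) eM be] primitive_multiples_factor[OF b(2) eM ce] by auto
  then have "r = p \<or> r = - p" by (auto simp: abs_if split: if_splits)
  then have "(\<forall>j\<in>I. c j = b j) \<or> (\<forall>j\<in>I. c j = - b j)" using be ce by auto
  then show ?thesis using bM unfolding multiples_lattice_def by (auto intro!: extensionalityI[of _ I])
qed

lemma primitive_multiples_uminus:
  assumes "b \<in> primitive_multiples I q a" shows "(\<lambda>i\<in>I. - b i) \<in> primitive_multiples I q a"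
proof -
  have bM: "b \<in> multiples_lattice I q a" using assms unfolding primitive_multiples_def by auto
  have "(\<lambda>i\<in>I. - b i) \<in> multiples_lattice I q a"
    using multiples_lattice_combination[OF bM bM, of "-1" 0] by simp
  moreover have "m = 1" if c: "c \<in> multiples_lattice I q a" "\<forall>i\<in>I. (\<lambda>i\<in>I. - b i) i = int m * c i" for m c
  proof -
    have eq: "b i = - int m * c i" if i: "i \<in> I" for i
    proof -
      have "- b i = int m * c i" using bspec[OF c(2) i] i by simp
      then show ?thesis by simp
    qed
    have "\<bar>- int m\<bar> = 1" by (rule primitive_multiples_factor[OF assms c(1) eq])
    then show ?thesis by simp
  qed
  moreover have "\<exists>i\<in>I. (\<lambda>i\<in>I. - b i) i \<noteq> 0" using assms unfolding primitive_multiples_def by auto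
  ultimately show ?thesis unfolding primitive_multiples_def mem_Collect_eq by blast
qed

section \<open>Lattice points in width balls and boxes\<close>

definition width_ball :: "'i set \<Rightarrow> real \<Rightarrow> ('i \<Rightarrow> real) set" where
  "width_ball I r = {w. \<forall>i\<in>I. \<bar>w i\<bar> \<le> r \<and> (\<forall>j\<in>I. w i - w j \<le> r)}"

text \<open>Half-open sides let the lattice points be counted exactly by differences of floors and
  keep the box apart from the adjacent width ball.\<close>

definition half_open_box :: "'i set \<Rightarrow> ('i \<Rightarrow> real) \<Rightarrow> ('i \<Rightarrow> real) \<Rightarrow> ('i \<Rightarrow> real) set" where
  "half_open_box I lo hi = {w. \<forall>i\<in>I. lo i < w i \<and> w i \<le> hi i}"

definition reflected :: "'i set \<Rightarrow> ('i \<Rightarrow> real) set \<Rightarrow> ('i \<Rightarrow> real) set" where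
  "reflected I S = {w. (\<lambda>i\<in>I. - w i) \<in> S}"

lemma floor_scaled_tendsto:
  fixes c :: real
  shows "((\<lambda>y. real_of_int \<lfloor>c * y\<rfloor> / y) \<longlongrightarrow> c) at_top"
proof (rule tendsto_sandwich)
  show "((\<lambda>y. c - 1 / y) \<longlongrightarrow> c) at_top" by real_asymp
  show "((\<lambda>y. c) \<longlongrightarrow> c) at_top" by simp
  show "\<forall>\<^sub>F y in at_top. c - 1 / y \<le> real_of_int \<lfloor>c * y\<rfloor> / y"
    using eventually_gt_at_top[of 0]
  proof eventually_elim
    case (elim y)
    have "c * y - 1 \<le> real_of_int \<lfloor>c * y\<rfloor>" by linarith
    then have "(c * y - 1) / y \<le> real_of_int \<lfloor>c * y\<rfloor> / y" using elim by (intro divide_right_mono) auto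
    then show ?case using elim by (simp add: diff_divide_distrib)
  qed
  show "\<forall>\<^sub>F y in at_top. real_of_int \<lfloor>c * y\<rfloor> / y \<le> c"
    using eventually_gt_at_top[of 0] by eventually_elim (simp add: field_simps)
qed

text \<open>Sort the vectors by their minimum -m, taken together with 0. For m > 0 the vectors with
  entries in [-m, k - m] that attain -m number (k + 1)^n - k^n; for m = 0 all (k + 1)^n qualify.
  Summing over m <= k gives the difference of powers.\<close>

lemma card_width_le:
  assumes fin: "finite I"
  shows "finite {b \<in> extensional I. width I b \<le> int k}"
    and "real (card {b \<in> extensional I. width I b \<le> int k}) = (real k + 1) ^ Suc (card I) - real k ^ Suc (card I)"
proof -
  define F where "F m = (I \<rightarrow>\<^sub>E {- int m..int k - int m})" for m
  define G where "G m = (if m = 0 then {} else I \<rightarrow>\<^sub>E {- int m + 1..int k - int m})" for m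
  have finF: "finite (F m)" for m unfolding F_def using fin by (intro finite_PiE) auto
  have GF: "G m \<subseteq> F m" for m unfolding G_def F_def by (auto simp: PiE_def Pi_def)
  have minw: "Min (insert 0 (b ` I)) = - int m" if b: "b \<in> F m - G m" "m \<le> k" for b m
  proof (rule Min_eqI)
    show "finite (insert 0 (b ` I))" using fin by simp
    show "- int m \<le> y" if "y \<in> insert 0 (b ` I)" for y using that b unfolding F_def by auto
    show "- int m \<in> insert 0 (b ` I)"
    proof (rule ccontr)
      assume c: "- int m \<notin> insert 0 (b ` I)"
      have "- int m + 1 \<le> b i" if "i \<in> I" for i
      proof -
        have "- int m \<le> b i" using that b unfolding F_def by auto
        moreover have "b i \<noteq> - int m" using that c by (metis imageI insertI2)
        ultimately show ?thesis by simp
      qed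
      then have "b \<in> G m" using b c unfolding F_def G_def by (auto simp: PiE_def Pi_def)
      then show False using b by simp
    qed
  qed
  have eq: "{b \<in> extensional I. width I b \<le> int k} = (\<Union>m\<in>{..k}. F m - G m)"
  proof (intro equalityI subsetI)
    fix b assume b: "b \<in> {b \<in> extensional I. width I b \<le> int k}"
    define lo hi where "lo = Min (insert 0 (b ` I))" and "hi = Max (insert 0 (b ` I))"
    have lh: "lo \<le> 0" "0 \<le> hi" "\<And>i. i \<in> I \<Longrightarrow> lo \<le> b i \<and> b i \<le> hi" "hi - lo \<le> int k"
      using b fin unfolding lo_def hi_def width_def by auto
    define m where "m = nat (- lo)"
    have m: "int m = - lo" "m \<le> k" using lh unfolding m_def by auto
    have "- int m \<le> b i \<and> b i \<le> int k - int m" if "i \<in> I" for i using lh(3)[OF that] lh(4) m(1) by linarith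
    then have "b \<in> F m" using b unfolding F_def by (auto simp: PiE_def Pi_def)
    moreover have "b \<notin> G m"
    proof
      assume "b \<in> G m"
      then have G: "m \<noteq> 0" "\<And>i. i \<in> I \<Longrightarrow> - int m + 1 \<le> b i" unfolding G_def by (auto split: if_splits)
      have "lo \<noteq> 0" using G(1) m by simp
      moreover have "lo \<noteq> b i" if "i \<in> I" for i using G(2)[OF that] m by linarith
      ultimately show False using Min_insert_0_attained[OF fin, of b] unfolding lo_def by blast
    qed
    ultimately show "b \<in> (\<Union>m\<in>{..k}. F m - G m)" using m by auto
  next
    fix b assume "b \<in> (\<Union>m\<in>{..k}. F m - G m)"
    then obtain m where m: "m \<le> k" "b \<in> F m - G m" by auto
    have "Max (insert 0 (b ` I)) \<le> int k - int m" using m fin unfolding F_def by auto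
    then have "width I b \<le> int k" unfolding width_def minw[OF m(2,1)] by simp
    then show "b \<in> {b \<in> extensional I. width I b \<le> int k}" using m(2) unfolding F_def by (auto simp: PiE_def)
  qed
  show "finite {b \<in> extensional I. width I b \<le> int k}" unfolding eq using finF by auto
  have "card {b \<in> extensional I. width I b \<le> int k} = (\<Sum>m\<in>{..k}. card (F m - G m))"
    unfolding eq
  proof (rule card_UN_disjoint)
    show "\<forall>m\<in>{..k}. \<forall>m'\<in>{..k}. m \<noteq> m' \<longrightarrow> (F m - G m) \<inter> (F m' - G m') = {}"
    proof (intro ballI impI)
      fix m m' assume m: "m \<in> {..k}" "m' \<in> {..k}" "m \<noteq> m'"
      have "b \<notin> F m' - G m'" if "b \<in> F m - G m" for b
        using minw[of b m] minw[of b m'] m that by auto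
      then show "(F m - G m) \<inter> (F m' - G m') = {}" by blast
    qed
  qed (use finF in auto)
  also have "\<dots> = (\<Sum>m\<in>{..k}. card (F m) - card (G m))"
    using GF finF by (intro sum.cong refl card_Diff_subset) (auto intro: finite_subset)
  also have "real \<dots> = (\<Sum>m\<in>{..k}. real (card (F m)) - real (card (G m)))"
    using GF finF by (simp add: of_nat_diff card_mono)
  also have "\<dots> = (\<Sum>m\<in>{..k}. (real k + 1) ^ card I - (if m = 0 then 0 else real k ^ card I))"
    unfolding F_def G_def using fin by (intro sum.cong refl) (auto simp: card_funcsetE)
  also have "\<dots> = (real k + 1) * (real k + 1) ^ card I - real k * real k ^ card I"
  proof -
    have "(\<Sum>m\<in>{..k}. if m = 0 then 0 else real k ^ card I) = (\<Sum>m\<in>{1..k}. real k ^ card I)"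
      by (rule sum.mono_neutral_cong_right) auto
    then show ?thesis by (simp add: sum_subtractf)
  qed
  finally show "real (card {b \<in> extensional I. width I b \<le> int k}) = (real k + 1) ^ Suc (card I) - real k ^ Suc (card I)" by simp
qed

lemma power_Suc_diff_bounds:
  fixes x y :: real assumes "0 \<le> y" "y \<le> x" "x = y + 1"
  shows "(real n + 1) * y ^ n \<le> x ^ Suc n - y ^ Suc n" "x ^ Suc n - y ^ Suc n \<le> (real n + 1) * x ^ n"
proof -
  have e: "x ^ Suc n - y ^ Suc n = (\<Sum>p<Suc n. x ^ p * y ^ (n - p))"
    unfolding power_diff_sumr2 using assms by (simp add: mult.commute)
  have "(\<Sum>p<Suc n. y ^ n) \<le> (\<Sum>p<Suc n. x ^ p * y ^ (n - p))"
  proof (rule sum_mono)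
    fix p assume "p \<in> {..<Suc n}"
    then have "y ^ n = y ^ p * y ^ (n - p)" by (simp add: power_add[symmetric])
    then show "y ^ n \<le> x ^ p * y ^ (n - p)" using assms by (simp add: mult_right_mono power_mono)
  qed
  then show "(real n + 1) * y ^ n \<le> x ^ Suc n - y ^ Suc n" unfolding e by (simp add: algebra_simps)
  have "(\<Sum>p<Suc n. x ^ p * y ^ (n - p)) \<le> (\<Sum>p<Suc n. x ^ n)"
  proof (rule sum_mono)
    fix p assume "p \<in> {..<Suc n}"
    then have "x ^ n = x ^ p * x ^ (n - p)" by (simp add: power_add[symmetric])
    then show "x ^ p * y ^ (n - p) \<le> x ^ n" using assms by (simp add: mult_left_mono power_mono)
  qed
  then show "x ^ Suc n - y ^ Suc n \<le> (real n + 1) * x ^ n" unfolding e by (simp add: algebra_simps)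
qed

lemma scaled_width_ball:
  fixes r y :: real
  assumes fin: "finite I" and y: "y > 0" and r: "r > 0"
  shows "scaled_points I (width_ball I r) y = {b \<in> extensional I. width I b \<le> int (nat \<lfloor>r * y\<rfloor>)} - {\<lambda>i\<in>I. 0}"
proof -
  have ry: "int (nat \<lfloor>r * y\<rfloor>) = \<lfloor>r * y\<rfloor>" using r y by simp
  have iff: "(\<lambda>i\<in>I. real_of_int (b i) / y) \<in> width_ball I r \<longleftrightarrow> width I b \<le> \<lfloor>r * y\<rfloor>" for b
  proof -
    have "(\<lambda>i\<in>I. real_of_int (b i) / y) \<in> width_ball I r \<longleftrightarrow>
       (\<forall>i\<in>I. \<bar>real_of_int (b i)\<bar> \<le> r * y \<and> (\<forall>j\<in>I. real_of_int (b i) - real_of_int (b j) \<le> r * y))"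
      unfolding width_ball_def using y by (simp add: pos_divide_le_eq abs_divide flip: diff_divide_distrib)
    also have "\<dots> \<longleftrightarrow> (\<forall>i\<in>I. \<bar>b i\<bar> \<le> \<lfloor>r * y\<rfloor> \<and> (\<forall>j\<in>I. b i - b j \<le> \<lfloor>r * y\<rfloor>))"
      by (simp add: le_floor_iff)
    also have "\<dots> \<longleftrightarrow> width I b \<le> \<lfloor>r * y\<rfloor>"
      unfolding width_le_iff[OF fin] using r y by auto
    finally show ?thesis .
  qed
  have "(\<exists>i\<in>I. b i \<noteq> 0) \<longleftrightarrow> b \<noteq> (\<lambda>i\<in>I. 0)" if "b \<in> extensional I" for b
    using that by (auto simp: fun_eq_iff extensional_def)
  then show ?thesis unfolding scaled_points_def ry using iff by auto
qed

text \<open>The width ball is r times the polar body of the difference body of the standard simplex.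
  Its volume (n + 1) r^n is the origin of the factor d in the main term.\<close>

lemma card_width_ball_tendsto:
  assumes fin: "finite I" and n: "card I = n" "n \<ge> 1" and r: "r > 0"
  shows "((\<lambda>y. real (card (scaled_points I (width_ball I r) y)) / y ^ n) \<longlongrightarrow> (real n + 1) * r ^ n) at_top"
proof (rule tendsto_sandwich)
  define k where "k y = real_of_int \<lfloor>r * y\<rfloor>" for y
  have card: "real (card (scaled_points I (width_ball I r) y)) = (k y + 1) ^ Suc n - k y ^ Suc n - 1" "k y \<ge> 0" if y: "y > 0" for y
  proof -
    define kk where "kk = nat \<lfloor>r * y\<rfloor>"
    define B where "B = {b \<in> extensional I. width I b \<le> int kk}"
    have k: "real kk = k y" unfolding k_def kk_def using r y by simp
    have z: "(\<lambda>i\<in>I. 0) \<in> B" unfolding B_def by (auto simp: width_le_iff[OF fin])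
    have finB: "finite B" unfolding B_def by (rule card_width_le(1)[OF fin])
    have "real (card B) = (k y + 1) ^ Suc n - k y ^ Suc n"
      unfolding B_def card_width_le(2)[OF fin] k n ..
    moreover have "card (B - {\<lambda>i\<in>I. 0}) = card B - 1" "card B \<ge> 1"
      using z finB by (auto simp: card_Diff_singleton Suc_le_eq card_gt_0_iff)
    ultimately show "real (card (scaled_points I (width_ball I r) y)) = (k y + 1) ^ Suc n - k y ^ Suc n - 1"
      unfolding scaled_width_ball[OF fin y r] kk_def[symmetric] B_def[symmetric] by (simp add: of_nat_diff)
    show "k y \<ge> 0" unfolding k_def using r y by simp
  qed
  have l1: "((\<lambda>y. k y / y) \<longlongrightarrow> r) at_top" unfolding k_def by (rule floor_scaled_tendsto)
  have l2: "((\<lambda>y. 1 / y) \<longlongrightarrow> (0::real)) at_top" by real_asymp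
  have l3: "((\<lambda>y. (k y + 1) / y) \<longlongrightarrow> r) at_top" using tendsto_add[OF l1 l2] by (simp add: add_divide_distrib)
  have l4: "((\<lambda>y. 1 / y ^ n) \<longlongrightarrow> (0::real)) at_top" using n by real_asymp
  show "((\<lambda>y. (real n + 1) * (k y / y) ^ n - 1 / y ^ n) \<longlongrightarrow> (real n + 1) * r ^ n) at_top"
    using tendsto_diff[OF tendsto_mult[OF tendsto_const tendsto_power[OF l1]] l4] by simp
  show "((\<lambda>y. (real n + 1) * ((k y + 1) / y) ^ n) \<longlongrightarrow> (real n + 1) * r ^ n) at_top"
    by (intro tendsto_intros l3)
  show "\<forall>\<^sub>F y in at_top. (real n + 1) * (k y / y) ^ n - 1 / y ^ n \<le> real (card (scaled_points I (width_ball I r) y)) / y ^ n"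
    using eventually_gt_at_top[of 0]
  proof eventually_elim
    case (elim y)
    have "(real n + 1) * k y ^ n - 1 \<le> real (card (scaled_points I (width_ball I r) y))"
      unfolding card(1)[OF elim] using power_Suc_diff_bounds(1)[of "k y" "k y + 1" n] card(2)[OF elim] by simp
    then have "((real n + 1) * k y ^ n - 1) / y ^ n \<le> real (card (scaled_points I (width_ball I r) y)) / y ^ n"
      using elim by (intro divide_right_mono) auto
    then show ?case by (simp add: power_divide diff_divide_distrib)
  qed
  show "\<forall>\<^sub>F y in at_top. real (card (scaled_points I (width_ball I r) y)) / y ^ n \<le> (real n + 1) * ((k y + 1) / y) ^ n"
    using eventually_gt_at_top[of 0]
  proof eventually_elim
    case (elim y)
    have "real (card (scaled_points I (width_ball I r) y)) \<le> (real n + 1) * (k y + 1) ^ n"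
      unfolding card(1)[OF elim] using power_Suc_diff_bounds(2)[of "k y" "k y + 1" n] card(2)[OF elim] by simp
    then have "real (card (scaled_points I (width_ball I r) y)) / y ^ n \<le> (real n + 1) * (k y + 1) ^ n / y ^ n"
      using elim by (intro divide_right_mono) auto
    then show ?case by (simp add: power_divide)
  qed
qed

lemma card_half_open_box_tendsto:
  assumes fin: "finite I" and n: "card I = n" "n \<ge> 1" and lo: "\<And>i. i \<in> I \<Longrightarrow> 0 \<le> lo i \<and> lo i \<le> hi i"
  shows "((\<lambda>y. real (card (scaled_points I (half_open_box I lo hi) y)) / y ^ n) \<longlongrightarrow> (\<Prod>i\<in>I. hi i - lo i)) at_top"
proof -
  have "((\<lambda>y. \<Prod>i\<in>I. real_of_int \<lfloor>hi i * y\<rfloor> / y - real_of_int \<lfloor>lo i * y\<rfloor> / y) \<longlongrightarrow> (\<Prod>i\<in>I. hi i - lo i)) at_top"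
    by (intro tendsto_prod tendsto_diff floor_scaled_tendsto)
  moreover have "\<forall>\<^sub>F y in at_top. (\<Prod>i\<in>I. real_of_int \<lfloor>hi i * y\<rfloor> / y - real_of_int \<lfloor>lo i * y\<rfloor> / y) =
      real (card (scaled_points I (half_open_box I lo hi) y)) / y ^ n"
    using eventually_gt_at_top[of 0]
  proof eventually_elim
    case (elim y)
    obtain i0 where i0: "i0 \<in> I" using n by fastforce
    have mem: "(\<lambda>i\<in>I. real_of_int (b i) / y) \<in> half_open_box I lo hi \<longleftrightarrow> (\<forall>i\<in>I. b i \<in> {\<lfloor>lo i * y\<rfloor><..\<lfloor>hi i * y\<rfloor>})" for b
      unfolding half_open_box_def using elim by (simp add: pos_less_divide_eq pos_divide_le_eq floor_less_iff le_floor_iff)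
    have "b i0 \<noteq> 0" if "\<forall>i\<in>I. b i \<in> {\<lfloor>lo i * y\<rfloor><..\<lfloor>hi i * y\<rfloor>}" for b :: "'a \<Rightarrow> int"
    proof -
      have "0 \<le> \<lfloor>lo i0 * y\<rfloor>" using lo[OF i0] elim by simp
      then show ?thesis using bspec[OF that i0] by auto
    qed
    then have "scaled_points I (half_open_box I lo hi) y = (\<Pi>\<^sub>E i\<in>I. {\<lfloor>lo i * y\<rfloor><..\<lfloor>hi i * y\<rfloor>})"
      unfolding scaled_points_def mem using i0 by (auto simp: PiE_def Pi_def)
    then have "real (card (scaled_points I (half_open_box I lo hi) y)) = (\<Prod>i\<in>I. real (nat (\<lfloor>hi i * y\<rfloor> - \<lfloor>lo i * y\<rfloor>)))"
      using fin by (simp add: card_PiE)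
    also have "\<dots> = (\<Prod>i\<in>I. real_of_int \<lfloor>hi i * y\<rfloor> - real_of_int \<lfloor>lo i * y\<rfloor>)"
    proof (rule prod.cong[OF refl])
      fix i assume "i \<in> I"
      then have "\<lfloor>lo i * y\<rfloor> \<le> \<lfloor>hi i * y\<rfloor>" using lo elim by (intro floor_mono mult_right_mono) auto
      then show "real (nat (\<lfloor>hi i * y\<rfloor> - \<lfloor>lo i * y\<rfloor>)) = real_of_int \<lfloor>hi i * y\<rfloor> - real_of_int \<lfloor>lo i * y\<rfloor>" by simp
    qed
    finally show ?case using n by (simp add: prod_dividef diff_divide_distrib[symmetric])
  qed
  ultimately show ?thesis by (rule Lim_transform_eventually)
qed

lemma card_reflected:
  "card (scaled_points I (reflected I S) y) = card (scaled_points I S y)"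
proof -
  have eq: "(\<lambda>i\<in>I. - ((\<lambda>i\<in>I. real_of_int ((\<lambda>i\<in>I. - b i) i) / y) i)) = (\<lambda>i\<in>I. real_of_int (b i) / y)"
    "(\<lambda>i\<in>I. - ((\<lambda>i\<in>I. real_of_int (b i) / y) i)) = (\<lambda>i\<in>I. real_of_int ((\<lambda>i\<in>I. - b i) i) / y)" for b :: "'a \<Rightarrow> int"
    by (auto simp: fun_eq_iff)
  have "bij_betw (\<lambda>b. \<lambda>i\<in>I. - b i) (scaled_points I S y) (scaled_points I (reflected I S) y)"
  proof (rule bij_betwI[where g = "\<lambda>b. \<lambda>i\<in>I. - b i"])
    show "(\<lambda>b. \<lambda>i\<in>I. - b i) \<in> scaled_points I S y \<rightarrow> scaled_points I (reflected I S) y"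
      unfolding scaled_points_def reflected_def mem_Collect_eq eq(1) Pi_iff by (intro ballI conjI) auto
    show "(\<lambda>b. \<lambda>i\<in>I. - b i) \<in> scaled_points I (reflected I S) y \<rightarrow> scaled_points I S y"
      unfolding scaled_points_def reflected_def mem_Collect_eq eq(2) Pi_iff by (intro ballI conjI) auto
  qed (auto simp: scaled_points_def fun_eq_iff extensional_def)
  then show ?thesis by (simp add: bij_betw_same_card)
qed

lemma scaled_points_Un: "scaled_points I (S \<union> T) y = scaled_points I S y \<union> scaled_points I T y"
  unfolding scaled_points_def by auto

text \<open>Next to a fixed \<open>b\<close>, only \<open>b\<close> and its negative are parallel to
  \<open>b\<close>; every further element forms an independent pair with it.\<close>

lemma card_primitive_le_pairs:
  assumes fin: "finite P" and P: "P \<subseteq> primitive_multiples I q a" and Q: "finite Q"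
    "\<And>b c. b \<in> P \<Longrightarrow> c \<in> P \<Longrightarrow> independent_pair I b c \<Longrightarrow> (b, c) \<in> Q"
  shows "card P \<le> 2 + card Q"
proof (cases "P = {}")
  case False
  then obtain b where b: "b \<in> P" by auto
  have "P \<subseteq> {b, \<lambda>i\<in>I. - b i} \<union> {c \<in> P. independent_pair I b c}"
    using primitive_multiples_parallel[of b I q a] P b by blast
  then have "card P \<le> card ({b, \<lambda>i\<in>I. - b i} \<union> {c \<in> P. independent_pair I b c})" using fin by (intro card_mono) auto
  also have "\<dots> \<le> card {b, \<lambda>i\<in>I. - b i} + card {c \<in> P. independent_pair I b c}" by (rule card_Un_le)
  also have "card {b, \<lambda>i\<in>I. - b i} \<le> 2" by (simp add: card_insert_if)
  also have "card {c \<in> P. independent_pair I b c} \<le> card Q"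
    using Q b by (intro card_inj_on_le[of "\<lambda>c. (b, c)"]) (auto simp: inj_on_def)
  finally show ?thesis by simp
qed simp

lemma lattice_scale_root:
  assumes "q > 0" shows "lattice_scale n q * real q powr (1 / real n) = real q"
  unfolding lattice_scale_def using assms by (simp add: powr_add[symmetric])

text \<open>Every primitive vector in the union of the width ball, the box and its reflection forces
  failure, and a residue vector has at most two such vectors unless it also has an independent pair
  of them. So half the first moment, less the pairs, bounds the failures from below.\<close>

lemma uncovered_ge:
  fixes R R' \<kappa> \<epsilon> :: real
  assumes fin: "finite I" and n: "card I = n" "n \<ge> 2" and R: "0 < R" "R < R'" and \<kappa>: "0 < \<kappa>" "\<kappa> < 1"
    and small: "2 * (6 * \<kappa> * R') ^ n < \<kappa>" and two: "n = 2 \<Longrightarrow> 2 * (2 / R') * (2 / R') < 1" and \<epsilon>: "\<epsilon> > 0"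
  shows "\<forall>\<^sub>F q in sequentially.
    (((real n + 1) / R' ^ n + 2 * (\<kappa> / (R' ^ n * 3 ^ (n - 1)))) / zeta (real n)
      - (if n = 2 then 0 else 4 * (25 * (2 / R') * (2 / R')) ^ n) - \<epsilon>) / 2 * real (card (primitive_residues I q))
    \<le> real (card (uncovered I q R))"
proof -
  have R': "R' > 0" using R by simp
  obtain h where h: "h \<in> I" using n by fastforce
  \<comment> \<open>Coordinate h exceeds the threshold by a factor up to 1 + \<kappa> and the others
    lie in a middle third, as the obstruction near the threshold demands. This box has volume
    \<kappa> / (R'^n 3^(n-1)).\<close>
  define lo where "lo i = (if i = h then 1 / R' else 1 / (3 * R'))" for i
  define hi where "hi i = (if i = h then (1 + \<kappa>) / R' else 2 / (3 * R'))" for i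
  define W where "W = width_ball I (1 / R')"
  define B where "B = half_open_box I lo hi"
  define C where "C = reflected I B"
  define S where "S = W \<union> (B \<union> C)"
  define V where "V = (real n + 1) / R' ^ n + 2 * (\<kappa> / (R' ^ n * 3 ^ (n - 1)))"
  have hi_le: "hi i \<le> 2 / R'" "0 < lo i" "lo i \<le> hi i" for i
    using \<kappa> R' unfolding hi_def lo_def by (auto simp: field_simps)
  have bd: "\<bar>w i\<bar> \<le> 2 / R'" if "w \<in> S" "i \<in> I" for w i
  proof -
    have "1 / R' \<le> 2 / R'" using R' by (simp add: divide_right_mono)
    moreover have "\<bar>w i\<bar> \<le> 1 / R' \<or> (lo i < \<bar>w i\<bar> \<and> \<bar>w i\<bar> \<le> hi i)"
      using that hi_le(2)[of i] unfolding S_def W_def B_def C_def width_ball_def half_open_box_def reflected_def by fastforce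
    ultimately show ?thesis using hi_le(1)[of i] by linarith
  qed
  have finS: "finite (scaled_points I S y)" if "y > 0" for y
    using scaled_points_bounded(1)[OF fin _ that, of "2 / R'" S] bd R' by auto
  have lim: "((\<lambda>y. real (card (scaled_points I S y)) / y ^ n) \<longlongrightarrow> V) at_top"
  proof -
    have "((\<lambda>y. real (card (scaled_points I W y)) / y ^ n + (real (card (scaled_points I B y)) / y ^ n + real (card (scaled_points I B y)) / y ^ n))
       \<longlongrightarrow> (real n + 1) * (1 / R') ^ n + ((\<Prod>i\<in>I. hi i - lo i) + (\<Prod>i\<in>I. hi i - lo i))) at_top"
      unfolding W_def B_def using n R' hi_le
      by (intro tendsto_add card_width_ball_tendsto card_half_open_box_tendsto fin) (auto intro: less_imp_le)
    also have "(\<Prod>i\<in>I. hi i - lo i) = \<kappa> / (R' ^ n * 3 ^ (n - 1))"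
    proof -
      have "(\<Prod>i\<in>I. hi i - lo i) = (hi h - lo h) * (\<Prod>i\<in>I - {h}. hi i - lo i)" using fin h by (rule prod.remove)
      also have "(\<Prod>i\<in>I - {h}. hi i - lo i) = (\<Prod>i\<in>I - {h}. 1 / (3 * R'))"
        by (rule prod.cong) (use R' in \<open>auto simp: hi_def lo_def field_simps\<close>)
      also have "\<dots> = 1 / (3 * R') ^ (n - 1)" using fin h n by (simp add: power_one_over)
      also have "hi h - lo h = \<kappa> / R'" unfolding hi_def lo_def by (simp add: diff_divide_distrib[symmetric])
      also have "\<kappa> / R' * (1 / (3 * R') ^ (n - 1)) = \<kappa> / (R' ^ n * 3 ^ (n - 1))"
      proof -
        have "R' ^ n = R' * R' ^ (n - 1)" using n by (cases n) auto
        then show ?thesis by (simp add: power_mult_distrib mult_ac)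
      qed
      finally show ?thesis .
    qed
    also have "(real n + 1) * (1 / R') ^ n + (\<kappa> / (R' ^ n * 3 ^ (n - 1)) + \<kappa> / (R' ^ n * 3 ^ (n - 1))) = V"
      unfolding V_def by (simp add: power_one_over)
    finally have l: "((\<lambda>y. real (card (scaled_points I W y)) / y ^ n + (real (card (scaled_points I B y)) / y ^ n + real (card (scaled_points I B y)) / y ^ n)) \<longlongrightarrow> V) at_top" .
    show ?thesis
    proof (rule Lim_transform_eventually[OF l])
      show "\<forall>\<^sub>F y in at_top. real (card (scaled_points I W y)) / y ^ n + (real (card (scaled_points I B y)) / y ^ n + real (card (scaled_points I B y)) / y ^ n)
         = real (card (scaled_points I S y)) / y ^ n"
        using eventually_gt_at_top[of 0]
      proof eventually_elim
        case (elim y)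
        have disj: "scaled_points I S1 y \<inter> scaled_points I S2 y = {}" if "S1 \<inter> S2 = {}" for S1 S2
          using that unfolding scaled_points_def by blast
        have sB: "w h > 1 / R'" if "w \<in> B" for w using that h unfolding B_def half_open_box_def lo_def by auto
        have sC: "- w h > 1 / R'" if "w \<in> C" for w using that h unfolding C_def reflected_def B_def half_open_box_def lo_def by auto
        have sW: "\<bar>w h\<bar> \<le> 1 / R'" if "w \<in> W" for w using that h unfolding W_def width_ball_def by auto
        have pos: "0 < 1 / R'" using R' by simp
        have "w \<notin> B \<union> C" if "w \<in> W" for w using sW[OF that] sB[of w] sC[of w] pos by auto
        moreover have "w \<notin> C" if "w \<in> B" for w using sB[OF that] sC[of w] pos by linarith
        ultimately have "W \<inter> (B \<union> C) = {}" "B \<inter> C = {}" by blast+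
        then have d: "scaled_points I W y \<inter> scaled_points I (B \<union> C) y = {}" "scaled_points I B y \<inter> scaled_points I C y = {}"
          by (auto intro!: disj)
        have f: "finite (scaled_points I W y)" "finite (scaled_points I (B \<union> C) y)" "finite (scaled_points I B y)" "finite (scaled_points I C y)"
          using finS[OF elim] unfolding S_def scaled_points_Un by auto
        have "card (scaled_points I S y) = card (scaled_points I W y) + (card (scaled_points I B y) + card (scaled_points I C y))"
          unfolding S_def scaled_points_Un[of I W "B \<union> C"] card_Un_disjoint[OF f(1,2) d(1)]
          unfolding scaled_points_Un[of I B C] card_Un_disjoint[OF f(3,4) d(2)] ..
        then show ?case unfolding C_def card_reflected by (simp add: add_divide_distrib)
      qed
    qed
  qed
  have fm: "\<forall>\<^sub>F q in sequentially.
    \<bar>(\<Sum>a\<in>primitive_residues I q. real (card (primitive_multiples I q a \<inter> scaled_points I S (lattice_scale n q))))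
       - V / zeta (real n) * real (card (primitive_residues I q))\<bar> \<le> \<epsilon> * real (card (primitive_residues I q))"
    by (rule first_moment_bounded[OF fin n _ _ lim \<epsilon>, of "2 / R'"]) (use bd R' in auto)
  have "(\<lambda>q::nat. real q powr (- 1 / real n)) \<longlonglongrightarrow> 0" using n by real_asymp
  then have e1: "\<forall>\<^sub>F q::nat in sequentially. real q powr (- 1 / real n) < min (R' - R) (3 * \<kappa> * R')"
    using R \<kappa> by (intro order_tendstoD) auto
  show ?thesis using fm e1 eventually_gt_at_top[of 0]
  proof eventually_elim
    case (elim q)
    have q: "q > 0" using elim by simp
    define X where "X = lattice_scale n q"
    define Q where "Q = real q powr (1 / real n)"
    have Q: "Q > 0" "real q powr (- 1 / real n) = 1 / Q" "X * Q = real q" "Q ^ n = real q"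
      unfolding Q_def X_def using q n lattice_scale_root[OF q] by (auto simp: powr_minus field_simps powr_power)
    have X: "X > 0" unfolding X_def by (rule lattice_scale_pos[OF q])
    \<comment> \<open>The first gap absorbs the +1 in the criterion for small width, the second the
      +1 in the count of points in a corner. Both hold for large q since q^(1/n) grows.\<close>
    have gap: "1 < (R' - R) * Q" "1 < 3 * \<kappa> * R' * Q"
      using elim(2) Q(1) unfolding Q(2) by (auto simp: pos_divide_less_eq)
    define s where "s = R * Q"
    define P where "P a = primitive_multiples I q a \<inter> scaled_points I S X" for a
    define pairs where "pairs a = short_independent_pairs I q a (2 / R' * X) (2 / R' * X)" for a
    have unc: "a \<in> uncovered I q R" if a: "a \<in> primitive_residues I q" and b: "b \<in> P a" for a b
    proof -
      have bM: "b \<in> multiples_lattice I q a" "\<exists>i\<in>I. b i \<noteq> 0" and bS: "b \<in> scaled_points I S X"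
        using b unfolding P_def primitive_multiples_def by auto
      have box: "\<not> covers I q a s" if c: "c \<in> multiples_lattice I q a" "(\<lambda>i\<in>I. real_of_int (c i) / X) \<in> B" for c
      proof -
        have cb: "lo i * X < c i" "c i \<le> hi i * X" if "i \<in> I" for i
          using c(2) that X unfolding B_def half_open_box_def by (auto simp: field_simps)
        show ?thesis
        proof (rule not_covers_near_threshold[OF fin q c(1) h, where Y = "X / R'" and \<tau> = "\<kappa> * q"])
          show "X / R' > 0" "X / R' \<le> c h" using X R' cb(1)[OF h] unfolding lo_def by auto
          show "X / R' / 3 \<le> c j \<and> c j \<le> 2 * (X / R') / 3" if "j \<in> I" "j \<noteq> h" for j
            using cb[OF that(1)] that(2) unfolding lo_def hi_def by (simp add: field_simps)
          have "s * c h \<le> s * ((1 + \<kappa>) / R' * X)"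
            using cb(2)[OF h] R Q unfolding hi_def s_def by (intro mult_left_mono) auto
          also have "\<dots> = R / R' * ((1 + \<kappa>) * (X * Q))" unfolding s_def by (simp add: field_simps)
          also have "\<dots> \<le> 1 * ((1 + \<kappa>) * (X * Q))" using R \<kappa> X Q by (intro mult_right_mono) auto
          finally show "s * c h \<le> q + \<kappa> * q" unfolding Q(3) by (simp add: algebra_simps)
          show "0 \<le> \<kappa> * q" "\<kappa> * q < q" using \<kappa> q by auto
          have e: "3 * (\<kappa> * q) / (X / R') = 3 * \<kappa> * R' * Q" unfolding Q(3)[symmetric] using X R' by (simp add: field_simps)
          have "(3 * (\<kappa> * q) / (X / R') + 1) ^ card I \<le> (6 * \<kappa> * R' * Q) ^ n"
          proof -
            have "6 * \<kappa> * R' * Q = 2 * (3 * \<kappa> * R' * Q)" by simp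
            then have "3 * \<kappa> * R' * Q + 1 \<le> 6 * \<kappa> * R' * Q" using gap(2) by linarith
            moreover have "0 \<le> 3 * \<kappa> * R' * Q + 1" using gap(2) by simp
            ultimately show ?thesis unfolding e n(1) by (rule power_mono)
          qed
          also have "\<dots> = (6 * \<kappa> * R') ^ n * q" unfolding Q(4)[symmetric] by (rule power_mult_distrib)
          finally have "2 * (3 * (\<kappa> * q) / (X / R') + 1) ^ card I \<le> (2 * (6 * \<kappa> * R') ^ n) * q" by simp
          also have "\<dots> < \<kappa> * q" using small q by (intro mult_strict_right_mono) auto
          finally show "2 * (3 * (\<kappa> * q) / (X / R') + 1) ^ card I < \<kappa> * q" .
        qed
      qed
      have "\<not> covers I q a s"
      proof -
        consider "(\<lambda>i\<in>I. real_of_int (b i) / X) \<in> W" | "(\<lambda>i\<in>I. real_of_int (b i) / X) \<in> B" | "(\<lambda>i\<in>I. real_of_int (b i) / X) \<in> C"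
          using bS unfolding scaled_points_def S_def by auto
        then show ?thesis
        proof cases
          case 1
          then have "b \<in> scaled_points I W X" using bS unfolding scaled_points_def by auto
          then have "width I b \<le> int (nat \<lfloor>1 / R' * X\<rfloor>)" unfolding W_def using scaled_width_ball[OF fin X, of "1 / R'"] R' by auto
          then have "width I b \<le> \<lfloor>1 / R' * X\<rfloor>" using X R' by simp
          then have "real_of_int (width I b) \<le> X / R'" by (simp add: le_floor_iff)
          then have "real_of_int (width I b) * (s + 1) \<le> X / R' * (s + 1)" using R Q unfolding s_def by (intro mult_right_mono) auto
          also have "\<dots> < X / R' * (R' * Q)" using gap(1) X R' unfolding s_def by (intro mult_strict_left_mono) (auto simp: algebra_simps)
          also have "\<dots> = q" using Q(3) R' by simp
          finally show ?thesis by (intro not_covers_of_small_width[OF fin q bM])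
        next
          case 2
          then show ?thesis by (rule box[OF bM(1)])
        next
          case 3
          define c where "c = restrict (\<lambda>i. - 1 * b i + 0 * b i) I"
          have "c \<in> multiples_lattice I q a" unfolding c_def by (rule multiples_lattice_combination[OF bM(1,1)])
          moreover have "(\<lambda>i\<in>I. real_of_int (c i) / X) \<in> B"
          proof -
            have "(\<lambda>i\<in>I. real_of_int (c i) / X) = (\<lambda>i\<in>I. - ((\<lambda>i\<in>I. real_of_int (b i) / X) i))"
              unfolding c_def by (auto simp: fun_eq_iff)
            then show ?thesis using 3 unfolding C_def reflected_def by simp
          qed
          ultimately show ?thesis by (rule box)
        qed
      qed
      then show ?thesis using a n unfolding uncovered_def s_def Q_def by auto
    qed
    have Pcard: "real (card (P a)) \<le> 2 * (if a \<in> uncovered I q R then 1 else 0) + real (card (pairs a))"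
      if a: "a \<in> primitive_residues I q" for a
    proof (cases "P a = {}")
      case False
      then have "a \<in> uncovered I q R" using unc[OF a] by auto
      moreover have "card (P a) \<le> 2 + card (pairs a)"
      proof (rule card_primitive_le_pairs)
        show "finite (P a)" unfolding P_def using finS[OF X] by auto
        show "P a \<subseteq> primitive_multiples I q a" unfolding P_def by auto
        show "finite (pairs a)" unfolding pairs_def by (rule finite_short_independent_pairs[OF fin])
        fix b c assume bc: "b \<in> P a" "c \<in> P a" "independent_pair I b c"
        have "\<bar>real_of_int (z i)\<bar> \<le> 2 / R' * X" if "z \<in> P a" "i \<in> I" for z i
          using scaled_points_bounded(3)[OF fin _ X, of "2 / R'" S z i] bd R' that unfolding P_def by auto
        then show "(b, c) \<in> pairs a" using bc unfolding pairs_def short_independent_pairs_def P_def primitive_multiples_def by auto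
      qed
      ultimately show ?thesis by simp
    qed simp
    define A where "A = real (card (primitive_residues I q))"
    define E where "E = (if n = 2 then 0 else 4 * (25 * (2 / R') * (2 / R')) ^ n)"
    have "(V / zeta (real n) - \<epsilon>) * A \<le> (\<Sum>a\<in>primitive_residues I q. real (card (P a)))"
      using elim(1) unfolding P_def X_def A_def by (simp add: left_diff_distrib abs_le_iff)
    also have "\<dots> \<le> (\<Sum>a\<in>primitive_residues I q. 2 * (if a \<in> uncovered I q R then 1 else 0) + real (card (pairs a)))"
      by (intro sum_mono Pcard)
    also have "\<dots> = 2 * real (card (uncovered I q R)) + (\<Sum>a\<in>primitive_residues I q. real (card (pairs a)))"
    proof -
      have "{a \<in> primitive_residues I q. a \<in> uncovered I q R} = uncovered I q R" unfolding uncovered_def by auto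
      then have "(\<Sum>a\<in>primitive_residues I q. if a \<in> uncovered I q R then 1 else 0) = real (card (uncovered I q R))"
        using sum.inter_filter[OF finite_primitive_residues[OF fin, of q], of "\<lambda>_. 1::real" "\<lambda>a. a \<in> uncovered I q R"] by simp
      then show ?thesis by (simp only: sum.distrib sum_distrib_left[symmetric])
    qed
    also have "(\<Sum>a\<in>primitive_residues I q. real (card (pairs a))) \<le> E * A"
      unfolding pairs_def X_def E_def A_def by (rule sum_short_pairs_le_primitive[OF fin n q _ _ two]) (use R' in auto)
    finally have "(V / zeta (real n) - E - \<epsilon>) * A \<le> 2 * real (card (uncovered I q R))" by (simp add: algebra_simps)
    then show ?case unfolding V_def E_def A_def by simp
  qed
qed

text \<open>The last condition expresses that \<open>u\<close> is reduced against \<open>w\<close>.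
  It replaces one factor B by r in the count; without this saving the largest dyadic range would
  cost as much as the main term.\<close>

definition slab_pairs ::
  "'i set \<Rightarrow> nat \<Rightarrow> ('i \<Rightarrow> int) \<Rightarrow> real \<Rightarrow> real \<Rightarrow> real \<Rightarrow> real \<Rightarrow> (('i \<Rightarrow> int) \<times> ('i \<Rightarrow> int)) set" where
  "slab_pairs I q a r s A B = {(w, u) \<in> short_independent_pairs I q a A B.
     r \<le> real_of_int (width I w) \<and> real_of_int (width I w) \<le> s \<and> (\<exists>i\<in>I. \<bar>real_of_int (u i)\<bar> \<le> r)}"

text \<open>These are the left ends of the interval of length s - r that contains the coordinate
  w_c: r if w_c is the maximum and the minimum is 0, -s if w_c is the minimum and the maximum is 0,
  and w_j + r if w_c is the maximum and w_j the minimum.\<close>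

definition shell_offsets :: "'i set \<Rightarrow> real \<Rightarrow> real \<Rightarrow> (('i \<Rightarrow> int) \<Rightarrow> real) set" where
  "shell_offsets I r s = insert (\<lambda>g. r) (insert (\<lambda>g. - s) ((\<lambda>j g. real_of_int (g j) + r) ` I))"

text \<open>The width is attained as a difference of two coordinates, one of which may be the constant \<open>0\<close>.\<close>

lemma shell_coordinate:
  assumes fin: "finite I" and r: "r > 0" and w: "r \<le> real_of_int (width I w)" "real_of_int (width I w) \<le> s"
  obtains c z where "c \<in> I" "z \<in> shell_offsets I r s"
    "z (restrict w (I - {c})) \<le> real_of_int (w c)" "real_of_int (w c) \<le> z (restrict w (I - {c})) + (s - r)"
proof -
  define hi lo where "hi = Max (insert 0 (w ` I))" and "lo = Min (insert 0 (w ` I))"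
  have wd: "width I w = hi - lo" unfolding width_def hi_def lo_def ..
  have "hi = 0 \<or> (\<exists>i\<in>I. hi = w i)" "lo = 0 \<or> (\<exists>i\<in>I. lo = w i)"
    unfolding hi_def lo_def using Max_insert_0_attained[OF fin] Min_insert_0_attained[OF fin] by blast+
  then consider "hi = 0" "lo = 0" | c where "c \<in> I" "hi = w c" "lo = 0" | c where "c \<in> I" "hi = 0" "lo = w c"
    | c j where "c \<in> I" "j \<in> I" "hi = w c" "lo = w j" by blast
  then show ?thesis
  proof cases
    case 1
    then show ?thesis using w r wd by simp
  next
    case (2 c)
    then show ?thesis using that[of c "\<lambda>g. r"] w wd unfolding shell_offsets_def by auto
  next
    case (3 c)
    then show ?thesis using that[of c "\<lambda>g. - s"] w wd unfolding shell_offsets_def by auto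
  next
    case (4 c j)
    then have "j \<noteq> c" using w r wd by auto
    then show ?thesis using that[of c "\<lambda>g. real_of_int (g j) + r"] 4 w wd unfolding shell_offsets_def by auto
  qed
qed

lemma planar_box_mono: "A \<le> A' \<Longrightarrow> B \<le> B' \<Longrightarrow> planar_box A B \<subseteq> planar_box A' B'"
  unfolding planar_box_def by auto

lemma incidences_mono: "Q \<subseteq> Q' \<Longrightarrow> incidences q l l' Q \<subseteq> incidences q l l' Q'"
  unfolding incidences_def by auto

text \<open>There are n choices for the small coordinate of \<open>u\<close>, n for the confined
  coordinate of \<open>w\<close>, and n + 2 offsets. For each, the count is a product of areas in
  which s - r replaces one A and r one B; recentring the thin box doubles a side, hence 50 instead
  of 25. All boxes contain the square of size \<eta>, whose incidences span the plane, so the area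
  bound applies to them.\<close>

lemma card_slab_triples_le:
  fixes r s A B \<eta> :: real
  assumes fin: "finite I" and n: "card I = n" "n \<ge> 1" and q: "q > 0"
    and sp: "spans_plane (incidences q l l' (planar_box \<eta> \<eta>))"
    and \<eta>: "0 \<le> \<eta>" "\<eta> \<le> s - r" "\<eta> \<le> r" "\<eta> \<le> A" "\<eta> \<le> B" and r: "r > 0"
  defines "T \<equiv> {(a, w, u) \<in> proportional_triples I q l l'. (w, u) \<in> slab_pairs I q a r s A B}"
  shows "finite T" "real (card T) \<le> real n * real n * (real n + 2) * (50 ^ n * (s - r) * A ^ (n - 1) * r * B ^ (n - 1) / real q ^ n)"
proof -
  define K where "K i c z = {(a, w, u) \<in> T. \<bar>real_of_int (u i)\<bar> \<le> r \<and>
      z (restrict w (I - {c})) \<le> real_of_int (w c) \<and> real_of_int (w c) \<le> z (restrict w (I - {c})) + (s - r)}" for i c and z :: "('a \<Rightarrow> int) \<Rightarrow> real"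
  define M where "M = 50 ^ n * (s - r) * A ^ (n - 1) * r * B ^ (n - 1) / real q ^ n"
  have cover: "T \<subseteq> (\<Union>(i, c, z)\<in>I \<times> I \<times> shell_offsets I r s. K i c z)"
  proof
    fix x assume x: "x \<in> T"
    then obtain a w u where xx: "x = (a, w, u)" "(w, u) \<in> slab_pairs I q a r s A B" unfolding T_def by auto
    obtain i where i: "i \<in> I" "\<bar>real_of_int (u i)\<bar> \<le> r" using xx(2) unfolding slab_pairs_def by auto
    have wd: "r \<le> real_of_int (width I w)" "real_of_int (width I w) \<le> s" using xx(2) unfolding slab_pairs_def by auto
    obtain c z where "c \<in> I" "z \<in> shell_offsets I r s"
      "z (restrict w (I - {c})) \<le> real_of_int (w c)" "real_of_int (w c) \<le> z (restrict w (I - {c})) + (s - r)"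
      using shell_coordinate[OF fin r wd] .
    then have "x \<in> K i c z" using x i unfolding K_def xx(1) by auto
    then show "x \<in> (\<Union>(i, c, z)\<in>I \<times> I \<times> shell_offsets I r s. K i c z)"
      using i \<open>c \<in> I\<close> \<open>z \<in> _\<close> by blast
  qed
  have piece: "finite (K i c z)" "real (card (K i c z)) \<le> M" if ic: "i \<in> I" "c \<in> I" for i c z
  proof -
    define V where "V k = (if k = i then r else B)" for k
    define Q where "Q k = planar_box A (V k)" for k
    define Z where "Z g = {(x, y). z g \<le> real_of_int x \<and> real_of_int x \<le> z g + (s - r) \<and> \<bar>real_of_int y\<bar> \<le> V c}" for g
    have V: "\<eta> \<le> V k" "0 \<le> V k" for k using \<eta> unfolding V_def by auto
    have finZ: "finite (Z g)" for g
    proof (rule finite_subset)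
      show "Z g \<subseteq> {\<lfloor>z g\<rfloor>..\<lceil>z g + (s - r)\<rceil>} \<times> {-\<lceil>V c\<rceil>..\<lceil>V c\<rceil>}" unfolding Z_def by (auto; linarith)
    qed simp
    have plane: "spans_plane (incidences q l l' (planar_box A' B'))" if "\<eta> \<le> A'" "\<eta> \<le> B'" for A' B'
      by (rule spans_plane_mono[OF incidences_mono[OF planar_box_mono[OF that]] sp])
    have cQ: "real (card (incidences q l l' (Q k))) \<le> 25 * A * V k / q" for k
      using card_incidences_box[OF q plane[OF \<eta>(4) V(1)[of k]]] q unfolding Q_def by (simp add: field_simps)
    have cZ: "real (card (incidences q l l' (Z g))) \<le> 50 * (s - r) * V c / q" for g
    proof -
      have "card (incidences q l l' (Z g)) \<le> card (incidences q l l' (planar_box (s - r) (2 * V c)))"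
      proof (rule card_incidences_translate[OF q])
        fix x y x' y' assume "(x, y) \<in> Z g" "(x', y') \<in> Z g"
        then show "(x - x', y - y') \<in> planar_box (s - r) (2 * V c)" unfolding Z_def planar_box_def by auto
      qed
      then have "real (card (incidences q l l' (Z g))) \<le> real (card (incidences q l l' (planar_box (s - r) (2 * V c))))" by simp
      also have "\<dots> \<le> 25 * (s - r) * (2 * V c) / q"
        using card_incidences_box[OF q plane[of "s - r" "2 * V c"]] \<eta> V[of c] q by (simp add: field_simps)
      finally show ?thesis by (simp add: mult_ac)
    qed
    have sub: "K i c z \<subseteq> proportional_triples I q l l'" unfolding K_def T_def by auto
    have mem: "(\<forall>k\<in>I - {c}. (w k, u k) \<in> Q k) \<and> (w c, u c) \<in> Z (restrict w (I - {c}))" if "(a, w, u) \<in> K i c z" for a w u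
      using that ic unfolding K_def T_def slab_pairs_def short_independent_pairs_def Q_def Z_def planar_box_def V_def by auto
    note b = card_proportional_triples_le[where S = "K i c z" and Q = Q and Z = Z, OF fin ic(2) _ finZ cZ sub mem]
    show "finite (K i c z)" by (rule b(1)) (auto simp: Q_def)
    have "real (card (K i c z)) \<le> 50 * (s - r) * V c / q * (\<Prod>k\<in>I - {c}. real (card (incidences q l l' (Q k))))"
      by (rule b(2)) (auto simp: Q_def)
    also have "\<dots> \<le> 50 * (s - r) * V c / q * (\<Prod>k\<in>I - {c}. 50 * A * V k / q)"
    proof (intro mult_left_mono prod_mono conjI)
      show "real (card (incidences q l l' (Q k))) \<le> 50 * A * V k / q" for k
      proof -
        have "0 \<le> A * V k / q" using \<eta> V[of k] by simp
        then have "25 * A * V k / q \<le> 50 * A * V k / q" by simp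
        then show ?thesis using cQ[of k] by linarith
      qed
    qed (use \<eta> V in auto)
    also have "\<dots> = 50 ^ n * (s - r) * A ^ (n - 1) * (\<Prod>k\<in>I. V k) / real q ^ n"
    proof -
      have "(\<Prod>k\<in>I - {c}. 50 * A * V k / q) = (50 * A / q) ^ (n - 1) * (\<Prod>k\<in>I - {c}. V k)"
      proof -
        have "(\<Prod>k\<in>I - {c}. 50 * A * V k / q) = (\<Prod>k\<in>I - {c}. (50 * A / q) * V k)" by simp
        also have "\<dots> = (\<Prod>k\<in>I - {c}. 50 * A / q) * (\<Prod>k\<in>I - {c}. V k)" by (rule prod.distrib)
        finally show ?thesis using fin ic n by simp
      qed
      moreover have "(\<Prod>k\<in>I. V k) = V c * (\<Prod>k\<in>I - {c}. V k)" by (rule prod.remove[OF fin ic(2)])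
      moreover have "(50::real) ^ n = 50 * 50 ^ (n - 1)" "real q ^ n = real q * real q ^ (n - 1)"
        using n by (cases n; simp)+
      ultimately show ?thesis by (simp add: power_divide power_mult_distrib)
    qed
    also have "(\<Prod>k\<in>I. V k) = r * B ^ (n - 1)"
    proof -
      have "(\<Prod>k\<in>I. V k) = V i * (\<Prod>k\<in>I - {i}. V k)" by (rule prod.remove[OF fin ic(1)])
      also have "(\<Prod>k\<in>I - {i}. V k) = (\<Prod>k\<in>I - {i}. B)" by (rule prod.cong) (auto simp: V_def)
      finally show ?thesis using fin ic n by (simp add: V_def)
    qed
    finally show "real (card (K i c z)) \<le> M" unfolding M_def by (simp add: mult_ac)
  qed
  have M0: "M \<ge> 0" unfolding M_def using \<eta> r by auto
  have finO: "finite (shell_offsets I r s)" "card (shell_offsets I r s) \<le> n + 2"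
  proof -
    show "finite (shell_offsets I r s)" unfolding shell_offsets_def using fin by simp
    have "card ((\<lambda>j g. real_of_int (g j) + r) ` I) \<le> n" using card_image_le[OF fin] n by metis
    then show "card (shell_offsets I r s) \<le> n + 2" unfolding shell_offsets_def
      using fin by (auto simp: card_insert_if)
  qed
  have finX: "finite (I \<times> I \<times> shell_offsets I r s)" using fin finO by auto
  have finU: "finite (\<Union>(i, c, z)\<in>I \<times> I \<times> shell_offsets I r s. K i c z)" using finX piece(1) by (auto intro!: finite_UN_I)
  then show "finite T" using cover finite_subset by blast
  have "card T \<le> card (\<Union>(i, c, z)\<in>I \<times> I \<times> shell_offsets I r s. K i c z)" using cover finU by (rule card_mono[rotated])
  also have "\<dots> \<le> (\<Sum>(i, c, z)\<in>I \<times> I \<times> shell_offsets I r s. card (K i c z))"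
    using card_UN_le[OF finX, of "\<lambda>(i, c, z). K i c z"] by (simp add: case_prod_unfold)
  finally have "real (card T) \<le> (\<Sum>(i, c, z)\<in>I \<times> I \<times> shell_offsets I r s. real (card (K i c z)))"
    by (simp add: case_prod_unfold flip: of_nat_sum)
  also have "\<dots> \<le> (\<Sum>(i, c, z)\<in>I \<times> I \<times> shell_offsets I r s. M)"
    using piece(2) by (intro sum_mono) auto
  also have "\<dots> = real n * (real n * real (card (shell_offsets I r s))) * M"
    using n by (simp add: case_prod_unfold card_cartesian_product)
  also have "\<dots> \<le> real n * (real n * (real n + 2)) * M"
    using finO(2) M0 by (intro mult_right_mono mult_left_mono) (auto simp flip: of_nat_Suc)
  finally show "real (card T) \<le> real n * real n * (real n + 2) * (50 ^ n * (s - r) * A ^ (n - 1) * r * B ^ (n - 1) / real q ^ n)"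
    unfolding M_def by (simp only: mult.assoc)
qed

text \<open>Degenerate multipliers are estimated without the shell condition. That bound is worse by
  a constant only, whereas their proportion tends to 0, so they disappear in \<epsilon>. For all
  other multipliers the thin boxes obey the area bound.\<close>

lemma sum_slab_pairs_le:
  fixes r s A B \<epsilon> :: real
  assumes fin: "finite I" and n: "card I = n" "n \<ge> 3" and pos: "0 < r" "r < s" "0 < A" "0 < B" and \<epsilon>: "\<epsilon> > 0"
  shows "\<forall>\<^sub>F q in sequentially.
    (\<Sum>a\<in>residue_vectors I q. real (card (slab_pairs I q a (r * lattice_scale n q) (s * lattice_scale n q) (A * lattice_scale n q) (B * lattice_scale n q))))
     \<le> (real n * real n * (real n + 2) * (50 ^ n * (s - r) * A ^ (n - 1) * r * B ^ (n - 1)) + \<epsilon>) * real q ^ n"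
proof -
  define \<eta> where "\<eta> = min (min (s - r) r) (min A B)"
  have \<eta>: "0 < \<eta>" "\<eta> \<le> s - r" "\<eta> \<le> r" "\<eta> \<le> A" "\<eta> \<le> B" using pos unfolding \<eta>_def by auto
  define \<delta> where "\<delta> = \<epsilon> / (25 * A * B) ^ n"
  have \<delta>: "\<delta> > 0" "\<delta> * (25 * A * B) ^ n = \<epsilon>" unfolding \<delta>_def using \<epsilon> pos by auto
  define C where "C = real n * real n * (real n + 2) * (50 ^ n * (s - r) * A ^ (n - 1) * r * B ^ (n - 1))"
  have C0: "C \<ge> 0" unfolding C_def using pos by auto
  have ne: "I \<noteq> {}" using n by auto
  show ?thesis
    using few_degenerate_pairs[OF n(2) \<eta>(1) \<delta>(1)] eventually_gt_at_top[of 0]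
  proof eventually_elim
    case (elim q)
    have q: "q > 0" using elim by simp
    define X where "X = lattice_scale n q"
    have X: "X > 0" unfolding X_def by (rule lattice_scale_pos[OF q])
    define Bad where "Bad = degenerate_pairs q (\<eta> * X)"
    have bad: "real (card Bad) \<le> \<delta> * (real q)\<^sup>2" using elim(1) unfolding Bad_def X_def lattice_scale_def .
    define R where "R = {0..<int q}"
    have finR: "finite (R \<times> R)" unfolding R_def by simp
    have BadR: "Bad \<subseteq> R \<times> R" unfolding Bad_def R_def degenerate_pairs_def by auto
    define P where "P a = slab_pairs I q a (r * X) (s * X) (A * X) (B * X)" for a
    define T where "T l l' = {(a, w, u) \<in> proportional_triples I q l l'. (w, u) \<in> P a}" for l l'
    define D where "D = (25 * (A * X) * (B * X) / q) ^ n"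
    define G where "G = C * (X * X / real q) ^ n"
    have gen: "finite (T l l')" "real (card (T l l')) \<le> D" for l l'
    proof -
      have "T l l' \<subseteq> {(a, b, c) \<in> proportional_triples I q l l'. independent_pair I b c \<and>
          (\<forall>i\<in>I. \<bar>real_of_int (b i)\<bar> \<le> A * X \<and> \<bar>real_of_int (c i)\<bar> \<le> B * X)}"
        unfolding T_def P_def slab_pairs_def short_independent_pairs_def by auto
      from card_independent_triples_le[OF fin ne q _ _ this]
      show "finite (T l l')" "real (card (T l l')) \<le> D" unfolding D_def using pos X n by auto
    qed
    have good: "real (card (T l l')) \<le> G" if "(l, l') \<in> R \<times> R - Bad" for l l'
    proof -
      have sp: "spans_plane (incidences q l l' (planar_box (\<eta> * X) (\<eta> * X)))"
        using that unfolding Bad_def degenerate_pairs_def R_def by auto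
      have "real (card (T l l')) \<le> real n * real n * (real n + 2) *
          (50 ^ n * (s * X - r * X) * (A * X) ^ (n - 1) * (r * X) * (B * X) ^ (n - 1) / real q ^ n)"
        unfolding T_def P_def
      proof (rule card_slab_triples_le(2)[OF fin n(1) _ q sp])
        show "1 \<le> n" using n by simp
        show "\<eta> * X \<le> s * X - r * X" using \<eta>(2) X by (simp add: left_diff_distrib[symmetric])
      qed (use \<eta> X pos in auto)
      also have "\<dots> = G"
      proof -
        have Xn: "X ^ n = X * X ^ (n - 1)" using n by (cases n) auto
        have d: "s * X - r * X = (s - r) * X" by (simp add: left_diff_distrib)
        show ?thesis unfolding G_def C_def power_divide power_mult_distrib Xn d by (simp add: mult_ac)
      qed
      finally show ?thesis .
    qed
    have "(\<Sum>a\<in>residue_vectors I q. card (P a)) \<le> (\<Sum>(l, l')\<in>R \<times> R. card (T l l'))"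
      unfolding T_def R_def
      by (rule sum_card_pairs_le[OF fin q]) (use gen(1) in \<open>auto simp: P_def slab_pairs_def short_independent_pairs_def T_def\<close>)
    then have "(\<Sum>a\<in>residue_vectors I q. real (card (P a))) \<le> (\<Sum>(l, l')\<in>R \<times> R. real (card (T l l')))"
      by (simp add: case_prod_unfold flip: of_nat_sum)
    also have "\<dots> = (\<Sum>(l, l')\<in>Bad. real (card (T l l'))) + (\<Sum>(l, l')\<in>R \<times> R - Bad. real (card (T l l')))"
      using finR BadR by (subst sum.subset_diff) (auto simp: add.commute)
    also have "\<dots> \<le> (\<Sum>(l, l')\<in>Bad. D) + (\<Sum>(l, l')\<in>R \<times> R - Bad. G)"
      using gen(2) good by (intro add_mono sum_mono) auto
    also have "\<dots> \<le> (\<delta> * (real q)\<^sup>2) * D + (real q)\<^sup>2 * G"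
    proof (rule add_mono)
      have D0: "D \<ge> 0" unfolding D_def using pos X by auto
      show "(\<Sum>(l, l')\<in>Bad. D) \<le> (\<delta> * (real q)\<^sup>2) * D" using mult_right_mono[OF bad D0] by (simp add: case_prod_unfold)
      have G0: "G \<ge> 0" unfolding G_def using C0 X by auto
      have "(\<Sum>(l, l')\<in>R \<times> R - Bad. G) \<le> (\<Sum>(l, l')\<in>R \<times> R. G)" using finR G0 by (intro sum_mono2) auto
      also have "\<dots> = (real q)\<^sup>2 * G" unfolding R_def by (simp add: case_prod_unfold card_cartesian_product power2_eq_square)
      finally show "(\<Sum>(l, l')\<in>R \<times> R - Bad. G) \<le> (real q)\<^sup>2 * G" .
    qed
    also have "(\<delta> * (real q)\<^sup>2) * D = \<epsilon> * real q ^ n"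
    proof -
      have "(real q)\<^sup>2 * D = (25 * A * B) ^ n * real q ^ n"
        unfolding D_def X_def using lattice_scale_power2[of n q "25 * A * B"] n q by (simp add: mult_ac)
      then show ?thesis using \<delta>(2) by (metis mult.assoc)
    qed
    also have "(real q)\<^sup>2 * G = C * real q ^ n"
      unfolding G_def X_def using lattice_scale_power2[of n q 1] n q by simp
    finally show ?case unfolding P_def X_def C_def by (simp add: algebra_simps)
  qed
qed

section \<open>From failure of covering to short vectors\<close>

lemma covers_mono: "covers I q a s \<Longrightarrow> s \<le> t \<Longrightarrow> covers I q a t"
  unfolding covers_def by (meson order.trans)

lemma flatness_const_nonneg: "0 \<le> flatness_const n"
  unfolding flatness_const_def using covering_const_nonneg by simp

lemma dyadic_scale:
  fixes x y \<nu> :: real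
  assumes "\<nu> / 2 ^ J \<le> x" "x < y" "y \<le> \<nu>"
  obtains j where "j \<le> J" "\<nu> / 2 ^ j / 2 < y" "y \<le> \<nu> / 2 ^ j"
proof -
  have ex: "\<exists>j. \<nu> / 2 ^ j < y" using assms by (intro exI[of _ J]) linarith
  define k where "k = (LEAST j. \<nu> / 2 ^ j < y)"
  have k: "\<nu> / 2 ^ k < y" "k \<le> J" unfolding k_def using ex assms
    by (auto intro: LeastI_ex Least_le)
  have "k \<noteq> 0" using k(1) assms(3) by (intro notI) simp
  then obtain j where j: "k = Suc j" by (cases k) auto
  have "\<not> \<nu> / 2 ^ j < y" using not_less_Least[of j "\<lambda>j. \<nu> / 2 ^ j < y"] j unfolding k_def by simp
  then show ?thesis using that[of j] k j by (simp add: not_less)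
qed

text \<open>
  If \<open>D\<close> denotes the covering constant then \<open>R < 1 / \<omega> + D / \<upsilon>\<close> for the normalised width \<open>\<omega>\<close> of
  the shortest vector and the normalised height \<open>\<upsilon>\<close> of a second one. Either \<open>\<omega>\<close> is below the
  threshold, or both vectors are short, or \<open>\<omega>\<close> lies in a shell of thickness proportional to \<open>1 / \<upsilon>\<close>.
\<close>

lemma uncovered_cases:
  fixes R \<theta> D :: real
  assumes fin: "finite I" and n: "card I = n" "n \<ge> 2" and q: "q > 0" and R: "R > 0" and \<theta>: "0 < \<theta>" "\<theta> \<le> 1"
    and D: "D = flatness_const n + 1" and J: "2 * D / (R * \<theta>) / 2 ^ J \<le> 4 * D / R"
    and a: "a \<in> uncovered I q R"
  defines "X \<equiv> lattice_scale n q" and "\<nu> \<equiv> (\<lambda>j::nat. 2 * D / (R * \<theta>) / 2 ^ j)"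
  shows "(\<exists>w\<in>primitive_multiples I q a. real_of_int (width I w) \<le> (1 + \<theta>) / R * X) \<or>
    (\<exists>p. p \<in> short_independent_pairs I q a (4 * D / R * X) (4 * D / R * X)) \<or>
    (\<exists>p. \<exists>j\<le>J. p \<in> slab_pairs I q a (1 / R * X) ((1 + 4 * D / (R * \<nu> j)) / R * X) (2 / R * X) (\<nu> j * X))"
proof -
  have ap: "a \<in> primitive_residues I q" using a unfolding uncovered_def by simp
  have ne: "I \<noteq> {}" using n by auto
  have X: "X > 0" unfolding X_def by (rule lattice_scale_pos[OF q])
  have D1: "D \<ge> 1" using D flatness_const_nonneg by simp
  define Q where "Q = real q powr (1 / real n)"
  have Q: "Q > 0" "X * Q = real q" unfolding Q_def X_def using q lattice_scale_root[OF q] by auto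
  have c2: "card I \<ge> 2" using n by simp
  obtain w u i where w: "w \<in> primitive_multiples I q a" and u: "u \<in> multiples_lattice I q a"
    and i: "i \<in> I" "height I w = \<bar>w i\<bar>" "2 * \<bar>u i\<bar> \<le> \<bar>w i\<bar>" "\<exists>j\<in>I. w i * u j \<noteq> w j * u i"
    and wu: "height I w \<le> height I u"
    and c: "covers I q a (real q / width I w + flatness_const (card I) * real q / height I u)"
    using covers_of_short_pair[OF fin c2 q ap] by blast
  define \<omega> where "\<omega> = real_of_int (width I w) / X"
  define \<upsilon> where "\<upsilon> = real_of_int (height I u) / X"
  have wM: "w \<in> multiples_lattice I q a" using w unfolding primitive_multiples_def by simp
  have "height I w > 0" using w height_pos_iff[OF fin ne] unfolding primitive_multiples_def by auto
  then have pos: "\<omega> > 0" "\<upsilon> > 0" unfolding \<omega>_def \<upsilon>_def using wu height_le_width[OF fin ne, of w] X by auto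
  have XX: "real_of_int (width I w) = \<omega> * X" "real_of_int (height I u) = \<upsilon> * X" unfolding \<omega>_def \<upsilon>_def using X by auto
  have ind: "independent_pair I w u" using i unfolding independent_pair_def by blast
  have wb: "\<bar>real_of_int (w k)\<bar> \<le> \<omega> * X" "\<bar>real_of_int (w k)\<bar> \<le> \<upsilon> * X" "\<bar>real_of_int (u k)\<bar> \<le> \<upsilon> * X" if "k \<in> I" for k
    using abs_le_width[OF fin that, of w] height_ge[OF fin that, of w] height_ge[OF fin that, of u] wu
    unfolding XX[symmetric] by linarith+
  \<comment> \<open>Failure at radius R q^(1/n) contradicts covering at the radius obtained from
    \<open>w\<close> and \<open>u\<close>, which equals q^(1/n) times 1/\<omega> plus the flatness
    constant over \<upsilon>.\<close>
  have main: "R < 1 / \<omega> + D / \<upsilon>"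
  proof -
    have "\<not> real q / width I w + flatness_const (card I) * real q / height I u \<le> R * Q"
      using a c covers_mono unfolding uncovered_def Q_def n(1) by blast
    then have "R * Q < real q / width I w + flatness_const n * real q / height I u" using n by simp
    also have "\<dots> = (1 / \<omega> + flatness_const n / \<upsilon>) * Q"
      unfolding XX Q(2)[symmetric] using X pos by (simp add: field_simps)
    finally have "R < 1 / \<omega> + flatness_const n / \<upsilon>" using Q(1) by simp
    moreover have "flatness_const n / \<upsilon> \<le> D / \<upsilon>" using D pos by (simp add: divide_right_mono)
    ultimately show ?thesis by linarith
  qed
  consider "\<omega> \<le> (1 + \<theta>) / R" | "\<upsilon> \<le> 4 * D / R" | "(1 + \<theta>) / R < \<omega>" "4 * D / R < \<upsilon>" by linarith
  then show ?thesis
  proof cases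
    case 1
    then have "real_of_int (width I w) \<le> (1 + \<theta>) / R * X" unfolding XX using X by (intro mult_right_mono) auto
    then show ?thesis using w by blast
  next
    case 2
    then have "\<upsilon> * X \<le> 4 * D / R * X" using X by (intro mult_right_mono) auto
    then have "(w, u) \<in> short_independent_pairs I q a (4 * D / R * X) (4 * D / R * X)"
      unfolding short_independent_pairs_def using wM u ind wb by (auto intro: order.trans)
    then show ?thesis by blast
  next
    case 3
    have "D / \<upsilon> \<le> R / 4" using 3(2) pos R D1 by (simp add: field_simps)
    then have w34: "3 / 4 * R < 1 / \<omega>" using main by linarith
    then have w2: "\<omega> < 2 / R" using pos R by (simp add: field_simps)
    have w1: "1 / R \<le> \<omega>"
    proof -
      have "1 / R \<le> (1 + \<theta>) / R" using \<theta> R by (simp add: divide_right_mono)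
      then show ?thesis using 3 by linarith
    qed
    \<comment> \<open>By the margin \<theta>, 1/\<omega> falls short of R by at least R \<theta> /
      2. The term D/\<upsilon> has to make up for it, which gives the upper end 2 D / (R \<theta>)
      of the dyadic range.\<close>
    have "1 / \<omega> < R / (1 + \<theta>)" using 3(1) pos R \<theta> by (simp add: field_simps)
    moreover have "R / (1 + \<theta>) \<le> R - R * \<theta> / 2"
    proof -
      have "1 \<le> (1 - \<theta> / 2) * (1 + \<theta>)" using \<theta> mult_left_mono[of \<theta> 1 \<theta>] by (simp add: algebra_simps)
      then have "R * 1 \<le> R * ((1 - \<theta> / 2) * (1 + \<theta>))" using R by (intro mult_left_mono) auto
      then have "R \<le> (R - R * \<theta> / 2) * (1 + \<theta>)" by (simp add: algebra_simps)
      moreover have "0 < 1 + \<theta>" using \<theta> by simp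
      ultimately show ?thesis using pos_divide_le_eq[of "1 + \<theta>" R "R - R * \<theta> / 2"] by blast
    qed
    ultimately have "R * \<theta> / 2 < D / \<upsilon>" using main by linarith
    then have ub: "\<upsilon> \<le> 2 * D / (R * \<theta>)" using pos R \<theta> by (simp add: field_simps)
    obtain j where j: "j \<le> J" "2 * D / (R * \<theta>) / 2 ^ j / 2 < \<upsilon>" "\<upsilon> \<le> 2 * D / (R * \<theta>) / 2 ^ j"
      using dyadic_scale[OF J 3(2) ub] .
    have jn: "\<nu> j / 2 < \<upsilon>" "\<upsilon> \<le> \<nu> j" "\<nu> j > 0" using j pos unfolding \<nu>_def by linarith+
    \<comment> \<open>From \<omega> R (1 - x) < 1 and (1 - x) (1 + 2 x) >= 1 follows \<omega> R < 1
      + 2 x: the shell has relative thickness 2 x, proportional to 1/\<upsilon>.\<close>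
    define x where "x = D / (R * \<upsilon>)"
    have x: "0 < x" "x \<le> 1/4" unfolding x_def using 3(2) pos R D1 by (auto simp: field_simps)
    have "\<omega> * R * (1 - x) < 1"
    proof -
      have "R * (1 - x) = R - D / \<upsilon>" unfolding x_def using R pos by (simp add: field_simps)
      then have "R * (1 - x) < 1 / \<omega>" using main by linarith
      then show ?thesis using pos by (simp add: field_simps)
    qed
    then have "\<omega> * R * (1 - x) * (1 + 2 * x) < 1 * (1 + 2 * x)" using x by (intro mult_strict_right_mono) auto
    moreover have "\<omega> * R * 1 \<le> \<omega> * R * ((1 - x) * (1 + 2 * x))"
    proof -
      have "0 \<le> x * (1 - 2 * x)" using x by (intro mult_nonneg_nonneg) auto
      then have "1 \<le> (1 - x) * (1 + 2 * x)" by (simp add: algebra_simps)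
      then show ?thesis using pos R by (intro mult_left_mono) auto
    qed
    ultimately have "\<omega> * R < 1 + 2 * x" by (simp add: mult.assoc)
    also have "2 * x \<le> 4 * D / (R * \<nu> j)"
    proof -
      have "2 * x = 4 * D / (R * (2 * \<upsilon>))" unfolding x_def by simp
      also have "\<dots> \<le> 4 * D / (R * \<nu> j)" using jn R D1 pos by (intro divide_left_mono mult_left_mono) auto
      finally show ?thesis .
    qed
    finally have "\<omega> * R \<le> 1 + 4 * D / (R * \<nu> j)" by simp
    then have w3: "\<omega> \<le> (1 + 4 * D / (R * \<nu> j)) / R" using R by (simp add: pos_le_divide_eq)
    have "(w, u) \<in> slab_pairs I q a (1 / R * X) ((1 + 4 * D / (R * \<nu> j)) / R * X) (2 / R * X) (\<nu> j * X)"
      unfolding slab_pairs_def short_independent_pairs_def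
    proof (intro CollectI case_prodI conjI ballI wM u ind)
      show "\<bar>real_of_int (w k)\<bar> \<le> 2 / R * X" if "k \<in> I" for k
        using wb(1)[OF that] mult_right_mono[of \<omega> "2 / R" X] w2 X by linarith
      show "\<bar>real_of_int (u k)\<bar> \<le> \<nu> j * X" if "k \<in> I" for k
        using wb(3)[OF that] mult_right_mono[of \<upsilon> "\<nu> j" X] jn X by linarith
      show "1 / R * X \<le> real_of_int (width I w)" unfolding XX using w1 X by (intro mult_right_mono) auto
      show "real_of_int (width I w) \<le> (1 + 4 * D / (R * \<nu> j)) / R * X" unfolding XX using w3 X by (intro mult_right_mono) auto
      \<comment> \<open>The reduction of \<open>u\<close> against \<open>w\<close> is used here:
        |u_i| <= |w_i| / 2, while the width of \<open>w\<close> is below 2 X / R.\<close>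
      have "2 * \<bar>real_of_int (u i)\<bar> \<le> \<bar>real_of_int (w i)\<bar>" using i(3) by linarith
      also have "\<dots> \<le> 2 / R * X" using wb(1)[OF i(1)] mult_right_mono[of \<omega> "2 / R" X] w2 X by linarith
      finally have "\<bar>real_of_int (u i)\<bar> \<le> 1 / R * X" by simp
      then show "\<exists>i\<in>I. \<bar>real_of_int (u i)\<bar> \<le> 1 / R * X" using i(1) by blast
    qed
    then show ?thesis using j(1) by blast
  qed
qed

lemma card_primitive_width_ball:
  fixes r :: real
  assumes fin: "finite I" and r: "r > 0" and X: "X > 0" and w: "w \<in> primitive_multiples I q a" "real_of_int (width I w) \<le> r * X"
  shows "2 \<le> card (primitive_multiples I q a \<inter> scaled_points I (width_ball I r) X)"
proof -
  obtain m where m: "m = nat \<lfloor>r * X\<rfloor>" by blast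
  define P where "P = primitive_multiples I q a \<inter> scaled_points I (width_ball I r) X"
  have P: "P = primitive_multiples I q a \<inter> ({b \<in> extensional I. width I b \<le> int m} - {\<lambda>i\<in>I. 0})"
    unfolding P_def scaled_width_ball[OF fin X r] m ..
  have finP: "finite P" using finite_subset[OF _ card_width_le(1)[OF fin, of m]] unfolding P by blast
  have wd: "width I w \<le> int m" using w(2) r X unfolding m by (simp add: le_floor_iff)
  define v where "v = (\<lambda>i\<in>I. - w i)"
  have nz: "\<exists>i\<in>I. w i \<noteq> 0" and ext: "w \<in> extensional I" using w unfolding primitive_multiples_def multiples_lattice_def by auto
  then obtain i where i: "i \<in> I" "w i \<noteq> 0" by blast
  have "w \<in> P" unfolding P using w(1) wd ext i by auto
  moreover have "v \<in> P"
  proof -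
    have "width I v \<le> int m"
      using wd unfolding v_def width_restrict width_le_iff[OF fin] by auto
    moreover have "v \<noteq> (\<lambda>i\<in>I. 0)" proof
      assume "v = (\<lambda>i\<in>I. 0)"
      then have "v i = 0" using i by simp
      then show False using i unfolding v_def by simp
    qed
    moreover have "v \<in> extensional I" unfolding v_def by simp
    ultimately show ?thesis using primitive_multiples_uminus[OF w(1)] unfolding P v_def[symmetric] by blast
  qed
  ultimately have "card {w, v} \<le> card P" using finP by (intro card_mono) blast+
  moreover have "w i \<noteq> v i" using i unfolding v_def by simp
  then have "w \<noteq> v" by blast
  then have "card {w, v} = 2" by simp
  ultimately show ?thesis unfolding P_def by simp
qed

lemma sum_indicator_uncovered:
  assumes "finite I" shows "(\<Sum>a\<in>primitive_residues I q. if a \<in> uncovered I q R then 1 else 0) = real (card (uncovered I q R))"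
proof -
  have "{a \<in> primitive_residues I q. a \<in> uncovered I q R} = uncovered I q R" unfolding uncovered_def by auto
  then show ?thesis
    using sum.inter_filter[OF finite_primitive_residues[OF assms, of q], of "\<lambda>_. 1::real" "\<lambda>a. a \<in> uncovered I q R"] by simp
qed

text \<open>Each failure is charged to primitive vectors in the enlarged width ball, of which there
  are at least two because of the sign, or to a pair of short vectors, or to a pair in one of the
  dyadic shells.\<close>

lemma uncovered_le:
  fixes R \<theta> D \<epsilon> :: real
  assumes fin: "finite I" and n: "card I = n" "n \<ge> 2" and R: "R > 0" and \<theta>: "0 < \<theta>" "\<theta> \<le> 1"
    and D: "D = flatness_const n + 1" and \<epsilon>: "\<epsilon> > 0"
    and two: "n = 2 \<Longrightarrow> 2 * (4 * D / R) * (4 * D / R) < 1" "n = 2 \<Longrightarrow> 2 * (2 / R) * (2 * D / (R * \<theta>)) < 1"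
  shows "\<forall>\<^sub>F q in sequentially. real (card (uncovered I q R)) \<le>
    ((real n + 1) * ((1 + \<theta>) / R) ^ n / (2 * zeta (real n))
     + (if n = 2 then 0 else 4 * (25 * (4 * D / R) * (4 * D / R)) ^ n
        + 32 * (real n * real n * (real n + 2)) * 50 ^ n * 2 ^ (n - 1) * D / R ^ (n + 2) * (2 * D / (R * \<theta>)) ^ (n - 2))
     + \<epsilon>) * real (card (primitive_residues I q))"
proof -
  have D1: "D \<ge> 1" using D flatness_const_nonneg by simp
  define \<nu> where "\<nu> = (\<lambda>j::nat. 2 * D / (R * \<theta>) / 2 ^ j)"
  have \<nu>: "\<nu> j > 0" "\<nu> j \<le> \<nu> 0" for j unfolding \<nu>_def using D1 R \<theta> by (auto intro!: divide_left_mono)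
  \<comment> \<open>The number of dyadic ranges depends on \<theta> and not on q, so finitely many
    statements for large q are combined.\<close>
  define J where "J = nat \<lceil>1 / \<theta>\<rceil>"
  have J: "2 * D / (R * \<theta>) / 2 ^ J \<le> 4 * D / R"
  proof -
    have "1 / \<theta> \<le> real J" unfolding J_def by linarith
    also have "\<dots> \<le> 2 ^ J" using of_nat_less_two_power[of J, where 'a = real] by simp
    finally have "1 / (\<theta> * 2 ^ J) \<le> 1" using \<theta> by (simp add: field_simps)
    then have "2 * D / R * (1 / (\<theta> * 2 ^ J)) \<le> 2 * D / R * 1" using D1 R by (intro mult_left_mono) auto
    also have "\<dots> \<le> 4 * D / R" using D1 R by (simp add: divide_right_mono)
    finally show ?thesis by simp
  qed
  define V where "V = (real n + 1) * ((1 + \<theta>) / R) ^ n"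
  define W where "W = width_ball I ((1 + \<theta>) / R)"
  have rW: "(1 + \<theta>) / R > 0" using R \<theta> by simp
  have fm: "\<forall>\<^sub>F q in sequentially.
    \<bar>(\<Sum>a\<in>primitive_residues I q. real (card (primitive_multiples I q a \<inter> scaled_points I W (lattice_scale n q))))
       - V / zeta (real n) * real (card (primitive_residues I q))\<bar> \<le> \<epsilon> * real (card (primitive_residues I q))"
    unfolding W_def V_def using n rW \<epsilon>
    by (intro first_moment_bounded[OF fin n(1,2), of "(1 + \<theta>) / R"] card_width_ball_tendsto fin) (auto simp: width_ball_def)
  define sp where "sp j = (1 + 4 * D / (R * \<nu> j)) / R" for j
  define T where "T q j a = slab_pairs I q a (1 / R * lattice_scale n q) (sp j * lattice_scale n q) (2 / R * lattice_scale n q) (\<nu> j * lattice_scale n q)" for q j a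
  define H where "H = 4 * (real n * real n * (real n + 2)) * 50 ^ n * 2 ^ (n - 1) * (4 * D) / R ^ (n + 2)"
  define \<delta> where "\<delta> = \<epsilon> / (8 * (real J + 1))"
  have \<delta>: "\<delta> > 0" unfolding \<delta>_def using \<epsilon> by simp
  have slab: "\<forall>\<^sub>F q in sequentially. \<forall>j\<in>{..J}. n \<noteq> 2 \<longrightarrow>
     (\<Sum>a\<in>residue_vectors I q. real (card (T q j a))) \<le> (H / 4 * \<nu> j ^ (n - 2) + \<delta>) * real q ^ n"
  proof (cases "n = 2")
    case False
    then have n3: "n \<ge> 3" using n by simp
    show ?thesis
    proof (intro eventually_ball_finite ballI)
      fix j
      have sr: "sp j - 1 / R = 4 * D / (R * \<nu> j) / R" unfolding sp_def by (simp add: add_divide_distrib)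
      have pos: "0 < 4 * D / (R * \<nu> j) / R" using D1 R \<nu>(1)[of j] by simp
      \<comment> \<open>The thickness 4 D / (R^2 \<nu>_j) of the shell cancels one of the n - 1
        factors \<nu>_j, which leaves the exponent n - 2.\<close>
      have e: "real n * real n * (real n + 2) * (50 ^ n * (sp j - 1 / R) * (2 / R) ^ (n - 1) * (1 / R) * \<nu> j ^ (n - 1)) = H / 4 * \<nu> j ^ (n - 2)"
      proof -
        have p1: "\<nu> j ^ (n - 1) = \<nu> j * \<nu> j ^ (n - 2)" using n3 by (metis Suc_1 Suc_diff_le diff_Suc_1 diff_Suc_Suc n(2) power_Suc)
        have p2: "R ^ (n + 2) = R * R * R * R ^ (n - 1)" using n by (cases n) (auto simp: power_add)
        show ?thesis unfolding sr H_def p1 p2 using R \<nu>(1)[of j] by (simp add: power_divide field_simps)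
      qed
      have "\<forall>\<^sub>F q in sequentially. (\<Sum>a\<in>residue_vectors I q. real (card (T q j a)))
         \<le> (real n * real n * (real n + 2) * (50 ^ n * (sp j - 1 / R) * (2 / R) ^ (n - 1) * (1 / R) * \<nu> j ^ (n - 1)) + \<delta>) * real q ^ n"
        unfolding T_def by (rule sum_slab_pairs_le[OF fin n(1) n3]) (use R \<nu>(1)[of j] sr pos \<delta> in auto)
      then show "\<forall>\<^sub>F q in sequentially. n \<noteq> 2 \<longrightarrow> (\<Sum>a\<in>residue_vectors I q. real (card (T q j a))) \<le> (H / 4 * \<nu> j ^ (n - 2) + \<delta>) * real q ^ n"
        unfolding e by (rule eventually_mono) auto
    qed simp
  qed simp
  show ?thesis using fm slab eventually_gt_at_top[of 0]
  proof eventually_elim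
    case (elim q)
    have q: "q > 0" using elim by simp
    define X where "X = lattice_scale n q"
    have X: "X > 0" unfolding X_def by (rule lattice_scale_pos[OF q])
    define A where "A = real (card (primitive_residues I q))"
    have A: "real q ^ n \<le> 4 * A" unfolding A_def using card_primitive_residues_ge[OF fin _ q] n by simp
    define P where "P a = primitive_multiples I q a \<inter> scaled_points I W X" for a
    define Sh where "Sh a = short_independent_pairs I q a (4 * D / R * X) (4 * D / R * X)" for a
    define Sm where "Sm a = short_independent_pairs I q a (2 / R * X) (\<nu> 0 * X)" for a
    have TSm: "T q j a \<subseteq> Sm a" for j a
      unfolding T_def Sm_def X_def[symmetric] slab_pairs_def short_independent_pairs_def
      using \<nu>(2)[of j] X by (auto intro: order.trans[OF _ mult_right_mono[of "\<nu> j" "\<nu> 0" X]])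
    have finT: "finite (T q j a)" and finSh: "finite (Sh a)" and finSm: "finite (Sm a)" for j a
      using finite_short_independent_pairs[OF fin] finite_subset[OF TSm] unfolding Sh_def Sm_def by auto
    \<comment> \<open>In the plane all slab pairs lie in the single set \<open>Sm\<close>, which the
      determinant shows to be empty; for n >= 3 they are summed over the dyadic ranges.\<close>
    define E where "E a = (if n = 2 then real (card (Sm a)) else (\<Sum>j\<in>{..J}. real (card (T q j a))))" for a
    have bound: "(if a \<in> uncovered I q R then 1 else 0) \<le> real (card (P a)) / 2 + real (card (Sh a)) + E a" for a
    proof -
      have E0: "E a \<ge> 0" unfolding E_def by (auto intro: sum_nonneg)
      show ?thesis
      proof (cases "a \<in> uncovered I q R")
      case True
      have "2 \<le> card (P a) \<or> 1 \<le> card (Sh a) \<or> 1 \<le> E a"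
        using uncovered_cases[OF fin n q R \<theta> D J True]
      proof (elim disjE)
        assume "\<exists>w\<in>primitive_multiples I q a. real_of_int (width I w) \<le> (1 + \<theta>) / R * lattice_scale n q"
        then show ?thesis unfolding P_def W_def using card_primitive_width_ball[OF fin rW X] unfolding X_def by blast
      next
        assume "\<exists>p. p \<in> short_independent_pairs I q a (4 * D / R * lattice_scale n q) (4 * D / R * lattice_scale n q)"
        then have "Sh a \<noteq> {}" unfolding Sh_def X_def by blast
        then have "card (Sh a) > 0" using finSh card_gt_0_iff by blast
        then show ?thesis by simp
      next
        assume "\<exists>p. \<exists>j\<le>J. p \<in> slab_pairs I q a (1 / R * lattice_scale n q) ((1 + 4 * D / (R * (2 * D / (R * \<theta>) / 2 ^ j))) / R * lattice_scale n q)
           (2 / R * lattice_scale n q) (2 * D / (R * \<theta>) / 2 ^ j * lattice_scale n q)"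
        then obtain p j where j: "j \<le> J" "p \<in> T q j a" unfolding T_def sp_def \<nu>_def by blast
        then have c: "card (T q j a) \<ge> 1" using finT by (metis One_nat_def Suc_leI card_gt_0_iff empty_iff)
        have "1 \<le> E a"
        proof (cases "n = 2")
          case True
          have "card (T q j a) \<le> card (Sm a)" using TSm finSm by (intro card_mono)
          then show ?thesis unfolding E_def using c True by simp
        next
          case False
          have "real (card (T q j a)) \<le> (\<Sum>j\<in>{..J}. real (card (T q j a)))" using j by (intro member_le_sum) auto
          then show ?thesis unfolding E_def using c False by simp
        qed
        then show ?thesis by simp
      qed
      then show ?thesis using True E0 by auto
      qed (use E0 in simp)
    qed
    have "real (card (uncovered I q R)) \<le> (\<Sum>a\<in>primitive_residues I q. real (card (P a)) / 2 + real (card (Sh a)) + E a)"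
      unfolding sum_indicator_uncovered[OF fin, symmetric] by (intro sum_mono bound)
    also have "\<dots> = (\<Sum>a\<in>primitive_residues I q. real (card (P a))) / 2 + (\<Sum>a\<in>primitive_residues I q. real (card (Sh a))) + (\<Sum>a\<in>primitive_residues I q. E a)"
      by (simp add: sum.distrib sum_divide_distrib)
    also have "\<dots> \<le> (V / zeta (real n) + \<epsilon>) * A / 2 + (if n = 2 then 0 else 4 * (25 * (4 * D / R) * (4 * D / R)) ^ n) * A
        + ((if n = 2 then 0 else 2 * H * \<nu> 0 ^ (n - 2)) + \<epsilon> / 2) * A"
    proof (intro add_mono)
      show "(\<Sum>a\<in>primitive_residues I q. real (card (P a))) / 2 \<le> (V / zeta (real n) + \<epsilon>) * A / 2"
        using elim(1) unfolding P_def X_def A_def by (simp add: distrib_right abs_le_iff)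
      show "(\<Sum>a\<in>primitive_residues I q. real (card (Sh a))) \<le> (if n = 2 then 0 else 4 * (25 * (4 * D / R) * (4 * D / R)) ^ n) * A"
        unfolding Sh_def X_def A_def by (rule sum_short_pairs_le_primitive[OF fin n q _ _ two(1)]) (use R D1 in auto)
      show "(\<Sum>a\<in>primitive_residues I q. E a) \<le> ((if n = 2 then 0 else 2 * H * \<nu> 0 ^ (n - 2)) + \<epsilon> / 2) * A"
      proof (cases "n = 2")
        case True
        have "(\<Sum>a\<in>primitive_residues I q. real (card (Sm a))) \<le> (if n = 2 then 0 else 4 * (25 * (2 / R) * \<nu> 0) ^ n) * A"
          unfolding Sm_def X_def A_def
          by (rule sum_short_pairs_le_primitive[OF fin n q]) (use R \<nu>(1)[of 0] two(2) in \<open>auto simp: \<nu>_def\<close>)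
        moreover have "0 \<le> \<epsilon> * real (card (primitive_residues I q))" using \<epsilon> by simp
        ultimately show ?thesis using True unfolding E_def A_def by simp
      next
        case False
        have "(\<Sum>a\<in>primitive_residues I q. E a) = (\<Sum>j\<in>{..J}. \<Sum>a\<in>primitive_residues I q. real (card (T q j a)))"
          unfolding E_def using False by (simp add: sum.swap[of _ "{..J}"])
        also have "\<dots> \<le> (\<Sum>j\<in>{..J}. \<Sum>a\<in>residue_vectors I q. real (card (T q j a)))"
          using primitive_residues_subset finite_residue_vectors[OF fin] by (intro sum_mono sum_mono2) auto
        also have "\<dots> \<le> (\<Sum>j\<in>{..J}. (H / 4 * \<nu> j ^ (n - 2) + \<delta>) * real q ^ n)"
          using elim(2) False by (intro sum_mono) auto
        also have "\<dots> = (H / 4 * (\<Sum>j\<in>{..J}. \<nu> j ^ (n - 2)) + (real J + 1) * \<delta>) * real q ^ n"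
          unfolding sum_distrib_right[symmetric] sum.distrib sum_distrib_left[symmetric] by simp
        also have "\<dots> \<le> (H / 4 * (2 * \<nu> 0 ^ (n - 2)) + \<epsilon> / 8) * (4 * A)"
        proof (rule mult_mono)
          have H0: "H \<ge> 0" unfolding H_def using D1 R by simp
          \<comment> \<open>As n - 2 >= 1 here, the powers decrease at least by the factor 1/2 from
            one range to the next, and the largest range dominates.\<close>
          have "(\<Sum>j\<in>{..J}. \<nu> j ^ (n - 2)) \<le> (\<Sum>j\<in>{..J}. \<nu> 0 ^ (n - 2) * (1/2) ^ j)"
          proof (rule sum_mono)
            fix j
            have "\<nu> j ^ (n - 2) = \<nu> 0 ^ (n - 2) * ((1/2) ^ j) ^ (n - 2)"
              unfolding \<nu>_def by (simp add: power_divide power_mult_distrib)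
            also have "((1/2::real) ^ j) ^ (n - 2) \<le> ((1/2) ^ j) ^ 1"
              using False n by (intro power_decreasing) (auto simp: power_le_one)
            finally show "\<nu> j ^ (n - 2) \<le> \<nu> 0 ^ (n - 2) * (1/2) ^ j" using \<nu>(1)[of 0] by (simp add: mult_left_mono)
          qed
          also have "\<dots> \<le> \<nu> 0 ^ (n - 2) * 2"
          proof -
            have "(\<Sum>j\<in>{..J}. (1/2::real) ^ j) = 2 - (1/2) ^ J"
              by (induction J) (auto simp: field_simps)
            then have "(\<Sum>j\<in>{..J}. (1/2::real) ^ j) \<le> 2" by simp
            then show ?thesis unfolding sum_distrib_left[symmetric] using \<nu>(1)[of 0] by (intro mult_left_mono) auto
          qed
          finally have "H / 4 * (\<Sum>j\<in>{..J}. \<nu> j ^ (n - 2)) \<le> H / 4 * (2 * \<nu> 0 ^ (n - 2))"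
            using H0 by (intro mult_left_mono) (auto simp: mult.commute)
          moreover have "(real J + 1) * \<delta> = \<epsilon> / 8" unfolding \<delta>_def by (simp add: field_simps)
          ultimately show "H / 4 * (\<Sum>j\<in>{..J}. \<nu> j ^ (n - 2)) + (real J + 1) * \<delta> \<le> H / 4 * (2 * \<nu> 0 ^ (n - 2)) + \<epsilon> / 8" by simp
          show "0 \<le> H / 4 * (2 * \<nu> 0 ^ (n - 2)) + \<epsilon> / 8" using H0 \<epsilon> \<nu>(1)[of 0] by simp
        qed (use A in auto)
        also have "\<dots> = (2 * H * \<nu> 0 ^ (n - 2) + \<epsilon> / 2) * A" by (simp add: algebra_simps)
        finally show ?thesis using False by simp
      qed
    qed
    also have "\<dots> = (V / (2 * zeta (real n)) + (if n = 2 then 0 else 4 * (25 * (4 * D / R) * (4 * D / R)) ^ n + 2 * H * \<nu> 0 ^ (n - 2)) + \<epsilon>) * A"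
    proof -
      have z: "(z + \<epsilon>) * A / 2 + s * A + (t + \<epsilon> / 2) * A = (z / 2 + (s + t) + \<epsilon>) * A" for z s t
        by (simp add: algebra_simps add_divide_distrib)
      show ?thesis unfolding z by simp
    qed
    also have "2 * H * \<nu> 0 ^ (n - 2) = 32 * (real n * real n * (real n + 2)) * 50 ^ n * 2 ^ (n - 1) * D / R ^ (n + 2) * (2 * D / (R * \<theta>)) ^ (n - 2)"
      unfolding H_def \<nu>_def by simp
    finally show ?case unfolding V_def A_def .
  qed
qed

section \<open>Asymptotics of the tail\<close>

lemma zeta_pos: "n \<ge> 2 \<Longrightarrow> zeta (real n) > 0"
  unfolding zeta_eq_suminf by (rule suminf_pos2[of _ 1]) (auto intro: summable_inverse_power)

text \<open>The bound for residue vectors involves three radii R < R1 < R'. Letting R' decrease to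
  R, by continuity of the explicit expression, and then the first moment error tend to 0 gives the
  bound at R itself.\<close>

lemma frobenius_tail_lower_bound:
  fixes R \<kappa> :: real
  assumes tail: "is_frobenius_tail TYPE('n::finite) \<Psi>" and n: "CARD('n) = n + 1" "n \<ge> 2"
    and R: "R > 0" and \<kappa>: "0 < \<kappa>" "\<kappa> < 1" "2 * (6 * \<kappa> * R) ^ n < \<kappa>"
    and two: "n = 2 \<Longrightarrow> 2 * (2 / R) * (2 / R) < 1"
  shows "(((real n + 1) / R ^ n + 2 * (\<kappa> / (R ^ n * 3 ^ (n - 1)))) / zeta (real n)
      - (if n = 2 then 0 else 4 * (25 * (2 / R) * (2 / R)) ^ n)) / 2 \<le> \<Psi> R"
proof (rule field_le_epsilon)
  fix \<epsilon> :: real assume \<epsilon>: "\<epsilon> > 0"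
  obtain i0 :: 'n where True by simp
  have I: "card (UNIV - {i0}) = n" using n by simp
  have z: "zeta (real n) > 0" using zeta_pos n by simp
  define L where "L R = (((real n + 1) / R ^ n + 2 * (\<kappa> / (R ^ n * 3 ^ (n - 1)))) / zeta (real n)
      - (if n = 2 then 0 else 4 * (25 * (2 / R) * (2 / R)) ^ n) - 2 * \<epsilon>) / 2" for R
  have "(L \<longlongrightarrow> L R) (at_right R)" unfolding L_def using R z by (auto intro!: tendsto_intros)
  moreover have "\<forall>\<^sub>F R' in at_right R. L R' \<le> \<Psi> R"
  proof -
    have "((\<lambda>R'. 2 * (6 * \<kappa> * R') ^ n) \<longlongrightarrow> 2 * (6 * \<kappa> * R) ^ n) (at_right R)" by (intro tendsto_intros)
    then have "\<forall>\<^sub>F R' in at_right R. 2 * (6 * \<kappa> * R') ^ n < \<kappa>" using \<kappa>(3) by (rule order_tendstoD(2))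
    moreover have "\<forall>\<^sub>F R' in at_right R. n = 2 \<longrightarrow> 2 * (2 / R') * (2 / R') < 1"
    proof (cases "n = 2")
      case True
      have "((\<lambda>R'. 2 * (2 / R') * (2 / R')) \<longlongrightarrow> 2 * (2 / R) * (2 / R)) (at_right R)" using R by (intro tendsto_intros) auto
      then show ?thesis using order_tendstoD(2) two True by fastforce
    qed simp
    moreover have "\<forall>\<^sub>F R' in at_right R. R' > R" by (simp add: eventually_at_filter)
    ultimately show ?thesis
    proof eventually_elim
      case (elim R')
      obtain R1 where R1: "R < R1" "R1 < R'" using dense elim by blast
      show "L R' \<le> \<Psi> R"
      proof (rule frobenius_tail_ge[OF tail _ R R1(1), of _ i0])
        show "CARD('n) \<ge> 3" using n by simp
        show "\<forall>\<^sub>F q in sequentially. L R' * real (card (primitive_residues (UNIV - {i0}) q)) \<le> real (card (uncovered (UNIV - {i0}) q R1))"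
          using uncovered_ge[OF _ I n(2) _ R1(2) \<kappa>(1,2), of "2 * \<epsilon>"] elim R R1 \<epsilon> unfolding L_def by simp
      qed
    qed
  qed
  ultimately have "L R \<le> \<Psi> R" by (rule tendsto_upperbound) simp
  then show "(((real n + 1) / R ^ n + 2 * (\<kappa> / (R ^ n * 3 ^ (n - 1)))) / zeta (real n)
      - (if n = 2 then 0 else 4 * (25 * (2 / R) * (2 / R)) ^ n)) / 2 \<le> \<Psi> R + \<epsilon>"
    unfolding L_def by simp
qed

lemma frobenius_tail_upper_bound:
  fixes R \<theta> D :: real
  assumes tail: "is_frobenius_tail TYPE('n::finite) \<Psi>" and n: "CARD('n) = n + 1" "n \<ge> 2"
    and R: "R > 0" and \<theta>: "0 < \<theta>" "\<theta> \<le> 1" and D: "D = flatness_const n + 1"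
    and two: "n = 2 \<Longrightarrow> 2 * (4 * D / R) * (4 * D / R) < 1" "n = 2 \<Longrightarrow> 2 * (2 / R) * (2 * D / (R * \<theta>)) < 1"
  shows "\<Psi> R \<le> (real n + 1) * ((1 + \<theta>) / R) ^ n / (2 * zeta (real n))
     + (if n = 2 then 0 else 4 * (25 * (4 * D / R) * (4 * D / R)) ^ n
        + 32 * (real n * real n * (real n + 2)) * 50 ^ n * 2 ^ (n - 1) * D / R ^ (n + 2) * (2 * D / (R * \<theta>)) ^ (n - 2))"
proof (rule field_le_epsilon)
  fix \<epsilon> :: real assume \<epsilon>: "\<epsilon> > 0"
  obtain i0 :: 'n where True by simp
  have I: "card (UNIV - {i0}) = n" using n by simp
  have z: "zeta (real n) > 0" using zeta_pos n by simp
  define U where "U R = (real n + 1) * ((1 + \<theta>) / R) ^ n / (2 * zeta (real n))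
     + (if n = 2 then 0 else 4 * (25 * (4 * D / R) * (4 * D / R)) ^ n
        + 32 * (real n * real n * (real n + 2)) * 50 ^ n * 2 ^ (n - 1) * D / R ^ (n + 2) * (2 * D / (R * \<theta>)) ^ (n - 2)) + \<epsilon>" for R
  have "(U \<longlongrightarrow> U R) (at_left R)" unfolding U_def using R z \<theta> by (auto intro!: tendsto_intros)
  moreover have "\<forall>\<^sub>F R' in at_left R. \<Psi> R \<le> U R'"
  proof -
    have "\<forall>\<^sub>F R' in at_left R. n = 2 \<longrightarrow> 2 * (4 * D / R') * (4 * D / R') < 1"
    proof (cases "n = 2")
      case True
      have "((\<lambda>R'. 2 * (4 * D / R') * (4 * D / R')) \<longlongrightarrow> 2 * (4 * D / R) * (4 * D / R)) (at_left R)" using R by (intro tendsto_intros) auto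
      then show ?thesis using order_tendstoD(2) two(1) True by fastforce
    qed simp
    moreover have "\<forall>\<^sub>F R' in at_left R. n = 2 \<longrightarrow> 2 * (2 / R') * (2 * D / (R' * \<theta>)) < 1"
    proof (cases "n = 2")
      case True
      have "((\<lambda>R'. 2 * (2 / R') * (2 * D / (R' * \<theta>))) \<longlongrightarrow> 2 * (2 / R) * (2 * D / (R * \<theta>))) (at_left R)"
        using R \<theta> by (intro tendsto_intros) auto
      then show ?thesis using order_tendstoD(2) two(2) True by fastforce
    qed simp
    moreover have "\<forall>\<^sub>F R' in at_left R. R' < R" by (simp add: eventually_at_filter)
    moreover have "\<forall>\<^sub>F R' in at_left R. R' > 0" using R by (rule order_tendstoD(1)[OF tendsto_ident_at])
    ultimately show ?thesis
    proof eventually_elim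
      case (elim R')
      show "\<Psi> R \<le> U R'"
      proof (rule frobenius_tail_le[OF tail _ elim(4,3), of i0])
        show "CARD('n) \<ge> 3" using n by simp
        show "\<forall>\<^sub>F q in sequentially. real (card (uncovered (UNIV - {i0}) q R')) \<le> U R' * real (card (primitive_residues (UNIV - {i0}) q))"
          using uncovered_le[OF _ I n(2) elim(4) \<theta> D \<epsilon>] elim unfolding U_def by simp
      qed
    qed
  qed
  ultimately have "\<Psi> R \<le> U R" by (rule tendsto_lowerbound) simp
  then show "\<Psi> R \<le> (real n + 1) * ((1 + \<theta>) / R) ^ n / (2 * zeta (real n))
     + (if n = 2 then 0 else 4 * (25 * (4 * D / R) * (4 * D / R)) ^ n
        + 32 * (real n * real n * (real n + 2)) * 50 ^ n * 2 ^ (n - 1) * D / R ^ (n + 2) * (2 * D / (R * \<theta>)) ^ (n - 2)) + \<epsilon>"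
    unfolding U_def .
qed

lemma power_one_plus_le:
  fixes \<theta> :: real assumes "0 \<le> \<theta>" "\<theta> \<le> 1" shows "(1 + \<theta>) ^ n \<le> 1 + (2 ^ n - 1) * \<theta>"
proof (induction n)
  case (Suc n)
  have "(1 + \<theta>) ^ Suc n \<le> (1 + (2 ^ n - 1) * \<theta>) * (1 + \<theta>)"
    using mult_right_mono[OF Suc, of "1 + \<theta>"] assms by (simp add: mult.commute)
  also have "\<dots> = 1 + \<theta> + (2 ^ n - 1) * \<theta> * (1 + \<theta>)" by (simp add: algebra_simps)
  also have "\<dots> \<le> 1 + \<theta> + (2 ^ n - 1) * \<theta> * 2" using assms by (intro add_left_mono mult_left_mono) auto
  finally show ?case by (simp add: algebra_simps)
qed simp

text \<open>
  The scale \<open>y R\<close> is the relative size of the second term: it is the order of the largest excess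
  \<open>\<kappa>\<close> with \<open>2 * (6 * \<kappa> * R) ^ n < \<kappa>\<close>.
\<close>

context
  fixes \<Psi> :: "real \<Rightarrow> real" and n :: nat and y :: "real \<Rightarrow> real"
  assumes tail: "is_frobenius_tail TYPE('n::finite) \<Psi>" and n: "CARD('n) = n + 1" "n \<ge> 2"
  defines "y \<equiv> \<lambda>R. R powr (- real n / (real n - 1))"
begin

lemma y_power: assumes "R > 0" shows "y R ^ (n - 1) = 1 / R ^ n"
proof -
  have "y R ^ (n - 1) = R powr (- real n / (real n - 1) * real (n - 1))"
    unfolding y_def using assms by (simp add: powr_powr flip: powr_realpow)
  also have "- real n / (real n - 1) * real (n - 1) = - real n" using n by (simp add: of_nat_diff)
  finally show ?thesis using assms by (simp add: powr_minus powr_realpow divide_inverse)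
qed

lemma y_tendsto: "(y \<longlongrightarrow> 0) at_top"
  unfolding y_def by (rule tendsto_neg_powr[OF _ filterlim_ident]) (use n in simp)

text \<open>For n >= 3 independent pairs with both lengths of order 1 / R cost R^(-2n); this is
  below the second term by a further factor \<open>y R\<close>.\<close>

lemma y_square_le:
  assumes "n \<noteq> 2" "R > 0" "y R < 1" shows "1 / R ^ n \<le> y R ^ 2"
proof -
  have "y R ^ (n - 1) \<le> y R ^ 2" using assms n by (intro power_decreasing) (auto simp: y_def)
  then show ?thesis using y_power assms by simp
qed

lemma frobenius_tail_asymptotic_lower:
  obtains c where "c > 0" "\<forall>\<^sub>F R in at_top. \<Psi> R > (real n + 1) / (2 * zeta (real n)) / R ^ n + c * (y R / R ^ n)"
proof -
  have z: "zeta (real n) > 0" using zeta_pos n by simp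
  \<comment> \<open>Since (y R)^(n-1) R^n = 1, the excess \<kappa> = b \<open>y R\<close> satisfies
    the corner condition as soon as 2 6^n b < 1; the powers of b beyond the first only help.\<close>
  define b :: real where "b = 1 / (2 * 6 ^ n + 1)"
  have b: "0 < b" "b < 1" "2 * 6 ^ n * b < 1"
    using zero_less_power[of "6::real" n] unfolding b_def by (simp_all add: divide_less_eq add_pos_pos)
  define c where "c = b / (3 ^ (n - 1) * zeta (real n))"
  have c: "c > 0" unfolding c_def using b z by simp
  have e1: "\<forall>\<^sub>F R in at_top. y R < 1" using order_tendstoD(2)[OF y_tendsto] by simp
  have e2: "\<forall>\<^sub>F R in at_top. y R < c / 2 / (2 * 100 ^ n)" using order_tendstoD(2)[OF y_tendsto] c by simp
  \<comment> \<open>Half of c pays for the independent pairs; taking c / 4 rather than the remaining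
    c / 2 makes the inequality strict.\<close>
  have "\<forall>\<^sub>F R in at_top. \<Psi> R > (real n + 1) / (2 * zeta (real n)) / R ^ n + c / 4 * (y R / R ^ n)"
    using e1 e2 eventually_gt_at_top[of 3]
  proof eventually_elim
    case (elim R)
    have R: "R > 0" and y: "y R > 0" using elim unfolding y_def by auto
    have k: "2 * (6 * (b * y R) * R) ^ n < b * y R"
    proof -
      have "(6 * (b * y R) * R) ^ n = 6 ^ n * (b * y R) * b ^ (n - 1) * (y R ^ (n - 1) * R ^ n)"
        using n by (cases n) (auto simp: power_mult_distrib)
      also have "\<dots> = 6 ^ n * (b * y R) * b ^ (n - 1)" unfolding y_power[OF R] using R by simp
      also have "\<dots> \<le> 6 ^ n * (b * y R) * b ^ 1"
        using b y n by (intro mult_left_mono power_decreasing) auto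
      finally have "2 * (6 * (b * y R) * R) ^ n \<le> (2 * 6 ^ n * b) * (b * y R)" by (simp add: mult_ac)
      also have "\<dots> < 1 * (b * y R)" using b y by (intro mult_strict_right_mono) auto
      finally show ?thesis by simp
    qed
    have "b * y R < 1 * 1" using b y elim by (intro mult_strict_mono) auto
    moreover have "2 * (2 / R) * (2 / R) < 1"
      using mult_strict_mono[of 3 R 3 R] elim R by (simp add: field_simps)
    ultimately have "(((real n + 1) / R ^ n + 2 * (b * y R / (R ^ n * 3 ^ (n - 1)))) / zeta (real n)
      - (if n = 2 then 0 else 4 * (25 * (2 / R) * (2 / R)) ^ n)) / 2 \<le> \<Psi> R"
      using frobenius_tail_lower_bound[OF tail n R _ _ k] b y by simp
    moreover have split: "(((real n + 1) / R ^ n + 2 * (b * y R / (R ^ n * 3 ^ (n - 1)))) / zeta (real n) - s) / 2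
      = (real n + 1) / (2 * zeta (real n)) / R ^ n + c * (y R / R ^ n) - s / 2" for s
      unfolding c_def using z R by (simp add: field_simps)
    moreover have "(if n = 2 then 0 else 4 * (25 * (2 / R) * (2 / R)) ^ n) / 2 \<le> c / 2 * (y R / R ^ n)"
    proof (cases "n = 2")
      case False
      have "4 * (25 * (2 / R) * (2 / R)) ^ n / 2 = 2 * 100 ^ n * (1 / R ^ n) * (1 / R ^ n)"
        by (simp add: power_divide power_mult_distrib[symmetric])
      also have "\<dots> \<le> 2 * 100 ^ n * y R ^ 2 * (1 / R ^ n)"
        using y_square_le[OF False R elim(1)] R by (intro mult_right_mono mult_left_mono) auto
      also have "\<dots> = (y R * (2 * 100 ^ n)) * (y R / R ^ n)" by (simp add: power2_eq_square)
      also have "\<dots> \<le> c / 2 * (y R / R ^ n)"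
        using elim(2) y R by (intro mult_right_mono) (auto simp: field_simps)
      finally show ?thesis using False by simp
    qed (use c y R in simp)
    moreover have "c / 4 * (y R / R ^ n) < c / 2 * (y R / R ^ n)"
      using c y R by (intro mult_strict_right_mono) auto
    moreover have "c * (y R / R ^ n) = c / 2 * (y R / R ^ n) + c / 2 * (y R / R ^ n)" by simp
    ultimately show ?case unfolding split by linarith
  qed
  then show thesis using that[of "c / 4"] c by simp
qed

lemma frobenius_tail_asymptotic_upper:
  obtains C where "\<forall>\<^sub>F R in at_top. \<Psi> R \<le> (real n + 1) / (2 * zeta (real n)) / R ^ n + C * (y R / R ^ n)"
proof -
  have z: "zeta (real n) > 0" using zeta_pos n by simp
  define D where "D = flatness_const n + 1"
  have D: "D \<ge> 1" unfolding D_def using flatness_const_nonneg by simp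
  \<comment> \<open>For n = 2 one has R^2 \<open>y R\<close> = 1, and the determinant condition for
    the widest range of \<open>u\<close> becomes 8 D < K.\<close>
  define K where "K = 8 * D + 1"
  have K: "K > 0" "8 * D < K" unfolding K_def using D by auto
  define H where "H = 32 * (real n * real n * (real n + 2)) * 50 ^ n * 2 ^ (n - 1) * D"
  have H: "H \<ge> 0" unfolding H_def using D by simp
  define C where "C = (real n + 1) / (2 * zeta (real n)) * 2 ^ n * K + 4 * (400 * D * D) ^ n + H * (2 * D / K) ^ (n - 2)"
  have e1: "\<forall>\<^sub>F R in at_top. y R < 1" using order_tendstoD(2)[OF y_tendsto] by simp
  have e2: "\<forall>\<^sub>F R in at_top. y R < 1 / K" using order_tendstoD(2)[OF y_tendsto] K by simp
  have "\<forall>\<^sub>F R in at_top. \<Psi> R \<le> (real n + 1) / (2 * zeta (real n)) / R ^ n + C * (y R / R ^ n)"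
    using e1 e2 eventually_gt_at_top[of "8 * D"]
  proof eventually_elim
    case (elim R)
    have R: "R > 0" and y: "y R > 0" using elim D unfolding y_def by auto
    define \<theta> where "\<theta> = K * y R"
    have \<theta>: "0 < \<theta>" "\<theta> \<le> 1" unfolding \<theta>_def using K y elim(2) by (auto simp: field_simps)
    have two1: "2 * (4 * D / R) * (4 * D / R) < 1"
    proof -
      have "8 * D * (8 * D) < R * R" using elim D by (intro mult_strict_mono) auto
      moreover have "0 \<le> D * D" by simp
      ultimately have "2 * (4 * D) * (4 * D) < R * R" by linarith
      then show ?thesis using R by (simp add: field_simps)
    qed
    have two2: "2 * (2 / R) * (2 * D / (R * \<theta>)) < 1" if "n = 2"
    proof -
      have "R ^ 2 * y R = 1" using y_power[OF R] that R by simp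
      have "2 * (2 / R) * (2 * D / (R * \<theta>)) = 8 * D / (K * (R ^ 2 * y R))"
        unfolding \<theta>_def by (simp add: power2_eq_square mult_ac)
      also have "\<dots> < 1" unfolding \<open>R ^ 2 * y R = 1\<close> using K by simp
      finally show ?thesis .
    qed
    have "\<Psi> R \<le> (real n + 1) * ((1 + \<theta>) / R) ^ n / (2 * zeta (real n))
     + (if n = 2 then 0 else 4 * (25 * (4 * D / R) * (4 * D / R)) ^ n + H / R ^ (n + 2) * (2 * D / (R * \<theta>)) ^ (n - 2))"
      unfolding H_def by (rule frobenius_tail_upper_bound[OF tail n R \<theta> D_def]) (use two1 two2 in auto)
    moreover have "(real n + 1) * ((1 + \<theta>) / R) ^ n / (2 * zeta (real n)) \<le>
      (real n + 1) / (2 * zeta (real n)) / R ^ n + (real n + 1) / (2 * zeta (real n)) * 2 ^ n * K * (y R / R ^ n)"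
    proof -
      define M where "M = (real n + 1) / (2 * zeta (real n)) / R ^ n"
      have M: "M \<ge> 0" unfolding M_def using R z by simp
      have "(real n + 1) * ((1 + \<theta>) / R) ^ n / (2 * zeta (real n)) = M * (1 + \<theta>) ^ n"
        unfolding M_def by (simp add: power_divide)
      also have "\<dots> \<le> M * (1 + 2 ^ n * \<theta>)"
        using power_one_plus_le[of \<theta> n] \<theta> M by (intro mult_left_mono) (auto simp: algebra_simps)
      also have "\<dots> = M + (real n + 1) / (2 * zeta (real n)) * 2 ^ n * K * (y R / R ^ n)"
        unfolding distrib_left by (simp add: M_def \<theta>_def)
      finally show ?thesis unfolding M_def .
    qed
    moreover have "(if n = 2 then 0 else 4 * (25 * (4 * D / R) * (4 * D / R)) ^ n + H / R ^ (n + 2) * (2 * D / (R * \<theta>)) ^ (n - 2))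
      \<le> 4 * (400 * D * D) ^ n * (y R / R ^ n) + H * (2 * D / K) ^ (n - 2) * (y R / R ^ n)"
    proof (cases "n = 2")
      case True
      have "0 \<le> 4 * (400 * D * D) ^ n * (y R / R ^ n) + H * (2 * D / K) ^ (n - 2) * (y R / R ^ n)"
        using D H K y R by (intro add_nonneg_nonneg mult_nonneg_nonneg) auto
      then show ?thesis using True by simp
    next
      case False
      have "4 * (25 * (4 * D / R) * (4 * D / R)) ^ n = 4 * (400 * D * D) ^ n * (1 / R ^ n) * (1 / R ^ n)"
        by (simp add: power_divide power_mult_distrib[symmetric] mult_ac)
      also have "\<dots> \<le> 4 * (400 * D * D) ^ n * y R * (1 / R ^ n)"
      proof -
        have "1 / R ^ n \<le> y R ^ 1" using y_square_le[OF False R elim(1)] power_decreasing[of 1 2 "y R"] y elim(1) by linarith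
        then show ?thesis using D R by (intro mult_right_mono mult_left_mono) auto
      qed
      finally have 1: "4 * (25 * (4 * D / R) * (4 * D / R)) ^ n \<le> 4 * (400 * D * D) ^ n * (y R / R ^ n)" by simp
      have "H / R ^ (n + 2) * (2 * D / (R * \<theta>)) ^ (n - 2) = H * (2 * D / K) ^ (n - 2) * (1 / R ^ n) * (1 / (R ^ 2 * R ^ (n - 2) * y R ^ (n - 2)))"
        unfolding \<theta>_def by (simp add: power_divide power_mult_distrib power_add power2_eq_square mult_ac)
      also have "R ^ 2 * R ^ (n - 2) = R ^ n" by (metis le_add_diff_inverse n(2) power_add)
      \<comment> \<open>This balance fixes \<theta> to be of order \<open>y R\<close>: the shells
        then cost no more, up to constants, than the enlarged threshold.\<close>
      also have "1 / (R ^ n * y R ^ (n - 2)) = y R"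
      proof -
        have "y R ^ (n - 1) = y R * y R ^ (n - 2)" using n by (metis Suc_diff_le Suc_1 diff_Suc_Suc power_Suc)
        then have "y R * (R ^ n * y R ^ (n - 2)) = 1" using y_power[OF R] R by (simp add: field_simps)
        then show ?thesis using y R by (simp add: field_simps)
      qed
      finally show ?thesis using 1 False by simp
    qed
    ultimately show ?case unfolding C_def by (simp add: algebra_simps)
  qed
  then show thesis using that by blast
qed

end

theorem theorem2:
  fixes d :: nat and \<Psi> :: "real \<Rightarrow> real"
  assumes "3 \<le> d"
    and "CARD('n::finite) = d"
    and "is_frobenius_tail TYPE('n) \<Psi>"
  shows "(\<lambda>R. \<Psi> R - real d / (2 * zeta (real d - 1)) * R powr (- (real d - 1)))
           \<in> O[at_top](\<lambda>R. R powr (- real d - 1 / (real d - 2)))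
         \<and> (\<exists>c>0. \<forall>\<^sub>F R in at_top.
              \<Psi> R > real d / (2 * zeta (real d - 1)) * R powr (- (real d - 1))
                    + c * R powr (- real d - 1 / (real d - 2)))"
proof -
  define n where "n = d - 1"
  have n: "CARD('n) = n + 1" "n \<ge> 2" and d: "d = n + 1" using assms unfolding n_def by auto
  obtain c where c: "c > 0" "\<forall>\<^sub>F R in at_top. \<Psi> R > (real n + 1) / (2 * zeta (real n)) / R ^ n + c * (R powr (- real n / (real n - 1)) / R ^ n)"
    using frobenius_tail_asymptotic_lower[OF assms(3) n] .
  obtain C where C: "\<forall>\<^sub>F R in at_top. \<Psi> R \<le> (real n + 1) / (2 * zeta (real n)) / R ^ n + C * (R powr (- real n / (real n - 1)) / R ^ n)"
    using frobenius_tail_asymptotic_upper[OF assms(3) n] .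
  have main: "real d / (2 * zeta (real d - 1)) * R powr (- (real d - 1)) = (real n + 1) / (2 * zeta (real n)) / R ^ n" if "R > 0" for R
  proof -
    have "real d - 1 = real n" "real d = real n + 1" unfolding d by simp_all
    then show ?thesis using powr_realpow[OF that, of n] by (simp only: powr_minus divide_inverse)
  qed
  have err: "R powr (- real d - 1 / (real d - 2)) = R powr (- real n / (real n - 1)) / R ^ n" if "R > 0" for R :: real
  proof -
    have "- real d - 1 / (real d - 2) = - real n / (real n - 1) - real n"
    proof -
      have "real n - 1 \<noteq> 0" using n by simp
      then have "1 / (real n - 1) = real n / (real n - 1) - 1" by (simp add: field_simps)
      then show ?thesis unfolding d by simp
    qed
    then show ?thesis using that by (simp add: powr_diff powr_realpow)
  qed
  show ?thesis
  proof
    show "(\<lambda>R. \<Psi> R - real d / (2 * zeta (real d - 1)) * R powr (- (real d - 1))) \<in> O[at_top](\<lambda>R. R powr (- real d - 1 / (real d - 2)))"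
    proof (rule bigoI)
      show "\<forall>\<^sub>F R in at_top. norm (\<Psi> R - real d / (2 * zeta (real d - 1)) * R powr (- (real d - 1))) \<le> C * norm (R powr (- real d - 1 / (real d - 2)))"
        using c(2) C eventually_gt_at_top[of 0]
      proof eventually_elim
        case (elim R)
        \<comment> \<open>The lower bound makes the difference positive, so the upper bound alone
          controls its absolute value.\<close>
        have "0 \<le> c * (R powr (- real n / (real n - 1)) / R ^ n)" using c(1) elim by simp
        then show ?case using elim unfolding main[OF elim(3)] err[OF elim(3)] by simp
      qed
    qed
    show "\<exists>c>0. \<forall>\<^sub>F R in at_top. \<Psi> R > real d / (2 * zeta (real d - 1)) * R powr (- (real d - 1)) + c * R powr (- real d - 1 / (real d - 2))"
    proof (intro exI conjI)
      show "\<forall>\<^sub>F R in at_top. \<Psi> R > real d / (2 * zeta (real d - 1)) * R powr (- (real d - 1)) + c * R powr (- real d - 1 / (real d - 2))"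
        using c(2) eventually_gt_at_top[of 0] by eventually_elim (simp only: main err)
    qed (use c in simp)
  qed
qed

end
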